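(* Let $(\varphi_{s,t})_{s\le t}$ be a $\mathcal P$-EF. Then there exist a continuous function $I\ni t\mapsto\gamma_t\in\mathbb R$ with $\gamma_0=0$ and a Borel measure $\mathcal H$ on $\mathbb R\times I$ with $\mathcal H(\mathbb R\times[0,t])<\infty$ and $\mathcal H(\mathbb R\times\{t\})=0$ for every $t\in I$, such that $$\varphi_{s,t}(z)=z+\gamma_s-\gamma_t+\int_{\mathbb R\times[s,t]}\frac{1+x\varphi_{s,u}(z)}{x-\varphi_{s,u}(z)}\,\mathcal H(dx\,du),\qquad s\le t,\ z\in\mathbb C^+.$$ The pair $((\gamma_t),\mathcal H)$ is unique. Conversely, given such a pair $((\gamma_t),\mathcal H)$, there is a unique $\mathcal P$-EF $(\varphi_{s,t})$ such that this equation holds.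
   Context: $I$ is a fixed interval $[0,T_0)$ ($0<T_0\le+\infty$) or $[0,T_0]$ ($0<T_0<+\infty$); indices $s\le t$ range over $I$. $\mathbb C^+$ is the open upper half-plane. For a Borel probability measure $\mu$ on $\mathbb R$ put $G_\mu(z)=\int_{\mathbb R}\frac1{z-x}\,\mu(dx)$ and $F_\mu=1/G_\mu$ on $\mathbb C^+$, and let $\mathcal P=\{F_\mu:\mu\text{ a Borel probability measure on }\mathbb R\}$. A $\mathcal P$-EF (evolution family in $\mathcal P$) is a family $(\varphi_{s,t})_{s,t\in I,\,s\le t}$ of holomorphic self-mappings of $\mathbb C^+$, all belonging to $\mathcal P$, such that $\varphi_{s,s}=\mathrm{id}$ for all $s$, $\varphi_{t,u}\circ\varphi_{s,t}=\varphi_{s,u}$ whenever $s\le t\le u$, and $(s,t)\mapsto\varphi_{s,t}$ is continuous for the topology of locally uniform convergence on $\mathbb C^+$. *)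

theory Defs
  imports "HOL-Probability.Probability"
begin

definition time_interval :: "real set \<Rightarrow> bool" where
  "time_interval I \<longleftrightarrow>
     (\<exists>T0::ereal. 0 < T0 \<and> I = {t. 0 \<le> t \<and> ereal t < T0}) \<or>
     (\<exists>T0::real. 0 < T0 \<and> I = {0..T0})"

definition upper_half_plane :: "complex set" where
  "upper_half_plane = {z. 0 < Im z}"

definition cauchy_transform :: "real measure \<Rightarrow> complex \<Rightarrow> complex" where
  "cauchy_transform \<mu> z = (LINT x|\<mu>. 1 / (z - complex_of_real x))"

definition recip_cauchy_transform :: "real measure \<Rightarrow> complex \<Rightarrow> complex" where
  "recip_cauchy_transform \<mu> z = 1 / cauchy_transform \<mu> z"

text \<open>Functions on the upper half-plane are represented by total functions on \<open>complex\<close>,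
  of which only the values on \<open>upper_half_plane\<close> matter.\<close>

definition class_P :: "(complex \<Rightarrow> complex) set" where
  "class_P = {f. \<exists>\<mu>. real_distribution \<mu> \<and>
     (\<forall>z\<in>upper_half_plane. f z = recip_cauchy_transform \<mu> z)}"

definition time_pairs :: "real set \<Rightarrow> (real \<times> real) set" where
  "time_pairs I = {(s, t). s \<in> I \<and> t \<in> I \<and> s \<le> t}"

text \<open>As the upper half-plane is locally compact, locally uniform convergence on it is uniform
  convergence on each of its compact subsets.\<close>

definition continuous_locally_uniformly ::
    "real set \<Rightarrow> (real \<Rightarrow> real \<Rightarrow> complex \<Rightarrow> complex) \<Rightarrow> bool" where
  "continuous_locally_uniformly I \<phi> \<longleftrightarrow>
     (\<forall>(s, t)\<in>time_pairs I. \<forall>K. compact K \<and> K \<subseteq> upper_half_plane \<longrightarrow>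
        uniform_limit K (\<lambda>(s', t'). \<phi> s' t') (\<phi> s t) (at (s, t) within time_pairs I))"

definition P_evolution_family ::
    "real set \<Rightarrow> (real \<Rightarrow> real \<Rightarrow> complex \<Rightarrow> complex) \<Rightarrow> bool" where
  "P_evolution_family I \<phi> \<longleftrightarrow>
     (\<forall>(s, t)\<in>time_pairs I. \<phi> s t holomorphic_on upper_half_plane \<and>
        \<phi> s t ` upper_half_plane \<subseteq> upper_half_plane \<and> \<phi> s t \<in> class_P) \<and>
     (\<forall>s\<in>I. \<forall>z\<in>upper_half_plane. \<phi> s s z = z) \<and>
     (\<forall>s\<in>I. \<forall>t\<in>I. \<forall>u\<in>I. s \<le> t \<and> t \<le> u \<longrightarrow>
        (\<forall>z\<in>upper_half_plane. \<phi> t u (\<phi> s t z) = \<phi> s u z)) \<and>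
     continuous_locally_uniformly I \<phi>"

definition driving_pair :: "real set \<Rightarrow> (real \<Rightarrow> real) \<Rightarrow> (real \<times> real) measure \<Rightarrow> bool" where
  "driving_pair I \<gamma> H \<longleftrightarrow>
     continuous_on I \<gamma> \<and> \<gamma> 0 = 0 \<and>
     sets H = sets (restrict_space borel (UNIV \<times> I)) \<and>
     (\<forall>t\<in>I. emeasure H (UNIV \<times> {0..t}) < \<infinity> \<and> emeasure H (UNIV \<times> {t}) = 0)"

text \<open>Integrability is required explicitly because the Bochner integral of a non-integrable
  function is 0 by convention.  For an evolution family and a driving pair it is automatic:
  the integrand is bounded and continuous on \<open>UNIV \<times> {s..t}\<close>, a set of finite measure.\<close>

definition evolution_equation ::
    "real set \<Rightarrow> (real \<Rightarrow> real \<Rightarrow> complex \<Rightarrow> complex) \<Rightarrow> (real \<Rightarrow> real) \<Rightarrow>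
     (real \<times> real) measure \<Rightarrow> bool" where
  "evolution_equation I \<phi> \<gamma> H \<longleftrightarrow>
     (\<forall>(s, t)\<in>time_pairs I. \<forall>z\<in>upper_half_plane.
        set_integrable H (UNIV \<times> {s..t})
          (\<lambda>(x, u). (1 + of_real x * \<phi> s u z) / (of_real x - \<phi> s u z)) \<and>
        \<phi> s t z = z + of_real (\<gamma> s) - of_real (\<gamma> t) +
          set_lebesgue_integral H (UNIV \<times> {s..t})
            (\<lambda>(x, u). (1 + of_real x * \<phi> s u z) / (of_real x - \<phi> s u z)))"

end

theory Submission
  imports Defs "HOL-Complex_Analysis.Complex_Analysis"
begin

text \<open>The kernel \<open>nev x w = (1 + x * w) / (x - w)\<close> is, for every real \<open>x\<close>, the Moebius rotation of the upper
half-plane about \<open>\<i>\<close> that sends \<open>x\<close> to infinity.  The reciprocal Cauchy transforms are exactly the maps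
\<open>z \<mapsto> a + z + (\<integral> nev x z d\<rho>)\<close> with \<open>a\<close> real and \<open>\<rho>\<close> a finite measure (Nevanlinna's representation with
slope 1 at infinity, \<open>class_P_nevanlinna\<close> and \<open>class_P_I\<close>), and \<open>\<rho>\<close> is determined by the map
(\<open>nev_transform_inject\<close>).  The evolution equation says that \<open>\<phi>\<close> is the flow of the infinitesimal maps of this
form given by \<open>H\<close> and \<open>\<gamma>\<close>, where time enters only through a measure without atoms and a continuous function
that need not have bounded variation.

From \<open>\<phi>\<close> to \<open>H\<close>: let \<open>\<Xi> z s t\<close> be \<open>\<phi> s t z - z\<close> without its real drift, that is
\<open>\<integral> nev x z d(\<rho> s t)\<close>.  The mass of \<open>\<rho> s t\<close> is at most a constant times the increment of the increasing
function \<open>t \<mapsto> Im (\<phi> 0 t \<i>)\<close>, because \<open>Im (nev x w)\<close> is bounded below on compact sets (\<open>mass_bound\<close>).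
Hence \<open>\<Xi>\<close> is additive in time up to errors that are small compared with this increment (\<open>\<Xi>_refine\<close>), and its
Riemann sums converge to an exactly additive function \<open>sewn\<close>.  Its values are again Nevanlinna functions; their
slope at infinity is zero, since otherwise \<open>\<phi> 0 T\<close> would have slope larger than 1
(\<open>slope_zero_from_0\<close>).  The representing measures \<open>\<nu> s t\<close> are additive in time, increase continuously,
and are therefore the sections of one measure on space-time (\<open>disintegrate\<close>); this measure is \<open>H\<close>.  With \<open>H\<close>
at hand, \<open>\<phi> s t z\<close> and the integral in the equation have the same increments up to a real drift, which depends neither
on \<open>s\<close> nor on \<open>z\<close>, and up to negligible errors; this yields \<open>\<gamma>\<close> (\<open>pair_exists\<close>).  Conversely every pair
that satisfies the equation has increments close to those of \<open>\<Xi>\<close>, so that any two pairs agree (\<open>pair_unique\<close>).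
All such comparisons rest on \<open>increments_zero\<close>: a function whose increments are negligible
compared with those of an increasing function is constant.

From \<open>(\<gamma>, H)\<close> to \<open>\<phi>\<close>: the kernel is only locally Lipschitz in \<open>w\<close>, and the essential point is that solutions do not
explode.  In the coordinate \<open>v = w + \<gamma>\<close> one Euler step is \<open>v \<mapsto> v + (\<integral> nev x (v - \<gamma>) d\<rho>)\<close>, and it multiplies
\<open>(1 + |v|\<^sup>2) / Im v\<close>, which is \<open>2 cosh\<close> of the hyperbolic distance from \<open>v\<close> to \<open>\<i>\<close>, by at most
\<open>1 + C * mass \<rho>\<close> (\<open>step_region\<close>).  So all Euler curves stay in one compact set, on which the kernel is Lipschitz;
Gronwall's inequality for atomless measures makes them converge, and it gives uniqueness, the semigroup property and
continuity.  Holomorphy passes to the limit, and the slope 1 at infinity follows by dominated convergence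
(\<open>flow_class_P\<close>).\<close>

section \<open>The Nevanlinna kernel\<close>

text \<open>For fixed \<open>x\<close> this is the rotation of the upper half-plane about its fixed point \<open>\<i>\<close> that moves the boundary
point \<open>x\<close> to infinity.\<close>

definition nev :: "real \<Rightarrow> complex \<Rightarrow> complex" where
  "nev x w = (1 + of_real x * w) / (of_real x - w)"

text \<open>The quotient \<open>(1 + |w|\<^sup>2) / Im w\<close> is \<open>2 cosh\<close> of the hyperbolic distance between \<open>w\<close> and \<open>\<i>\<close>, so these sets
are the closed hyperbolic discs about \<open>\<i>\<close>.  They exhaust the half-plane by compact sets that are adapted to the kernel.\<close>

definition region :: "real \<Rightarrow> complex set" where
  "region R = {w. 0 < Im w \<and> 1 + (norm w)\<^sup>2 \<le> R * Im w}"

lemma real_minus_ne_0: "0 < Im w \<Longrightarrow> complex_of_real x - w \<noteq> 0"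
  by (auto simp: complex_eq_iff)

lemma nev_i [simp]: "nev x \<i> = \<i>"
proof -
  have "1 + complex_of_real x * \<i> = \<i> * (complex_of_real x - \<i>)" by (simp add: algebra_simps)
  moreover have "complex_of_real x - \<i> \<noteq> 0" by (rule real_minus_ne_0) simp
  ultimately show ?thesis by (simp add: nev_def)
qed

lemma norm_real_minus_sq: "(norm (complex_of_real x - w))\<^sup>2 = (x - Re w)\<^sup>2 + (Im w)\<^sup>2"
  by (simp add: cmod_power2)

lemma Im_nev: "Im (nev x w) = Im w * ((1 + x\<^sup>2) / (norm (complex_of_real x - w))\<^sup>2)"
  by (simp add: nev_def Im_divide norm_real_minus_sq) (simp add: algebra_simps power2_eq_square add_divide_distrib)

lemma norm_nev_sq:
  assumes "0 < Im w"
  shows "1 + (norm (nev x w))\<^sup>2 = (1 + (norm w)\<^sup>2) * ((1 + x\<^sup>2) / (norm (complex_of_real x - w))\<^sup>2)"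
proof -
  have n: "(norm (complex_of_real x - w))\<^sup>2 \<noteq> 0" using real_minus_ne_0[OF assms] by simp
  have "(norm (1 + of_real x * w))\<^sup>2 + (norm (complex_of_real x - w))\<^sup>2 = (1 + x\<^sup>2) * (1 + (norm w)\<^sup>2)"
    unfolding cmod_power2 by (simp add: algebra_simps power2_eq_square)
  with n show ?thesis
    by (simp add: nev_def norm_divide power_divide field_simps)
qed

lemma nev_diff:
  assumes "0 < Im w" "0 < Im w'"
  shows "nev x w - nev x w' = (w - w') * (of_real (1 + x\<^sup>2) / ((of_real x - w) * (of_real x - w')))"
  using real_minus_ne_0[OF assms(1), of x] real_minus_ne_0[OF assms(2), of x]
  by (simp add: nev_def field_simps power2_eq_square)

lemma Im_nev_pos: "0 < Im w \<Longrightarrow> 0 < Im (nev x w)"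
  using real_minus_ne_0[of w x] by (simp add: Im_nev add_pos_nonneg)

text \<open>A rotation about \<open>\<i>\<close> preserves the hyperbolic discs about \<open>\<i>\<close>; all bounds on the kernel that are uniform in the
unbounded variable \<open>x\<close> come from here.\<close>

lemma nev_region:
  assumes "w \<in> region R" shows "nev x w \<in> region R"
proof -
  have w: "0 < Im w" "1 + (norm w)\<^sup>2 \<le> R * Im w" using assms by (auto simp: region_def)
  have "1 + (norm (nev x w))\<^sup>2 \<le> R * Im (nev x w)"
    unfolding norm_nev_sq[OF w(1)] Im_nev mult.assoc[symmetric]
    by (intro mult_right_mono w) simp
  thus ?thesis using Im_nev_pos[OF w(1)] by (auto simp: region_def)
qed

lemma region_bounds:
  assumes "w \<in> region R"
  shows "0 < Im w" "0 < R" "1 \<le> R * Im w" "norm w \<le> R"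
proof -
  have w: "0 < Im w" "1 + (norm w)\<^sup>2 \<le> R * Im w" using assms by (auto simp: region_def)
  show "0 < Im w" by fact
  show 1: "1 \<le> R * Im w" using w zero_le_power2[of "norm w"] by linarith
  show R: "0 < R" using 1 w(1) mult_nonpos_nonneg[of R "Im w"] by linarith
  have "(norm w)\<^sup>2 \<le> R * norm w" using w R abs_Im_le_cmod[of w] mult_left_mono[of "Im w" "norm w" R] by linarith
  thus "norm w \<le> R" using w(1) by (cases "w = 0") (auto simp: power2_eq_square)
qed

text \<open>The ratio is \<open>Im (nev x w) / Im w\<close>, and both imaginary parts lie between \<open>1 / R\<close> and \<open>R\<close>.\<close>

lemma region_ratio_bound:
  assumes "w \<in> region R"
  shows "(1 + x\<^sup>2) / (norm (complex_of_real x - w))\<^sup>2 \<le> R\<^sup>2"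
proof -
  note w = region_bounds[OF assms]
  have "Im (nev x w) \<le> R"
    using region_bounds(4)[OF nev_region[OF assms]] abs_Im_le_cmod[of "nev x w"] by (meson abs_le_D1 order_trans)
  hence "Im w * ((1 + x\<^sup>2) / (norm (complex_of_real x - w))\<^sup>2) \<le> R" by (simp add: Im_nev)
  hence "R * (Im w * ((1 + x\<^sup>2) / (norm (complex_of_real x - w))\<^sup>2)) \<le> R * R" using w by (intro mult_left_mono) auto
  moreover have "1 * ((1 + x\<^sup>2) / (norm (complex_of_real x - w))\<^sup>2) \<le> (R * Im w) * ((1 + x\<^sup>2) / (norm (complex_of_real x - w))\<^sup>2)"
    by (intro mult_right_mono w) simp
  ultimately show ?thesis by (simp add: power2_eq_square mult.assoc)
qed

lemma norm_one_plus_sq: "norm (complex_of_real (1 + x\<^sup>2)) = 1 + x\<^sup>2"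
  by (simp del: of_real_add of_real_power)

lemma kernel_bound:
  assumes "w \<in> region R" "w' \<in> region R"
  shows "norm (of_real (1 + x\<^sup>2) / ((complex_of_real x - w) * (of_real x - w'))) \<le> R\<^sup>2"
proof -
  have R: "0 < R" using region_bounds[OF assms(1)] by simp
  have *: "sqrt (1 + x\<^sup>2) / norm (complex_of_real x - v) \<le> R" if "v \<in> region R" for v
  proof -
    have "(sqrt (1 + x\<^sup>2) / norm (complex_of_real x - v))\<^sup>2 \<le> R\<^sup>2"
      using region_ratio_bound[OF that, of x] by (simp add: power_divide)
    thus ?thesis using R by (simp add: abs_le_square_iff[symmetric])
  qed
  have "norm (of_real (1 + x\<^sup>2) / ((complex_of_real x - w) * (of_real x - w')))
      = (sqrt (1 + x\<^sup>2) / norm (complex_of_real x - w)) * (sqrt (1 + x\<^sup>2) / norm (complex_of_real x - w'))"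
    unfolding norm_divide norm_mult norm_one_plus_sq by (simp add: field_simps)
  also have "\<dots> \<le> R * R"
    by (intro mult_mono * assms) (use R in auto)
  finally show ?thesis by (simp add: power2_eq_square)
qed

lemma nev_lipschitz:
  assumes "w \<in> region R" "w' \<in> region R"
  shows "norm (nev x w - nev x w') \<le> R\<^sup>2 * norm (w - w')"
  unfolding nev_diff[OF region_bounds(1)[OF assms(1)] region_bounds(1)[OF assms(2)]] norm_mult
  using mult_left_mono[OF kernel_bound[OF assms], of "norm (w - w')"] by (simp add: mult.commute)

lemma norm_nev_le: "w \<in> region R \<Longrightarrow> norm (nev x w) \<le> R"
  by (rule region_bounds(4)[OF nev_region])

lemma Im_nev_ge: "w \<in> region R \<Longrightarrow> 1 \<le> R * Im (nev x w)"
  by (rule region_bounds(3)[OF nev_region])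

lemma region_mono: "R \<le> R' \<Longrightarrow> region R \<subseteq> region R'"
  by (auto simp: region_def intro: order_trans[OF _ mult_right_mono])

lemma compact_subset_region:
  assumes "compact S" "S \<subseteq> upper_half_plane"
  obtains R where "0 < R" "S \<subseteq> region R"
proof -
  have "continuous_on S (\<lambda>w. (1 + (norm w)\<^sup>2) / Im w)"
    using assms(2) by (intro continuous_intros) (auto simp: upper_half_plane_def)
  hence "compact ((\<lambda>w. (1 + (norm w)\<^sup>2) / Im w) ` S)" by (rule compact_continuous_image[OF _ assms(1)])
  hence "bounded ((\<lambda>w. (1 + (norm w)\<^sup>2) / Im w) ` S)" by (rule compact_imp_bounded)
  then obtain B where B: "\<And>w. w \<in> S \<Longrightarrow> norm ((1 + (norm w)\<^sup>2) / Im w) \<le> B"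
    unfolding bounded_iff by auto
  have "S \<subseteq> region (max 1 B)"
  proof
    fix w assume w: "w \<in> S"
    hence "0 < Im w" using assms(2) by (auto simp: upper_half_plane_def)
    moreover have "(1 + (norm w)\<^sup>2) / Im w \<le> max 1 B" using abs_ge_self[of "(1 + (norm w)\<^sup>2) / Im w"] B[OF w] unfolding real_norm_def by linarith
    ultimately show "w \<in> region (max 1 B)" by (simp add: region_def pos_divide_le_eq)
  qed
  thus ?thesis using that[of "max 1 B"] by auto
qed

lemma in_some_region: assumes "0 < Im w" obtains R where "0 < R" "w \<in> region R"
  using compact_subset_region[of "{w}"] assms by (auto simp: upper_half_plane_def)

text \<open>Parameter integrals are differentiated at \<open>w\<close> with a bound that has to hold for all points near \<open>w\<close>.\<close>

lemma region_nhds: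
  assumes "0 < Im w" obtains R where "0 < R" "w \<in> region R" "eventually (\<lambda>v. v \<in> region R) (nhds w)"
proof -
  have "open upper_half_plane" by (simp add: upper_half_plane_def open_halfspace_Im_gt)
  moreover have "w \<in> upper_half_plane" using assms by (simp add: upper_half_plane_def)
  ultimately obtain e where e: "0 < e" "cball w e \<subseteq> upper_half_plane" by (meson open_contains_cball)
  obtain R where R: "0 < R" "cball w e \<subseteq> region R" using compact_subset_region[of "cball w e"] e by auto
  have "eventually (\<lambda>v. v \<in> ball w e) (nhds w)" using e by (intro eventually_nhds_in_open) auto
  hence "eventually (\<lambda>v. v \<in> region R) (nhds w)"
    by eventually_elim (use R(2) ball_subset_cball in blast)
  moreover have "w \<in> region R" using R(2) e(1) by (auto simp: subset_eq)
  ultimately show ?thesis using that R(1) by blast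
qed

lemma open_uhp: "open upper_half_plane" by (simp add: upper_half_plane_def open_halfspace_Im_gt)

lemma continuous_on_nev:
  assumes "continuous_on A f" "continuous_on A g" "\<And>p. p \<in> A \<Longrightarrow> 0 < Im (g p)"
  shows "continuous_on A (\<lambda>p. nev (f p) (g p))"
  unfolding nev_def using assms(1,2) real_minus_ne_0[OF assms(3)] by (intro continuous_intros) auto

lemma borel_nev [measurable]:
  assumes [measurable]: "f \<in> borel_measurable M" "g \<in> borel_measurable M"
  shows "(\<lambda>p. nev (f p) (g p)) \<in> borel_measurable M"
  unfolding nev_def by measurable

section \<open>Nevanlinna transforms of finite measures\<close>

definition nev_transform :: "real measure \<Rightarrow> complex \<Rightarrow> complex" where
  "nev_transform \<rho> z = (LINT x|\<rho>. nev x z)"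

locale fin_borel = finite_measure \<rho> for \<rho> :: "real measure" +
  assumes sets_borel [measurable_cong, simp]: "sets \<rho> = sets borel"
begin

abbreviation mass :: real where "mass \<equiv> measure \<rho> UNIV"

lemma space_UNIV [simp]: "space \<rho> = UNIV" using sets_eq_imp_space_eq[OF sets_borel] by simp

lemma integrable_nev: "0 < Im z \<Longrightarrow> integrable \<rho> (\<lambda>x. nev x z)"
  by (erule in_some_region) (rule integrable_const_bound, rule AE_I2, erule norm_nev_le, measurable)

lemma integrable_ratio: "0 < Im z \<Longrightarrow> integrable \<rho> (\<lambda>x. (1 + x\<^sup>2) / (norm (complex_of_real x - z))\<^sup>2)"
  by (erule in_some_region) (rule integrable_const_bound, rule AE_I2, simp, erule region_ratio_bound, measurable)

lemma nev_transform_i [simp]: "nev_transform \<rho> \<i> = \<i> * mass" by (simp add: nev_transform_def scaleR_conv_of_real)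

lemma Im_nev_transform: "0 < Im z \<Longrightarrow> Im (nev_transform \<rho> z) = Im z * (LINT x|\<rho>. (1 + x\<^sup>2) / (norm (complex_of_real x - z))\<^sup>2)"
  unfolding nev_transform_def integral_Im[OF integrable_nev, symmetric] Im_nev
  by (rule integral_mult_right_zero)

lemma Im_nev_transform_nonneg: "0 < Im z \<Longrightarrow> 0 \<le> Im (nev_transform \<rho> z)"
  by (simp add: Im_nev_transform) 

lemma norm_nev_transform_le: "z \<in> region R \<Longrightarrow> norm (nev_transform \<rho> z) \<le> R * mass"
  using Bochner_Integration.integral_norm_bound_integral[of \<rho> "\<lambda>x. nev x z" "\<lambda>_. R"]
  by (auto simp: nev_transform_def integrable_nev[OF region_bounds(1)] norm_nev_le mult.commute)

text \<open>The mass of a measure is controlled by the value of its transform at a single point.\<close>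

lemma Im_nev_transform_ge: assumes z: "z \<in> region R" shows "mass \<le> R * Im (nev_transform \<rho> z)"
proof -
  have "mass = (LINT x|\<rho>. 1)" by simp
  also have "\<dots> \<le> (LINT x|\<rho>. R * Im (nev x z))"
    by (intro integral_mono integrable_mult_right integrable_Im integrable_nev region_bounds(1)[OF z] Im_nev_ge z) simp
  also have "\<dots> = R * Im (nev_transform \<rho> z)"
    unfolding nev_transform_def integral_Im[OF integrable_nev[OF region_bounds(1)[OF z]], symmetric] by simp
  finally show ?thesis .
qed

lemma nev_transform_lipschitz:
  assumes "z \<in> region R" "z' \<in> region R" shows "norm (nev_transform \<rho> z - nev_transform \<rho> z') \<le> R\<^sup>2 * norm (z - z') * mass"
proof -
  note i = integrable_nev[OF region_bounds(1)[OF assms(1)]] integrable_nev[OF region_bounds(1)[OF assms(2)]]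
  have "nev_transform \<rho> z - nev_transform \<rho> z' = (LINT x|\<rho>. nev x z - nev x z')"
    unfolding nev_transform_def using i by simp
  also have "norm \<dots> \<le> (LINT x|\<rho>. R\<^sup>2 * norm (z - z'))"
    by (rule Bochner_Integration.integral_norm_bound_integral) (use i in \<open>auto simp: nev_lipschitz assms\<close>)
  finally show ?thesis by (simp add: mult_ac)
qed

text \<open>The difference quotient of the kernel is explicit (\<open>nev_diff\<close>) and bounded on a region around \<open>w\<close>, so
dominated convergence applies.\<close>

lemma nev_transform_has_derivative:
  assumes w: "0 < Im w"
  shows "(nev_transform \<rho> has_field_derivative (LINT x|\<rho>. of_real (1 + x\<^sup>2) / ((of_real x - w) * (of_real x - w)))) (at w)"
proof -
  obtain R where R: "0 < R" "w \<in> region R" "eventually (\<lambda>v. v \<in> region R) (nhds w)"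
    using region_nhds[OF w] by blast
  let ?k = "\<lambda>v x. complex_of_real (1 + x\<^sup>2) / ((of_real x - w) * (of_real x - v))"
  have "((\<lambda>v. LINT x|\<rho>. ?k v x) \<longlongrightarrow> (LINT x|\<rho>. ?k w x)) (at w)"
  unfolding tendsto_at_iff_sequentially
  proof -
    show "\<forall>X. (\<forall>i. X i \<in> UNIV - {w}) \<longrightarrow> X \<longlonglongrightarrow> w \<longrightarrow>
      ((\<lambda>v. LINT x|\<rho>. ?k v x) \<circ> X) \<longlonglongrightarrow> (LINT x|\<rho>. ?k w x)"
    proof (intro allI impI)
      fix X assume X: "X \<longlonglongrightarrow> w"
      hence ev: "eventually (\<lambda>i. X i \<in> region R) sequentially"
        by (rule eventually_compose_filterlim[OF R(3)])
      then obtain n where n: "\<And>i. n \<le> i \<Longrightarrow> X i \<in> region R" by (auto simp: eventually_sequentially)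
      have "(\<lambda>i. LINT x|\<rho>. ?k (X (i + n)) x) \<longlonglongrightarrow> (LINT x|\<rho>. ?k w x)"
      proof (rule integral_dominated_convergence[where w = "\<lambda>_. R\<^sup>2"])
        show "AE x in \<rho>. (\<lambda>i. ?k (X (i + n)) x) \<longlonglongrightarrow> ?k w x"
          using LIMSEQ_ignore_initial_segment[OF X] real_minus_ne_0[OF w]
          by (intro AE_I2 tendsto_intros) auto
        show "AE x in \<rho>. norm (?k (X (i + n)) x) \<le> R\<^sup>2" for i
          using n[of "i + n"] R(2) by (intro AE_I2 kernel_bound) auto
      qed auto
      thus "((\<lambda>v. LINT x|\<rho>. ?k v x) \<circ> X) \<longlonglongrightarrow> (LINT x|\<rho>. ?k w x)"
        unfolding o_def by (rule LIMSEQ_offset)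
    qed
  qed
  moreover have "eventually (\<lambda>v. (LINT x|\<rho>. ?k v x) = (nev_transform \<rho> v - nev_transform \<rho> w) / (v - w)) (at w)"
  proof -
    have "eventually (\<lambda>v. v \<in> region R \<and> v \<noteq> w) (at w)"
      using R(3) by (simp add: eventually_at_filter eventually_mono)
    thus ?thesis
    proof eventually_elim
      case (elim v)
      note i = integrable_nev[OF region_bounds(1), of v R] integrable_nev[OF w]
      have "(nev_transform \<rho> v - nev_transform \<rho> w) = (LINT x|\<rho>. nev x v - nev x w)"
        using i elim unfolding nev_transform_def by simp
      also have "\<dots> = (LINT x|\<rho>. (v - w) * ?k v x)"
        using elim region_bounds(1)[of v R] w
        by (intro Bochner_Integration.integral_cong refl) (simp only: nev_diff mult.commute)
      also have "\<dots> = (v - w) * (LINT x|\<rho>. ?k v x)" by (rule integral_mult_right_zero)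
      finally show ?case using elim by simp
    qed
  qed
  ultimately show ?thesis
    unfolding has_field_derivative_iff by (rule Lim_transform_eventually)
qed

lemma nev_transform_holomorphic: "nev_transform \<rho> holomorphic_on upper_half_plane"
  unfolding holomorphic_on_def field_differentiable_def
  using has_field_derivative_at_within[OF nev_transform_has_derivative] by (auto simp: upper_half_plane_def)

end

section \<open>The Nevanlinna representation\<close>

text \<open>Cauchy's formula at \<open>z\<close>, plus the conjugate of Cauchy's formula for \<open>h u / (1 - cnj z * u)\<close> at \<open>0\<close>: on the unit circle
the conjugate of \<open>1 / (1 - cnj z * e)\<close> is \<open>e / (e - z)\<close>, so subtracting the two leaves only the imaginary part of \<open>h\<close>.\<close>

lemma schwarz_formula:
  assumes h: "h holomorphic_on cball 0 1" and z: "norm z < 1"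
  defines "e \<equiv> \<lambda>t::real. exp (2 * of_real pi * \<i> * of_real t)"
  shows "((\<lambda>t. (e t + z) / (e t - z) * of_real (Im (h (e t)))) has_integral - \<i> * (h z - of_real (Re (h 0)))) {0..1}"
proof -
  have e1: "norm (e t) = 1" for t unfolding e_def by (simp add: norm_exp_eq_Re)
  have ee: "cnj (e t) = inverse (e t)" for t
    using complex_norm_square[of "e t"] e1[of t] by (intro inverse_unique[symmetric]) simp
  have e0: "e t \<noteq> 0" for t by (simp add: e_def)
  have ez: "e t - w \<noteq> 0" if "norm w < 1" for t w using e1[of t] that by auto
  have C: "((\<lambda>t. g (e t) * e t / (e t - w)) has_integral g w) {0..1}"
    if g: "g holomorphic_on cball 0 1" and w: "norm w < 1" for g w
  proof -
    have "((\<lambda>u. g u / (u - w)) has_contour_integral (2 * of_real pi * \<i> * g w)) (circlepath 0 1)"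
      using Cauchy_integral_circlepath_simple[OF g, of w] w by simp
    hence "((\<lambda>t. g (e t) / (e t - w) * (2 * pi * \<i> * e t)) has_integral (2 * of_real pi * \<i> * g w)) {0..1}"
      unfolding has_contour_integral_def
    proof (rule has_integral_eq[rotated])
      fix t :: real assume t: "t \<in> {0..1}"
      have "circlepath 0 1 t = e t" by (simp add: circlepath e_def)
      moreover have "vector_derivative (circlepath 0 1) (at t within {0..1}) = 2 * pi * \<i> * e t"
        using vector_derivative_circlepath01[of t 0 1] t by (simp add: e_def)
      ultimately show "g (circlepath 0 1 t) / (circlepath 0 1 t - w) * vector_derivative (circlepath 0 1) (at t within {0..1})
        = g (e t) / (e t - w) * (2 * pi * \<i> * e t)" by simp
    qed
    from has_integral_mult_right[OF this, of "1 / (2 * of_real pi * \<i>)"]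
    show ?thesis by (simp add: field_simps)
  qed
  have I1: "((\<lambda>t. h (e t) * e t / (e t - z)) has_integral h z) {0..1}" by (rule C[OF h z])
  have I3: "((\<lambda>t. h (e t)) has_integral h 0) {0..1}"
    using C[OF h, of 0] e0 by simp
  have nz: "1 - cnj z * u \<noteq> 0" if "norm u \<le> 1" for u
  proof
    assume "1 - cnj z * u = 0"
    hence "norm (cnj z * u) = 1" by simp
    moreover have "norm z * norm u < 1" using z that mult_left_le[of "norm u" "norm z"] by simp
    ultimately show False by (simp add: norm_mult)
  qed
  have "(\<lambda>u. h u / (1 - cnj z * u)) holomorphic_on cball 0 1"
    using nz by (intro holomorphic_intros h) auto
  from C[OF this, of 0] have "((\<lambda>t. h (e t) / (1 - cnj z * e t)) has_integral h 0) {0..1}"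
    using e0 by simp
  from has_integral_cnj[THEN iffD2, OF this]
  have I2: "((\<lambda>t. cnj (h (e t)) * e t / (e t - z)) has_integral cnj (h 0)) {0..1}"
  proof (rule has_integral_eq[rotated])
    fix t show "(cnj \<circ> (\<lambda>t. h (e t) / (1 - cnj z * e t))) t = cnj (h (e t)) * e t / (e t - z)"
      using e0[of t] ez[OF z, of t] by (simp add: ee field_simps)
  qed
  have I4: "((\<lambda>t. cnj (h (e t))) has_integral cnj (h 0)) {0..1}"
    using has_integral_cnj[THEN iffD2, OF I3] by (simp add: o_def)
  have "((\<lambda>t. (1/(2*\<i>)) * ((2 * (h (e t) * e t / (e t - z) - cnj (h (e t)) * e t / (e t - z))) - (h (e t) - cnj (h (e t)))))
      has_integral (1/(2*\<i>)) * (2 * (h z - cnj (h 0)) - (h 0 - cnj (h 0)))) {0..1}"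
    by (intro has_integral_mult_right has_integral_diff I1 I2 I3 I4)
  moreover have "(1/(2*\<i>)) * (2 * (h z - cnj (h 0)) - (h 0 - cnj (h 0))) = - \<i> * (h z - of_real (Re (h 0)))"
    by (simp add: complex_eq_iff algebra_simps Re_divide Im_divide)
  moreover have "(1/(2*\<i>)) * ((2 * (h (e t) * e t / (e t - z) - cnj (h (e t)) * e t / (e t - z))) - (h (e t) - cnj (h (e t))))
     = (e t + z) / (e t - z) * of_real (Im (h (e t)))" for t
  proof -
    have *: "h (e t) - cnj (h (e t)) = 2 * \<i> * of_real (Im (h (e t)))" by (simp add: complex_eq_iff)
    have "2 * (h (e t) * e t / (e t - z) - cnj (h (e t)) * e t / (e t - z)) - (h (e t) - cnj (h (e t)))
      = (h (e t) - cnj (h (e t))) * ((e t + z) / (e t - z))"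
    proof -
      have gen: "2 * D - (A - B) = (A - B) * q" if "q = 2 * p - 1" "D = (A - B) * p" for A B D p q :: complex
        unfolding that by (simp add: algebra_simps)
      have "(e t + z) / (e t - z) = 2 * (e t / (e t - z)) - 1" using ez[OF z, of t] by (simp add: field_simps)
      moreover have "h (e t) * e t / (e t - z) - cnj (h (e t)) * e t / (e t - z) = (h (e t) - cnj (h (e t))) * (e t / (e t - z))"
        by (simp add: left_diff_distrib diff_divide_distrib)
      ultimately show ?thesis by (rule gen)
    qed
    thus ?thesis unfolding * by simp
  qed
  ultimately show ?thesis by (simp only:)
qed

text \<open>The formula of Schwarz on the circles of radius \<open>r < 1\<close> represents \<open>g (r * z)\<close> by a measure with density
\<open>Im (g (r * e))\<close> of total mass \<open>Im (g 0)\<close> on the fixed interval \<open>{0..1}\<close>.  These measures are tight; a weak limit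
as \<open>r\<close> tends to \<open>1\<close> represents \<open>g\<close>.\<close>

lemma herglotz_representation:
  assumes g: "g holomorphic_on ball 0 1" and pos: "\<And>z. norm z < 1 \<Longrightarrow> 0 \<le> Im (g z)"
  obtains M where "real_distribution M"
    "\<And>z. norm z < 1 \<Longrightarrow> g z = of_real (Re (g 0)) + \<i> * of_real (Im (g 0)) *
       (LINT t|M. (exp (2 * of_real pi * \<i> * of_real t) + z) / (exp (2 * of_real pi * \<i> * of_real t) - z))"
proof -
  define e where "e = (\<lambda>t::real. exp (2 * of_real pi * \<i> * of_real t))"
  define S where "S = (\<lambda>z t. (e t + z) / (e t - z))"
  have e1: "norm (e t) = 1" for t unfolding e_def by (simp add: norm_exp_eq_Re)
  have ez: "e t - w \<noteq> 0" if "norm w < 1" for t w using e1[of t] that by auto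
  have conte: "continuous_on A e" for A unfolding e_def by (intro continuous_intros)
  have contS: "continuous_on A (S z)" if "norm z < 1" for A z
    unfolding S_def using ez[OF that] by (intro continuous_intros conte) auto
  have bS: "norm (S z t) \<le> 2 / (1 - norm z)" if "norm z < 1" for z t
  proof -
    have "norm (e t + z) \<le> 2" using norm_triangle_ineq[of "e t" z] e1[of t] that by simp
    moreover have "1 - norm z \<le> norm (e t - z)" using norm_triangle_ineq2[of "e t" z] e1[of t] by simp
    ultimately show ?thesis using that unfolding S_def norm_divide by (intro frac_le) auto
  qed
  define r where "r = (\<lambda>n::nat. 1 - 1 / real (n + 2))"
  have r: "0 < r n" "r n < 1" for n by (auto simp: r_def field_simps)
  have rlim: "r \<longlonglongrightarrow> 1"
  proof -
    have "(\<lambda>n. 1 - 1 / real (n + 2)) \<longlonglongrightarrow> 1 - 0"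
      by (intro tendsto_intros LIMSEQ_ignore_initial_segment[OF lim_1_over_n])
    thus ?thesis by (simp add: r_def)
  qed
  define p where "p = (\<lambda>n t. Im (g (of_real (r n) * e t)))"
  have nr: "norm (of_real (r n) * u) < 1" if "norm u \<le> 1" for n and u :: complex
  proof -
    have "r n * norm u \<le> r n * 1" using r[of n] that by (intro mult_left_mono) auto
    moreover have "norm (of_real (r n) * u) = r n * norm u" using r[of n] by (simp add: norm_mult)
    ultimately show ?thesis using r[of n] by linarith
  qed
  have p0: "0 \<le> p n t" for n t unfolding p_def using nr[of "e t" n] e1[of t] by (intro pos) auto
  have gcont: "continuous_on (ball 0 1) g" by (rule holomorphic_on_imp_continuous_on[OF g])
  have contp: "continuous_on A (p n)" for A n
    unfolding p_def
    by (intro continuous_intros continuous_on_compose2[OF gcont] conte) (use nr e1 in auto)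
  have pint: "set_integrable lborel {0..1} (\<lambda>t. F t * of_real (p n t))" "(LINT t:{0..1}|lborel. F t * of_real (p n t)) = integral {0..1} (\<lambda>t. F t * of_real (p n t))"
    if "\<And>A. continuous_on A F" for F :: "real \<Rightarrow> complex" and n
  proof -
    show 1: "set_integrable lborel {0..1} (\<lambda>t. F t * of_real (p n t))"
      unfolding set_integrable_def
      by (rule borel_integrable_compact) (auto intro!: continuous_intros that contp)
    show "(LINT t:{0..1}|lborel. F t * of_real (p n t)) = integral {0..1} (\<lambda>t. F t * of_real (p n t))"
      by (rule set_borel_integral_eq_integral(2)[OF 1])
  qed
  have F: "(LINT t:{0..1}|lborel. S z t * of_real (p n t)) = - \<i> * (g (of_real (r n) * z) - of_real (Re (g 0)))"
    if z: "norm z < 1" for z n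
  proof -
    have "(\<lambda>z. g (of_real (r n) * z)) holomorphic_on cball 0 1"
      using nr by (intro holomorphic_on_compose_gen[OF _ g, unfolded o_def] holomorphic_intros) auto
    from schwarz_formula[OF this z]
    have "((\<lambda>t. S z t * of_real (p n t)) has_integral - \<i> * (g (of_real (r n) * z) - of_real (Re (g 0)))) {0..1}"
      by (simp add: S_def p_def e_def)
    thus ?thesis using pint(2)[OF contS[OF z], of n] by (simp add: integral_unique)
  qed
  have rint: "set_integrable lborel {0..1} (p n)" for n
    unfolding set_integrable_def
    by (rule borel_integrable_compact) (auto intro!: contp)
  have mass: "(LINT t:{0..1}|lborel. p n t) = Im (g 0)" for n
  proof -
    have "complex_of_real (LINT t:{0..1}|lborel. p n t) = (LINT t:{0..1}|lborel. of_real (p n t))"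
      by (rule set_integral_complex_of_real[symmetric])
    also have "\<dots> = (LINT t:{0..1}|lborel. S 0 t * of_real (p n t))"
      using ez[of 0] by (simp add: S_def)
    also have "\<dots> = of_real (Im (g 0))" unfolding F[of 0 n, simplified]
      by (simp add: complex_eq_iff)
    finally show ?thesis by (simp only: of_real_eq_iff)
  qed
  have glim: "(\<lambda>n. g (of_real (r n) * z)) \<longlonglongrightarrow> g z" if z: "norm z < 1" for z
  proof (rule continuous_on_tendsto_compose[OF gcont])
    have "(\<lambda>n. of_real (r n) * z) \<longlonglongrightarrow> of_real 1 * z" by (intro tendsto_intros rlim)
    thus "(\<lambda>n. of_real (r n) * z) \<longlonglongrightarrow> z" by simp
    show "z \<in> ball 0 1" "\<forall>\<^sub>F n in sequentially. complex_of_real (r n) * z \<in> ball 0 1"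
      using z nr[of z] by auto
  qed
  show ?thesis
  proof (cases "Im (g 0) = 0")
    case True
    \<comment> \<open>all the measures below vanish, and \<open>g\<close> is constant\<close>
    have const: "g z = of_real (Re (g 0))" if z: "norm z < 1" for z
    proof -
      have "g (of_real (r n) * z) = of_real (Re (g 0))" for n
      proof -
        have "norm (LINT t:{0..1}|lborel. S z t * of_real (p n t)) \<le> (LINT t:{0..1}|lborel. 2 / (1 - norm z) * p n t)"
          unfolding set_lebesgue_integral_def
        proof (rule Bochner_Integration.integral_norm_bound_integral)
          show "integrable lborel (\<lambda>t. indicat_real {0..1} t *\<^sub>R (S z t * of_real (p n t)))"
            using pint(1)[OF contS[OF z]] by (simp add: set_integrable_def)
          show "integrable lborel (\<lambda>t. indicat_real {0..1} t *\<^sub>R (2 / (1 - norm z) * p n t))"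
            using set_integrable_mult_right[OF rint[of n], of "2 / (1 - norm z)"] by (simp add: set_integrable_def)
          show "norm (indicat_real {0..1} t *\<^sub>R (S z t * of_real (p n t))) \<le> indicat_real {0..1} t *\<^sub>R (2 / (1 - norm z) * p n t)" for t
            using mult_right_mono[OF bS[OF z, of t] p0[of n t]] p0[of n t] by (simp add: norm_mult indicator_def)
        qed
        also have "\<dots> = 2 / (1 - norm z) * (LINT t:{0..1}|lborel. p n t)" by simp
        also have "\<dots> = 0" using mass[of n] True by simp
        finally show ?thesis using F[OF z, of n] by simp
      qed
      with LIMSEQ_unique[OF glim[OF z]] show ?thesis by simp
    qed
    have ret: "real_distribution (return borel 0)"
      by (intro real_distribution.intro prob_space_return real_distribution_axioms.intro) auto
    show ?thesis
      by (rule that[OF ret]) (unfold True of_real_0 mult_zero_right mult_zero_left add_0_right, erule const)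
  next
    case False
    define m where "m = Im (g 0)"
    have m: "0 < m" using False pos[of 0] by (simp add: m_def)
    define d where "d = (\<lambda>n t. indicator {0..1} t * (p n t / m))"
    have d0: "0 \<le> d n t" for n t using p0[of n t] m by (simp add: d_def)
    have dm [measurable]: "d n \<in> borel_measurable borel" for n
      unfolding d_def using borel_measurable_continuous_onI[OF contp[of UNIV n]] by measurable
    have di: "integrable lborel (d n)" "(LINT t|lborel. d n t) = 1" for n
    proof -
      have *: "d n = (\<lambda>t. (1 / m) * (indicator {0..1} t *\<^sub>R p n t))" by (auto simp: d_def)
      show "integrable lborel (d n)" unfolding * using rint[of n]
        by (intro integrable_mult_right) (simp add: set_integrable_def)
      show "(LINT t|lborel. d n t) = 1" unfolding * using mass[of n] m
        by (simp add: set_lebesgue_integral_def m_def)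
    qed
    define \<mu> where "\<mu> = (\<lambda>n. density lborel (d n))"
    have prob: "prob_space (\<mu> n)" for n
    proof
      have "emeasure (\<mu> n) (space (\<mu> n)) = (\<integral>\<^sup>+t. ennreal (d n t) \<partial>lborel)"
        unfolding \<mu>_def by (simp add: emeasure_density)
      also have "\<dots> = 1" using nn_integral_eq_integral[OF di(1)[of n]] d0 di(2)[of n] by simp
      finally show "emeasure (\<mu> n) (space (\<mu> n)) = 1" .
    qed
    have rd: "real_distribution (\<mu> n)" for n
      by (intro real_distribution.intro prob real_distribution_axioms.intro) (simp add: \<mu>_def)
    have tight: "tight \<mu>"
      unfolding tight_def
    proof (intro conjI allI impI rd)
      fix \<epsilon> :: real assume "0 < \<epsilon>"
      have "1 - \<epsilon> < measure (\<mu> n) {-1<..1}" for n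
      proof -
      interpret real_distribution "\<mu> n" by (rule rd)
      have "emeasure (\<mu> n) (space (\<mu> n) - {-1<..1}) = (\<integral>\<^sup>+t. ennreal (d n t) * indicator (space lborel - {-1<..1}) t \<partial>lborel)"
        unfolding \<mu>_def by (simp add: emeasure_density)
      also have "\<dots> = (\<integral>\<^sup>+t. 0 \<partial>(lborel :: real measure))" by (intro nn_integral_cong) (auto simp: d_def indicator_def)
      finally have "measure (\<mu> n) (space (\<mu> n) - {-1<..1}) = 0" by (simp add: measure_def)
      hence "measure (\<mu> n) {-1<..1} = 1" using prob_compl[of "{-1<..1}"] by simp
      thus ?thesis using \<open>0 < \<epsilon>\<close> by simp
      qed
      thus "\<exists>a b. a < b \<and> (\<forall>n. 1 - \<epsilon> < measure (\<mu> n) {a<..b})"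
        by (intro exI[of _ "-1"] exI[of _ 1]) simp
    qed
    obtain s M where s: "strict_mono (s :: nat \<Rightarrow> nat)" and M: "real_distribution M" "weak_conv_m (\<mu> \<circ> id \<circ> s) M"
      using tight_imp_convergent_subsubsequence[OF tight strict_mono_id] by blast
    have "g z = of_real (Re (g 0)) + \<i> * of_real (Im (g 0)) * (LINT t|M. S z t)" if z: "norm z < 1" for z
    proof -
      have "(\<lambda>n. integral\<^sup>L ((\<mu> \<circ> id \<circ> s) n) (S z)) \<longlonglongrightarrow> integral\<^sup>L M (S z)"
        by (rule weak_conv_imp_integral_bdd_continuous_conv[OF _ M])
          (use rd contS[OF z, of UNIV] bS[OF z] in \<open>auto simp: continuous_on_eq_continuous_at\<close>)
      moreover have "integral\<^sup>L ((\<mu> \<circ> id \<circ> s) n) (S z) = - \<i> * (g (of_real (r (s n)) * z) - of_real (Re (g 0))) / m" for n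
      proof -
        have "integral\<^sup>L (\<mu> (s n)) (S z) = (LINT t|lborel. d (s n) t *\<^sub>R S z t)"
          unfolding \<mu>_def by (rule integral_density)
            (use d0 borel_measurable_continuous_onI[OF contS[OF z]] in auto)
        also have "\<dots> = (LINT t:{0..1}|lborel. S z t * of_real (p (s n) t)) / m"
          unfolding set_lebesgue_integral_def integral_divide_zero[symmetric]
          by (intro Bochner_Integration.integral_cong) (auto simp: d_def indicator_def scaleR_conv_of_real)
        finally show ?thesis by (simp add: F[OF z])
      qed
      moreover have "(\<lambda>n. - \<i> * (g (of_real (r (s n)) * z) - of_real (Re (g 0))) / m) \<longlonglongrightarrow> - \<i> * (g z - of_real (Re (g 0))) / m"
        using LIMSEQ_subseq_LIMSEQ[OF glim[OF z] s] m by (intro tendsto_intros) (auto simp: o_def)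
      ultimately have "integral\<^sup>L M (S z) = - \<i> * (g z - of_real (Re (g 0))) / m"
        using LIMSEQ_unique by (simp only:) blast
      hence "of_real m * integral\<^sup>L M (S z) = - \<i> * (g z - of_real (Re (g 0)))" using m by simp
      hence "\<i> * (of_real m * integral\<^sup>L M (S z)) = \<i> * (- \<i> * (g z - of_real (Re (g 0))))" by (simp only:)
      thus ?thesis by (simp add: m_def[symmetric] algebra_simps)
    qed
    thus ?thesis unfolding S_def e_def by (rule that[OF M(1)])
  qed
qed

text \<open>The Cayley transform carries the half-plane to the disc and the Herglotz kernel at \<open>e\<close> to the kernel \<open>nev x\<close> at the
boundary point \<open>x\<close> that corresponds to \<open>e\<close>.  The point \<open>e = 1\<close> corresponds to infinity; its mass becomes the linear term.\<close>

theorem nevanlinna_representation: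
  assumes f: "f holomorphic_on upper_half_plane" and pos: "\<And>z. 0 < Im z \<Longrightarrow> 0 \<le> Im (f z)"
  obtains a c \<rho> where "0 \<le> c" "fin_borel \<rho>"
    "\<And>z. 0 < Im z \<Longrightarrow> f z = complex_of_real a + of_real c * z + nev_transform \<rho> z"
proof -
  define C where "C = (\<lambda>w. \<i> * (1 + w) / (1 - w))"
  define D where "D = (\<lambda>z. (z - \<i>) / (z + \<i>))"
  define e where "e = (\<lambda>t::real. exp (2 * of_real pi * \<i> * of_real t))"
  have ImC: "0 < Im (C w)" if "norm w < 1" for w
  proof -
    have "(norm w)\<^sup>2 < 1" using that by (simp add: power_less_one_iff)
    hence w: "(Re w)\<^sup>2 + (Im w)\<^sup>2 < 1" by (simp add: cmod_power2)
    have "w \<noteq> 1" using that by auto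
    hence d: "0 < (1 - Re w)\<^sup>2 + (Im w)\<^sup>2" by (simp add: sum_power2_gt_zero_iff complex_eq_iff)
    have "Im (C w) = (1 - (Re w)\<^sup>2 - (Im w)\<^sup>2) / ((1 - Re w)\<^sup>2 + (Im w)\<^sup>2)"
      by (simp add: C_def Im_divide) (simp add: power2_eq_square algebra_simps)
    thus ?thesis using w d by simp
  qed
  have nD: "norm (D z) < 1" if "0 < Im z" for z
  proof -
    have "norm (z - \<i>) < norm (z + \<i>)"
    proof (rule power2_less_imp_less)
      show "(norm (z - \<i>))\<^sup>2 < (norm (z + \<i>))\<^sup>2" using that
        unfolding cmod_power2 by (simp add: power2_eq_square algebra_simps)
    qed simp
    thus ?thesis by (simp add: D_def norm_divide divide_less_eq)
  qed
  have zi: "z + \<i> \<noteq> 0" if "0 < Im z" for z using that by (auto simp: complex_eq_iff)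
  have CD: "C (D z) = z" if "0 < Im z" for z
  proof -
    have "1 - D z = 2 * \<i> / (z + \<i>)" "1 + D z = 2 * z / (z + \<i>)"
      using zi[OF that] by (auto simp: D_def field_simps)
    thus ?thesis using zi[OF that] by (simp add: C_def)
  qed
  have Dz: "D z \<noteq> 1" if "0 < Im z" for z using nD[OF that] by auto
  have "(\<lambda>w. f (C w)) holomorphic_on ball 0 1"
    by (rule holomorphic_on_compose_gen[OF _ f, unfolded o_def])
      (use ImC in \<open>auto simp: C_def upper_half_plane_def intro!: holomorphic_intros\<close>)
  then obtain M where M: "real_distribution M" and
    rep0: "\<And>w. norm w < 1 \<Longrightarrow> f (C w) = of_real (Re (f (C 0))) + \<i> * of_real (Im (f (C 0))) *
       (LINT t|M. (exp (2 * of_real pi * \<i> * of_real t) + w) / (exp (2 * of_real pi * \<i> * of_real t) - w))"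
    using herglotz_representation[of "\<lambda>w. f (C w)"] pos[OF ImC] by blast
  have ee: "exp (2 * complex_of_real pi * \<i> * of_real t) = e t" for t by (simp add: e_def)
  note rep = rep0[unfolded ee]
  interpret M: real_distribution M by fact
  define m where "m = Im (f (C 0))"
  have m: "0 \<le> m" unfolding m_def by (intro pos ImC) simp
  have e1: "norm (e t) = 1" for t unfolding e_def by (simp add: norm_exp_eq_Re)
  have [measurable]: "e \<in> borel_measurable borel" unfolding e_def
    by (intro borel_measurable_continuous_onI continuous_intros)
  define X where "X = (\<lambda>t. Re (C (e t)))"
  have [measurable]: "X \<in> borel_measurable borel" unfolding X_def C_def by measurable
  have CX: "C (e t) = of_real (X t)" if "e t \<noteq> 1" for t
  proof -
    have "(Re (e t))\<^sup>2 + (Im (e t))\<^sup>2 = 1" using e1[of t] by (simp add: cmod_def)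
    hence "Im (C (e t)) = 0" by (simp add: C_def Im_divide) (simp add: power2_eq_square algebra_simps)
    thus ?thesis by (simp add: X_def complex_eq_iff)
  qed
  have key: "\<i> * ((e t + D z) / (e t - D z)) = (if e t = 1 then z else nev (X t) z)" if z: "0 < Im z" for t z
  proof (cases "e t = 1")
    case True
    thus ?thesis using CD[OF z] by (simp add: C_def)
  next
    case False
    have q: "1 - e t \<noteq> 0" using False by simp
    have s: "z + \<i> \<noteq> 0" by (rule zi[OF z])
    have x: "of_real (X t) = \<i> * (1 + e t) / (1 - e t)" using CX[OF False] by (simp add: C_def)
    have "e t - D z \<noteq> 0" using e1[of t] nD[OF z] by auto
    hence n: "e t * (z + \<i>) - (z - \<i>) \<noteq> 0" using s by (simp add: D_def field_simps)
    have "\<i> * ((e t + D z) / (e t - D z)) = \<i> * ((e t * (z + \<i>) + (z - \<i>)) / (e t * (z + \<i>) - (z - \<i>)))"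
      using s by (simp add: D_def divide_simps)
    also have "\<dots> = (1 + of_real (X t) * z) / (of_real (X t) - z)"
    proof -
      have a: "1 + of_real (X t) * z = \<i> * (e t * (z + \<i>) + (z - \<i>)) / (1 - e t)"
        using q unfolding x by (simp add: field_simps)
      have b: "of_real (X t) - z = (e t * (z + \<i>) - (z - \<i>)) / (1 - e t)"
        using q unfolding x by (simp add: field_simps)
      show ?thesis unfolding a b using q n by simp
    qed
    finally show ?thesis using False by (simp add: nev_def)
  qed
  define \<rho> where "\<rho> = distr (density M (\<lambda>t. ennreal (m * indicator {t. e t \<noteq> 1} t))) borel X"
  have fin: "fin_borel \<rho>"
  proof (intro fin_borel.intro finite_measureI fin_borel_axioms.intro)
    have "emeasure \<rho> (space \<rho>) = (\<integral>\<^sup>+t. ennreal (m * indicator {t. e t \<noteq> 1} t) \<partial>M)"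
      unfolding \<rho>_def by (simp add: emeasure_distr emeasure_density)
    also have "\<dots> \<le> (\<integral>\<^sup>+t. ennreal m \<partial>M)" by (intro nn_integral_mono) (auto simp: indicator_def m)
    also have "\<dots> = ennreal m" using M.emeasure_space_1 by (simp del: M.space_eq_univ)
    finally show "emeasure \<rho> (space \<rho>) \<noteq> \<infinity>" by (auto simp: top_unique)
  qed (simp add: \<rho>_def)
  define c where "c = m * measure M {t. e t = 1}"
  have "f z = complex_of_real (Re (f (C 0))) + of_real c * z + nev_transform \<rho> z" if z: "0 < Im z" for z
  proof -
    obtain R where R: "z \<in> region R" using in_some_region[OF z] by blast
    have mn: "integrable M (\<lambda>t. indicator {t. e t \<noteq> 1} t *\<^sub>R nev (X t) z)"
      by (rule M.integrable_const_bound[where B = R])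
        (use norm_nev_le[OF R] region_bounds(2)[OF R] in \<open>auto simp: indicator_def\<close>)
    have "\<i> * (LINT t|M. (e t + D z) / (e t - D z)) = (LINT t|M. \<i> * ((e t + D z) / (e t - D z)))"
      by (rule integral_mult_right_zero[symmetric])
    also have "\<dots> = (LINT t|M. indicator {t. e t = 1} t *\<^sub>R z + indicator {t. e t \<noteq> 1} t *\<^sub>R nev (X t) z)"
      unfolding key[OF z] by (intro Bochner_Integration.integral_cong) (auto simp: indicator_def)
    also have "\<dots> = measure M {t. e t = 1} *\<^sub>R z + (LINT t|M. indicator {t. e t \<noteq> 1} t *\<^sub>R nev (X t) z)"
    proof -
      have "integrable M (\<lambda>t. indicat_real {t. e t = 1} t)"
        by (rule M.integrable_const_bound[where B = 1]) (auto simp: indicator_def)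
      thus ?thesis using mn by simp
    qed
    finally have 1: "\<i> * (LINT t|M. (e t + D z) / (e t - D z)) =
      measure M {t. e t = 1} *\<^sub>R z + (LINT t|M. indicator {t. e t \<noteq> 1} t *\<^sub>R nev (X t) z)" .
    have "nev_transform \<rho> z = (LINT t|density M (\<lambda>t. ennreal (m * indicator {t. e t \<noteq> 1} t)). nev (X t) z)"
      unfolding nev_transform_def \<rho>_def by (rule integral_distr) measurable
    also have "\<dots> = (LINT t|M. (m * indicator {t. e t \<noteq> 1} t) *\<^sub>R nev (X t) z)"
      by (rule integral_density) (use m in auto)
    also have "\<dots> = of_real m * (LINT t|M. indicator {t. e t \<noteq> 1} t *\<^sub>R nev (X t) z)"
      by (simp add: scaleR_conv_of_real mult.assoc)
    finally have 2: "nev_transform \<rho> z = of_real m * (LINT t|M. indicator {t. e t \<noteq> 1} t *\<^sub>R nev (X t) z)" .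
    have "f z = of_real (Re (f (C 0))) + of_real m * (\<i> * (LINT t|M. (e t + D z) / (e t - D z)))"
      using rep[OF nD[OF z]] CD[OF z] by (simp add: m_def mult_ac)
    thus ?thesis unfolding 1 2 by (simp add: c_def scaleR_conv_of_real algebra_simps)
  qed
  moreover have "0 \<le> c" using m by (simp add: c_def)
  ultimately show ?thesis using that fin by blast
qed

lemma divide_at_top_tendsto_0: "((\<lambda>y::real. a / y) \<longlongrightarrow> 0) at_top"
  by (rule tendsto_divide_0[OF tendsto_const]) (simp add: filterlim_at_top_imp_at_infinity filterlim_ident)

context fin_borel begin

lemma norm_nev_iy: assumes "1 \<le> y" shows "norm (nev x (\<i> * of_real y)) \<le> 1 + \<bar>x\<bar>" "norm (nev x (\<i> * of_real y)) \<le> y"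
proof -
  have y: "y \<le> norm (complex_of_real x - \<i> * of_real y)"
    using abs_Im_le_cmod[of "complex_of_real x - \<i> * of_real y"] assms by simp
  have "norm (1 + of_real x * (\<i> * of_real y)) \<le> 1 + \<bar>x\<bar> * y"
    using norm_triangle_ineq[of 1 "of_real x * (\<i> * of_real y)"] assms by (simp add: norm_mult)
  also have "\<dots> \<le> (1 + \<bar>x\<bar>) * y" using assms by (simp add: algebra_simps)
  also have "\<dots> \<le> (1 + \<bar>x\<bar>) * norm (complex_of_real x - \<i> * of_real y)" using y by (intro mult_left_mono) auto
  finally show "norm (nev x (\<i> * of_real y)) \<le> 1 + \<bar>x\<bar>"
    unfolding nev_def norm_divide using y assms by (subst pos_divide_le_eq) auto
  have "1 + x\<^sup>2 * y\<^sup>2 \<le> y\<^sup>2 * (x\<^sup>2 + y\<^sup>2)"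
    using power_increasing[of 0 4 y] assms by (simp add: algebra_simps power2_eq_square power4_eq_xxxx)
  hence "(norm (1 + of_real x * (\<i> * of_real y)))\<^sup>2 \<le> (y * norm (complex_of_real x - \<i> * of_real y))\<^sup>2"
    unfolding power_mult_distrib cmod_power2 by (simp add: power_mult_distrib)
  hence "norm (1 + of_real x * (\<i> * of_real y)) \<le> y * norm (complex_of_real x - \<i> * of_real y)"
    by (rule power2_le_imp_le) (use assms in auto)
  thus "norm (nev x (\<i> * of_real y)) \<le> y"
    unfolding nev_def norm_divide using y assms by (subst pos_divide_le_eq) auto
qed

lemma nev_transform_iy_tendsto: "((\<lambda>y. nev_transform \<rho> (\<i> * of_real y) / of_real y) \<longlongrightarrow> 0) at_top"
proof -
  have "((\<lambda>y. LINT x|\<rho>. nev x (\<i> * of_real y) / of_real y) \<longlongrightarrow> (LINT x|\<rho>. 0)) at_top"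
  proof (rule integral_dominated_convergence_at_top[where w = "\<lambda>_. 1"])
    show "\<forall>\<^sub>F y in at_top. AE x in \<rho>. norm (nev x (\<i> * of_real y) / of_real y) \<le> 1"
      using eventually_ge_at_top[of 1] by eventually_elim (auto simp: norm_divide norm_nev_iy divide_le_eq)
    show "AE x in \<rho>. ((\<lambda>y. nev x (\<i> * complex_of_real y) / complex_of_real y) \<longlongrightarrow> 0) at_top"
    proof (rule AE_I2, rule tendsto_norm_zero_cancel, rule tendsto_sandwich)
      fix x
      show "\<forall>\<^sub>F y in at_top. 0 \<le> norm (nev x (\<i> * of_real y) / of_real y)" by simp
      show "\<forall>\<^sub>F y in at_top. norm (nev x (\<i> * of_real y) / of_real y) \<le> (1 + \<bar>x\<bar>) / y"
        using eventually_ge_at_top[of 1] by eventually_elim (auto simp: norm_divide norm_nev_iy intro!: divide_right_mono)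
      show "((\<lambda>y. (1 + \<bar>x\<bar>) / y) \<longlongrightarrow> 0) at_top" by (rule divide_at_top_tendsto_0)
    qed simp
  qed auto
  thus ?thesis by (simp add: nev_transform_def)
qed

end

text \<open>The coefficient of the linear term can be read off at infinity, hence is determined by the function.\<close>

lemma nevanlinna_slope:
  assumes "fin_borel \<rho>" and f: "\<And>z. 0 < Im z \<Longrightarrow> f z = complex_of_real a + of_real c * z + nev_transform \<rho> z"
  shows "((\<lambda>y. f (\<i> * of_real y) / (\<i> * of_real y)) \<longlongrightarrow> of_real c) at_top"
proof -
  interpret fin_borel \<rho> by fact
  have "((\<lambda>y::real. of_real a / of_real y / \<i> + of_real c + nev_transform \<rho> (\<i> * of_real y) / of_real y / \<i>) \<longlongrightarrow> 0 / \<i> + of_real c + 0 / \<i>) at_top"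
  proof (intro tendsto_intros nev_transform_iy_tendsto)
    show "((\<lambda>y::real. complex_of_real a / of_real y) \<longlongrightarrow> 0) at_top"
    proof -
      have "((\<lambda>y::real. a / y) \<longlongrightarrow> 0) at_top"
        by (rule divide_at_top_tendsto_0)
      from tendsto_of_real[OF this, where 'a = complex] show ?thesis by simp
    qed
  qed auto
  moreover have "\<forall>\<^sub>F y::real in at_top. of_real a / of_real y / \<i> + of_real c + nev_transform \<rho> (\<i> * of_real y) / of_real y / \<i>
     = f (\<i> * of_real y) / (\<i> * of_real y)"
    using eventually_gt_at_top[of 0] by eventually_elim (simp add: f field_simps)
  ultimately show ?thesis using Lim_transform_eventually by force
qed

section \<open>Reciprocal Cauchy transforms\<close>

lemma class_P_slope:
  assumes "\<phi> \<in> class_P"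
  shows "((\<lambda>y. \<phi> (\<i> * of_real y) / (\<i> * of_real y)) \<longlongrightarrow> 1) at_top"
proof -
  obtain \<mu> where mu: "real_distribution \<mu>" and \<phi>: "\<And>z. 0 < Im z \<Longrightarrow> \<phi> z = recip_cauchy_transform \<mu> z"
    using assms by (auto simp: class_P_def upper_half_plane_def)
  interpret real_distribution \<mu> by fact
  have "((\<lambda>y. LINT x|\<mu>. (\<i> * of_real y) * (1 / (\<i> * of_real y - complex_of_real x))) \<longlongrightarrow> (LINT x|\<mu>. 1)) at_top"
  proof (rule integral_dominated_convergence_at_top[where w = "\<lambda>_. 1"])
    show "\<forall>\<^sub>F y in at_top. AE x in \<mu>. norm ((\<i> * of_real y) * (1 / (\<i> * of_real y - complex_of_real x))) \<le> 1"
      using eventually_gt_at_top[of 0]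
    proof eventually_elim
      case (elim y)
      have "y \<le> norm (\<i> * of_real y - complex_of_real x)" for x
        using abs_Im_le_cmod[of "\<i> * of_real y - complex_of_real x"] elim by simp
      thus ?case using elim by (auto simp: norm_mult norm_divide divide_le_eq)
    qed
    show "AE x in \<mu>. ((\<lambda>y. (\<i> * of_real y) * (1 / (\<i> * of_real y - complex_of_real x))) \<longlongrightarrow> 1) at_top"
    proof (rule AE_I2)
      fix x :: real
      have "((\<lambda>y::real. x / y) \<longlongrightarrow> 0) at_top"
        by (rule divide_at_top_tendsto_0)
      note T = tendsto_of_real[OF this, where 'a = complex]
      have "((\<lambda>y. 1 / (1 - of_real (x / y) / \<i>)) \<longlongrightarrow> 1 / (1 - of_real 0 / \<i>)) at_top"
        by (rule tendsto_divide[OF tendsto_const tendsto_diff[OF tendsto_const tendsto_divide[OF T tendsto_const]]]) auto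
      moreover have "\<forall>\<^sub>F y in at_top. 1 / (1 - of_real (x / y) / \<i>) = (\<i> * of_real y) * (1 / (\<i> * of_real y - complex_of_real x))"
        using eventually_gt_at_top[of 0]
      proof eventually_elim
        case (elim y)
        have "\<i> * of_real y - complex_of_real x \<noteq> 0" using elim by (auto simp: complex_eq_iff)
        moreover have "1 - of_real (x / y) / \<i> = (\<i> * of_real y - complex_of_real x) / (\<i> * of_real y)"
          using elim by (simp add: field_simps)
        ultimately show ?case using elim by simp
      qed
      ultimately show "((\<lambda>y. (\<i> * of_real y) * (1 / (\<i> * of_real y - complex_of_real x))) \<longlongrightarrow> 1) at_top"
        using Lim_transform_eventually by force
    qed
  qed auto
  hence "((\<lambda>y. (\<i> * of_real y) * cauchy_transform \<mu> (\<i> * of_real y)) \<longlongrightarrow> 1) at_top"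
    unfolding cauchy_transform_def integral_mult_right_zero using prob_space by simp
  from tendsto_inverse[OF this]
  have "((\<lambda>y. inverse ((\<i> * of_real y) * cauchy_transform \<mu> (\<i> * of_real y))) \<longlongrightarrow> 1) at_top" by simp
  moreover have "\<forall>\<^sub>F y in at_top. inverse ((\<i> * of_real y) * cauchy_transform \<mu> (\<i> * of_real y)) = \<phi> (\<i> * of_real y) / (\<i> * of_real y)"
    using eventually_gt_at_top[of 0] by eventually_elim (simp add: \<phi> recip_cauchy_transform_def field_simps)
  ultimately show ?thesis using Lim_transform_eventually by force
qed

text \<open>The reciprocal of a Cauchy transform has slope 1 at infinity because the measure has mass 1.\<close>

lemma class_P_nevanlinna:
  assumes "\<phi> \<in> class_P" "\<phi> holomorphic_on upper_half_plane" "\<phi> ` upper_half_plane \<subseteq> upper_half_plane"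
  obtains a \<rho> where "fin_borel \<rho>" "\<And>z. 0 < Im z \<Longrightarrow> \<phi> z = complex_of_real a + z + nev_transform \<rho> z"
proof -
  have "0 \<le> Im (\<phi> z)" if "0 < Im z" for z
    using assms(3) that by (force simp: upper_half_plane_def)
  then obtain a c \<rho> where r: "0 \<le> c" "fin_borel \<rho>"
    "\<And>z. 0 < Im z \<Longrightarrow> \<phi> z = complex_of_real a + of_real c * z + nev_transform \<rho> z"
    by (rule nevanlinna_representation[OF assms(2)]) (assumption, rule that)
  have "of_real c = (1::complex)"
    by (rule tendsto_unique[OF _ nevanlinna_slope[OF r(2,3)] class_P_slope[OF assms(1)]]) simp
  thus ?thesis using r(2,3) that by (simp add: of_real_eq_1_iff)
qed

text \<open>Represent \<open>- 1 / \<phi>\<close> instead of \<open>\<phi>\<close>.  The slope of \<open>\<phi>\<close> turns into a bound for the second moment of the representing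
measure \<open>\<rho>\<close>, by monotone convergence along \<open>\<i> * y\<close>, and \<open>(1 + x\<^sup>2) * \<rho>\<close> is a probability measure with
Cauchy transform \<open>1 / \<phi>\<close> up to a constant.  The constant vanishes because both sides tend to \<open>0\<close> along the
imaginary axis.\<close>

lemma class_P_I:
  assumes hol: "\<phi> holomorphic_on upper_half_plane" and pos: "\<And>z. 0 < Im z \<Longrightarrow> 0 < Im (\<phi> z)"
    and slope: "((\<lambda>y. \<phi> (\<i> * of_real y) / (\<i> * of_real y)) \<longlongrightarrow> 1) at_top"
  shows "\<phi> \<in> class_P"
proof -
  define q where "q = (\<lambda>z. - 1 / \<phi> z)"
  have nz: "\<phi> z \<noteq> 0" if "0 < Im z" for z using pos[OF that] by auto
  have qhol: "q holomorphic_on upper_half_plane"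
    unfolding q_def using nz by (intro holomorphic_intros hol) (auto simp: upper_half_plane_def)
  have qpos: "0 \<le> Im (q z)" if "0 < Im z" for z
    using pos[OF that] by (simp add: q_def Im_divide divide_nonneg_nonneg)
  obtain a c \<rho> where r: "0 \<le> c" "fin_borel \<rho>"
    "\<And>z. 0 < Im z \<Longrightarrow> q z = complex_of_real a + of_real c * z + nev_transform \<rho> z"
    by (rule nevanlinna_representation[OF qhol qpos]) (assumption, rule that)
  interpret fin_borel \<rho> by fact
  have T: "((\<lambda>y. - (\<i> * of_real y) * q (\<i> * of_real y)) \<longlongrightarrow> 1) at_top"
  proof -
    have "((\<lambda>y. inverse (\<phi> (\<i> * of_real y) / (\<i> * of_real y))) \<longlongrightarrow> inverse 1) at_top"
      by (intro tendsto_inverse slope) simp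
    moreover have "inverse (\<phi> (\<i> * of_real y) / (\<i> * of_real y)) = - (\<i> * of_real y) * q (\<i> * of_real y)" for y
      by (simp add: q_def)
    ultimately show ?thesis by simp
  qed
  have inv0: "((\<lambda>y::real. 1 / (\<i> * of_real y)) \<longlongrightarrow> 0) at_top"
  proof -
    have "((\<lambda>y::real. 1 / y) \<longlongrightarrow> 0) at_top"
      by (rule divide_at_top_tendsto_0)
    from tendsto_divide[OF tendsto_of_real[OF this, where 'a = complex] tendsto_const[of \<i>]]
    have "((\<lambda>y. complex_of_real (1 / y) / \<i>) \<longlongrightarrow> 0) at_top" by (simp only: of_real_0 div_0) simp
    moreover have "complex_of_real (1 / y) / \<i> = 1 / (\<i> * of_real y)" for y by (simp only: of_real_divide of_real_1 divide_divide_eq_left' mult.commute)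
    ultimately show ?thesis by (simp only:)
  qed
  have q0: "((\<lambda>y. q (\<i> * of_real y)) \<longlongrightarrow> 0) at_top"
  proof (rule Lim_transform_eventually)
    show "((\<lambda>y. - ((- (\<i> * of_real y) * q (\<i> * of_real y)) * (1 / (\<i> * of_real y)))) \<longlongrightarrow> 0) at_top"
      using tendsto_minus[OF tendsto_mult[OF T inv0]] by simp
    show "\<forall>\<^sub>F y::real in at_top. - ((- (\<i> * of_real y) * q (\<i> * of_real y)) * (1 / (\<i> * of_real y))) = q (\<i> * of_real y)"
      using eventually_gt_at_top[of 0] by eventually_elim simp
  qed
  have c: "c = 0"
  proof -
    have "((\<lambda>y. q (\<i> * of_real y) * (1 / (\<i> * of_real y))) \<longlongrightarrow> 0) at_top"
      using tendsto_mult[OF q0 inv0] by simp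
    hence "of_real c = (0::complex)"
      using tendsto_unique[OF _ nevanlinna_slope[OF r(2,3)], of 0] by simp
    thus ?thesis by simp
  qed
  define h where "h = (\<lambda>y x. y\<^sup>2 * ((1 + x\<^sup>2) / (x\<^sup>2 + y\<^sup>2)) :: real)"
  have hy: "h y x = y * (y * ((1 + x\<^sup>2) / (norm (complex_of_real x - \<i> * of_real y))\<^sup>2))" for x y
    by (simp add: h_def norm_real_minus_sq) (simp add: power2_eq_square)
  have hint: "integrable \<rho> (h y)" if "0 < y" for y
    unfolding hy by (intro integrable_mult_right integrable_ratio) (use that in simp)
  have hI: "(LINT x|\<rho>. h y x) = Re (- (\<i> * of_real y) * q (\<i> * of_real y))" if "0 < y" for y
    unfolding hy integral_mult_right_zero using that Im_nev_transform[of "\<i> * of_real y"]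
    by (simp add: r(3) c)
  have hlim: "((\<lambda>n. LINT x|\<rho>. h (real (Suc n)) x) \<longlonglongrightarrow> 1)"
  proof -
    have "((\<lambda>y. Re (- (\<i> * of_real y) * q (\<i> * of_real y))) \<longlongrightarrow> Re 1) at_top" by (intro tendsto_Re T)
    moreover have "filterlim (\<lambda>n. real (Suc n)) at_top sequentially"
      using filterlim_compose[OF filterlim_real_sequentially filterlim_Suc] .
    ultimately have "(\<lambda>n. Re (- (\<i> * of_real (real (Suc n))) * q (\<i> * of_real (real (Suc n))))) \<longlonglongrightarrow> 1"
      using filterlim_compose by fastforce
    moreover have "(LINT x|\<rho>. h (real (Suc n)) x) = Re (- (\<i> * of_real (real (Suc n))) * q (\<i> * of_real (real (Suc n))))" for n
      by (rule hI) simp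
    ultimately show ?thesis by (simp only:)
  qed
  have hmono: "h y x \<le> h y' x" if "0 < y" "y \<le> y'" for x y y'
  proof -
    have p: "0 < x\<^sup>2 + y\<^sup>2" "0 < x\<^sup>2 + y'\<^sup>2" using that by (auto intro!: add_nonneg_pos)
    have "y\<^sup>2 \<le> y'\<^sup>2" using that by (intro power_mono) auto
    hence "x\<^sup>2 * y\<^sup>2 \<le> x\<^sup>2 * y'\<^sup>2" by (intro mult_left_mono) auto
    hence "y\<^sup>2 / (x\<^sup>2 + y\<^sup>2) \<le> y'\<^sup>2 / (x\<^sup>2 + y'\<^sup>2)"
      using p by (simp add: divide_simps) (simp add: algebra_simps)
    hence "(1 + x\<^sup>2) * (y\<^sup>2 / (x\<^sup>2 + y\<^sup>2)) \<le> (1 + x\<^sup>2) * (y'\<^sup>2 / (x\<^sup>2 + y'\<^sup>2))"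
      by (rule mult_left_mono) simp
    thus ?thesis by (simp add: h_def mult.commute)
  qed
  have hpt: "(\<lambda>n. h (real (Suc n)) x) \<longlonglongrightarrow> 1 + x\<^sup>2" for x
  proof -
    have "(\<lambda>n. (1 + x\<^sup>2) / (x\<^sup>2 * (1 / real (Suc n))\<^sup>2 + 1)) \<longlonglongrightarrow> (1 + x\<^sup>2) / (x\<^sup>2 * 0\<^sup>2 + 1)"
      by (intro tendsto_intros LIMSEQ_Suc[OF lim_1_over_n]) auto
    moreover have "(1 + x\<^sup>2) / (x\<^sup>2 * (1 / real (Suc n))\<^sup>2 + 1) = h (real (Suc n)) x" for n
    proof -
      have "x\<^sup>2 * (1 / real (Suc n))\<^sup>2 + 1 = (x\<^sup>2 + (real (Suc n))\<^sup>2) / (real (Suc n))\<^sup>2"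
        by (simp add: field_simps)
      thus ?thesis unfolding h_def by simp
    qed
    ultimately show ?thesis by simp
  qed
  have fin: "integrable \<rho> (\<lambda>x. 1 + x\<^sup>2)" "(LINT x|\<rho>. 1 + x\<^sup>2) = 1"
  proof -
    have i: "integrable \<rho> (h (real (Suc n)))" for n by (rule hint) simp
    have m: "AE x in \<rho>. mono (\<lambda>n. h (real (Suc n)) x)"
      by (intro AE_I2 monoI hmono) auto
    have l: "AE x in \<rho>. (\<lambda>n. h (real (Suc n)) x) \<longlonglongrightarrow> 1 + x\<^sup>2" by (intro AE_I2 hpt)
    have u: "(\<lambda>x. 1 + x\<^sup>2) \<in> borel_measurable \<rho>" by measurable
    show "integrable \<rho> (\<lambda>x. 1 + x\<^sup>2)" by (rule integrable_monotone_convergence[OF i m l hlim u])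
    show "(LINT x|\<rho>. 1 + x\<^sup>2) = 1" by (rule integral_monotone_convergence[OF i m l hlim u])
  qed
  define \<mu> where "\<mu> = density \<rho> (\<lambda>x. ennreal (1 + x\<^sup>2))"
  have \<mu>: "real_distribution \<mu>"
  proof (intro real_distribution.intro real_distribution_axioms.intro prob_spaceI)
    have "emeasure \<mu> (space \<mu>) = (\<integral>\<^sup>+x. ennreal (1 + x\<^sup>2) \<partial>\<rho>)" by (simp add: \<mu>_def emeasure_density)
    also have "\<dots> = ennreal (LINT x|\<rho>. 1 + x\<^sup>2)" by (rule nn_integral_eq_integral[OF fin(1)]) simp
    finally show "emeasure \<mu> (space \<mu>) = 1" by (simp add: fin(2))
  qed (simp add: \<mu>_def)
  interpret \<mu>: real_distribution \<mu> by fact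
  have xint: "integrable \<rho> (\<lambda>x. x)"
  proof (rule Bochner_Integration.integrable_bound[OF fin(1)])
    have "\<bar>x\<bar> \<le> 1 + x\<^sup>2" for x :: real
      using sum_squares_bound[of 1 "\<bar>x\<bar>"] by simp
    thus "AE x in \<rho>. norm x \<le> norm (1 + x\<^sup>2)" by (intro AE_I2) (simp add: abs_of_nonneg)
  qed simp
  define b where "b = a - (LINT x|\<rho>. x)"
  have G: "cauchy_transform \<mu> z = of_real b - q z" "norm (cauchy_transform \<mu> z) \<le> 1 / Im z" if z: "0 < Im z" for z
  proof -
    have n: "norm (1 / (z - complex_of_real x)) \<le> 1 / Im z" for x
      using abs_Im_le_cmod[of "z - complex_of_real x"] z by (simp add: norm_divide frac_le)
    have gi: "integrable \<mu> (\<lambda>x. 1 / (z - complex_of_real x))"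
      by (rule \<mu>.integrable_const_bound[where B = "1 / Im z"]) (auto simp: n)
    show "norm (cauchy_transform \<mu> z) \<le> 1 / Im z"
      using Bochner_Integration.integral_norm_bound_integral[OF gi, of "\<lambda>_. 1 / Im z"] \<mu>.prob_space
      by (simp add: cauchy_transform_def n)
    have "cauchy_transform \<mu> z = (LINT x|\<rho>. (1 + x\<^sup>2) *\<^sub>R (1 / (z - complex_of_real x)))"
      unfolding cauchy_transform_def \<mu>_def by (rule integral_density) auto
    also have "\<dots> = (LINT x|\<rho>. - of_real x - nev x z)"
    proof (intro Bochner_Integration.integral_cong refl)
      fix x
      have "complex_of_real x - z \<noteq> 0" "z - complex_of_real x \<noteq> 0" using real_minus_ne_0[OF z, of x] by auto
      thus "(1 + x\<^sup>2) *\<^sub>R (1 / (z - complex_of_real x)) = - of_real x - nev x z"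
        by (simp add: nev_def scaleR_conv_of_real divide_simps) (simp add: algebra_simps power2_eq_square)
    qed
    also have "\<dots> = - of_real (LINT x|\<rho>. x) - nev_transform \<rho> z"
      using xint integrable_nev[OF z] by (simp add: nev_transform_def)
    finally show "cauchy_transform \<mu> z = of_real b - q z" using r(3)[OF z] c by (simp add: b_def)
  qed
  have b0: "b = 0"
  proof -
    have "((\<lambda>y. cauchy_transform \<mu> (\<i> * of_real y)) \<longlongrightarrow> 0) at_top"
    proof (rule Lim_null_comparison)
      show "\<forall>\<^sub>F y in at_top. norm (cauchy_transform \<mu> (\<i> * of_real y)) \<le> 1 / y"
        using eventually_gt_at_top[of 0] by eventually_elim (use G(2)[of "\<i> * of_real y" for y] in simp)
      show "((\<lambda>y::real. 1 / y) \<longlongrightarrow> 0) at_top"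
        by (rule divide_at_top_tendsto_0)
    qed
    moreover have "((\<lambda>y. cauchy_transform \<mu> (\<i> * of_real y)) \<longlongrightarrow> of_real b - 0) at_top"
    proof (rule Lim_transform_eventually)
      show "((\<lambda>y. of_real b - q (\<i> * of_real y)) \<longlongrightarrow> of_real b - 0) at_top" by (intro tendsto_intros q0)
      show "\<forall>\<^sub>F y in at_top. of_real b - q (\<i> * of_real y) = cauchy_transform \<mu> (\<i> * of_real y)"
        using eventually_gt_at_top[of 0] by eventually_elim (simp add: G(1))
    qed
    ultimately have "of_real b = (0::complex)" using tendsto_unique by force
    thus ?thesis by simp
  qed
  have "\<phi> z = recip_cauchy_transform \<mu> z" if "0 < Im z" for z
    using G(1)[OF that] nz[OF that] by (simp add: b0 recip_cauchy_transform_def q_def)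
  thus ?thesis using \<mu> by (auto simp: class_P_def upper_half_plane_def)
qed

section \<open>A finite measure is determined by its Nevanlinna transform\<close>

text \<open>Fubini's theorem: the Fourier transform of the convolution of \<open>\<rho>\<close> with a Cauchy density of width \<open>y\<close> is a product.\<close>

lemma (in fin_borel) poisson_fourier:
  assumes y: "0 < y"
  shows "(LINT u|lborel. iexp (s * u) * of_real (LINT x|\<rho>. y / ((u - x)\<^sup>2 + y\<^sup>2)))
    = (LINT x|\<rho>. iexp (s * x)) * (LINT v|lborel. iexp (s * (y * v)) * of_real (inverse (1 + v\<^sup>2)))"
proof -
  have ic: "integrable lborel (\<lambda>v::real. inverse (1 + v\<^sup>2))"
    using integrable_inverse_1_plus_square by (simp add: set_integrable_def)
  have pos: "0 < a\<^sup>2 + y\<^sup>2" for a using y by (intro add_nonneg_pos) auto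
  interpret P: pair_sigma_finite lborel \<rho> by unfold_locales
  define f where "f = (\<lambda>u x. iexp (s * u) * complex_of_real (y / ((u - x)\<^sup>2 + y\<^sup>2)))"
  have shape2: "y / ((x + y * v - x)\<^sup>2 + y\<^sup>2) = (1 / y) * inverse (1 + v\<^sup>2)" for x v
  proof -
    have "(x + y * v - x)\<^sup>2 + y\<^sup>2 = y\<^sup>2 * (1 + v\<^sup>2)" by (simp add: power_mult_distrib algebra_simps)
    thus ?thesis using y by (simp add: power2_eq_square divide_simps)
  qed
  have shape: "y * (y / ((x + y * v - x)\<^sup>2 + y\<^sup>2)) = inverse (1 + v\<^sup>2)" for x v
    unfolding shape2 using y by simp
  have pint: "integrable lborel (\<lambda>u. y / ((u - x)\<^sup>2 + y\<^sup>2))" "(LINT u|lborel. y / ((u - x)\<^sup>2 + y\<^sup>2)) = (LINT v|lborel. inverse (1 + v\<^sup>2))" for x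
  proof -
    have "integrable lborel (\<lambda>v. y / ((x + y * v - x)\<^sup>2 + y\<^sup>2))"
      unfolding shape2 by (intro integrable_mult_right ic)
    thus "integrable lborel (\<lambda>u. y / ((u - x)\<^sup>2 + y\<^sup>2))"
      using lborel_integrable_real_affine_iff[of y "\<lambda>u. y / ((u - x)\<^sup>2 + y\<^sup>2)" x] y by simp
    show "(LINT u|lborel. y / ((u - x)\<^sup>2 + y\<^sup>2)) = (LINT v|lborel. inverse (1 + v\<^sup>2))"
      using lborel_integral_real_affine[of y "\<lambda>u. y / ((u - x)\<^sup>2 + y\<^sup>2)" x] y
      unfolding shape2 integral_mult_right_zero by simp
  qed
  have [measurable]: "case_prod f \<in> borel_measurable (lborel \<Otimes>\<^sub>M \<rho>)"
    unfolding f_def by measurable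
  have nf: "norm (f u x) = y / ((u - x)\<^sup>2 + y\<^sup>2)" for u x
    using y pos[of "u - x"] by (simp add: f_def norm_mult norm_divide del: of_real_divide of_real_add)
  have fint: "integrable (lborel \<Otimes>\<^sub>M \<rho>) (case_prod f)"
  proof -
    interpret Q: pair_sigma_finite \<rho> lborel by unfold_locales
    have "integrable (\<rho> \<Otimes>\<^sub>M lborel) (\<lambda>(x, u). f u x)"
    proof (rule Q.Fubini_integrable)
      show "(\<lambda>(x, u). f u x) \<in> borel_measurable (\<rho> \<Otimes>\<^sub>M lborel)" unfolding f_def by measurable
      show "integrable \<rho> (\<lambda>x. LINT u|lborel. norm (case (x, u) of (x, u) \<Rightarrow> f u x))"
        by (simp add: nf pint)
      show "AE x in \<rho>. integrable lborel (\<lambda>u. case (x, u) of (x, u) \<Rightarrow> f u x)"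
      proof (rule AE_I2)
        fix x
        have "integrable lborel (\<lambda>u. f u x)"
        proof (rule Bochner_Integration.integrable_bound[OF pint(1)[of x]])
          show "(\<lambda>u. f u x) \<in> borel_measurable lborel" unfolding f_def by measurable
          show "AE u in lborel. norm (f u x) \<le> norm (y / ((u - x)\<^sup>2 + y\<^sup>2))" unfolding nf using y by simp
        qed
        thus "integrable lborel (\<lambda>u. case (x, u) of (x, u) \<Rightarrow> f u x)" by simp
      qed
    qed
    thus ?thesis by (rule Q.integrable_product_swap_iff[THEN iffD2, of "\<lambda>(x,u). f u x", simplified]|simp add: P.integrable_product_swap_iff)
  qed
  have "(LINT u|lborel. iexp (s * u) * of_real (LINT x|\<rho>. y / ((u - x)\<^sup>2 + y\<^sup>2))) = (LINT u|lborel. LINT x|\<rho>. f u x)"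
    unfolding f_def by (simp del: of_real_divide)
  also have "\<dots> = (LINT x|\<rho>. LINT u|lborel. f u x)" by (rule P.Fubini_integral[OF fint, symmetric])
  also have "\<dots> = (LINT x|\<rho>. iexp (s * x) * (LINT v|lborel. iexp (s * (y * v)) * of_real (inverse (1 + v\<^sup>2))))"
  proof (intro Bochner_Integration.integral_cong refl)
    fix x
    have "(LINT u|lborel. f u x) = (LINT v|lborel. y *\<^sub>R f (x + y * v) x)"
      using lborel_integral_real_affine[of y "\<lambda>u. f u x" x] y by simp
    also have "\<dots> = (LINT v|lborel. iexp (s * x) * (iexp (s * (y * v)) * of_real (inverse (1 + v\<^sup>2))))"
    proof (intro Bochner_Integration.integral_cong refl)
      fix v
      have "y *\<^sub>R f (x + y * v) x = iexp (s * (x + y * v)) * complex_of_real (y * (y / ((x + y * v - x)\<^sup>2 + y\<^sup>2)))"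
        unfolding f_def by (simp add: scaleR_conv_of_real)
      also have "iexp (s * (x + y * v)) = iexp (s * x) * iexp (s * (y * v))"
        by (simp add: exp_add[symmetric] algebra_simps)
      finally show "y *\<^sub>R f (x + y * v) x = iexp (s * x) * (iexp (s * (y * v)) * of_real (inverse (1 + v\<^sup>2)))"
        unfolding shape by (simp only: mult.assoc)
    qed
    also have "\<dots> = iexp (s * x) * (LINT v|lborel. iexp (s * (y * v)) * of_real (inverse (1 + v\<^sup>2)))"
      by (rule integral_mult_right_zero)
    finally show "(LINT u|lborel. f u x) = \<dots>" .
  qed
  finally show ?thesis by simp
qed

text \<open>As the width tends to \<open>0\<close>, the second factor tends to \<open>pi\<close>, hence can be cancelled eventually.\<close>

lemma poisson_fourier_nonzero:
  "eventually (\<lambda>n. (LINT v|lborel. iexp (s * (1 / real (n + 2) * v)) * complex_of_real (inverse (1 + v\<^sup>2))) \<noteq> 0) sequentially"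
proof -
  have ic: "integrable lborel (\<lambda>v::real. inverse (1 + v\<^sup>2))" and I: "(LINT v|lborel. inverse (1 + v\<^sup>2)) = pi"
    using integrable_inverse_1_plus_square LBINT_inverse_1_plus_square
    by (auto simp: set_integrable_def interval_lebesgue_integral_def set_lebesgue_integral_def)
  have "(\<lambda>n. LINT v|lborel. iexp (s * (1 / real (n + 2) * v)) * complex_of_real (inverse (1 + v\<^sup>2))) \<longlonglongrightarrow>
    (LINT v|lborel. complex_of_real (inverse (1 + v\<^sup>2)))"
  proof (rule integral_dominated_convergence[OF _ _ ic])
    show "AE v in lborel. (\<lambda>n. iexp (s * (1 / real (n + 2) * v)) * complex_of_real (inverse (1 + v\<^sup>2))) \<longlonglongrightarrow> complex_of_real (inverse (1 + v\<^sup>2))"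
    proof (rule AE_I2)
      fix v
      have "(\<lambda>n. iexp (s * (1 / real (n + 2) * v)) * complex_of_real (inverse (1 + v\<^sup>2))) \<longlonglongrightarrow> iexp (s * (0 * v)) * complex_of_real (inverse (1 + v\<^sup>2))"
        by (intro tendsto_intros LIMSEQ_ignore_initial_segment[OF lim_1_over_n])
      thus "(\<lambda>n. iexp (s * (1 / real (n + 2) * v)) * complex_of_real (inverse (1 + v\<^sup>2))) \<longlonglongrightarrow> complex_of_real (inverse (1 + v\<^sup>2))" by simp
    qed
    show "AE v in lborel. norm (iexp (s * (1 / real (n + 2) * v)) * complex_of_real (inverse (1 + v\<^sup>2))) \<le> inverse (1 + v\<^sup>2)" for n
      by (intro AE_I2) (simp only: norm_mult norm_exp_i_times norm_of_real, simp)
  qed auto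
  moreover have "(LINT v|lborel. complex_of_real (inverse (1 + v\<^sup>2))) = of_real pi"
    using I by (subst integral_complex_of_real) simp
  ultimately have "(\<lambda>n. LINT v|lborel. iexp (s * (1 / real (n + 2) * v)) * complex_of_real (inverse (1 + v\<^sup>2))) \<longlonglongrightarrow> of_real pi"
    by (simp only:)
  thus ?thesis by (rule tendsto_imp_eventually_ne) simp
qed

text \<open>The convolution with a Cauchy density can be computed from the transform.  The restriction \<open>y < 1\<close> keeps \<open>z\<close> away
from \<open>\<i>\<close>, where \<open>1 + z\<^sup>2\<close> vanishes.\<close>

lemma (in fin_borel) poisson_nev_transform:
  assumes y: "0 < y" "y < 1"
  shows "(LINT x|\<rho>. y / ((u - x)\<^sup>2 + y\<^sup>2)) = Im ((nev_transform \<rho> (Complex u y) - Complex u y * of_real mass) / (1 + (Complex u y)\<^sup>2))"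
proof -
  let ?z = "Complex u y"
  have z: "0 < Im ?z" using y by simp
  have nz: "1 + ?z\<^sup>2 \<noteq> 0"
  proof
    assume "1 + ?z\<^sup>2 = 0"
    hence "1 + u\<^sup>2 - y\<^sup>2 = 0" "u * y = 0" by (auto simp: complex_eq_iff power2_eq_square)
    moreover have "y\<^sup>2 < 1" using y by (simp add: power_less_one_iff)
    ultimately show False using zero_le_power2[of u] by linarith
  qed
  have b: "integrable \<rho> (\<lambda>x. 1 / (complex_of_real x - ?z))"
  proof (rule integrable_const_bound[where B = "1 / y"])
    show "AE x in \<rho>. norm (1 / (complex_of_real x - ?z)) \<le> 1 / y"
      using abs_Im_le_cmod[of "complex_of_real x - ?z" for x] y by (intro AE_I2) (simp add: norm_divide frac_le)
  qed simp
  have "nev_transform \<rho> ?z = (LINT x|\<rho>. ?z + (1 + ?z\<^sup>2) * (1 / (complex_of_real x - ?z)))"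
    unfolding nev_transform_def
  proof (intro Bochner_Integration.integral_cong refl)
    fix x
    show "nev x ?z = ?z + (1 + ?z\<^sup>2) * (1 / (complex_of_real x - ?z))"
      using real_minus_ne_0[OF z, of x] by (simp add: nev_def field_simps power2_eq_square)
  qed
  also have "\<dots> = ?z * of_real mass + (1 + ?z\<^sup>2) * (LINT x|\<rho>. 1 / (complex_of_real x - ?z))"
    unfolding Bochner_Integration.integral_add[OF integrable_const integrable_mult_right[OF b]] integral_mult_right_zero
    by (simp add: scaleR_conv_of_real mult.commute)
  finally have "(nev_transform \<rho> ?z - ?z * of_real mass) / (1 + ?z\<^sup>2) = (LINT x|\<rho>. 1 / (complex_of_real x - ?z))"
    using nz by simp
  moreover have "Im (1 / (complex_of_real x - ?z)) = y / ((u - x)\<^sup>2 + y\<^sup>2)" for x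
    by (simp add: Im_divide power2_commute)
  ultimately show ?thesis by (simp only: integral_Im[OF b, symmetric])
qed

text \<open>The transform determines the convolutions with all Cauchy densities of small width, hence the characteristic function.\<close>

theorem nev_transform_inject:
  assumes "fin_borel \<rho>" "fin_borel \<rho>'" and eq: "\<And>z. 0 < Im z \<Longrightarrow> nev_transform \<rho> z = nev_transform \<rho>' z"
  shows "\<rho> = \<rho>'"
proof -
  interpret A: fin_borel \<rho> by fact
  interpret B: fin_borel \<rho>' by fact
  have m: "A.mass = B.mass" using eq[of \<i>] by simp
  have F: "(LINT x|\<rho>. iexp (s * x)) = (LINT x|\<rho>'. iexp (s * x))" for s
  proof -
    obtain n where n: "(LINT v|lborel. iexp (s * (1 / real (n + 2) * v)) * complex_of_real (inverse (1 + v\<^sup>2))) \<noteq> 0"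
      using poisson_fourier_nonzero[of s] by (auto simp: eventually_sequentially)
    define y where "y = 1 / real (n + 2)"
    have y: "0 < y" "y < 1" by (auto simp: y_def field_simps)
    have "(LINT x|\<rho>. y / ((u - x)\<^sup>2 + y\<^sup>2)) = (LINT x|\<rho>'. y / ((u - x)\<^sup>2 + y\<^sup>2))" for u
      unfolding A.poisson_nev_transform[OF y] B.poisson_nev_transform[OF y] using y by (simp add: eq m)
    hence "(LINT x|\<rho>. iexp (s * x)) * (LINT v|lborel. iexp (s * (y * v)) * of_real (inverse (1 + v\<^sup>2))) =
      (LINT x|\<rho>'. iexp (s * x)) * (LINT v|lborel. iexp (s * (y * v)) * of_real (inverse (1 + v\<^sup>2)))"
      unfolding A.poisson_fourier[OF y(1), symmetric] B.poisson_fourier[OF y(1), symmetric] by simp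
    thus ?thesis using n unfolding y_def[symmetric] by simp
  qed
  show ?thesis
  proof (cases "A.mass = 0")
    case True
    have "emeasure \<rho> X = 0 \<and> emeasure \<rho>' X = 0" if "X \<in> sets borel" for X
      using A.bounded_measure[of X] B.bounded_measure[of X] True m
      by (simp add: A.emeasure_eq_measure B.emeasure_eq_measure measure_le_0_iff)
    thus ?thesis by (intro measure_eqI) auto
  next
    case False
    hence pos: "0 < A.mass" using measure_nonneg[of \<rho> UNIV] by linarith
    define N where "N = (\<lambda>\<rho>. density \<rho> (\<lambda>_::real. ennreal (1 / A.mass)))"
    have rd: "real_distribution (N \<tau>)" "char (N \<tau>) s = (LINT x|\<tau>. iexp (s * x)) / A.mass"
      if "fin_borel \<tau>" "measure \<tau> UNIV = A.mass" for \<tau> s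
    proof -
      interpret T: fin_borel \<tau> by fact
      show "real_distribution (N \<tau>)"
      proof (intro real_distribution.intro real_distribution_axioms.intro prob_spaceI)
        show "emeasure (N \<tau>) (space (N \<tau>)) = 1"
          using pos that(2) by (simp add: N_def emeasure_density T.emeasure_eq_measure ennreal_mult[symmetric])
      qed (simp add: N_def)
      have "char (N \<tau>) s = (LINT x|\<tau>. (1 / A.mass) *\<^sub>R iexp (s * x))"
        unfolding char_def N_def by (rule integral_density) (use pos in auto)
      also have "\<dots> = (LINT x|\<tau>. iexp (s * x)) / A.mass"
        by (simp add: scaleR_conv_of_real)
      finally show "char (N \<tau>) s = (LINT x|\<tau>. iexp (s * x)) / A.mass" .
    qed
    have "char (N \<rho>) = char (N \<rho>')"
      unfolding fun_eq_iff rd(2)[OF assms(1) refl] rd(2)[OF assms(2) m[symmetric]] F by simp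
    hence "N \<rho> = N \<rho>'"
      by (rule Levy_uniqueness[OF rd(1)[OF assms(1) refl] rd(1)[OF assms(2) m[symmetric]]])
    moreover have "\<tau> = density (N \<tau>) (\<lambda>_. ennreal A.mass)" if "fin_borel \<tau>" for \<tau>
    proof -
      interpret T: fin_borel \<tau> by fact
      have "density (N \<tau>) (\<lambda>_. ennreal A.mass) = density \<tau> (\<lambda>x. 1)"
        unfolding N_def using pos by (subst density_density_eq) (auto simp: ennreal_mult[symmetric])
      also have "\<dots> = \<tau>" by (rule measure_eqI) (auto simp: emeasure_density)
      finally show ?thesis by simp
    qed
    ultimately show ?thesis using assms(1,2) by metis
  qed
qed

section \<open>Finite measures on space-time without time atoms\<close>

locale st_measure = finite_measure N for N :: "(real \<times> real) measure" +
  assumes sets_N [measurable_cong, simp]: "sets N = sets borel"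
    and atomless: "measure N (UNIV \<times> {t}) = 0"
begin

lemma space_N [simp]: "space N = UNIV" using sets_eq_imp_space_eq[OF sets_N] by simp

definition strip_mass :: "real \<Rightarrow> real \<Rightarrow> real" where
  "strip_mass s t = measure N (UNIV \<times> {s<..t})"

definition x_marginal :: "real \<Rightarrow> real \<Rightarrow> real measure" where
  "x_marginal s t = distr (density N (indicator (UNIV \<times> {s<..t}))) borel fst"

definition nev_integral :: "(real \<Rightarrow> complex) \<Rightarrow> real \<Rightarrow> real \<Rightarrow> complex" where
  "nev_integral w s t = (LINT p:UNIV \<times> {s<..t}|N. nev (fst p) (w (snd p)))"

lemma strip_borel [measurable, simp]: "A \<in> sets borel \<Longrightarrow> B \<in> sets borel \<Longrightarrow> (A :: real set) \<times> (B :: real set) \<in> sets borel"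
  unfolding borel_prod[symmetric] by simp

lemma fst_N [measurable]: "fst \<in> borel_measurable N" and snd_N [measurable]: "snd \<in> borel_measurable N"
  unfolding measurable_cong_sets[OF sets_N refl]
  by (intro borel_measurable_continuous_onI continuous_intros)+

lemma compose_fst: "f \<in> borel_measurable borel \<Longrightarrow> (\<lambda>p. f (fst p)) \<in> borel_measurable N"
  and compose_snd: "g \<in> borel_measurable borel \<Longrightarrow> (\<lambda>p. g (snd p)) \<in> borel_measurable N"
  using measurable_compose[OF fst_N] measurable_compose[OF snd_N] by auto

lemma strip_mass_cdf: "s \<le> t \<Longrightarrow> strip_mass s t = cdf (distr N borel snd) t - cdf (distr N borel snd) s"
proof -
  assume st: "s \<le> t"
  have "cdf (distr N borel snd) t - cdf (distr N borel snd) s = measure N (UNIV \<times> {..t}) - measure N (UNIV \<times> {..s})"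
    unfolding cdf_def by (subst (1 2) measure_distr) (auto simp: snd_N intro!: arg_cong2[where f = "(-)"] arg_cong[where f = "measure N"])
  also have "\<dots> = measure N (UNIV \<times> {..t} - UNIV \<times> {..s})"
    using st by (intro finite_measure_Diff[symmetric]) auto
  also have "UNIV \<times> {..t} - UNIV \<times> {..s} = (UNIV :: real set) \<times> {s<..t}" by auto
  finally show ?thesis by (simp add: strip_mass_def)
qed

lemma cdf_cont: "continuous_on A (cdf (distr N borel snd))"
proof -
  interpret D: finite_borel_measure "distr N borel snd"
    by (intro finite_borel_measure.intro finite_measure_distr finite_borel_measure_axioms.intro snd_N) auto
  have "measure (distr N borel snd) {x} = measure N (UNIV \<times> {x})" for x
    by (subst measure_distr) (auto simp: snd_N intro!: arg_cong[where f = "measure N"])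
  hence "isCont (cdf (distr N borel snd)) x" for x
    unfolding D.isCont_cdf by (simp add: atomless)
  thus ?thesis by (intro continuous_at_imp_continuous_on) auto
qed

lemma strip_mass_nonneg [simp]: "0 \<le> strip_mass s t" by (simp add: strip_mass_def)

lemma strip_mass_add: "s \<le> t \<Longrightarrow> t \<le> u \<Longrightarrow> strip_mass s u = strip_mass s t + strip_mass t u" by (simp add: strip_mass_cdf)

lemma strip_mass_refl [simp]: "strip_mass s s = 0" by (simp add: strip_mass_def)

lemma strip_mass_le_total: "strip_mass s t \<le> measure N UNIV" unfolding strip_mass_def by (rule finite_measure_mono) auto

lemma strip_mass_mono: "s' \<le> s \<Longrightarrow> t \<le> t' \<Longrightarrow> strip_mass s t \<le> strip_mass s' t'"
  unfolding strip_mass_def by (rule finite_measure_mono) auto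

text \<open>Without atoms the mass is a uniformly continuous function of time.\<close>

lemma strip_mass_uniformly_small:
  assumes "0 < e"
  obtains d where "0 < d" "\<And>s t. a \<le> s \<Longrightarrow> s \<le> t \<Longrightarrow> t \<le> b \<Longrightarrow> t - s < d \<Longrightarrow> strip_mass s t < e"
proof -
  have "uniformly_continuous_on {a..b} (cdf (distr N borel snd))"
    by (intro compact_uniformly_continuous cdf_cont) simp
  then obtain d where d: "0 < d" "\<And>x y. x \<in> {a..b} \<Longrightarrow> y \<in> {a..b} \<Longrightarrow> dist y x < d \<Longrightarrow>
      dist (cdf (distr N borel snd) y) (cdf (distr N borel snd) x) < e"
    using assms unfolding uniformly_continuous_on_def by metis
  show ?thesis
  proof (rule that[OF d(1)])
    fix s t assume "a \<le> s" "s \<le> t" "t \<le> b" "t - s < d"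
    thus "strip_mass s t < e" using d(2)[of s t] by (auto simp: strip_mass_cdf dist_real_def)
  qed
qed

lemma x_marginal_integral:
  fixes f :: "real \<Rightarrow> 'b::{banach, second_countable_topology}"
  assumes [measurable]: "f \<in> borel_measurable borel"
  shows "(LINT x|x_marginal s t. f x) = (LINT p:UNIV \<times> {s<..t}|N. f (fst p))"
proof -
  have "(LINT x|x_marginal s t. f x) = (LINT p|density N (\<lambda>p. ennreal (indicator (UNIV \<times> {s<..t}) p)). f (fst p))"
    unfolding x_marginal_def by (subst integral_distr) (auto simp: ennreal_indicator fst_N)
  also have "\<dots> = (LINT p:UNIV \<times> {s<..t}|N. f (fst p))"
    unfolding set_lebesgue_integral_def by (rule integral_density) (auto intro!: compose_fst assms)
  finally show ?thesis .
qed

lemma x_marginal_emeasure: "A \<in> sets borel \<Longrightarrow> emeasure (x_marginal s t) A = emeasure N (A \<times> {s<..t})"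
proof -
  assume A [measurable]: "A \<in> sets borel"
  have "fst -` A = A \<times> (UNIV :: real set)" by auto
  hence f: "fst -` A \<in> sets N" by simp
  have "emeasure (x_marginal s t) A = emeasure (density N (indicator (UNIV \<times> {s<..t}))) (fst -` A)"
    unfolding x_marginal_def by (subst emeasure_distr) (auto simp: fst_N)
  also have "\<dots> = (\<integral>\<^sup>+p. indicator (UNIV \<times> {s<..t}) p * indicator (fst -` A) p \<partial>N)"
    by (rule emeasure_density[OF _ f]) simp
  also have "\<dots> = (\<integral>\<^sup>+p. indicator (A \<times> {s<..t}) p \<partial>N)"
    by (intro nn_integral_cong) (auto simp: indicator_def)
  also have "\<dots> = emeasure N (A \<times> {s<..t})" by (intro nn_integral_indicator) simp
  finally show ?thesis .
qed

lemma x_marginal_fin: "fin_borel (x_marginal s t)"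
proof (intro fin_borel.intro finite_measureI fin_borel_axioms.intro)
  show "emeasure (x_marginal s t) (space (x_marginal s t)) \<noteq> \<infinity>"
    using x_marginal_emeasure[of UNIV s t] by (simp add: x_marginal_def)
qed (simp add: x_marginal_def)

lemma x_marginal_mass: "measure (x_marginal s t) UNIV = strip_mass s t"
  using x_marginal_emeasure[of UNIV s t] by (simp add: measure_def strip_mass_def)

lemma nev_integral_const: "0 < Im z \<Longrightarrow> nev_integral (\<lambda>_. z) s t = nev_transform (x_marginal s t) z"
  unfolding nev_integral_def nev_transform_def by (rule x_marginal_integral[symmetric]) simp

text \<open>Curves that are only measurable in time are allowed because Euler step functions have to be inserted into the integral.\<close>

definition admissible :: "real \<Rightarrow> (real \<Rightarrow> complex) \<Rightarrow> real \<Rightarrow> real \<Rightarrow> bool" where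
  "admissible R w s t \<longleftrightarrow> (\<forall>u\<in>{s<..t}. w u \<in> region R) \<and> set_borel_measurable borel {s<..t} w"

lemma admissibleI_cont:
  assumes "continuous_on {s..t} w" "\<And>u. s \<le> u \<Longrightarrow> u \<le> t \<Longrightarrow> w u \<in> region R"
  shows "admissible R w s t"
  unfolding admissible_def
proof
  have "continuous_on {s<..t} w" by (rule continuous_on_subset[OF assms(1)]) auto
  thus "set_borel_measurable borel {s<..t} w"
    unfolding set_borel_measurable_def by (intro borel_measurable_continuous_on_indicator) auto
qed (use assms in auto)

lemma admissible_sub: "admissible R w s t \<Longrightarrow> s \<le> s' \<Longrightarrow> t' \<le> t \<Longrightarrow> admissible R w s' t'"
proof -
  assume a: "admissible R w s t" and "s \<le> s'" "t' \<le> t"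
  hence sub: "{s'<..t'} \<subseteq> {s<..t}" by auto
  have "set_borel_measurable borel {s'<..t'} w"
  proof (rule set_borel_measurable_subset[of borel "{s<..t}"])
    show "set_borel_measurable borel {s<..t} w" using a by (simp add: admissible_def)
  qed (use sub in auto)
  thus ?thesis using a sub by (auto simp: admissible_def)
qed

lemma admissible_const: "z \<in> region R \<Longrightarrow> admissible R (\<lambda>_. z) s t" by (rule admissibleI_cont) auto

lemma strip_measurable:
  fixes f :: "real \<Rightarrow> 'b::{banach, second_countable_topology}"
  assumes "set_borel_measurable borel {s<..t} f"
  shows "set_borel_measurable N (UNIV \<times> {s<..t}) (\<lambda>p. f (snd p))"
proof -
  have [measurable]: "(\<lambda>u. indicator {s<..t} u *\<^sub>R f u) \<in> borel_measurable borel"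
    using assms by (simp add: set_borel_measurable_def)
  have "(\<lambda>p. indicator {s<..t} (snd p) *\<^sub>R f (snd p)) \<in> borel_measurable N"
    by (rule compose_snd) measurable
  moreover have "indicat_real {s<..t} (snd p) *\<^sub>R f (snd p) = indicator (UNIV \<times> {s<..t}) p *\<^sub>R f (snd p)" for p :: "real \<times> real"
    by (cases p) (auto simp: indicator_def)
  ultimately show ?thesis by (simp add: set_borel_measurable_def)
qed

lemma set_integrable_bounded:
  fixes f :: "real \<times> real \<Rightarrow> 'b::{banach, second_countable_topology}"
  assumes "set_borel_measurable N S f" "\<And>p. p \<in> S \<Longrightarrow> norm (f p) \<le> B"
  shows "set_integrable N S f"
  unfolding set_integrable_def
proof (rule integrable_const_bound[where B = "max 0 B"])
  show "AE p in N. norm (indicator S p *\<^sub>R f p) \<le> max 0 B"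
    using assms(2) by (intro AE_I2) (simp add: indicator_def le_max_iff_disj)
  show "(\<lambda>p. indicator S p *\<^sub>R f p) \<in> borel_measurable N" using assms(1) by (simp add: set_borel_measurable_def)
qed

lemma admissible_measurable:
  assumes "admissible R w s t"
  shows "set_borel_measurable N (UNIV \<times> {s<..t}) (\<lambda>p. nev (fst p) (w (snd p)))"
proof -
  have M: "(\<lambda>p. indicator (UNIV \<times> {s<..t}) p *\<^sub>R w (snd p)) \<in> borel_measurable N"
    using strip_measurable[of s t w] assms by (simp add: set_borel_measurable_def admissible_def)
  have "(\<lambda>p. indicat_real (UNIV \<times> {s<..t}) p *\<^sub>R nev (fst p) (indicator (UNIV \<times> {s<..t}) p *\<^sub>R w (snd p))) \<in> borel_measurable N"
    by (rule borel_measurable_scaleR, rule borel_measurable_indicator, simp, rule borel_nev[OF fst_N M])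
  moreover have "indicat_real (UNIV \<times> {s<..t}) p *\<^sub>R nev (fst p) (indicator (UNIV \<times> {s<..t}) p *\<^sub>R w (snd p))
    = indicator (UNIV \<times> {s<..t}) p *\<^sub>R nev (fst p) (w (snd p))" for p by (auto simp: indicator_def)
  ultimately show ?thesis by (simp add: set_borel_measurable_def)
qed

lemma admissible_integrable:
  assumes "admissible R w s t"
  shows "set_integrable N (UNIV \<times> {s<..t}) (\<lambda>p. nev (fst p) (w (snd p)))"
  by (rule set_integrable_bounded[OF admissible_measurable[OF assms], of R])
    (use assms in \<open>auto simp: admissible_def intro!: norm_nev_le\<close>)

lemma strip_integral_add:
  fixes f :: "real \<times> real \<Rightarrow> 'b::{banach, second_countable_topology}"
  assumes "set_integrable N (UNIV \<times> {s<..u}) f" "s \<le> t" "t \<le> u"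
  shows "(LINT p:UNIV \<times> {s<..u}|N. f p) = (LINT p:UNIV \<times> {s<..t}|N. f p) + (LINT p:UNIV \<times> {t<..u}|N. f p)"
proof -
  have e: "UNIV \<times> {s<..u} = UNIV \<times> {s<..t} \<union> (UNIV :: real set) \<times> {t<..u}" using assms(2,3) by auto
  have i: "set_integrable N (UNIV \<times> {s<..t}) f" "set_integrable N (UNIV \<times> {t<..u}) f"
    by (rule set_integrable_subset[OF assms(1)]; use assms(2,3) in auto)+
  show ?thesis unfolding e by (rule set_integral_Un[OF _ i]) auto
qed

lemma nev_integral_add: "admissible R w s u \<Longrightarrow> s \<le> t \<Longrightarrow> t \<le> u \<Longrightarrow> nev_integral w s u = nev_integral w s t + nev_integral w t u"
  unfolding nev_integral_def by (rule strip_integral_add[OF admissible_integrable])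

lemma nev_integral_refl [simp]: "nev_integral w s s = 0" by (simp add: nev_integral_def set_lebesgue_integral_def)

lemma strip_integral_le:
  fixes f :: "real \<Rightarrow> real"
  assumes "set_borel_measurable borel {s<..t} f" "\<And>u. u \<in> {s<..t} \<Longrightarrow> \<bar>f u\<bar> \<le> B"
  shows "set_integrable N (UNIV \<times> {s<..t}) (\<lambda>p. f (snd p))"
    "(LINT p:UNIV \<times> {s<..t}|N. f (snd p)) \<le> B * strip_mass s t"
proof -
  show i: "set_integrable N (UNIV \<times> {s<..t}) (\<lambda>p. f (snd p))"
    by (rule set_integrable_bounded[OF strip_measurable[OF assms(1)], of B]) (use assms(2) in auto)
  have c: "set_integrable N (UNIV \<times> {s<..t}) (\<lambda>p. B)"
    by (rule set_integrable_bounded[of _ _ "\<bar>B\<bar>"]) (auto simp: set_borel_measurable_def)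
  have "(LINT p:UNIV \<times> {s<..t}|N. f (snd p)) \<le> (LINT p:UNIV \<times> {s<..t}|N. B)"
    by (rule set_integral_mono[OF i c]) (use assms(2) in \<open>auto intro: order_trans[OF abs_ge_self]\<close>)
  also have "\<dots> = B * strip_mass s t" by (simp add: set_lebesgue_integral_def strip_mass_def)
  finally show "(LINT p:UNIV \<times> {s<..t}|N. f (snd p)) \<le> B * strip_mass s t" .
qed

lemma nev_integral_bound: assumes "admissible R w s t" shows "norm (nev_integral w s t) \<le> R * strip_mass s t"
proof -
  have c: "set_integrable N (UNIV \<times> {s<..t}) (\<lambda>p. R)"
    by (rule set_integrable_bounded[of _ _ "\<bar>R\<bar>"]) (auto simp: set_borel_measurable_def)
  have "norm (nev_integral w s t) \<le> (LINT p:UNIV \<times> {s<..t}|N. norm (nev (fst p) (w (snd p))))"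
    unfolding nev_integral_def by (rule set_integral_norm_bound[OF admissible_integrable[OF assms]])
  also have "\<dots> \<le> (LINT p:UNIV \<times> {s<..t}|N. R)"
    by (rule set_integral_mono[OF set_integrable_norm[OF admissible_integrable[OF assms]] c])
      (use assms in \<open>auto simp: admissible_def intro!: norm_nev_le\<close>)
  also have "\<dots> = R * strip_mass s t" by (simp add: set_lebesgue_integral_def strip_mass_def)
  finally show ?thesis .
qed

lemma norm_diff_meas:
  assumes "admissible R v s t" "admissible R w s t"
  shows "set_borel_measurable borel {s<..t} (\<lambda>u. norm (v u - w u))"
proof -
  have [measurable]: "(\<lambda>u. indicat_real {s<..t} u *\<^sub>R v u) \<in> borel_measurable borel" "(\<lambda>u. indicat_real {s<..t} u *\<^sub>R w u) \<in> borel_measurable borel"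
    using assms by (auto simp: admissible_def set_borel_measurable_def)
  have "(\<lambda>u. norm (indicat_real {s<..t} u *\<^sub>R v u - indicator {s<..t} u *\<^sub>R w u)) \<in> borel_measurable borel" by measurable
  moreover have "(\<lambda>u. norm (indicat_real {s<..t} u *\<^sub>R v u - indicator {s<..t} u *\<^sub>R w u)) = (\<lambda>u. indicator {s<..t} u *\<^sub>R norm (v u - w u))"
    by (auto simp: indicator_def fun_eq_iff)
  ultimately show ?thesis by (simp add: set_borel_measurable_def)
qed

lemma nev_integral_diff:
  assumes "admissible R v s t" "admissible R w s t"
  shows "norm (nev_integral v s t - nev_integral w s t) \<le> R\<^sup>2 * (LINT p:UNIV \<times> {s<..t}|N. norm (v (snd p) - w (snd p)))"
proof -
  have d: "norm (v u - w u) \<le> 2 * R" if "u \<in> {s<..t}" for u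
  proof -
    have "v u \<in> region R" "w u \<in> region R" using that assms by (auto simp: admissible_def)
    from region_bounds(4)[OF this(1)] region_bounds(4)[OF this(2)]
    show ?thesis using norm_triangle_ineq4[of "v u" "w u"] by linarith
  qed
  have i: "set_integrable N (UNIV \<times> {s<..t}) (\<lambda>p. norm (v (snd p) - w (snd p)))"
    by (rule strip_integral_le(1)[OF norm_diff_meas[OF assms], of "2 * R"]) (use d in auto)
  note I = admissible_integrable[OF assms(1)] admissible_integrable[OF assms(2)]
  have "nev_integral v s t - nev_integral w s t = (LINT p:UNIV \<times> {s<..t}|N. nev (fst p) (v (snd p)) - nev (fst p) (w (snd p)))"
    unfolding nev_integral_def by (rule set_integral_diff(2)[OF I, symmetric])
  also have "norm \<dots> \<le> (LINT p:UNIV \<times> {s<..t}|N. norm (nev (fst p) (v (snd p)) - nev (fst p) (w (snd p))))"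
    by (rule set_integral_norm_bound[OF set_integral_diff(1)[OF I]])
  also have "\<dots> \<le> (LINT p:UNIV \<times> {s<..t}|N. R\<^sup>2 * norm (v (snd p) - w (snd p)))"
    by (rule set_integral_mono[OF set_integrable_norm[OF set_integral_diff(1)[OF I]] set_integrable_mult_right[OF i]])
      (use assms in \<open>auto simp: admissible_def intro!: nev_lipschitz\<close>)
  also have "\<dots> = R\<^sup>2 * (LINT p:UNIV \<times> {s<..t}|N. norm (v (snd p) - w (snd p)))"
    by (rule set_integral_mult_right)
  finally show ?thesis .
qed

lemma nev_integral_diff_le:
  assumes "admissible R v s t" "admissible R w s t" "\<And>u. u \<in> {s<..t} \<Longrightarrow> norm (v u - w u) \<le> e"
  shows "norm (nev_integral v s t - nev_integral w s t) \<le> R\<^sup>2 * e * strip_mass s t"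
  using nev_integral_diff[OF assms(1,2)] mult_left_mono[OF strip_integral_le(2)[OF norm_diff_meas[OF assms(1,2)], of e], of "R\<^sup>2"] assms(3)
  by (fastforce simp: mult.assoc)

section \<open>Gronwall's inequality\<close>

text \<open>The interval is cut into finitely many pieces on which \<open>L\<close> times the mass is at most \<open>1 / 2\<close>.  On each piece the
integral over the piece absorbs half of the maximum of \<open>g\<close>, and what is left depends on the earlier pieces only.  The
constant must not depend on the starting time \<open>s\<close> nor on \<open>g\<close>.\<close>

lemma gronwall:
  fixes a b L :: real
  assumes "a \<le> b" "0 \<le> L"
  obtains C where "1 \<le> C" "\<And>s c g. a \<le> s \<Longrightarrow> s \<le> b \<Longrightarrow> continuous_on {s..b} g \<Longrightarrow>
      (\<And>t. s \<le> t \<Longrightarrow> t \<le> b \<Longrightarrow> 0 \<le> g t) \<Longrightarrow>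
      (\<And>t. s \<le> t \<Longrightarrow> t \<le> b \<Longrightarrow> g t \<le> c + L * (LINT p:UNIV \<times> {s<..t}|N. g (snd p))) \<Longrightarrow>
      (\<forall>t\<in>{s..b}. g t \<le> C * c)"
proof -
  define A where "A = measure N UNIV"
  define D where "D = 2 * (1 + L * A)"
  have A0: "0 \<le> A" by (simp add: A_def)
  have D1: "1 \<le> D" using A0 assms by (simp add: D_def)
  have "0 < 1 / (2 * (L + 1))" using assms by simp
  then obtain d where d: "0 < d" "\<And>s t. a \<le> s \<Longrightarrow> s \<le> t \<Longrightarrow> t \<le> b \<Longrightarrow> t - s < d \<Longrightarrow> strip_mass s t < 1 / (2 * (L + 1))"
    using strip_mass_uniformly_small[of _ a b] by blast
  define h where "h = d / 2"
  have h: "0 < h" "h < d" using d by (auto simp: h_def)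
  have Lt: "L * strip_mass s t \<le> 1 / 2" if "a \<le> s" "s \<le> t" "t \<le> b" "t - s \<le> h" for s t
  proof -
    have "L * strip_mass s t \<le> (L + 1) * strip_mass s t" by (simp add: algebra_simps)
    also have "\<dots> \<le> (L + 1) * (1 / (2 * (L + 1)))"
      using d(2)[of s t] that h assms by (intro mult_left_mono) auto
    also have "\<dots> = 1 / 2" using assms by simp
    finally show ?thesis .
  qed
  obtain K :: nat where K: "(b - a) / h \<le> real K" using real_arch_simple by blast
  show ?thesis
  proof (rule that[of "D ^ K"])
    show "1 \<le> D ^ K" using D1 by simp
    fix s c :: real and g :: "real \<Rightarrow> real"
    assume s: "a \<le> s" "s \<le> b" and cont: "continuous_on {s..b} g" and pos: "\<And>t. s \<le> t \<Longrightarrow> t \<le> b \<Longrightarrow> 0 \<le> g t"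
      and ineq: "\<And>t. s \<le> t \<Longrightarrow> t \<le> b \<Longrightarrow> g t \<le> c + L * (LINT p:UNIV \<times> {s<..t}|N. g (snd p))"
    have c0: "0 \<le> c" using pos[of s] ineq[of s] s by (simp add: set_lebesgue_integral_def)
    have meas: "set_borel_measurable borel {x<..y} g" if "s \<le> x" "y \<le> b" for x y
      unfolding set_borel_measurable_def
      by (intro borel_measurable_continuous_on_indicator continuous_on_subset[OF cont]) (use that in auto)
    have step: "\<forall>t. s \<le> t \<longrightarrow> t \<le> b \<longrightarrow> t \<le> s + real k * h \<longrightarrow> g t \<le> c * D ^ k" for k
    proof (induction k)
      case 0
      show ?case using ineq[of s] s by (simp add: set_lebesgue_integral_def)
    next
      case (Suc k)
      define r where "r = min b (s + real k * h)"
      define r' where "r' = min b (s + real (Suc k) * h)"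
      have r: "s \<le> r" "r \<le> r'" "r' \<le> b" "r' - r \<le> h"
        using s h by (auto simp: r_def r'_def algebra_simps min_def)
      have "compact (g ` {s..r'})" "g ` {s..r'} \<noteq> {}"
        using r by (auto intro!: compact_continuous_image continuous_on_subset[OF cont])
      then obtain m where m: "m \<in> {s..r'}" "\<And>t. t \<in> {s..r'} \<Longrightarrow> g t \<le> g m"
        using compact_attains_sup[of "g ` {s..r'}"] by auto
      have Dk: "1 \<le> D ^ k" using D1 by simp
      have le: "c * D ^ k \<le> c * D ^ Suc k"
        using c0 D1 Dk by (intro mult_left_mono power_increasing) auto
      have "g m \<le> c * D ^ Suc k"
      proof (cases "m \<le> r")
        case True
        hence "g m \<le> c * D ^ k" using Suc.IH m r by (auto simp: r_def)
        thus ?thesis using le by linarith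
      next
        case False
        have IH: "g t \<le> c * D ^ k" if "s \<le> t" "t \<le> r" for t
          using Suc.IH that by (auto simp: r_def)
        have i: "set_integrable N (UNIV \<times> {s<..m}) (\<lambda>p. g (snd p))"
          by (rule strip_integral_le(1)[OF meas, of _ _ "g m"]) (use m pos r in auto)
        have "(LINT p:UNIV \<times> {s<..m}|N. g (snd p)) = (LINT p:UNIV \<times> {s<..r}|N. g (snd p)) + (LINT p:UNIV \<times> {r<..m}|N. g (snd p))"
          by (rule strip_integral_add[OF i]) (use r False in auto)
        also have "(LINT p:UNIV \<times> {s<..r}|N. g (snd p)) \<le> c * D ^ k * strip_mass s r"
          by (rule strip_integral_le(2)[OF meas]) (use IH r pos in auto)
        also have "\<dots> \<le> c * D ^ k * A"
          unfolding A_def using c0 Dk by (intro mult_left_mono strip_mass_le_total) auto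
        also have "(LINT p:UNIV \<times> {r<..m}|N. g (snd p)) \<le> g m * strip_mass r m"
          by (rule strip_integral_le(2)[OF meas]) (use m r pos in auto)
        finally have "L * (LINT p:UNIV \<times> {s<..m}|N. g (snd p)) \<le> L * (c * D ^ k * A + g m * strip_mass r m)"
          using assms by (intro mult_left_mono) auto
        moreover have "(L * strip_mass r m) * g m \<le> (1 / 2) * g m"
          using Lt[of r m] r m s False pos[of m] by (intro mult_right_mono) auto
        ultimately have "g m \<le> c + L * (c * D ^ k * A) + g m / 2"
          using ineq[of m] m r by (simp add: algebra_simps)
        hence "g m \<le> 2 * (c + L * (c * D ^ k * A))" by simp
        also have "\<dots> \<le> 2 * (c * D ^ k + L * (c * D ^ k * A))"
          using mult_left_mono[OF Dk c0] by simp
        also have "\<dots> = c * D ^ Suc k" by (simp add: D_def algebra_simps)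
        finally show ?thesis .
      qed
      thus ?case using m by (force simp: r'_def)
    qed
    show "\<forall>t\<in>{s..b}. g t \<le> D ^ K * c"
    proof
      fix t assume t: "t \<in> {s..b}"
      have "b - a \<le> real K * h" using K h by (simp add: pos_divide_le_eq)
      hence "t \<le> s + real K * h" using t s by auto
      thus "g t \<le> D ^ K * c" using step[of K] t by (auto simp: mult.commute)
    qed
  qed
qed

end

section \<open>The Euler scheme\<close>

text \<open>A bounded real translation, used for passing between the coordinates \<open>w\<close> and \<open>w + \<gamma>\<close>.\<close>

lemma region_shift:
  assumes "v \<in> region R" "\<bar>a\<bar> \<le> g"
  shows "v + complex_of_real a \<in> region ((2 + 2 * g\<^sup>2) * R)"
proof -
  have v: "0 < Im v" "1 + (norm v)\<^sup>2 \<le> R * Im v" using assms(1) by (auto simp: region_def)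
  have "\<bar>a\<bar>\<^sup>2 \<le> g\<^sup>2" using assms(2) by (intro power_mono) auto
  hence a: "a\<^sup>2 \<le> g\<^sup>2" by simp
  have "(norm (v + of_real a))\<^sup>2 \<le> (norm v + \<bar>a\<bar>)\<^sup>2"
    using norm_triangle_ineq[of v "of_real a"] by (intro power_mono) auto
  also have "\<dots> \<le> 2 * (norm v)\<^sup>2 + 2 * a\<^sup>2" using zero_le_power2[of "norm v - \<bar>a\<bar>"]
    by (simp add: power2_sum power2_diff)
  finally have "1 + (norm (v + of_real a))\<^sup>2 \<le> 1 + 2 * (norm v)\<^sup>2 + 2 * g\<^sup>2" using a by linarith
  also have "\<dots> \<le> (2 + 2 * g\<^sup>2) * (1 + (norm v)\<^sup>2)" by (simp add: algebra_simps)
  also have "\<dots> \<le> (2 + 2 * g\<^sup>2) * (R * Im v)" by (intro mult_left_mono v) simp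
  finally show ?thesis using v by (simp add: region_def)
qed

lemma (in fin_borel) integral_sq_le:
  assumes [measurable]: "f \<in> borel_measurable borel" and b: "\<And>x. \<bar>f x\<bar> \<le> B"
  shows "(LINT x|\<rho>. f x)\<^sup>2 \<le> mass * (LINT x|\<rho>. (f x)\<^sup>2)"
proof (cases "mass = 0")
  case True
  have "norm (LINT x|\<rho>. f x) \<le> (LINT x|\<rho>. B)"
    by (rule Bochner_Integration.integral_norm_bound_integral[OF integrable_const_bound[where B = B]])
      (use b in auto)
  thus ?thesis using True by simp
next
  case False
  hence m: "0 < mass" using measure_nonneg[of \<rho> UNIV] by linarith
  define c where "c = (LINT x|\<rho>. f x) / mass"
  have i: "integrable \<rho> f" by (rule integrable_const_bound[where B = B]) (use b in auto)
  have i2: "integrable \<rho> (\<lambda>x. (f x)\<^sup>2)"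
    by (rule integrable_const_bound[where B = "B\<^sup>2"]) (use b in \<open>auto intro!: power2_le_iff_abs_le[THEN iffD2] order_trans[OF abs_ge_zero]\<close>)
  have "0 \<le> (LINT x|\<rho>. (f x - c)\<^sup>2)" by simp
  also have "\<dots> = (LINT x|\<rho>. (f x)\<^sup>2 - 2 * c * f x + c\<^sup>2)"
    by (intro Bochner_Integration.integral_cong) (auto simp: power2_diff)
  also have "\<dots> = (LINT x|\<rho>. (f x)\<^sup>2) - 2 * c * (LINT x|\<rho>. f x) + c\<^sup>2 * mass"
    using i i2 by (simp add: mult.commute)
  finally have "0 \<le> (LINT x|\<rho>. (f x)\<^sup>2) - (LINT x|\<rho>. f x)\<^sup>2 / mass"
    using m by (simp add: c_def power2_eq_square field_simps)
  thus ?thesis using m by (simp add: field_simps)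
qed

text \<open>Put \<open>S = 1 + |v|\<^sup>2\<close> and let \<open>P\<close> be the relative growth of the imaginary part, so that \<open>Im (v + \<kappa>) = Im v * (1 + P)\<close> for the
increment \<open>\<kappa>\<close>.  The Cauchy-Schwarz inequality gives \<open>|\<kappa>|\<^sup>2 \<le> S * c * mass * P\<close>, whence
\<open>1 + |v + \<kappa>|\<^sup>2 \<le> S * (1 + sqrt (c * mass * P))\<^sup>2 \<le> S * (1 + c * mass) * (1 + P)\<close>.  The factor \<open>1 + P\<close> cancels against
the growth of the imaginary part.  A bound that is linear in the mass is what allows infinitely many small steps.\<close>

lemma (in fin_borel) step_region:
  assumes v: "v \<in> region R" and a: "\<bar>a\<bar> \<le> g"
  shows "v + nev_transform \<rho> (v - complex_of_real a) \<in> region (R * (1 + (2 + 2 * g\<^sup>2) * mass))"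
proof -
  define c where "c = 2 + 2 * g\<^sup>2"
  define w where "w = v - complex_of_real a"
  define \<kappa> where "\<kappa> = nev_transform \<rho> w"
  define S where "S = 1 + (norm v)\<^sup>2"
  define P where "P = (LINT x|\<rho>. (1 + x\<^sup>2) / (norm (complex_of_real x - w))\<^sup>2)"
  have v': "0 < Im v" "S \<le> R * Im v" using v by (auto simp: region_def S_def)
  have w: "0 < Im w" "Im w = Im v" using v' by (auto simp: w_def)
  have S: "1 \<le> S" "(norm v)\<^sup>2 \<le> S" by (auto simp: S_def)
  have c: "0 \<le> c" by (simp add: c_def)
  have m: "0 \<le> mass" by simp
  have P: "0 \<le> P" unfolding P_def by simp
  have ImK: "Im \<kappa> = Im v * P" unfolding \<kappa>_def P_def using Im_nev_transform[OF w(1)] w by simp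
  have wS: "1 + (norm w)\<^sup>2 \<le> c * S"
  proof -
    have "\<bar>a\<bar>\<^sup>2 \<le> g\<^sup>2" using a by (intro power_mono) auto
    hence a2: "a\<^sup>2 \<le> g\<^sup>2" by simp
    have "(norm w)\<^sup>2 \<le> (norm v + \<bar>a\<bar>)\<^sup>2"
      unfolding w_def using norm_triangle_ineq4[of v "of_real a"] by (intro power_mono) auto
    also have "\<dots> \<le> 2 * (norm v)\<^sup>2 + 2 * a\<^sup>2" using zero_le_power2[of "norm v - \<bar>a\<bar>"]
      by (simp add: power2_sum power2_diff)
    finally have "1 + (norm w)\<^sup>2 \<le> 1 + 2 * (norm v)\<^sup>2 + 2 * g\<^sup>2" using a2 by linarith
    also have "\<dots> \<le> c * S" by (simp add: c_def S_def algebra_simps)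
    finally show ?thesis .
  qed
  obtain Q where Q: "w \<in> region Q" using in_some_region[OF w(1)] by blast
  have "(norm \<kappa>)\<^sup>2 \<le> (LINT x|\<rho>. norm (nev x w))\<^sup>2"
    unfolding \<kappa>_def nev_transform_def by (intro power_mono integral_norm_bound) simp
  also have "\<dots> \<le> mass * (LINT x|\<rho>. (norm (nev x w))\<^sup>2)"
    by (rule integral_sq_le[of _ Q]) (auto simp: norm_nev_le[OF Q])
  finally have K1: "(norm \<kappa>)\<^sup>2 \<le> mass * (LINT x|\<rho>. (norm (nev x w))\<^sup>2)" .
  have "(LINT x|\<rho>. (norm (nev x w))\<^sup>2) \<le> (LINT x|\<rho>. (c * S) * ((1 + x\<^sup>2) / (norm (complex_of_real x - w))\<^sup>2))"
  proof (rule integral_mono)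
    show "integrable \<rho> (\<lambda>x. (norm (nev x w))\<^sup>2)"
      by (rule integrable_const_bound[where B = "Q\<^sup>2"]) (auto intro!: power_mono norm_nev_le[OF Q])
    show "integrable \<rho> (\<lambda>x. (c * S) * ((1 + x\<^sup>2) / (norm (complex_of_real x - w))\<^sup>2))"
      by (intro integrable_mult_right integrable_ratio w)
    fix x
    have "(norm (nev x w))\<^sup>2 \<le> (1 + (norm w)\<^sup>2) * ((1 + x\<^sup>2) / (norm (complex_of_real x - w))\<^sup>2)"
      using norm_nev_sq[OF w(1), of x] by linarith
    also have "\<dots> \<le> (c * S) * ((1 + x\<^sup>2) / (norm (complex_of_real x - w))\<^sup>2)" by (intro mult_right_mono wS) simp
    finally show "(norm (nev x w))\<^sup>2 \<le> (c * S) * ((1 + x\<^sup>2) / (norm (complex_of_real x - w))\<^sup>2)" .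
  qed
  also have "(LINT x|\<rho>. (c * S) * ((1 + x\<^sup>2) / (norm (complex_of_real x - w))\<^sup>2)) = (c * S) * P"
    unfolding P_def by (rule integral_mult_right_zero)
  finally have "mass * (LINT x|\<rho>. (norm (nev x w))\<^sup>2) \<le> mass * (c * S * P)" by (rule mult_left_mono[OF _ m])
  with K1 have K: "(norm \<kappa>)\<^sup>2 \<le> S * (c * mass) * P" by (simp add: mult_ac)
  have "2 * norm v * norm \<kappa> \<le> S * (c * mass + P)"
  proof (rule power2_le_imp_le)
    have "(2 * norm v * norm \<kappa>)\<^sup>2 = 4 * ((norm v)\<^sup>2 * (norm \<kappa>)\<^sup>2)" by (simp add: power_mult_distrib)
    also have "\<dots> \<le> 4 * (S * (S * (c * mass) * P))"
      using S K by (intro mult_left_mono mult_mono) auto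
    also have "\<dots> = S\<^sup>2 * (4 * (c * mass) * P)" by (simp add: power2_eq_square)
    also have "\<dots> \<le> S\<^sup>2 * (c * mass + P)\<^sup>2"
      using zero_le_power2[of "c * mass - P"] by (intro mult_left_mono) (auto simp: power2_sum power2_diff algebra_simps)
    finally show "(2 * norm v * norm \<kappa>)\<^sup>2 \<le> (S * (c * mass + P))\<^sup>2" by (simp add: power_mult_distrib)
    show "0 \<le> S * (c * mass + P)" using S c m P by simp
  qed
  moreover have "(norm (v + \<kappa>))\<^sup>2 \<le> (norm v + norm \<kappa>)\<^sup>2" by (intro power_mono norm_triangle_ineq) simp
  ultimately have "1 + (norm (v + \<kappa>))\<^sup>2 \<le> S + S * (c * mass + P) + S * (c * mass) * P"
    using K by (simp add: S_def power2_sum)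
  also have "\<dots> = S * ((1 + c * mass) * (1 + P))" by (simp add: algebra_simps)
  also have "\<dots> \<le> (R * Im v) * ((1 + c * mass) * (1 + P))"
    using v' c m P by (intro mult_right_mono) auto
  also have "\<dots> = (R * (1 + c * mass)) * Im (v + \<kappa>)" by (simp add: ImK algebra_simps)
  finally have "1 + (norm (v + \<kappa>))\<^sup>2 \<le> (R * (1 + c * mass)) * Im (v + \<kappa>)" .
  moreover have "0 < Im (v + \<kappa>)" using v' P by (simp add: ImK add_pos_nonneg)
  ultimately show ?thesis by (simp add: region_def \<kappa>_def w_def c_def)
qed

lemma closed_region: "0 < R \<Longrightarrow> closed (region R)"
proof -
  assume R: "0 < R"
  have "region R = {w. 1 + (norm w)\<^sup>2 \<le> R * Im w}"
  proof -
    have "0 < Im w" if "1 + (norm w)\<^sup>2 \<le> R * Im w" for w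
    proof -
      have "0 < R * Im w" using that zero_le_power2[of "norm w"] by linarith
      thus ?thesis using R by (simp add: zero_less_mult_iff)
    qed
    thus ?thesis by (auto simp: region_def)
  qed
  moreover have "closed {w. 1 + (norm w)\<^sup>2 \<le> R * Im w}" by (intro closed_Collect_le continuous_intros)
  ultimately show ?thesis by simp
qed

locale driven = st_measure +
  fixes \<gamma> :: "real \<Rightarrow> real" and g :: real
  assumes cont_\<gamma>: "continuous_on UNIV \<gamma>" and bound_\<gamma>: "\<And>t. \<bar>\<gamma> t\<bar> \<le> g"
begin

definition driven_by :: "(real \<Rightarrow> complex) \<Rightarrow> real \<Rightarrow> real \<Rightarrow> bool" where
  "driven_by w s b \<longleftrightarrow> continuous_on {s..b} w \<and> (\<forall>t\<in>{s..b}. 0 < Im (w t) \<and> w t = w s + of_real (\<gamma> s) - of_real (\<gamma> t) + nev_integral w s t)"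

lemma driven_byD:
  assumes "driven_by w s b"
  shows "continuous_on {s..b} w" "t \<in> {s..b} \<Longrightarrow> 0 < Im (w t)"
    "t \<in> {s..b} \<Longrightarrow> w t = w s + of_real (\<gamma> s) - of_real (\<gamma> t) + nev_integral w s t"
  using assms unfolding driven_by_def by blast+

lemma nev_integral_continuous: assumes "admissible R w s b" shows "continuous_on {s..b} (nev_integral w s)"
proof (rule continuous_on_iff[THEN iffD2], intro ballI allI impI)
  fix t and e :: real assume t: "t \<in> {s..b}" and e: "0 < e"
  have "0 < e / (\<bar>R\<bar> + 1)" using e by simp
  then obtain d where d: "0 < d" "\<And>x y. s \<le> x \<Longrightarrow> x \<le> y \<Longrightarrow> y \<le> b \<Longrightarrow> y - x < d \<Longrightarrow> strip_mass x y < e / (\<bar>R\<bar> + 1)"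
    using strip_mass_uniformly_small[of _ s b] by blast
  have *: "norm (nev_integral w s y - nev_integral w s x) < e" if "s \<le> x" "x \<le> y" "y \<le> b" "y - x < d" for x y
  proof -
    have "nev_integral w s y = nev_integral w s x + nev_integral w x y" using that by (intro nev_integral_add[OF admissible_sub[OF assms]]) auto
    hence "norm (nev_integral w s y - nev_integral w s x) = norm (nev_integral w x y)" by simp
    also have "\<dots> \<le> R * strip_mass x y" using that by (intro nev_integral_bound admissible_sub[OF assms]) auto
    also have "\<dots> \<le> (\<bar>R\<bar> + 1) * strip_mass x y" by (intro mult_right_mono) auto
    also have "\<dots> < (\<bar>R\<bar> + 1) * (e / (\<bar>R\<bar> + 1))" using d(2)[OF that] by (intro mult_strict_left_mono) auto
    finally show ?thesis by simp
  qed
  show "\<exists>d>0. \<forall>t'\<in>{s..b}. dist t' t < d \<longrightarrow> dist (nev_integral w s t') (nev_integral w s t) < e"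
  proof (intro exI conjI ballI impI)
    fix t' assume t': "t' \<in> {s..b}" "dist t' t < d"
    show "dist (nev_integral w s t') (nev_integral w s t) < e"
    proof (cases "t \<le> t'")
      case True thus ?thesis using *[of t t'] t t' by (auto simp: dist_norm)
    next
      case False thus ?thesis using *[of t' t] t t' by (auto simp: dist_norm norm_minus_commute)
    qed
  qed (rule d)
qed

text \<open>The kernel is Lipschitz on a region, so two driven curves satisfy Gronwall's inequality.\<close>

lemma driven_stability:
  assumes "a \<le> b"
  obtains C where "1 \<le> C" "\<And>s v w. a \<le> s \<Longrightarrow> s \<le> b \<Longrightarrow> driven_by v s b \<Longrightarrow> driven_by w s b \<Longrightarrow>
    (\<forall>t\<in>{s..b}. v t \<in> region R \<and> w t \<in> region R) \<Longrightarrow> (\<forall>t\<in>{s..b}. norm (v t - w t) \<le> C * norm (v s - w s))"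
proof -
  obtain C where C: "1 \<le> C" "\<And>s c g. a \<le> s \<Longrightarrow> s \<le> b \<Longrightarrow> continuous_on {s..b} g \<Longrightarrow>
      (\<And>t. s \<le> t \<Longrightarrow> t \<le> b \<Longrightarrow> 0 \<le> g t) \<Longrightarrow>
      (\<And>t. s \<le> t \<Longrightarrow> t \<le> b \<Longrightarrow> g t \<le> c + R\<^sup>2 * (LINT p:UNIV \<times> {s<..t}|N. g (snd p))) \<Longrightarrow>
      (\<forall>t\<in>{s..b}. g t \<le> C * c)"
    using gronwall[OF assms, of "R\<^sup>2"] by auto
  show ?thesis
  proof (rule that[OF C(1)])
    fix s v w assume s: "a \<le> s" "s \<le> b" and v: "driven_by v s b" and w: "driven_by w s b"
      and reg: "\<forall>t\<in>{s..b}. v t \<in> region R \<and> w t \<in> region R"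
    have cv: "continuous_on {s..b} v" "continuous_on {s..b} w" using driven_byD(1)[OF v] driven_byD(1)[OF w] by auto
    have ad: "admissible R v s b" "admissible R w s b" by (intro admissibleI_cont cv; use reg in auto)+
    show "\<forall>t\<in>{s..b}. norm (v t - w t) \<le> C * norm (v s - w s)"
    proof (rule C(2)[OF s])
      show "continuous_on {s..b} (\<lambda>t. norm (v t - w t))" by (intro continuous_intros cv)
      fix t assume t: "s \<le> t" "t \<le> b"
      have "v t - w t = (v s - w s) + (nev_integral v s t - nev_integral w s t)"
      proof -
        have "v t = v s + of_real (\<gamma> s) - of_real (\<gamma> t) + nev_integral v s t" "w t = w s + of_real (\<gamma> s) - of_real (\<gamma> t) + nev_integral w s t"
          using driven_byD(3)[OF v, of t] driven_byD(3)[OF w, of t] t by auto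
        thus ?thesis by simp
      qed
      hence "norm (v t - w t) \<le> norm (v s - w s) + norm (nev_integral v s t - nev_integral w s t)" by (metis norm_triangle_ineq)
      also have "norm (nev_integral v s t - nev_integral w s t) \<le> R\<^sup>2 * (LINT p:UNIV \<times> {s<..t}|N. norm (v (snd p) - w (snd p)))"
        by (intro nev_integral_diff admissible_sub[OF ad(1)] admissible_sub[OF ad(2)]) (use t in auto)
      finally show "norm (v t - w t) \<le> norm (v s - w s) + R\<^sup>2 * (LINT p:UNIV \<times> {s<..t}|N. norm (v (snd p) - w (snd p)))" by simp
    qed auto
  qed
qed

lemma driven_by_region:
  assumes "driven_by w s b" obtains R where "0 < R" "\<forall>t\<in>{s..b}. w t \<in> region R"
proof -
  have "compact (w ` {s..b})" by (intro compact_continuous_image driven_byD(1)[OF assms]) simp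
  moreover have "w ` {s..b} \<subseteq> upper_half_plane" using driven_byD(2)[OF assms] by (auto simp: upper_half_plane_def)
  ultimately obtain R where "0 < R" "w ` {s..b} \<subseteq> region R" using compact_subset_region by blast
  thus ?thesis using that by blast
qed

lemma driven_unique:
  assumes "driven_by v s b" "driven_by w s b" "v s = w s" "t \<in> {s..b}"
  shows "v t = w t"
proof -
  obtain R1 where R1: "\<forall>t\<in>{s..b}. v t \<in> region R1" using driven_by_region[OF assms(1)] by blast
  obtain R2 where R2: "\<forall>t\<in>{s..b}. w t \<in> region R2" using driven_by_region[OF assms(2)] by blast
  have sb: "s \<le> b" using assms(4) by auto
  have reg: "\<forall>t\<in>{s..b}. v t \<in> region (max R1 R2) \<and> w t \<in> region (max R1 R2)"
    using R1 R2 region_mono[of R1 "max R1 R2"] region_mono[of R2 "max R1 R2"] by auto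
  obtain C where C: "\<And>s' v w. s \<le> s' \<Longrightarrow> s' \<le> b \<Longrightarrow> driven_by v s' b \<Longrightarrow> driven_by w s' b \<Longrightarrow>
    (\<forall>t\<in>{s'..b}. v t \<in> region (max R1 R2) \<and> w t \<in> region (max R1 R2)) \<Longrightarrow> (\<forall>t\<in>{s'..b}. norm (v t - w t) \<le> C * norm (v s' - w s'))"
    using driven_stability[OF sb, of "max R1 R2"] by metis
  show ?thesis using C[OF order_refl sb assms(1,2) reg] assms(3,4) by auto
qed

primrec euler_grid :: "real \<Rightarrow> real \<Rightarrow> nat \<Rightarrow> complex \<Rightarrow> complex" where
  "euler_grid s h 0 z = z"
| "euler_grid s h (Suc k) z = euler_grid s h k z + of_real (\<gamma> (s + real k * h)) - of_real (\<gamma> (s + real (Suc k) * h))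
     + nev_transform (x_marginal (s + real k * h) (s + real (Suc k) * h)) (euler_grid s h k z)"

text \<open>The intervals of the grid are open on the left because time intervals carry the mass of \<open>{s<..t}\<close>; hence the
ceiling and the shift by one.\<close>

definition slot :: "real \<Rightarrow> real \<Rightarrow> real \<Rightarrow> nat" where
  "slot s h u = nat (\<lceil>(u - s) / h\<rceil> - 1)"

text \<open>The Euler polygon, written in integrated form with the grid values frozen on each interval of the grid.\<close>

definition euler_path :: "real \<Rightarrow> real \<Rightarrow> real \<Rightarrow> complex \<Rightarrow> complex" where
  "euler_path s h t z = z + of_real (\<gamma> s) - of_real (\<gamma> t) + nev_integral (\<lambda>u. euler_grid s h (slot s h u) z) s t"

lemma slot_eq:
  assumes "0 < h" "s + real k * h < u" "u \<le> s + real (Suc k) * h"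
  shows "slot s h u = k"
proof -
  have "\<lceil>(u - s) / h\<rceil> = int k + 1"
    using assms by (intro ceiling_unique) (auto simp: field_simps)
  thus ?thesis by (simp add: slot_def)
qed

lemma slot_exists:
  assumes "0 < h" "s < u" obtains k where "s + real k * h < u" "u \<le> s + real (Suc k) * h"
proof (rule that[of "slot s h u"])
  have "0 < (u - s) / h" using assms by simp
  hence "1 \<le> \<lceil>(u - s) / h\<rceil>" by linarith
  hence r: "real (slot s h u) = of_int \<lceil>(u - s) / h\<rceil> - 1" by (simp add: slot_def)
  have "of_int \<lceil>(u - s) / h\<rceil> - 1 < (u - s) / h" "(u - s) / h \<le> of_int \<lceil>(u - s) / h\<rceil>" by linarith+
  hence "real (slot s h u) < (u - s) / h" "(u - s) / h \<le> real (slot s h u) + 1" using r by linarith+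
  thus "s + real (slot s h u) * h < u" "u \<le> s + real (Suc (slot s h u)) * h"
    using assms(1) by (auto simp: field_simps)
qed

abbreviation "cg \<equiv> 2 + 2 * g\<^sup>2"

definition orbit_bound :: "real \<Rightarrow> real" where "orbit_bound R = cg * (cg * R * exp (cg * measure N UNIV))"

lemma cg_pos: "0 < cg" by (simp add: add_pos_nonneg)

text \<open>The factors \<open>1 + C * mass\<close> of the single steps multiply up to at most \<open>exp (C * total mass)\<close>.\<close>

lemma scaled_step:
  assumes v: "v + of_real (\<gamma> r) \<in> region (cg * R * exp (cg * strip_mass s r))" and "s \<le> r" "r \<le> t" and R: "0 < R"
  shows "v + of_real (\<gamma> r) + nev_transform (x_marginal r t) v \<in> region (cg * R * exp (cg * strip_mass s t))"
proof -
  interpret m: fin_borel "x_marginal r t" by (rule x_marginal_fin)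
  have "v + of_real (\<gamma> r) + nev_transform (x_marginal r t) v \<in> region (cg * R * exp (cg * strip_mass s r) * (1 + cg * strip_mass r t))"
    using m.step_region[OF v bound_\<gamma>[of r]] by (simp add: x_marginal_mass)
  moreover have le: "cg * R * exp (cg * strip_mass s r) * (1 + cg * strip_mass r t) \<le> cg * R * exp (cg * strip_mass s r) * exp (cg * strip_mass r t)"
    using R cg_pos by (intro mult_left_mono exp_ge_add_one_self) auto
  moreover have eq: "cg * R * exp (cg * strip_mass s r) * exp (cg * strip_mass r t) = cg * R * exp (cg * strip_mass s t)"
    using assms by (simp add: strip_mass_add[of s r t] exp_add[symmetric] algebra_simps)
  ultimately show ?thesis using subsetD[OF region_mono[OF le[unfolded eq]]] by blast
qed

text \<open>Back from the coordinate \<open>w + \<gamma>\<close> to \<open>w\<close>.\<close>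

lemma to_orbit_bound:
  assumes "v + of_real (\<gamma> r) \<in> region (cg * R * exp (cg * strip_mass s t))" and "0 < R"
  shows "v \<in> region (orbit_bound R)"
proof -
  have "v + of_real (\<gamma> r) + of_real (- \<gamma> r) \<in> region (cg * (cg * R * exp (cg * strip_mass s t)))"
    by (rule region_shift[OF assms(1)]) (simp add: bound_\<gamma>)
  moreover have "cg * (cg * R * exp (cg * strip_mass s t)) \<le> orbit_bound R"
    unfolding orbit_bound_def using cg_pos assms(2) strip_mass_le_total[of s t] by (intro mult_left_mono) auto
  ultimately show ?thesis using region_mono[of "cg * (cg * R * exp (cg * strip_mass s t))" "orbit_bound R"] by auto
qed

context
  fixes R s h :: real and z :: complex
  assumes R: "0 < R" and h: "0 < h" and z: "z \<in> region R"
begin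

lemma euler_grid_scaled: "euler_grid s h k z + of_real (\<gamma> (s + real k * h)) \<in> region (cg * R * exp (cg * strip_mass s (s + real k * h)))"
proof (induction k)
  case 0
  show ?case using region_shift[OF z bound_\<gamma>[of s]] by simp
next
  case (Suc k)
  have "euler_grid s h k z + of_real (\<gamma> (s + real k * h)) + nev_transform (x_marginal (s + real k * h) (s + real (Suc k) * h)) (euler_grid s h k z)
    \<in> region (cg * R * exp (cg * strip_mass s (s + real (Suc k) * h)))"
    by (rule scaled_step[OF Suc.IH]) (use h R in auto)
  thus ?case by (simp add: algebra_simps)
qed

lemma euler_grid_region: "euler_grid s h k z \<in> region (orbit_bound R)" by (rule to_orbit_bound[OF euler_grid_scaled R])

lemma euler_grid_admissible: "admissible (orbit_bound R) (\<lambda>u. euler_grid s h (slot s h u) z) s t"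
  unfolding admissible_def set_borel_measurable_def
proof
  show "\<forall>u\<in>{s<..t}. euler_grid s h (slot s h u) z \<in> region (orbit_bound R)" using euler_grid_region by auto
  have "(\<lambda>u. \<lceil>(u - s) / h\<rceil> :: int) \<in> measurable borel (count_space UNIV)" by measurable
  hence [measurable]: "slot s h \<in> measurable borel (count_space UNIV)"
    unfolding slot_def by (rule measurable_compose) simp
  have "(\<lambda>u. euler_grid s h (slot s h u) z) \<in> borel_measurable borel"
    by (rule measurable_compose[where N = "count_space UNIV" and f = "slot s h"]) auto
  thus "(\<lambda>u. indicat_real {s<..t} u *\<^sub>R euler_grid s h (slot s h u) z) \<in> borel_measurable borel" by measurable
qed

lemma nev_integral_slot:
  assumes "s + real k * h \<le> t" "t \<le> s + real (Suc k) * h"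
  shows "nev_integral (\<lambda>u. euler_grid s h (slot s h u) z) (s + real k * h) t = nev_transform (x_marginal (s + real k * h) t) (euler_grid s h k z)"
proof -
  have "nev_integral (\<lambda>u. euler_grid s h (slot s h u) z) (s + real k * h) t = nev_integral (\<lambda>_. euler_grid s h k z) (s + real k * h) t"
    unfolding nev_integral_def
    by (intro set_lebesgue_integral_cong) (use assms in \<open>auto simp: slot_eq[OF h]\<close>)
  thus ?thesis using nev_integral_const[OF region_bounds(1)[OF euler_grid_region]] by simp
qed

lemma euler_path_grid: "euler_path s h (s + real k * h) z = euler_grid s h k z"
proof (induction k)
  case 0 show ?case by (simp add: euler_path_def)
next
  case (Suc k)
  have "nev_integral (\<lambda>u. euler_grid s h (slot s h u) z) s (s + real (Suc k) * h) =
    nev_integral (\<lambda>u. euler_grid s h (slot s h u) z) s (s + real k * h) + nev_integral (\<lambda>u. euler_grid s h (slot s h u) z) (s + real k * h) (s + real (Suc k) * h)"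
    by (rule nev_integral_add[OF euler_grid_admissible]) (use h in auto)
  also have "nev_integral (\<lambda>u. euler_grid s h (slot s h u) z) (s + real k * h) (s + real (Suc k) * h) = nev_transform (x_marginal (s + real k * h) (s + real (Suc k) * h)) (euler_grid s h k z)"
    by (rule nev_integral_slot) (use h in auto)
  finally show ?case using Suc.IH by (simp add: euler_path_def algebra_simps)
qed

lemma euler_path_slot:
  assumes "s + real k * h \<le> t" "t \<le> s + real (Suc k) * h"
  shows "euler_path s h t z = euler_grid s h k z + of_real (\<gamma> (s + real k * h)) - of_real (\<gamma> t) + nev_transform (x_marginal (s + real k * h) t) (euler_grid s h k z)"
proof -
  have "nev_integral (\<lambda>u. euler_grid s h (slot s h u) z) s t =
    nev_integral (\<lambda>u. euler_grid s h (slot s h u) z) s (s + real k * h) + nev_integral (\<lambda>u. euler_grid s h (slot s h u) z) (s + real k * h) t"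
    by (rule nev_integral_add[OF euler_grid_admissible]) (use h assms in auto)
  thus ?thesis using euler_path_grid[of k] nev_integral_slot[OF assms] by (simp add: euler_path_def algebra_simps)
qed

lemma euler_path_region: assumes "s \<le> t" shows "euler_path s h t z \<in> region (orbit_bound R)"
proof (cases "s = t")
  case True thus ?thesis using euler_path_grid[of 0] euler_grid_region[of 0] by simp
next
  case False
  with assms h obtain k where k: "s + real k * h < t" "t \<le> s + real (Suc k) * h" using slot_exists[of h s t] by auto
  have "euler_grid s h k z + of_real (\<gamma> (s + real k * h)) + nev_transform (x_marginal (s + real k * h) t) (euler_grid s h k z) \<in> region (cg * R * exp (cg * strip_mass s t))"
    by (rule scaled_step[OF euler_grid_scaled]) (use k h R in auto)
  hence "euler_path s h t z + of_real (\<gamma> t) \<in> region (cg * R * exp (cg * strip_mass s t))"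
    using euler_path_slot[of k t] k by (simp add: add.assoc)
  thus ?thesis by (rule to_orbit_bound[OF _ R])
qed

lemma euler_grid_near_path:
  assumes "s < u" obtains r where "s \<le> r" "r \<le> u" "u - r \<le> h"
    "norm (euler_grid s h (slot s h u) z - euler_path s h u z) \<le> \<bar>\<gamma> r - \<gamma> u\<bar> + orbit_bound R * strip_mass r u"
proof -
  obtain k where k: "s + real k * h < u" "u \<le> s + real (Suc k) * h" using slot_exists[OF h assms] by auto
  define r where "r = s + real k * h"
  interpret m: fin_borel "x_marginal r u" by (rule x_marginal_fin)
  have "euler_grid s h (slot s h u) z - euler_path s h u z = - (of_real (\<gamma> r - \<gamma> u) + nev_transform (x_marginal r u) (euler_grid s h k z))"
    using euler_path_slot[of k u] k by (simp add: slot_eq[OF h k] r_def)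
  hence "norm (euler_grid s h (slot s h u) z - euler_path s h u z) \<le> norm (of_real (\<gamma> r - \<gamma> u) :: complex) + norm (nev_transform (x_marginal r u) (euler_grid s h k z))"
    using norm_triangle_ineq by (metis norm_minus_cancel)
  also have "norm (nev_transform (x_marginal r u) (euler_grid s h k z)) \<le> orbit_bound R * strip_mass r u"
    using m.norm_nev_transform_le[OF euler_grid_region] by (simp add: x_marginal_mass)
  finally have "norm (euler_grid s h (slot s h u) z - euler_path s h u z) \<le> \<bar>\<gamma> r - \<gamma> u\<bar> + orbit_bound R * strip_mass r u"
    by (simp del: of_real_diff)
  thus ?thesis using that[of r] k h by (auto simp: r_def algebra_simps)
qed

lemma euler_path_continuous: "continuous_on {s..b} (\<lambda>t. euler_path s h t z)"
  unfolding euler_path_def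
  by (intro continuous_intros nev_integral_continuous[OF euler_grid_admissible] continuous_on_subset[OF cont_\<gamma>]) auto

end

lemma euler_grid_holomorphic: "0 < h \<Longrightarrow> euler_grid s h k holomorphic_on upper_half_plane"
proof (induction k)
  case (Suc k)
  interpret m: fin_borel "x_marginal (s + real k * h) (s + real (Suc k) * h)" by (rule x_marginal_fin)
  have "euler_grid s h k ` upper_half_plane \<subseteq> upper_half_plane"
  proof safe
    fix z assume "z \<in> upper_half_plane"
    then obtain R where "0 < R" "z \<in> region R" using in_some_region by (auto simp: upper_half_plane_def)
    from region_bounds(1)[OF euler_grid_region[OF this(1) \<open>0 < h\<close> this(2)]] show "euler_grid s h k z \<in> upper_half_plane"
      by (auto simp: upper_half_plane_def)
  qed
  hence "(nev_transform (x_marginal (s + real k * h) (s + real (Suc k) * h)) \<circ> euler_grid s h k) holomorphic_on upper_half_plane"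
    using Suc by (intro holomorphic_on_compose_gen[OF _ m.nev_transform_holomorphic]) auto
  thus ?case unfolding euler_grid.simps o_def by (intro holomorphic_intros Suc)
next
  case 0
  have "euler_grid s h 0 = (\<lambda>z. z)" by auto
  thus ?case by (simp add: holomorphic_on_ident)
qed

lemma euler_path_holomorphic:
  assumes "0 < h" "s \<le> t" shows "euler_path s h t holomorphic_on upper_half_plane"
proof (cases "s = t")
  case True
  have "euler_path s h t = (\<lambda>z. z)" using True by (auto simp: euler_path_def)
  thus ?thesis by (simp add: holomorphic_on_ident)
next
  case False
  with assms obtain k where k: "s + real k * h < t" "t \<le> s + real (Suc k) * h" using slot_exists[of h s t] by auto
  interpret m: fin_borel "x_marginal (s + real k * h) t" by (rule x_marginal_fin)
  have "euler_grid s h k ` upper_half_plane \<subseteq> upper_half_plane"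
  proof safe
    fix z assume "z \<in> upper_half_plane"
    then obtain R where "0 < R" "z \<in> region R" using in_some_region by (auto simp: upper_half_plane_def)
    from region_bounds(1)[OF euler_grid_region[OF this(1) \<open>0 < h\<close> this(2)]] show "euler_grid s h k z \<in> upper_half_plane"
      by (auto simp: upper_half_plane_def)
  qed
  hence "(nev_transform (x_marginal (s + real k * h) t) \<circ> euler_grid s h k) holomorphic_on upper_half_plane"
    using euler_grid_holomorphic[OF assms(1)] by (intro holomorphic_on_compose_gen[OF _ m.nev_transform_holomorphic]) auto
  hence "(\<lambda>z. euler_grid s h k z + of_real (\<gamma> (s + real k * h)) - of_real (\<gamma> t) + nev_transform (x_marginal (s + real k * h) t) (euler_grid s h k z)) holomorphic_on upper_half_plane"
    unfolding o_def by (intro holomorphic_intros euler_grid_holomorphic assms)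
  thus ?thesis
  proof (rule holomorphic_transform)
    fix z assume "z \<in> upper_half_plane"
    then obtain R where "0 < R" "z \<in> region R" using in_some_region by (auto simp: upper_half_plane_def)
    thus "euler_grid s h k z + of_real (\<gamma> (s + real k * h)) - of_real (\<gamma> t) + nev_transform (x_marginal (s + real k * h) t) (euler_grid s h k z) = euler_path s h t z"
      using euler_path_slot[of R h z s k t] k assms by simp
  qed
qed

end

context driven begin

lemma \<gamma>_uniform:
  assumes "0 < e" obtains d where "0 < d" "\<And>x y. a \<le> x \<Longrightarrow> x \<le> y \<Longrightarrow> y \<le> b \<Longrightarrow> y - x < d \<Longrightarrow> \<bar>\<gamma> x - \<gamma> y\<bar> < e"
proof -
  have "uniformly_continuous_on {a..b} \<gamma>"
    by (intro compact_uniformly_continuous continuous_on_subset[OF cont_\<gamma>]) auto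
  then obtain d where d: "0 < d" "\<And>x y. x \<in> {a..b} \<Longrightarrow> y \<in> {a..b} \<Longrightarrow> dist y x < d \<Longrightarrow> dist (\<gamma> y) (\<gamma> x) < e"
    using assms unfolding uniformly_continuous_on_def by metis
  show ?thesis
  proof (rule that[OF d(1)])
    fix x y assume "a \<le> x" "x \<le> y" "y \<le> b" "y - x < d"
    thus "\<bar>\<gamma> x - \<gamma> y\<bar> < e" using d(2)[of x y] by (auto simp: dist_real_def abs_minus_commute)
  qed
qed

lemma modulus:
  assumes "0 < e" "0 \<le> Q"
  obtains d where "0 < d" "\<And>x y. a \<le> x \<Longrightarrow> x \<le> y \<Longrightarrow> y \<le> b \<Longrightarrow> y - x < d \<Longrightarrow> \<bar>\<gamma> x - \<gamma> y\<bar> + Q * strip_mass x y < e"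
proof -
  obtain d1 where d1: "0 < d1" "\<And>x y. a \<le> x \<Longrightarrow> x \<le> y \<Longrightarrow> y \<le> b \<Longrightarrow> y - x < d1 \<Longrightarrow> \<bar>\<gamma> x - \<gamma> y\<bar> < e / 2"
    using \<gamma>_uniform[of "e / 2" a b] assms by auto
  have "0 < e / (2 * (Q + 1))" using assms by simp
  then obtain d2 where d2: "0 < d2" "\<And>x y. a \<le> x \<Longrightarrow> x \<le> y \<Longrightarrow> y \<le> b \<Longrightarrow> y - x < d2 \<Longrightarrow> strip_mass x y < e / (2 * (Q + 1))"
    using strip_mass_uniformly_small[of _ a b] by blast
  show ?thesis
  proof (rule that[of "min d1 d2"])
    fix x y assume xy: "a \<le> x" "x \<le> y" "y \<le> b" "y - x < min d1 d2"
    have "Q * strip_mass x y \<le> (Q + 1) * strip_mass x y" by (simp add: algebra_simps)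
    also have "\<dots> \<le> (Q + 1) * (e / (2 * (Q + 1)))" using d2(2)[of x y] xy assms by (intro mult_left_mono) auto
    also have "\<dots> = e / 2"
    proof -
      have "Q + 1 \<noteq> 0" using assms by simp
      thus ?thesis by (simp add: field_simps)
    qed
    finally show "\<bar>\<gamma> x - \<gamma> y\<bar> + Q * strip_mass x y < e" using d1(2)[of x y] xy by simp
  qed (use d1 d2 in auto)
qed

lemma orbit_bound_pos: "0 < R \<Longrightarrow> 0 < orbit_bound R" using cg_pos by (simp add: orbit_bound_def)

lemma euler_grid_path_uniform:
  assumes "0 < R" "0 < e"
  obtains d where "0 < d" "\<And>h s u z. 0 < h \<Longrightarrow> h < d \<Longrightarrow> a \<le> s \<Longrightarrow> s < u \<Longrightarrow> u \<le> b \<Longrightarrow> z \<in> region R \<Longrightarrow>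
    norm (euler_grid s h (slot s h u) z - euler_path s h u z) \<le> e"
proof -
  obtain d where d: "0 < d" "\<And>x y. a \<le> x \<Longrightarrow> x \<le> y \<Longrightarrow> y \<le> b \<Longrightarrow> y - x < d \<Longrightarrow> \<bar>\<gamma> x - \<gamma> y\<bar> + orbit_bound R * strip_mass x y < e"
    using modulus[of e "orbit_bound R" a b] orbit_bound_pos[OF assms(1)] assms(2) less_imp_le by blast
  show ?thesis
  proof (rule that[OF d(1)])
    fix h s u z assume *: "0 < h" "h < d" "a \<le> s" "s < u" "u \<le> b" "z \<in> region R"
    obtain r where "s \<le> r" "r \<le> u" "u - r \<le> h"
      "norm (euler_grid s h (slot s h u) z - euler_path s h u z) \<le> \<bar>\<gamma> r - \<gamma> u\<bar> + orbit_bound R * strip_mass r u"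
      using euler_grid_near_path[OF assms(1) *(1,6,4)] by blast
    thus "norm (euler_grid s h (slot s h u) z - euler_path s h u z) \<le> e" using d(2)[of r u] * by simp
  qed
qed

text \<open>Two Euler curves satisfy the same integral equation up to the oscillation over one grid interval; Gronwall's inequality
bounds their distance uniformly in all of the parameters, including the starting time.\<close>

lemma euler_path_cauchy:
  assumes "a \<le> b" "0 < R" "0 < e"
  obtains d where "0 < d" "\<And>h h' s t z. 0 < h \<Longrightarrow> h < d \<Longrightarrow> 0 < h' \<Longrightarrow> h' < d \<Longrightarrow> a \<le> s \<Longrightarrow> s \<le> t \<Longrightarrow> t \<le> b \<Longrightarrow> z \<in> region R \<Longrightarrow>
    norm (euler_path s h t z - euler_path s h' t z) \<le> e"
proof -
  define L where "L = (orbit_bound R)\<^sup>2"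
  define A where "A = measure N UNIV"
  have L: "0 \<le> L" by (simp add: L_def)
  have A: "0 \<le> A" by (simp add: A_def)
  obtain C where C: "1 \<le> C" "\<And>s c g. a \<le> s \<Longrightarrow> s \<le> b \<Longrightarrow> continuous_on {s..b} g \<Longrightarrow>
      (\<And>t. s \<le> t \<Longrightarrow> t \<le> b \<Longrightarrow> 0 \<le> g t) \<Longrightarrow>
      (\<And>t. s \<le> t \<Longrightarrow> t \<le> b \<Longrightarrow> g t \<le> c + L * (LINT p:UNIV \<times> {s<..t}|N. g (snd p))) \<Longrightarrow>
      (\<forall>t\<in>{s..b}. g t \<le> C * c)"
    using gronwall[OF assms(1) L] by auto
  define e' where "e' = e / (2 * (C * L * A) + 1)"
  have CLA: "0 \<le> C * L * A" using C(1) L A by simp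
  have e': "0 < e'" using assms(3) CLA by (simp add: e'_def)
  have Ce: "C * (L * (2 * e' * A)) \<le> e"
  proof -
    have "C * (L * (2 * e' * A)) = (2 * (C * L * A)) * e'" by (simp add: algebra_simps)
    also have "\<dots> \<le> (2 * (C * L * A) + 1) * e'" using e' by (intro mult_right_mono) auto
    also have "\<dots> = e" using CLA by (simp add: e'_def)
    finally show ?thesis .
  qed
  obtain d where d: "0 < d" "\<And>h s u z. 0 < h \<Longrightarrow> h < d \<Longrightarrow> a \<le> s \<Longrightarrow> s < u \<Longrightarrow> u \<le> b \<Longrightarrow> z \<in> region R \<Longrightarrow>
    norm (euler_grid s h (slot s h u) z - euler_path s h u z) \<le> e'"
    using euler_grid_path_uniform[OF assms(2) e', of a b] by blast
  show ?thesis
  proof (rule that[OF d(1)])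
    fix h h' s t z assume h: "0 < h" "h < d" "0 < h'" "h' < d" and s: "a \<le> s" "s \<le> t" "t \<le> b" and z: "z \<in> region R"
    let ?g = "\<lambda>t. norm (euler_path s h t z - euler_path s h' t z)"
    let ?Y = "\<lambda>h u. euler_grid s h (slot s h u) z"
    have cg: "continuous_on {s..b} ?g"
      by (intro continuous_intros euler_path_continuous[OF assms(2)] h z)
    have "\<forall>t\<in>{s..b}. ?g t \<le> C * (L * (2 * e' * A))"
    proof (rule C(2)[OF _ _ cg])
      fix t assume t: "s \<le> t" "t \<le> b"
      note ad = euler_grid_admissible[OF assms(2) h(1) z, of s t] euler_grid_admissible[OF assms(2) h(3) z, of s t]
      have reg: "?Y h u \<in> region (orbit_bound R)" "?Y h' u \<in> region (orbit_bound R)" for u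
        using euler_grid_region[OF assms(2) h(1) z] euler_grid_region[OF assms(2) h(3) z] by auto
      have i1: "set_integrable N (UNIV \<times> {s<..t}) (\<lambda>p. norm (?Y h (snd p) - ?Y h' (snd p)))"
      proof (rule strip_integral_le(1)[OF norm_diff_meas[OF ad], of "orbit_bound R + orbit_bound R"])
        fix u
        show "\<bar>norm (?Y h u - ?Y h' u)\<bar> \<le> orbit_bound R + orbit_bound R"
          using norm_triangle_ineq4[of "?Y h u" "?Y h' u"] region_bounds(4)[OF reg(1)[of u]] region_bounds(4)[OF reg(2)[of u]] by simp
      qed
      have cg': "continuous_on {s..t} ?g" by (rule continuous_on_subset[OF cg]) (use t in auto)
      have "compact (?g ` {s..t})" by (intro compact_continuous_image cg') simp
      hence "bounded (?g ` {s..t})" by (rule compact_imp_bounded)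
      then obtain B where "\<forall>x\<in>?g ` {s..t}. norm x \<le> B" unfolding bounded_iff by blast
      hence B: "\<And>u. u \<in> {s..t} \<Longrightarrow> \<bar>?g u\<bar> \<le> B" by simp
      have gm: "set_borel_measurable borel {s<..t} ?g"
        unfolding set_borel_measurable_def
        by (intro borel_measurable_continuous_on_indicator continuous_on_subset[OF cg']) auto
      have i2: "set_integrable N (UNIV \<times> {s<..t}) (\<lambda>p. ?g (snd p))"
        by (rule strip_integral_le(1)[OF gm, of B]) (use B in auto)
      have i3: "set_integrable N (UNIV \<times> {s<..t}) (\<lambda>p. 2 * e')"
        by (rule set_integrable_bounded[of _ _ "2 * e'"]) (use e' in \<open>auto simp: set_borel_measurable_def\<close>)
      have "?g t = norm (nev_integral (?Y h) s t - nev_integral (?Y h') s t)" by (simp add: euler_path_def)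
      also have "\<dots> \<le> L * (LINT p:UNIV \<times> {s<..t}|N. norm (?Y h (snd p) - ?Y h' (snd p)))"
        unfolding L_def by (rule nev_integral_diff[OF ad])
      also have "\<dots> \<le> L * (LINT p:UNIV \<times> {s<..t}|N. ?g (snd p) + 2 * e')"
      proof (intro mult_left_mono L set_integral_mono i1 set_integral_add(1)[OF i2 i3])
        fix p :: "real \<times> real" assume p: "p \<in> UNIV \<times> {s<..t}"
        define u where "u = snd p"
        have u: "s < u" "u \<le> b" using p t by (auto simp: u_def)
        have "?Y h u - ?Y h' u = (?Y h u - euler_path s h u z) + ((euler_path s h u z - euler_path s h' u z) - (?Y h' u - euler_path s h' u z))" by simp
        hence "norm (?Y h u - ?Y h' u) \<le> norm (?Y h u - euler_path s h u z) + (?g u + norm (?Y h' u - euler_path s h' u z))"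
          by (metis order_trans[OF norm_triangle_ineq add_left_mono[OF norm_triangle_ineq4]])
        thus "norm (?Y h (snd p) - ?Y h' (snd p)) \<le> ?g (snd p) + 2 * e'"
          using d(2)[OF h(1,2) s(1) u z] d(2)[OF h(3,4) s(1) u z] unfolding u_def by linarith
      qed
      also have "(LINT p:UNIV \<times> {s<..t}|N. ?g (snd p) + 2 * e') = (LINT p:UNIV \<times> {s<..t}|N. ?g (snd p)) + (LINT p:UNIV \<times> {s<..t}|N. 2 * e')"
        by (rule set_integral_add(2)[OF i2 i3])
      also have "(LINT p:UNIV \<times> {s<..t}|N. 2 * e') = 2 * e' * strip_mass s t" by (simp add: set_lebesgue_integral_def strip_mass_def)
      also have "L * ((LINT p:UNIV \<times> {s<..t}|N. ?g (snd p)) + 2 * e' * strip_mass s t) \<le> L * ((LINT p:UNIV \<times> {s<..t}|N. ?g (snd p)) + 2 * e' * A)"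
        unfolding A_def using e' L by (intro mult_left_mono add_left_mono strip_mass_le_total) auto
      finally show "?g t \<le> L * (2 * e' * A) + L * (LINT p:UNIV \<times> {s<..t}|N. ?g (snd p))"
        by (simp add: algebra_simps)
    qed (use s in auto)
    thus "norm (euler_path s h t z - euler_path s h' t z) \<le> e" using Ce s by force
  qed
qed

section \<open>The flow driven by a pair\<close>

definition flow :: "real \<Rightarrow> real \<Rightarrow> complex \<Rightarrow> complex" where
  "flow s t z = lim (\<lambda>n. euler_path s (1 / real (Suc n)) t z)"

lemma euler_path_flow:
  assumes "a \<le> b" "0 < R" "0 < e"
  obtains n0 where "\<And>n s t z. n0 \<le> n \<Longrightarrow> a \<le> s \<Longrightarrow> s \<le> t \<Longrightarrow> t \<le> b \<Longrightarrow> z \<in> region R \<Longrightarrow>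
    norm (euler_path s (1 / real (Suc n)) t z - flow s t z) \<le> e"
proof -
  have ev: "\<exists>n0. \<forall>n\<ge>n0. 1 / real (Suc n) < d" if "0 < d" for d
    using order_tendstoD(2)[OF LIMSEQ_Suc[OF lim_1_over_n], of d] that by (auto simp: eventually_sequentially)
  have conv: "(\<lambda>n. euler_path s (1 / real (Suc n)) t z) \<longlonglongrightarrow> flow s t z" if "a \<le> s" "s \<le> t" "t \<le> b" "z \<in> region R" for s t z
  proof -
    have "Cauchy (\<lambda>n. euler_path s (1 / real (Suc n)) t z)"
    proof (rule CauchyI)
      fix e :: real assume "0 < e"
      then obtain d where d: "0 < d" "\<And>h h' s t z. 0 < h \<Longrightarrow> h < d \<Longrightarrow> 0 < h' \<Longrightarrow> h' < d \<Longrightarrow> a \<le> s \<Longrightarrow> s \<le> t \<Longrightarrow> t \<le> b \<Longrightarrow> z \<in> region R \<Longrightarrow>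
        norm (euler_path s h t z - euler_path s h' t z) \<le> e / 2" using euler_path_cauchy[OF assms(1,2), of "e / 2"] by (metis half_gt_zero)
      from ev[OF d(1)] obtain n0 where n0: "\<forall>n\<ge>n0. 1 / real (Suc n) < d" by blast
      show "\<exists>M. \<forall>m\<ge>M. \<forall>n\<ge>M. norm (euler_path s (1 / real (Suc m)) t z - euler_path s (1 / real (Suc n)) t z) < e"
      proof (intro exI[of _ n0] allI impI)
        fix m n assume "n0 \<le> m" "n0 \<le> n"
        hence "norm (euler_path s (1 / real (Suc m)) t z - euler_path s (1 / real (Suc n)) t z) \<le> e / 2"
          using n0 that by (intro d(2)) auto
        thus "norm (euler_path s (1 / real (Suc m)) t z - euler_path s (1 / real (Suc n)) t z) < e" using \<open>0 < e\<close> by linarith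
      qed
    qed
    thus ?thesis unfolding flow_def by (intro convergent_LIMSEQ_iff[THEN iffD1] Cauchy_convergent)
  qed
  obtain d where d: "0 < d" "\<And>h h' s t z. 0 < h \<Longrightarrow> h < d \<Longrightarrow> 0 < h' \<Longrightarrow> h' < d \<Longrightarrow> a \<le> s \<Longrightarrow> s \<le> t \<Longrightarrow> t \<le> b \<Longrightarrow> z \<in> region R \<Longrightarrow>
    norm (euler_path s h t z - euler_path s h' t z) \<le> e" using euler_path_cauchy[OF assms] by blast
  from ev[OF d(1)] obtain n0 where n0: "\<forall>n\<ge>n0. 1 / real (Suc n) < d" by blast
  show ?thesis
  proof (rule that[of n0])
    fix n s t z assume *: "n0 \<le> n" "a \<le> s" "s \<le> t" "t \<le> b" "z \<in> region R"
    have "(\<lambda>m. norm (euler_path s (1 / real (Suc n)) t z - euler_path s (1 / real (Suc m)) t z)) \<longlonglongrightarrow> norm (euler_path s (1 / real (Suc n)) t z - flow s t z)"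
      by (intro tendsto_intros conv *)
    moreover have "\<forall>m\<ge>n0. norm (euler_path s (1 / real (Suc n)) t z - euler_path s (1 / real (Suc m)) t z) \<le> e"
      using n0 * by (intro allI impI d(2)) auto
    ultimately show "norm (euler_path s (1 / real (Suc n)) t z - flow s t z) \<le> e" by (rule Lim_bounded[OF _ ])
  qed
qed

lemma euler_path_tendsto:
  assumes "s \<le> t" "z \<in> region R"
  shows "(\<lambda>n. euler_path s (1 / real (Suc n)) t z) \<longlonglongrightarrow> flow s t z"
proof (rule LIMSEQ_I)
  fix e :: real assume "0 < e"
  then obtain n0 where "\<And>n s' t' z. n0 \<le> n \<Longrightarrow> s \<le> s' \<Longrightarrow> s' \<le> t' \<Longrightarrow> t' \<le> t \<Longrightarrow> z \<in> region R \<Longrightarrow>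
    norm (euler_path s' (1 / real (Suc n)) t' z - flow s' t' z) \<le> e / 2"
    using euler_path_flow[OF assms(1) region_bounds(2)[OF assms(2)], of "e / 2"] by (metis half_gt_zero)
  thus "\<exists>n0. \<forall>n\<ge>n0. norm (euler_path s (1 / real (Suc n)) t z - flow s t z) < e"
    using assms \<open>0 < e\<close> by (intro exI[of _ n0]) (force intro: le_less_trans[of _ "e / 2"])
qed

lemma flow_region:
  assumes "s \<le> t" "z \<in> region R" shows "flow s t z \<in> region (orbit_bound R)"
proof -
  note R = region_bounds(2)[OF assms(2)]
  show ?thesis
    by (rule closed_sequentially[OF closed_region[OF orbit_bound_pos[OF R]] _ euler_path_tendsto[OF assms]])
      (rule euler_path_region[OF R _ assms(2,1)], simp)
qed

lemma flow_refl [simp]: "flow s s z = z" by (simp add: flow_def euler_path_def)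

text \<open>The Euler curves converge uniformly, and the integral is continuous under uniform convergence within a region.\<close>

lemma flow_driven:
  assumes z: "0 < Im z" shows "driven_by (\<lambda>t. flow s t z) s b"
proof (cases "s \<le> b")
  case False thus ?thesis by (simp add: driven_by_def)
next
  case sb: True
  obtain R where R: "0 < R" "z \<in> region R" using in_some_region[OF z] by blast
  have reg: "flow s t z \<in> region (orbit_bound R)" if "s \<le> t" for t using flow_region[OF that R(2)] .
  have ul: "uniform_limit {s..b} (\<lambda>n t. euler_path s (1 / real (Suc n)) t z) (\<lambda>t. flow s t z) sequentially"
  proof (rule uniform_limitI)
    fix e :: real assume "0 < e"
    then obtain n0 where "\<And>n s' t' z. n0 \<le> n \<Longrightarrow> s \<le> s' \<Longrightarrow> s' \<le> t' \<Longrightarrow> t' \<le> b \<Longrightarrow> z \<in> region R \<Longrightarrow>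
      norm (euler_path s' (1 / real (Suc n)) t' z - flow s' t' z) \<le> e / 2"
      using euler_path_flow[OF sb R(1), of "e / 2"] by (metis half_gt_zero)
    thus "\<forall>\<^sub>F n in sequentially. \<forall>t\<in>{s..b}. dist (euler_path s (1 / real (Suc n)) t z) (flow s t z) < e"
      using \<open>0 < e\<close> R(2) unfolding eventually_sequentially dist_norm
      by (intro exI[of _ n0]) (force intro: le_less_trans[of _ "e / 2"])
  qed
  have cont: "continuous_on {s..b} (\<lambda>t. flow s t z)"
  proof (rule uniform_limit_theorem[OF _ ul])
    have "continuous_on {s..b} (\<lambda>t. euler_path s (1 / real (Suc n)) t z)" for n
      by (rule euler_path_continuous[OF R(1) _ R(2)]) simp
    thus "\<forall>\<^sub>F n in sequentially. continuous_on {s..b} (\<lambda>t. euler_path s (1 / real (Suc n)) t z)" by simp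
  qed simp
  have "flow s t z = z + of_real (\<gamma> s) - of_real (\<gamma> t) + nev_integral (\<lambda>u. flow s u z) s t" if t: "s \<le> t" "t \<le> b" for t
  proof -
    define h where "h n = 1 / real (Suc n)" for n :: nat
    have h: "0 < h n" for n by (simp add: h_def)
    have h0: "h \<longlonglongrightarrow> 0" unfolding h_def by (rule LIMSEQ_Suc[OF lim_1_over_n])
    have ad: "admissible (orbit_bound R) (\<lambda>u. flow s u z) s t"
      by (rule admissibleI_cont[OF continuous_on_subset[OF cont]]) (use t reg in auto)
    have "(\<lambda>n. nev_integral (\<lambda>u. euler_grid s (h n) (slot s (h n) u) z) s t) \<longlonglongrightarrow> nev_integral (\<lambda>u. flow s u z) s t"
    proof (rule LIMSEQ_I)
      fix e :: real assume e: "0 < e"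
      define K where "K = (orbit_bound R)\<^sup>2 * strip_mass s t"
      have K: "0 \<le> K" by (simp add: K_def)
      define e' where "e' = e / (4 * (K + 1))"
      have e': "0 < e'" using e K by (simp add: e'_def)
      obtain d where d: "0 < d" "\<And>h s' u z. 0 < h \<Longrightarrow> h < d \<Longrightarrow> s \<le> s' \<Longrightarrow> s' < u \<Longrightarrow> u \<le> b \<Longrightarrow> z \<in> region R \<Longrightarrow>
        norm (euler_grid s' h (slot s' h u) z - euler_path s' h u z) \<le> e'"
        using euler_grid_path_uniform[OF R(1) e', of s b] by blast
      obtain n0 where n0: "\<And>n s' t' z. n0 \<le> n \<Longrightarrow> s \<le> s' \<Longrightarrow> s' \<le> t' \<Longrightarrow> t' \<le> b \<Longrightarrow> z \<in> region R \<Longrightarrow>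
        norm (euler_path s' (1 / real (Suc n)) t' z - flow s' t' z) \<le> e'" using euler_path_flow[OF sb R(1) e'] by blast
      obtain n1 where n1: "\<And>n. n1 \<le> n \<Longrightarrow> h n < d"
        using order_tendstoD(2)[OF h0 d(1)] by (auto simp: eventually_sequentially)
      show "\<exists>n0. \<forall>n\<ge>n0. norm (nev_integral (\<lambda>u. euler_grid s (h n) (slot s (h n) u) z) s t - nev_integral (\<lambda>u. flow s u z) s t) < e"
      proof (intro exI[of _ "max n0 n1"] allI impI)
        fix n assume n: "max n0 n1 \<le> n"
        have "norm (nev_integral (\<lambda>u. euler_grid s (h n) (slot s (h n) u) z) s t - nev_integral (\<lambda>u. flow s u z) s t) \<le> (orbit_bound R)\<^sup>2 * (2 * e') * strip_mass s t"
        proof (rule nev_integral_diff_le[OF euler_grid_admissible[OF R(1) h R(2)] ad])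
          fix u assume u: "u \<in> {s<..t}"
          have "norm (euler_grid s (h n) (slot s (h n) u) z - euler_path s (h n) u z) \<le> e'"
            using u n1[of n] n t R(2) h by (intro d(2)) auto
          moreover have "norm (euler_path s (h n) u z - flow s u z) \<le> e'"
            using n0[of n s u z] n u t R(2) by (simp add: h_def)
          ultimately show "norm (euler_grid s (h n) (slot s (h n) u) z - flow s u z) \<le> 2 * e'"
            using norm_triangle_ineq[of "euler_grid s (h n) (slot s (h n) u) z - euler_path s (h n) u z" "euler_path s (h n) u z - flow s u z"] by simp
        qed
        also have "\<dots> = 2 * e' * K" by (simp add: K_def)
        also have "\<dots> \<le> 2 * e' * (K + 1)" using e' by (intro mult_left_mono) auto
        also have "\<dots> = e / 2"
        proof -
          have "K + 1 \<noteq> 0" using K by simp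
          thus ?thesis by (simp add: e'_def field_simps)
        qed
        also have "\<dots> < e" using e by simp
        finally show "norm (nev_integral (\<lambda>u. euler_grid s (h n) (slot s (h n) u) z) s t - nev_integral (\<lambda>u. flow s u z) s t) < e" .
      qed
    qed
    hence "(\<lambda>n. euler_path s (h n) t z) \<longlonglongrightarrow> z + of_real (\<gamma> s) - of_real (\<gamma> t) + nev_integral (\<lambda>u. flow s u z) s t"
      unfolding euler_path_def by (intro tendsto_intros)
    moreover have "(\<lambda>n. euler_path s (h n) t z) \<longlonglongrightarrow> flow s t z" unfolding h_def by (rule euler_path_tendsto[OF t(1) R(2)])
    ultimately show ?thesis by (rule LIMSEQ_unique[rotated])
  qed
  hence "flow s t z = flow s s z + of_real (\<gamma> s) - of_real (\<gamma> t) + nev_integral (\<lambda>u. flow s u z) s t" if "t \<in> {s..b}" for t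
    using that unfolding flow_refl by simp
  moreover have "0 < Im (flow s t z)" if "t \<in> {s..b}" for t using region_bounds(1)[OF reg] that by simp
  ultimately show ?thesis unfolding driven_by_def using cont by blast
qed

lemma driven_by_subinterval:
  assumes "driven_by w s b" "s \<le> s'" "s' \<le> b'" "b' \<le> b" shows "driven_by w s' b'"
proof -
  obtain R where R: "\<forall>t\<in>{s..b}. w t \<in> region R" using driven_by_region[OF assms(1)] by blast
  have ad: "admissible R w s b" by (rule admissibleI_cont[OF driven_byD(1)[OF assms(1)]]) (use R in auto)
  show ?thesis unfolding driven_by_def
  proof (intro conjI ballI)
    show "continuous_on {s'..b'} w" by (rule continuous_on_subset[OF driven_byD(1)[OF assms(1)]]) (use assms in auto)
    fix t assume t: "t \<in> {s'..b'}"
    show "0 < Im (w t)" using driven_byD(2)[OF assms(1), of t] t assms by auto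
    have "nev_integral w s t = nev_integral w s s' + nev_integral w s' t" by (rule nev_integral_add[OF admissible_sub[OF ad]]) (use t assms in auto)
    thus "w t = w s' + of_real (\<gamma> s') - of_real (\<gamma> t) + nev_integral w s' t"
      using driven_byD(3)[OF assms(1), of t] driven_byD(3)[OF assms(1), of s'] t assms by simp
  qed
qed

lemma flow_unique:
  assumes "driven_by w s b" "t \<in> {s..b}" shows "w t = flow s t (w s)"
proof -
  have "0 < Im (w s)" using driven_byD(2)[OF assms(1), of s] assms(2) by auto
  thus ?thesis using driven_unique[OF assms(1) flow_driven[of "w s" s b] _ assms(2)] by simp
qed

lemma flow_semigroup:
  assumes "0 < Im z" "s \<le> t" "t \<le> u" shows "flow t u (flow s t z) = flow s u z"
  using flow_unique[OF driven_by_subinterval[OF flow_driven[OF assms(1), of s u] assms(2,3) order_refl], of u] assms by simp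

lemma flow_holomorphic: assumes "s \<le> t" shows "flow s t holomorphic_on upper_half_plane"
proof (rule holomorphic_uniform_sequence[OF open_uhp])
  show "euler_path s (1 / real (Suc n)) t holomorphic_on upper_half_plane" for n
    by (rule euler_path_holomorphic[OF _ assms]) simp
  fix x assume "x \<in> upper_half_plane"
  then obtain d where d: "0 < d" "cball x d \<subseteq> upper_half_plane" using open_uhp by (meson open_contains_cball)
  obtain R where R: "0 < R" "cball x d \<subseteq> region R" using compact_subset_region[OF compact_cball d(2)] by blast
  have "uniform_limit (cball x d) (\<lambda>n. euler_path s (1 / real (Suc n)) t) (flow s t) sequentially"
  proof (rule uniform_limitI)
    fix e :: real assume "0 < e"
    then obtain n0 where "\<And>n s' t' z. n0 \<le> n \<Longrightarrow> s \<le> s' \<Longrightarrow> s' \<le> t' \<Longrightarrow> t' \<le> t \<Longrightarrow> z \<in> region R \<Longrightarrow>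
      norm (euler_path s' (1 / real (Suc n)) t' z - flow s' t' z) \<le> e / 2"
      using euler_path_flow[OF assms R(1), of "e / 2"] by (metis half_gt_zero)
    thus "\<forall>\<^sub>F n in sequentially. \<forall>z\<in>cball x d. dist (euler_path s (1 / real (Suc n)) t z) (flow s t z) < e"
      using \<open>0 < e\<close> R(2) assms unfolding eventually_sequentially dist_norm
      by (intro exI[of _ n0]) (force intro: le_less_trans[of _ "e / 2"])
  qed
  thus "\<exists>d>0. cball x d \<subseteq> upper_half_plane \<and> uniform_limit (cball x d) (\<lambda>n. euler_path s (1 / real (Suc n)) t) (flow s t) sequentially"
    using d by blast
qed

lemma flow_time:
  assumes "s \<le> t" "t \<le> t'" "z \<in> region R"
  shows "norm (flow s t' z - flow s t z) \<le> \<bar>\<gamma> t - \<gamma> t'\<bar> + orbit_bound R * strip_mass t t'"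
proof -
  have dr: "driven_by (\<lambda>u. flow s u z) t t'"
    by (rule driven_by_subinterval[OF flow_driven[OF region_bounds(1)[OF assms(3)], of s t']]) (use assms in auto)
  have "flow s t' z - flow s t z = of_real (\<gamma> t - \<gamma> t') + nev_integral (\<lambda>u. flow s u z) t t'"
    using driven_byD(3)[OF dr, of t'] assms by simp
  moreover have "norm (nev_integral (\<lambda>u. flow s u z) t t') \<le> orbit_bound R * strip_mass t t'"
    by (intro nev_integral_bound admissibleI_cont driven_byD(1)[OF dr] flow_region) (use assms in auto)
  ultimately show ?thesis
    using norm_triangle_ineq[of "of_real (\<gamma> t - \<gamma> t')" "nev_integral (\<lambda>u. flow s u z) t t'"] by (simp del: of_real_diff)
qed

text \<open>Changing the final time is controlled by the modulus of continuity of \<open>\<gamma>\<close> and of the mass.  A change of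
the starting time is, by the semigroup property, a change of the starting point, which is controlled by stability.  The
general case passes through the earlier of the two starting times, so that every intermediate pair is ordered.\<close>

lemma flow_continuous:
  assumes "a \<le> b" "0 < R" "0 < e"
  obtains d where "0 < d" "\<And>s t s' t' z. a \<le> s \<Longrightarrow> s \<le> t \<Longrightarrow> t \<le> b \<Longrightarrow> a \<le> s' \<Longrightarrow> s' \<le> t' \<Longrightarrow> t' \<le> b \<Longrightarrow>
    \<bar>s - s'\<bar> < d \<Longrightarrow> \<bar>t - t'\<bar> < d \<Longrightarrow> z \<in> region R \<Longrightarrow> norm (flow s t z - flow s' t' z) < e"
proof -
  define R2 where "R2 = max (orbit_bound R) (orbit_bound (orbit_bound R))"
  obtain C where C: "1 \<le> C" "\<And>s v w. a \<le> s \<Longrightarrow> s \<le> b \<Longrightarrow> driven_by v s b \<Longrightarrow> driven_by w s b \<Longrightarrow>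
    (\<forall>t\<in>{s..b}. v t \<in> region R2 \<and> w t \<in> region R2) \<Longrightarrow> (\<forall>t\<in>{s..b}. norm (v t - w t) \<le> C * norm (v s - w s))"
    using driven_stability[OF assms(1), of R2] by blast
  have "0 < e / (3 * C)" using assms(3) C(1) by simp
  then obtain d where d: "0 < d" "\<And>x y. a \<le> x \<Longrightarrow> x \<le> y \<Longrightarrow> y \<le> b \<Longrightarrow> y - x < d \<Longrightarrow> \<bar>\<gamma> x - \<gamma> y\<bar> + orbit_bound R * strip_mass x y < e / (3 * C)"
    using modulus[of "e / (3 * C)" "orbit_bound R" a b] orbit_bound_pos[OF assms(2)] less_imp_le by blast
  have C3: "C * (e / (3 * C)) = e / 3" "e / (3 * C) \<le> e / 3"
    using C(1) assms(3) by (auto simp: field_simps)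
  have S: "norm (flow s t z - flow s' t z) < e / 3"
    if "a \<le> s" "s \<le> s'" "s' \<le> t" "t \<le> b" "s' - s < d" "z \<in> region R" for s s' t z
  proof -
    have z: "0 < Im z" using region_bounds(1)[OF that(6)] .
    define z1 where "z1 = flow s s' z"
    have z1: "z1 \<in> region (orbit_bound R)" unfolding z1_def by (rule flow_region) (use that in auto)
    have "norm (z1 - z) < e / (3 * C)"
      using flow_time[of s s s' z R] d(2)[of s s'] that by (simp add: z1_def)
    hence "C * norm (z1 - z) < e / 3" using C(1) C3(1) mult_strict_left_mono[of _ _ C] by fastforce
    moreover have "\<forall>u\<in>{s'..b}. norm (flow s' u z1 - flow s' u z) \<le> C * norm (flow s' s' z1 - flow s' s' z)"
    proof (rule C(2))
      show "driven_by (\<lambda>u. flow s' u z1) s' b" "driven_by (\<lambda>u. flow s' u z) s' b"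
        using flow_driven region_bounds(1)[OF z1] z by auto
      show "\<forall>t\<in>{s'..b}. flow s' t z1 \<in> region R2 \<and> flow s' t z \<in> region R2"
        using flow_region[OF _ z1] flow_region[OF _ that(6)] region_mono[of "orbit_bound R" R2] region_mono[of "orbit_bound (orbit_bound R)" R2]
        by (auto simp: R2_def)
    qed (use that in auto)
    moreover have "flow s t z = flow s' t z1" unfolding z1_def using flow_semigroup[OF z] that by simp
    ultimately show ?thesis using that by force
  qed
  have T: "norm (flow s t z - flow s t' z) < e / 3"
    if "a \<le> s" "s \<le> t" "t \<le> t'" "t' \<le> b" "t' - t < d" "z \<in> region R" for s t' t z
    using flow_time[OF that(2,3,6)] d(2)[of t t'] that C3(2) by (simp add: norm_minus_commute)
  show ?thesis
  proof (rule that[OF d(1)])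
    fix s t s' t' z assume *: "a \<le> s" "s \<le> t" "t \<le> b" "a \<le> s'" "s' \<le> t'" "t' \<le> b" "\<bar>s - s'\<bar> < d" "\<bar>t - t'\<bar> < d" "z \<in> region R"
    define m where "m = min s s'"
    have 1: "norm (flow m t z - flow s t z) < e / 3" by (rule S) (use * d in \<open>auto simp: m_def\<close>)
    have 3: "norm (flow m t' z - flow s' t' z) < e / 3" by (rule S) (use * d in \<open>auto simp: m_def\<close>)
    have 2: "norm (flow m t z - flow m t' z) < e / 3"
    proof (cases "t \<le> t'")
      case True show ?thesis by (rule T) (use * True in \<open>auto simp: m_def\<close>)
    next
      case False
      have "norm (flow m t' z - flow m t z) < e / 3" by (rule T) (use * False in \<open>auto simp: m_def\<close>)
      thus ?thesis by (simp add: norm_minus_commute)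
    qed
    have "flow s t z - flow s' t' z = ((flow m t z - flow m t' z) + (flow m t' z - flow s' t' z)) - (flow m t z - flow s t z)" by simp
    hence "norm (flow s t z - flow s' t' z) \<le> norm ((flow m t z - flow m t' z) + (flow m t' z - flow s' t' z)) + norm (flow m t z - flow s t z)"
      by (simp only: norm_triangle_ineq4)
    moreover note norm_triangle_ineq[of "flow m t z - flow m t' z" "flow m t' z - flow s' t' z"]
    ultimately show "norm (flow s t z - flow s' t' z) < e" using 1 2 3 by linarith
  qed
qed

end

context st_measure begin

lemma Im_nev_integral_nonneg:
  assumes "admissible R w s t" shows "0 \<le> Im (nev_integral w s t)"
proof -
  have i: "integrable N (\<lambda>p. indicator (UNIV \<times> {s<..t}) p *\<^sub>R nev (fst p) (w (snd p)))"
    using admissible_integrable[OF assms] by (simp add: set_integrable_def)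
  have "Im (nev_integral w s t) = (LINT p|N. Im (indicator (UNIV \<times> {s<..t}) p *\<^sub>R nev (fst p) (w (snd p))))"
    unfolding nev_integral_def set_lebesgue_integral_def by (rule integral_Im[OF i, symmetric])
  also have "0 \<le> \<dots>"
  proof (rule Bochner_Integration.integral_nonneg)
    fix p :: "real \<times> real"
    show "0 \<le> Im (indicator (UNIV \<times> {s<..t}) p *\<^sub>R nev (fst p) (w (snd p)))"
    proof (cases "p \<in> UNIV \<times> {s<..t}")
      case True
      hence "w (snd p) \<in> region R" using assms by (auto simp: admissible_def)
      hence "0 < Im (nev (fst p) (w (snd p)))" by (intro Im_nev_pos region_bounds(1))
      thus ?thesis using True by simp
    qed simp
  qed
  finally show ?thesis .
qed

end

context driven begin

lemma Im_flow_ge: assumes "s \<le> t" "0 < Im z" shows "Im z \<le> Im (flow s t z)"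
proof -
  obtain R where R: "0 < R" "z \<in> region R" using in_some_region[OF assms(2)] by blast
  note dr = flow_driven[OF assms(2), of s t]
  have ad: "admissible (orbit_bound R) (\<lambda>u. flow s u z) s t"
    by (rule admissibleI_cont[OF driven_byD(1)[OF dr]]) (use flow_region[OF _ R(2)] in auto)
  have "flow s t z = z + of_real (\<gamma> s) - of_real (\<gamma> t) + nev_integral (\<lambda>u. flow s u z) s t"
    using driven_byD(3)[OF dr, of t] assms by simp
  from arg_cong[OF this, of Im] show ?thesis using Im_nev_integral_nonneg[OF ad] by simp
qed

text \<open>It remains to see that the integral is \<open>o(y)\<close> on the curves from \<open>\<i> * y\<close>.  Since \<open>orbit_bound\<close> is linear, these curves
satisfy \<open>y \<le> Im w\<close> and \<open>|w| \<le> C * y\<close>; on such \<open>w\<close> the kernel divided by \<open>y\<close> is bounded and tends to \<open>0\<close>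
for every \<open>x\<close>.\<close>

lemma flow_class_P:
  assumes st: "s \<le> t" shows "flow s t \<in> class_P"
proof (rule class_P_I[OF flow_holomorphic[OF st]])
  show "0 < Im (flow s t z)" if "0 < Im z" for z using Im_flow_ge[OF st that] that by linarith
  define C where "C = 2 * orbit_bound 1"
  have C: "0 < C" using orbit_bound_pos[of 1] by (simp add: C_def)
  define D where "D = 1 + C * (1 + C)"
  have D: "0 \<le> D" using C by (simp add: D_def)
  have K: "norm (nev x w) / y \<le> min D ((1 + C * \<bar>x\<bar>) / y)" if y: "1 \<le> y" and w: "y \<le> Im w" "norm w \<le> C * y" for x w y
  proof -
    let ?d = "norm (complex_of_real x - w)"
    have dy: "y \<le> ?d" using abs_Im_le_cmod[of "complex_of_real x - w"] w(1) y by simp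
    have "\<bar>x\<bar> \<le> ?d + norm w" using norm_triangle_ineq[of "complex_of_real x - w" w] by simp
    also have "\<dots> \<le> ?d + C * ?d" using w(2) mult_left_mono[OF dy, of C] C by linarith
    finally have xd: "\<bar>x\<bar> \<le> (1 + C) * ?d" by (simp add: algebra_simps)
    have n: "norm (1 + of_real x * w) \<le> 1 + \<bar>x\<bar> * norm w"
      using norm_triangle_ineq[of 1 "of_real x * w"] by (simp add: norm_mult)
    have "norm (1 + of_real x * w) \<le> D * y * ?d"
    proof -
      have "\<bar>x\<bar> * norm w \<le> ((1 + C) * ?d) * (C * y)" using xd w(2) C y by (intro mult_mono) auto
      moreover have "1 \<le> y * ?d" using y dy mult_mono[of 1 y 1 ?d] by simp
      ultimately show ?thesis using n by (simp add: D_def algebra_simps)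
    qed
    hence "norm (nev x w) \<le> D * y"
      unfolding nev_def norm_divide using dy y by (subst pos_divide_le_eq) auto
    hence 1: "norm (nev x w) / y \<le> D" using y by (simp add: pos_divide_le_eq)
    have "norm (1 + of_real x * w) \<le> (1 + C * \<bar>x\<bar>) * ?d"
    proof -
      have "\<bar>x\<bar> * norm w \<le> \<bar>x\<bar> * (C * y)" using w by (intro mult_left_mono) auto
      also have "\<dots> \<le> \<bar>x\<bar> * (C * ?d)" using dy C by (intro mult_left_mono) auto
      finally show ?thesis using n dy y by (simp add: algebra_simps)
    qed
    hence "norm (nev x w) \<le> 1 + C * \<bar>x\<bar>"
      unfolding nev_def norm_divide using dy y by (subst pos_divide_le_eq) auto
    hence "norm (nev x w) / y \<le> (1 + C * \<bar>x\<bar>) / y" using y by (intro divide_right_mono) auto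
    thus ?thesis using 1 by simp
  qed
  define hh where "hh = (\<lambda>y (p :: real \<times> real). min D ((1 + C * \<bar>fst p\<bar>) / y) :: real)"
  have hm: "hh y \<in> borel_measurable N" for y unfolding hh_def
    by (rule compose_fst) measurable
  have JB: "norm (nev_integral (\<lambda>u. flow s u (\<i> * of_real y)) s t / of_real y) \<le> (LINT p|N. hh y p)" if y: "1 \<le> y" for y
  proof -
    let ?z = "\<i> * complex_of_real y"
    define R where "R = (1 + y\<^sup>2) / y"
    have z: "0 < Im ?z" "?z \<in> region R" using y by (auto simp: region_def R_def norm_mult)
    have "R \<le> 2 * y" using y by (simp add: R_def pos_divide_le_eq power2_eq_square mult_mono[of 1 y 1 y, simplified])
    hence "orbit_bound R \<le> C * y" using mult_left_mono[of R "2 * y" "orbit_bound 1"] orbit_bound_pos[of 1]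
      by (simp add: C_def orbit_bound_def algebra_simps)
    hence nw: "norm (flow s u ?z) \<le> C * y" if "s \<le> u" for u
      using region_bounds(4)[OF flow_region[OF that z(2)]] by linarith
    have ad: "admissible (orbit_bound R) (\<lambda>u. flow s u ?z) s t"
      by (rule admissibleI_cont[OF driven_byD(1)[OF flow_driven[OF z(1)]]]) (use flow_region[OF _ z(2)] in auto)
    have i: "integrable N (\<lambda>p. indicator (UNIV \<times> {s<..t}) p *\<^sub>R nev (fst p) (flow s (snd p) ?z))"
      using admissible_integrable[OF ad] by (simp add: set_integrable_def)
    have "nev_integral (\<lambda>u. flow s u ?z) s t / of_real y = (LINT p|N. indicator (UNIV \<times> {s<..t}) p *\<^sub>R nev (fst p) (flow s (snd p) ?z) / of_real y)"
      unfolding nev_integral_def set_lebesgue_integral_def by simp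
    also have "norm \<dots> \<le> (LINT p|N. hh y p)"
    proof (rule Bochner_Integration.integral_norm_bound_integral)
      show "integrable N (\<lambda>p. indicator (UNIV \<times> {s<..t}) p *\<^sub>R nev (fst p) (flow s (snd p) ?z) / of_real y)" using i by simp
      show "integrable N (hh y)"
        by (rule integrable_const_bound[OF _ hm, of _ D]) (use C D y in \<open>auto simp: hh_def\<close>)
      fix p :: "real \<times> real"
      have "0 \<le> hh y p" using C D y by (simp add: hh_def)
      moreover have "norm (nev (fst p) (flow s (snd p) ?z)) / y \<le> hh y p" if "p \<in> UNIV \<times> {s<..t}"
        unfolding hh_def using that y nw Im_flow_ge[of s "snd p" ?z] z by (intro K) auto
      ultimately show "norm (indicator (UNIV \<times> {s<..t}) p *\<^sub>R nev (fst p) (flow s (snd p) ?z) / of_real y) \<le> hh y p"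
        using y by (cases "p \<in> UNIV \<times> {s<..t}") (auto simp: norm_divide)
    qed
    finally show ?thesis .
  qed
  have h0: "((\<lambda>y. LINT p|N. hh y p) \<longlongrightarrow> (LINT p|N. 0)) at_top"
  proof (rule integral_dominated_convergence_at_top[where w = "\<lambda>_. D"])
    show "\<forall>\<^sub>F y in at_top. AE p in N. norm (hh y p) \<le> D"
      using eventually_ge_at_top[of 1] by eventually_elim (use C D in \<open>auto simp: hh_def\<close>)
    show "AE p in N. ((\<lambda>y. hh y p) \<longlongrightarrow> 0) at_top"
    proof (rule AE_I2)
      fix p :: "real \<times> real"
      have "((\<lambda>y. (1 + C * \<bar>fst p\<bar>) / y) \<longlongrightarrow> 0) at_top"
        by (rule divide_at_top_tendsto_0)
      from tendsto_min[OF tendsto_const[of D] this] show "((\<lambda>y. hh y p) \<longlongrightarrow> 0) at_top"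
        using D by (simp add: hh_def)
    qed
  qed (use hm in auto)
  have J0: "((\<lambda>y. nev_integral (\<lambda>u. flow s u (\<i> * of_real y)) s t / of_real y) \<longlongrightarrow> 0) at_top"
  proof (rule Lim_null_comparison)
    show "\<forall>\<^sub>F y in at_top. norm (nev_integral (\<lambda>u. flow s u (\<i> * of_real y)) s t / of_real y) \<le> (LINT p|N. hh y p)"
      using eventually_ge_at_top[of 1] by eventually_elim (rule JB)
    show "((\<lambda>y. LINT p|N. hh y p) \<longlongrightarrow> 0) at_top" using h0 by simp
  qed
  have "((\<lambda>y. of_real ((\<gamma> s - \<gamma> t) / y) :: complex) \<longlongrightarrow> of_real 0) at_top"
    by (intro tendsto_of_real tendsto_divide_0[OF tendsto_const]) (simp add: filterlim_at_top_imp_at_infinity filterlim_ident)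
  hence "((\<lambda>y. 1 + (of_real ((\<gamma> s - \<gamma> t) / y) + nev_integral (\<lambda>u. flow s u (\<i> * of_real y)) s t / of_real y) / \<i>) \<longlongrightarrow> 1 + (of_real 0 + 0) / \<i>) at_top"
    by (intro tendsto_add tendsto_divide J0 tendsto_const) auto
  moreover have "\<forall>\<^sub>F y in at_top. 1 + (of_real ((\<gamma> s - \<gamma> t) / y) + nev_integral (\<lambda>u. flow s u (\<i> * of_real y)) s t / of_real y) / \<i> = flow s t (\<i> * of_real y) / (\<i> * of_real y)"
    using eventually_gt_at_top[of 0]
  proof eventually_elim
    case (elim y)
    have e: "flow s t (\<i> * of_real y) = \<i> * of_real y + of_real (\<gamma> s) - of_real (\<gamma> t) + nev_integral (\<lambda>u. flow s u (\<i> * of_real y)) s t"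
      using driven_byD(3)[OF flow_driven[of "\<i> * of_real y" s t], of t] elim st by simp
    show ?case unfolding e using elim by (simp add: field_simps)
  qed
  ultimately show "((\<lambda>y. flow s t (\<i> * of_real y) / (\<i> * of_real y)) \<longlongrightarrow> 1) at_top"
    using Lim_transform_eventually by force
qed

end

section \<open>Functions determined by their infinitesimal increments\<close>

lemma fine_partition:
  fixes a b d :: real assumes "a \<le> b" "0 < d"
  obtains n :: nat and p :: "nat \<Rightarrow> real" where "p 0 = a" "p n = b" "mono p" "\<And>i. p (Suc i) - p i < d" "\<And>i. i \<le> n \<Longrightarrow> p i \<in> {a..b}"
proof -
  obtain n :: nat where n: "(b - a) / d < real n" using reals_Archimedean2 by blast
  have n0: "0 < n" using n assms by (cases n) (auto simp: divide_less_eq)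
  define st where "st = (b - a) / real n"
  define p where "p = (\<lambda>i. a + real i * st)"
  have step: "0 \<le> st" using assms by (simp add: st_def)
  have m: "mono p" unfolding p_def by (intro monoI add_left_mono mult_right_mono step) auto
  have pn: "p n = b" using n0 by (simp add: p_def st_def)
  show ?thesis
  proof (rule that[of p n, OF _ pn m])
    show "p 0 = a" by (simp add: p_def)
    show "p (Suc i) - p i < d" for i
    proof -
      have "p (Suc i) - p i = st" by (simp add: p_def algebra_simps)
      moreover have "st < d" using n n0 assms by (simp add: st_def field_simps)
      ultimately show ?thesis by simp
    qed
    show "p i \<in> {a..b}" if "i \<le> n" for i
      using monoD[OF m that] monoD[OF m, of 0 i] pn by (simp add: p_def)
  qed
qed

text \<open>Sum the local estimate over a fine partition and let \<open>e\<close> tend to \<open>0\<close>.\<close>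

lemma increments_nonneg:
  fixes D A :: "real \<Rightarrow> real"
  assumes ab: "a \<le> b" and A: "A a \<le> A b"
    and inc: "\<And>e. 0 < e \<Longrightarrow> \<exists>d>0. \<forall>s t. a \<le> s \<and> s \<le> t \<and> t \<le> b \<and> t - s < d \<longrightarrow> - e * (A t - A s) \<le> D t - D s"
  shows "D a \<le> D b"
proof (rule field_le_epsilon)
  fix e :: real assume "0 < e"
  define e' where "e' = e / (A b - A a + 1)"
  have e': "0 < e'" using \<open>0 < e\<close> A by (simp add: e'_def)
  from inc[OF e'] obtain d where d: "0 < d" "\<And>s t. a \<le> s \<Longrightarrow> s \<le> t \<Longrightarrow> t \<le> b \<Longrightarrow> t - s < d \<Longrightarrow> - e' * (A t - A s) \<le> D t - D s"
    by blast
  obtain n p where p: "p 0 = a" "p n = b" "mono p" "\<And>i. p (Suc i) - p i < d" "\<And>i. i \<le> n \<Longrightarrow> p i \<in> {a..b}"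
    using fine_partition[OF ab d(1)] by metis
  have "(\<Sum>i<n. - e' * (A (p (Suc i)) - A (p i))) \<le> (\<Sum>i<n. D (p (Suc i)) - D (p i))"
  proof (rule sum_mono)
    fix i assume "i \<in> {..<n}"
    thus "- e' * (A (p (Suc i)) - A (p i)) \<le> D (p (Suc i)) - D (p i)"
      using p(5)[of i] p(5)[of "Suc i"] p(4)[of i] monoD[OF p(3), of i "Suc i"] by (intro d(2)) auto
  qed
  hence "- e' * (A b - A a) \<le> D b - D a"
    unfolding sum_distrib_left[symmetric] sum_lessThan_telescope[of "\<lambda>i. A (p i)"] sum_lessThan_telescope[of "\<lambda>i. D (p i)"] by (simp add: p)
  moreover have "e' * (A b - A a) \<le> e"
  proof -
    have "e' * (A b - A a) \<le> e' * (A b - A a + 1)" using e' by (intro mult_left_mono) auto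
    also have "\<dots> = e" using A by (simp add: e'_def)
    finally show ?thesis .
  qed
  ultimately show "D a \<le> D b + e" by linarith
qed

lemma increments_zero:
  fixes D :: "real \<Rightarrow> 'a::real_normed_vector" and A :: "real \<Rightarrow> real"
  assumes ab: "a \<le> b" and A: "A a \<le> A b"
    and inc: "\<And>e. 0 < e \<Longrightarrow> \<exists>d>0. \<forall>s t. a \<le> s \<and> s \<le> t \<and> t \<le> b \<and> t - s < d \<longrightarrow> norm (D t - D s) \<le> e * (A t - A s)"
  shows "D b = D a"
proof -
  have "- norm (D a - D a) \<le> - norm (D b - D a)"
  proof (rule increments_nonneg[OF ab A])
    fix e :: real assume "0 < e"
    from inc[OF this] obtain d where d: "0 < d" "\<And>s t. a \<le> s \<Longrightarrow> s \<le> t \<Longrightarrow> t \<le> b \<Longrightarrow> t - s < d \<Longrightarrow> norm (D t - D s) \<le> e * (A t - A s)"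
      by blast
    show "\<exists>d>0. \<forall>s t. a \<le> s \<and> s \<le> t \<and> t \<le> b \<and> t - s < d \<longrightarrow> - e * (A t - A s) \<le> - norm (D t - D a) - - norm (D s - D a)"
    proof (intro exI conjI allI impI)
      fix s t assume "a \<le> s \<and> s \<le> t \<and> t \<le> b \<and> t - s < d"
      hence "norm (D t - D s) \<le> e * (A t - A s)" using d(2) by blast
      moreover have "norm (D t - D a) \<le> norm (D t - D s) + norm (D s - D a)"
        using norm_triangle_ineq[of "D t - D s" "D s - D a"] by simp
      ultimately show "- e * (A t - A s) \<le> - norm (D t - D a) - - norm (D s - D a)" by linarith
    qed (rule d)
  qed
  thus ?thesis by simp
qed

section \<open>Evolution families\<close>

locale evolution =
  fixes I :: "real set" and \<phi> :: "real \<Rightarrow> real \<Rightarrow> complex \<Rightarrow> complex"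
  assumes I: "time_interval I" and EF: "P_evolution_family I \<phi>"

lemma time_interval_facts:
  assumes "time_interval I"
  shows "0 \<in> I" "t \<in> I \<Longrightarrow> 0 \<le> t" "t \<in> I \<Longrightarrow> 0 \<le> s \<Longrightarrow> s \<le> t \<Longrightarrow> s \<in> I"
  using assms unfolding time_interval_def by (auto simp: zero_ereal_def intro: le_less_trans[of "ereal s" "ereal t"])

context evolution begin

lemmas I0 = time_interval_facts(1)[OF I] and I_nonneg = time_interval_facts(2)[OF I] and I_down = time_interval_facts(3)[OF I]

lemma pairs: "t \<in> I \<Longrightarrow> 0 \<le> s \<Longrightarrow> s \<le> t \<Longrightarrow> (s, t) \<in> time_pairs I"
  using I_down by (auto simp: time_pairs_def)

lemma \<phi>_hol: "t \<in> I \<Longrightarrow> 0 \<le> s \<Longrightarrow> s \<le> t \<Longrightarrow> \<phi> s t holomorphic_on upper_half_plane"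
  and \<phi>_self: "t \<in> I \<Longrightarrow> 0 \<le> s \<Longrightarrow> s \<le> t \<Longrightarrow> \<phi> s t ` upper_half_plane \<subseteq> upper_half_plane"
  and \<phi>_P: "t \<in> I \<Longrightarrow> 0 \<le> s \<Longrightarrow> s \<le> t \<Longrightarrow> \<phi> s t \<in> class_P"
  using EF pairs[of t s] unfolding P_evolution_family_def by fast+

lemma \<phi>_pos: "t \<in> I \<Longrightarrow> 0 \<le> s \<Longrightarrow> s \<le> t \<Longrightarrow> 0 < Im z \<Longrightarrow> 0 < Im (\<phi> s t z)"
  using \<phi>_self[of t s] by (auto simp: upper_half_plane_def image_subset_iff)

lemma \<phi>_refl: "s \<in> I \<Longrightarrow> 0 < Im z \<Longrightarrow> \<phi> s s z = z"
  using EF by (auto simp: P_evolution_family_def upper_half_plane_def)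

lemma \<phi>_comp: "u \<in> I \<Longrightarrow> 0 \<le> s \<Longrightarrow> s \<le> t \<Longrightarrow> t \<le> u \<Longrightarrow> 0 < Im z \<Longrightarrow> \<phi> t u (\<phi> s t z) = \<phi> s u z"
proof -
  assume a: "u \<in> I" "0 \<le> s" "s \<le> t" "t \<le> u" "0 < Im z"
  hence "s \<in> I" "t \<in> I" using I_down[of u] by auto
  thus ?thesis using EF a unfolding P_evolution_family_def upper_half_plane_def by blast
qed

definition triangle :: "real \<Rightarrow> (real \<times> real) set" where
  "triangle T = {(s, t). 0 \<le> s \<and> s \<le> t \<and> t \<le> T}"

lemma compact_triangle: "compact (triangle T)"
proof -
  have "triangle T = ({0..T} \<times> {0..T}) \<inter> {p. fst p \<le> snd p}" by (auto simp: triangle_def)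
  moreover have "closed {p :: real \<times> real. fst p \<le> snd p}" by (intro closed_Collect_le continuous_intros)
  ultimately show ?thesis by (auto intro!: compact_Int_closed compact_Times)
qed

text \<open>Locally uniform convergence gives continuity in time uniformly in \<open>z\<close>; every single map is continuous in \<open>z\<close>.\<close>

lemma joint_continuity:
  assumes T: "T \<in> I" and Z: "compact Z" "Z \<subseteq> upper_half_plane"
  shows "continuous_on (triangle T \<times> Z) (\<lambda>(p, z). \<phi> (fst p) (snd p) z)"
  unfolding continuous_on_iff
proof (intro ballI allI impI)
  fix x and e :: real assume x: "x \<in> triangle T \<times> Z" and e: "0 < e"
  obtain s t z where [simp]: "x = ((s, t), z)" by (metis prod.exhaust)
  have st: "0 \<le> s" "s \<le> t" "t \<le> T" "z \<in> Z" using x by (auto simp: triangle_def)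
  have tI: "t \<in> I" using I_down[OF T] st by auto
  have "uniform_limit Z (\<lambda>(s', t'). \<phi> s' t') (\<phi> s t) (at (s, t) within time_pairs I)"
    using EF pairs[OF tI st(1,2)] Z unfolding P_evolution_family_def continuous_locally_uniformly_def by blast
  from uniform_limitD[OF this, of "e / 2"] e
  have "\<forall>\<^sub>F p in at (s, t) within time_pairs I. \<forall>z\<in>Z. dist (\<phi> (fst p) (snd p) z) (\<phi> s t z) < e / 2"
    by (simp add: case_prod_beta)
  then obtain d1 where d1: "0 < d1" "\<And>p z. p \<in> time_pairs I \<Longrightarrow> p \<noteq> (s, t) \<Longrightarrow> dist p (s, t) < d1 \<Longrightarrow> z \<in> Z \<Longrightarrow> dist (\<phi> (fst p) (snd p) z) (\<phi> s t z) < e / 2"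
    unfolding eventually_at by blast
  have "continuous_on Z (\<phi> s t)"
    by (rule holomorphic_on_imp_continuous_on[OF holomorphic_on_subset[OF \<phi>_hol[OF tI st(1,2)] Z(2)]])
  then obtain d2 where d2: "0 < d2" "\<And>z'. z' \<in> Z \<Longrightarrow> dist z' z < d2 \<Longrightarrow> dist (\<phi> s t z') (\<phi> s t z) < e / 2"
    using st(4) e unfolding continuous_on_iff by (metis half_gt_zero)
  show "\<exists>d>0. \<forall>x'\<in>triangle T \<times> Z. dist x' x < d \<longrightarrow>
      dist (case x' of (p, z) \<Rightarrow> \<phi> (fst p) (snd p) z) (case x of (p, z) \<Rightarrow> \<phi> (fst p) (snd p) z) < e"
  proof (intro exI[of _ "min d1 d2"] conjI ballI impI)
    show "0 < min d1 d2" using d1 d2 by simp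
    fix x' assume x': "x' \<in> triangle T \<times> Z" "dist x' x < min d1 d2"
    obtain p z' where [simp]: "x' = (p, z')" by (metis prod.exhaust)
    have d: "dist p (s, t) < d1" "dist z' z < d2"
      using x'(2) dist_fst_le[of x' x] dist_snd_le[of x' x] by auto
    have "p \<in> time_pairs I" using x'(1) pairs[of "snd p" "fst p"] I_down[OF T, of "snd p"] by (cases p) (auto simp: triangle_def)
    hence "dist (\<phi> (fst p) (snd p) z') (\<phi> s t z') < e / 2"
      using d1(2)[of p z'] d x'(1) e by (cases "p = (s, t)") auto
    moreover have "dist (\<phi> s t z') (\<phi> s t z) < e / 2" using d2(2)[of z'] d x'(1) by auto
    ultimately have "dist (\<phi> (fst p) (snd p) z') (\<phi> s t z) < e"
      using dist_triangle[of "\<phi> (fst p) (snd p) z'" "\<phi> s t z" "\<phi> s t z'"] by linarith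
    thus "dist (case x' of (p, z) \<Rightarrow> \<phi> (fst p) (snd p) z) (case x of (p, z) \<Rightarrow> \<phi> (fst p) (snd p) z) < e" by simp
  qed
qed

lemma orbit_region:
  assumes T: "T \<in> I" and Z: "compact Z" "Z \<subseteq> upper_half_plane"
  obtains R where "0 < R" "\<And>s t z. 0 \<le> s \<Longrightarrow> s \<le> t \<Longrightarrow> t \<le> T \<Longrightarrow> z \<in> Z \<Longrightarrow> \<phi> s t z \<in> region R"
proof -
  define f where "f = (\<lambda>(p, z). \<phi> (fst p) (snd p) z)"
  have "compact (f ` (triangle T \<times> Z))"
    unfolding f_def by (intro compact_continuous_image joint_continuity T Z compact_Times compact_triangle)
  moreover have "f ` (triangle T \<times> Z) \<subseteq> upper_half_plane"
  proof safe
    fix s t z assume "(s, t) \<in> triangle T" "z \<in> Z"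
    thus "f ((s, t), z) \<in> upper_half_plane"
      using \<phi>_self[of t s] I_down[OF T, of t] Z(2) by (auto simp: f_def triangle_def)
  qed
  ultimately obtain R where R: "0 < R" "f ` (triangle T \<times> Z) \<subseteq> region R" using compact_subset_region by blast
  show ?thesis
  proof (rule that[OF R(1)])
    fix s t z assume "0 \<le> s" "s \<le> t" "t \<le> T" "z \<in> Z"
    hence "f ((s, t), z) \<in> f ` (triangle T \<times> Z)" by (intro imageI) (auto simp: triangle_def)
    thus "\<phi> s t z \<in> region R" using R(2) by (auto simp: f_def)
  qed
qed

lemma orbit_equicontinuous:
  assumes T: "T \<in> I" and Z: "compact Z" "Z \<subseteq> upper_half_plane" and e: "0 < e"
  obtains d where "0 < d" "\<And>s t z. 0 \<le> s \<Longrightarrow> s \<le> t \<Longrightarrow> t \<le> T \<Longrightarrow> t - s < d \<Longrightarrow> z \<in> Z \<Longrightarrow> norm (\<phi> s t z - z) < e"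
proof -
  define f where "f = (\<lambda>(p, z). \<phi> (fst p) (snd p) z)"
  have "uniformly_continuous_on (triangle T \<times> Z) f"
    unfolding f_def by (intro compact_uniformly_continuous joint_continuity T Z compact_Times compact_triangle)
  then obtain d where d: "0 < d" "\<And>x x'. x \<in> triangle T \<times> Z \<Longrightarrow> x' \<in> triangle T \<times> Z \<Longrightarrow> dist x' x < d \<Longrightarrow> dist (f x') (f x) < e"
    using e unfolding uniformly_continuous_on_def by metis
  show ?thesis
  proof (rule that[OF d(1)])
    fix s t z assume *: "0 \<le> s" "s \<le> t" "t \<le> T" "t - s < d" "z \<in> Z"
    have "dist (f ((s, t), z)) (f ((s, s), z)) < e"
      by (rule d(2)) (use * in \<open>auto simp: triangle_def dist_Pair_Pair dist_real_def\<close>)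
    moreover have "\<phi> s s z = z" using \<phi>_refl[of s z] I_down[OF T, of s] * Z(2) by (auto simp: upper_half_plane_def)
    ultimately show "norm (\<phi> s t z - z) < e" by (simp add: f_def dist_norm)
  qed
qed

lemma \<phi>_time_continuous:
  assumes "T \<in> I" "0 \<le> s" "0 < Im z"
  shows "continuous_on {s..T} (\<lambda>t. \<phi> s t z)"
proof -
  have "continuous_on {s..T} ((\<lambda>(p, z). \<phi> (fst p) (snd p) z) \<circ> (\<lambda>t. ((s, t), z)))"
    by (rule continuous_on_compose[OF _ continuous_on_subset[OF joint_continuity[OF assms(1), of "{z}"]]])
      (use assms in \<open>auto intro!: continuous_intros simp: triangle_def upper_half_plane_def\<close>)
  thus ?thesis by (simp add: o_def)
qed

text \<open>The real number \<open>Re (\<phi> s t \<i>)\<close> is the additive constant in the Nevanlinna representation of \<open>\<phi> s t\<close>, because the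
kernel takes the value \<open>\<i>\<close> at \<open>\<i>\<close>.\<close>

definition \<Xi> :: "complex \<Rightarrow> real \<Rightarrow> real \<Rightarrow> complex" where
  "\<Xi> z s t = \<phi> s t z - z - of_real (Re (\<phi> s t \<i>))"

definition \<rho> :: "real \<Rightarrow> real \<Rightarrow> real measure" where
  "\<rho> s t = (SOME \<rho>. fin_borel \<rho> \<and> (\<forall>z. 0 < Im z \<longrightarrow> \<Xi> z s t = nev_transform \<rho> z))"

lemma \<rho>: assumes "t \<in> I" "0 \<le> s" "s \<le> t"
  shows "fin_borel (\<rho> s t)" "0 < Im z \<Longrightarrow> \<Xi> z s t = nev_transform (\<rho> s t) z"
proof -
  obtain a \<rho>' where r: "fin_borel \<rho>'" "\<And>z. 0 < Im z \<Longrightarrow> \<phi> s t z = complex_of_real a + z + nev_transform \<rho>' z"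
    by (rule class_P_nevanlinna[OF \<phi>_P[OF assms] \<phi>_hol[OF assms] \<phi>_self[OF assms]]) (rule that)
  have "Re (\<phi> s t \<i>) = a" using r(2)[of \<i>] fin_borel.nev_transform_i[OF r(1)] by simp
  hence "fin_borel \<rho>' \<and> (\<forall>z. 0 < Im z \<longrightarrow> \<Xi> z s t = nev_transform \<rho>' z)" using r by (auto simp: \<Xi>_def)
  hence "fin_borel (\<rho> s t) \<and> (\<forall>z. 0 < Im z \<longrightarrow> \<Xi> z s t = nev_transform (\<rho> s t) z)" unfolding \<rho>_def by (rule someI)
  thus "fin_borel (\<rho> s t)" "0 < Im z \<Longrightarrow> \<Xi> z s t = nev_transform (\<rho> s t) z" by auto
qed

lemma \<Xi>_refl: "s \<in> I \<Longrightarrow> 0 < Im z \<Longrightarrow> \<Xi> z s s = 0" by (simp add: \<Xi>_def \<phi>_refl)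

text \<open>The intrinsic clock against which all increments are measured.\<close>

definition growth :: "real \<Rightarrow> real" where "growth t = Im (\<phi> 0 t \<i>)"

lemma \<phi>_step: assumes "u \<in> I" "0 \<le> s" "s \<le> t" "t \<le> u" "0 < Im z"
  shows "\<phi> s u z - \<phi> s t z = of_real (Re (\<phi> t u \<i>)) + \<Xi> (\<phi> s t z) t u"
  using \<phi>_comp[OF assms] by (simp add: \<Xi>_def)

text \<open>The imaginary part of the curve from \<open>\<i>\<close> grows by the imaginary part of the transform of \<open>\<rho> t u\<close> at a point of a compact
set, and this dominates the mass.\<close>

lemma mass_bound:
  assumes "T \<in> I"
  obtains M where "0 < M" "\<And>t u. 0 \<le> t \<Longrightarrow> t \<le> u \<Longrightarrow> u \<le> T \<Longrightarrow> measure (\<rho> t u) UNIV \<le> M * (growth u - growth t)"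
proof -
  obtain R where R: "0 < R" "\<And>s t z. 0 \<le> s \<Longrightarrow> s \<le> t \<Longrightarrow> t \<le> T \<Longrightarrow> z \<in> {\<i>} \<Longrightarrow> \<phi> s t z \<in> region R"
    using orbit_region[OF assms, of "{\<i>}"] by (auto simp: upper_half_plane_def)
  show ?thesis
  proof (rule that[OF R(1)])
    fix t u assume tu: "0 \<le> t" "t \<le> u" "u \<le> T"
    have uI: "u \<in> I" using I_down[OF assms] tu by auto
    interpret r: fin_borel "\<rho> t u" by (rule \<rho>[OF uI tu(1,2)])
    have w: "\<phi> 0 t \<i> \<in> region R" using R(2)[of 0 t] tu by auto
    have "r.mass \<le> R * Im (nev_transform (\<rho> t u) (\<phi> 0 t \<i>))" by (rule r.Im_nev_transform_ge[OF w])
    also have "Im (nev_transform (\<rho> t u) (\<phi> 0 t \<i>)) = growth u - growth t"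
      using arg_cong[OF \<phi>_step[OF uI order_refl tu(1,2), of \<i>], of Im] \<rho>(2)[OF uI tu(1,2) region_bounds(1)[OF w]]
      by (simp add: growth_def)
    finally show "r.mass \<le> R * (growth u - growth t)" .
  qed
qed

lemma growth_mono: assumes "u \<in> I" "0 \<le> t" "t \<le> u" shows "growth t \<le> growth u"
proof -
  obtain M where M: "0 < M" "\<And>t u'. 0 \<le> t \<Longrightarrow> t \<le> u' \<Longrightarrow> u' \<le> u \<Longrightarrow> measure (\<rho> t u') UNIV \<le> M * (growth u' - growth t)"
    using mass_bound[OF assms(1)] by blast
  have "0 \<le> M * (growth u - growth t)" using M(2)[OF assms(2,3) order_refl] measure_nonneg order_trans by blast
  thus ?thesis using M(1) by (simp add: zero_le_mult_iff)
qed

text \<open>Following the curve along the partition gives \<open>\<phi> s t z - z\<close> as the sum of the increments taken at the points of the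
curve.  Moving these points back to \<open>z\<close> costs at most a Lipschitz constant times the distance travelled times the masses,
and the masses add up to a multiple of the increase of \<open>growth\<close>.  The real drift is removed by subtracting the
real part of the same error at \<open>\<i>\<close>.\<close>

lemma \<Xi>_refine:
  assumes T: "T \<in> I" and Z: "compact Z" "Z \<subseteq> upper_half_plane" and e: "0 < e"
  obtains d where "0 < d" "\<And>p n z. mono p \<Longrightarrow> 0 \<le> p 0 \<Longrightarrow> p n \<le> T \<Longrightarrow> p n - p 0 < d \<Longrightarrow> z \<in> Z \<Longrightarrow>
    norm (\<Xi> z (p 0) (p n) - (\<Sum>i<n. \<Xi> z (p i) (p (Suc i)))) \<le> e * (growth (p n) - growth (p (0::nat)))"
proof -
  define Z' where "Z' = insert \<i> Z"
  have Z': "compact Z'" "Z' \<subseteq> upper_half_plane" using Z by (auto simp: Z'_def upper_half_plane_def)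
  obtain R where R: "0 < R" "\<And>s t z. 0 \<le> s \<Longrightarrow> s \<le> t \<Longrightarrow> t \<le> T \<Longrightarrow> z \<in> Z' \<Longrightarrow> \<phi> s t z \<in> region R"
    using orbit_region[OF T Z'] by blast
  obtain M where M: "0 < M" "\<And>t u. 0 \<le> t \<Longrightarrow> t \<le> u \<Longrightarrow> u \<le> T \<Longrightarrow> measure (\<rho> t u) UNIV \<le> M * (growth u - growth t)"
    using mass_bound[OF T] by blast
  define e' where "e' = e / (2 * R\<^sup>2 * M)"
  have e': "0 < e'" using e R M by (simp add: e'_def)
  obtain d where d: "0 < d" "\<And>s t z. 0 \<le> s \<Longrightarrow> s \<le> t \<Longrightarrow> t \<le> T \<Longrightarrow> t - s < d \<Longrightarrow> z \<in> Z' \<Longrightarrow> norm (\<phi> s t z - z) < e'"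
    using orbit_equicontinuous[OF T Z' e'] by blast
  show ?thesis
  proof (rule that[OF d(1)])
    fix p :: "nat \<Rightarrow> real" and n z
    assume p: "mono p" "0 \<le> p 0" "p n \<le> T" "p n - p 0 < d" and z: "z \<in> Z"
    define D where "D = (\<lambda>z. \<phi> (p 0) (p n) z - z - (\<Sum>i<n. \<phi> (p i) (p (Suc i)) z - z))"
    have D: "norm (D z) \<le> R\<^sup>2 * e' * M * (growth (p n) - growth (p 0))" if z: "z \<in> Z'" for z
    proof -
      have zp: "0 < Im z" using z Z' by (auto simp: upper_half_plane_def)
      have pm: "p i \<le> p j" if "i \<le> j" for i j using monoD[OF p(1) that] .
      have "norm (\<phi> (p 0) (p m) z - z - (\<Sum>i<m. \<phi> (p i) (p (Suc i)) z - z)) \<le> R\<^sup>2 * e' * M * (growth (p m) - growth (p 0))" if "m \<le> n" for m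
        using that
      proof (induction m)
        case 0
        have "p 0 \<in> I" using I_down[OF T, of "p 0"] p pm[of 0 n] by auto
        thus ?case by (simp add: \<phi>_refl zp)
      next
        case (Suc m)
        have le: "0 \<le> p 0" "p 0 \<le> p m" "p m \<le> p (Suc m)" "p (Suc m) \<le> T" using p pm[of 0 m] pm[of m "Suc m"] pm[of "Suc m" n] Suc.prems by auto
        have uI: "p (Suc m) \<in> I" using I_down[OF T, of "p (Suc m)"] le by auto
        have pm0: "0 \<le> p m" using le by auto
        interpret r: fin_borel "\<rho> (p m) (p (Suc m))" by (rule \<rho>[OF uI pm0 le(3)])
        define y where "y = \<phi> (p 0) (p m) z"
        have y: "y \<in> region R" unfolding y_def using R(2) le z by auto
        have "p 0 \<in> I" using I_down[OF T, of "p 0"] le by auto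
        hence zR: "z \<in> region R" using R(2)[of "p 0" "p 0" z] le z \<phi>_refl[of "p 0" z] zp by auto
        have "\<phi> (p 0) (p (Suc m)) z - y = of_real (Re (\<phi> (p m) (p (Suc m)) \<i>)) + nev_transform (\<rho> (p m) (p (Suc m))) y"
          unfolding y_def using \<phi>_step[OF uI le(1-3) zp] \<rho>(2)[OF uI pm0 le(3) region_bounds(1)[OF y]] by (simp add: y_def)
        moreover have "\<phi> (p m) (p (Suc m)) z - z = of_real (Re (\<phi> (p m) (p (Suc m)) \<i>)) + nev_transform (\<rho> (p m) (p (Suc m))) z"
          using \<rho>(2)[OF uI pm0 le(3) zp] by (simp add: \<Xi>_def algebra_simps)
        ultimately have eq: "\<phi> (p 0) (p (Suc m)) z - z - (\<Sum>i<Suc m. \<phi> (p i) (p (Suc i)) z - z) =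
          (y - z - (\<Sum>i<m. \<phi> (p i) (p (Suc i)) z - z)) + (nev_transform (\<rho> (p m) (p (Suc m))) y - nev_transform (\<rho> (p m) (p (Suc m))) z)"
          by (simp add: algebra_simps)
        have "norm (nev_transform (\<rho> (p m) (p (Suc m))) y - nev_transform (\<rho> (p m) (p (Suc m))) z) \<le> R\<^sup>2 * norm (y - z) * r.mass"
          by (rule r.nev_transform_lipschitz[OF y zR])
        also have "\<dots> \<le> R\<^sup>2 * e' * (M * (growth (p (Suc m)) - growth (p m)))"
        proof (intro mult_mono)
          have "p m - p 0 < d" using p pm[of m n] Suc.prems by simp
          thus "norm (y - z) \<le> e'" unfolding y_def using d(2)[of "p 0" "p m" z] le z by auto
          show "r.mass \<le> M * (growth (p (Suc m)) - growth (p m))" using M(2)[OF pm0 le(3,4)] .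
        qed (use e' in auto)
        finally have 1: "norm (nev_transform (\<rho> (p m) (p (Suc m))) y - nev_transform (\<rho> (p m) (p (Suc m))) z) \<le> R\<^sup>2 * e' * M * (growth (p (Suc m)) - growth (p m))"
          by (simp add: mult.assoc)
        have 2: "norm (y - z - (\<Sum>i<m. \<phi> (p i) (p (Suc i)) z - z)) \<le> R\<^sup>2 * e' * M * (growth (p m) - growth (p 0))"
          using Suc unfolding y_def by simp
        have "norm (\<phi> (p 0) (p (Suc m)) z - z - (\<Sum>i<Suc m. \<phi> (p i) (p (Suc i)) z - z)) \<le>
          R\<^sup>2 * e' * M * (growth (p m) - growth (p 0)) + R\<^sup>2 * e' * M * (growth (p (Suc m)) - growth (p m))"
          unfolding eq using norm_triangle_mono[OF 2 1] .
        thus ?case by (simp add: right_diff_distrib)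
      qed
      thus ?thesis by (simp add: D_def)
    qed
    have "\<Xi> z (p 0) (p n) - (\<Sum>i<n. \<Xi> z (p i) (p (Suc i))) = D z - of_real (Re (D \<i>))"
      by (simp add: \<Xi>_def D_def sum_subtractf Re_sum)
    also have "norm \<dots> \<le> norm (D z) + norm (D \<i>)"
      using norm_triangle_ineq4[of "D z" "of_real (Re (D \<i>))"] abs_Re_le_cmod[of "D \<i>"] by simp
    also have "\<dots> \<le> 2 * (R\<^sup>2 * e' * M * (growth (p n) - growth (p 0)))"
      using D[of z] D[of \<i>] z by (simp add: Z'_def)
    also have "\<dots> = e * (growth (p n) - growth (p 0))" using R M by (simp add: e'_def)
    finally show "norm (\<Xi> z (p 0) (p n) - (\<Sum>i<n. \<Xi> z (p i) (p (Suc i)))) \<le> e * (growth (p n) - growth (p 0))" .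
  qed
qed

end

section \<open>Sewing increments together\<close>

definition clip :: "real \<Rightarrow> real \<Rightarrow> real \<Rightarrow> real" where "clip s t x = max s (min t x)"

lemma clip_mono: "x \<le> y \<Longrightarrow> clip s t x \<le> clip s t y" by (auto simp: clip_def)

lemma clip_range: "s \<le> t \<Longrightarrow> clip s t x \<in> {s..t}" by (auto simp: clip_def)

lemma clip_diff: "x \<le> y \<Longrightarrow> clip s t y - clip s t x \<le> y - x" by (auto simp: clip_def)

context evolution begin

text \<open>The dyadic grid of the whole time axis, clipped to \<open>{s..t}\<close>: sums over adjacent intervals then use the same grid
points, which makes additivity visible before the limit.\<close>

definition riemann :: "nat \<Rightarrow> complex \<Rightarrow> real \<Rightarrow> real \<Rightarrow> complex" where
  "riemann n z s t = (\<Sum>k<nat \<lceil>t\<rceil> * 2 ^ n. \<Xi> z (clip s t (real k / 2 ^ n)) (clip s t (real (Suc k) / 2 ^ n)))"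

lemma grid_end: assumes "nat \<lceil>t\<rceil> * 2 ^ n \<le> k" shows "t \<le> real k / 2 ^ n"
proof -
  have "t \<le> real (nat \<lceil>t\<rceil>)" by linarith
  moreover have "real (nat \<lceil>t\<rceil> * 2 ^ n) \<le> real k" using assms by (simp only: of_nat_le_iff)
  hence "real (nat \<lceil>t\<rceil>) \<le> real k / 2 ^ n" by (simp add: pos_le_divide_eq)
  ultimately show ?thesis by linarith
qed

lemma riemann_extend:
  assumes "t \<in> I" "0 \<le> s" "s \<le> t" "0 < Im z" "nat \<lceil>t\<rceil> * 2 ^ n \<le> K"
  shows "riemann n z s t = (\<Sum>k<K. \<Xi> z (clip s t (real k / 2 ^ n)) (clip s t (real (Suc k) / 2 ^ n)))"
  unfolding riemann_def
proof (rule sum.mono_neutral_left)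
  show "\<forall>k\<in>{..<K} - {..<nat \<lceil>t\<rceil> * 2 ^ n}. \<Xi> z (clip s t (real k / 2 ^ n)) (clip s t (real (Suc k) / 2 ^ n)) = 0"
  proof
    fix k assume "k \<in> {..<K} - {..<nat \<lceil>t\<rceil> * 2 ^ n}"
    hence "nat \<lceil>t\<rceil> * 2 ^ n \<le> k" "nat \<lceil>t\<rceil> * 2 ^ n \<le> Suc k" by auto
    hence "clip s t (real k / 2 ^ n) = t" "clip s t (real (Suc k) / 2 ^ n) = t"
      using grid_end[of t n k] grid_end[of t n "Suc k"] assms(3) by (auto simp: clip_def)
    thus "\<Xi> z (clip s t (real k / 2 ^ n)) (clip s t (real (Suc k) / 2 ^ n)) = 0" by (simp add: \<Xi>_refl assms)
  qed
qed (use assms in auto)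

definition refined :: "real \<Rightarrow> complex set \<Rightarrow> real \<Rightarrow> real \<Rightarrow> bool" where
  "refined T Z e d \<longleftrightarrow> 0 < d \<and> (\<forall>p n z. mono p \<longrightarrow> 0 \<le> p 0 \<longrightarrow> p n \<le> T \<longrightarrow> p n - p 0 < d \<longrightarrow> z \<in> Z \<longrightarrow>
    norm (\<Xi> z (p 0) (p n) - (\<Sum>i<n. \<Xi> z (p i) (p (Suc i)))) \<le> e * (growth (p n) - growth (p (0::nat))))"

lemma refinedD: "refined T Z e d \<Longrightarrow> mono p \<Longrightarrow> 0 \<le> p 0 \<Longrightarrow> p n \<le> T \<Longrightarrow> p n - p 0 < d \<Longrightarrow> z \<in> Z \<Longrightarrow>
    norm (\<Xi> z (p 0) (p n) - (\<Sum>i<n. \<Xi> z (p i) (p (Suc i)))) \<le> e * (growth (p n) - growth (p (0::nat)))"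
  unfolding refined_def by blast

lemma refined_exists:
  assumes "T \<in> I" "compact Z" "Z \<subseteq> upper_half_plane" "0 < e"
  obtains d where "refined T Z e d"
  by (rule \<Xi>_refine[OF assms]) (rule that, unfold refined_def, blast)

lemma riemann_near_\<Xi>:
  assumes r: "refined T Z e d" and s: "0 \<le> s" "s \<le> t" "t \<le> T" "t - s < d" and z: "z \<in> Z"
  shows "norm (\<Xi> z s t - riemann n z s t) \<le> e * (growth t - growth s)"
proof -
  define p where "p = (\<lambda>k::nat. clip s t (real k / 2 ^ n))"
  have m: "mono p" unfolding p_def by (intro monoI clip_mono divide_right_mono) auto
  have p0: "p 0 = s" using s by (auto simp: p_def clip_def)
  have pK: "p (nat \<lceil>t\<rceil> * 2 ^ n) = t" using grid_end[of t n, OF order_refl] s by (auto simp: p_def clip_def)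
  have "norm (\<Xi> z (p 0) (p (nat \<lceil>t\<rceil> * 2 ^ n)) - (\<Sum>i<nat \<lceil>t\<rceil> * 2 ^ n. \<Xi> z (p i) (p (Suc i)))) \<le> e * (growth (p (nat \<lceil>t\<rceil> * 2 ^ n)) - growth (p 0))"
    by (rule refinedD[OF r m]) (use p0 pK s z in auto)
  thus ?thesis unfolding p0 pK by (simp add: riemann_def p_def)
qed

lemma telescope_clip:
  assumes "0 \<le> s" "s \<le> t" "t \<le> real K / 2 ^ n"
  shows "(\<Sum>k<K. e * (growth (clip s t (real (Suc k) / 2 ^ n)) - growth (clip s t (real k / 2 ^ n)))) = e * (growth t - growth s)"
proof -
  have "clip s t (real K / 2 ^ n) = t" "clip s t (real 0 / 2 ^ n) = s" using assms by (auto simp: clip_def)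
  thus ?thesis unfolding sum_distrib_left[symmetric] sum_lessThan_telescope[of "\<lambda>k. growth (clip s t (real k / 2 ^ n))"] by simp
qed

text \<open>Each interval of the coarser grid is refined separately, and the errors telescope.\<close>

lemma riemann_cauchy:
  assumes T: "T \<in> I" and Z: "Z \<subseteq> upper_half_plane" and r: "refined T Z e d" and n: "1 / 2 ^ n < d"
    and s: "0 \<le> s" "s \<le> t" "t \<le> T" and z: "z \<in> Z"
  shows "norm (riemann n z s t - riemann (n + j) z s t) \<le> e * (growth t - growth s)"
proof -
  define K where "K = nat \<lceil>t\<rceil> * 2 ^ n"
  define X where "X = (\<lambda>i. \<Xi> z (clip s t (real i / 2 ^ (n + j))) (clip s t (real (Suc i) / 2 ^ (n + j))))"
  have "riemann (n + j) z s t = (\<Sum>i<K * 2 ^ j. X i)" by (simp add: riemann_def X_def K_def power_add mult.assoc)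
  also have "\<dots> = (\<Sum>k<K. sum X {k * 2 ^ j..<k * 2 ^ j + 2 ^ j})" by (rule sum.nat_group[symmetric])
  finally have S2: "riemann (n + j) z s t = (\<Sum>k<K. \<Sum>i<2 ^ j. X (i + k * 2 ^ j))"
    using sum.shift_bounds_nat_ivl[of X 0 "k * 2 ^ j" "2 ^ j" for k]
    by (simp add: add.commute atLeast0LessThan)
  have E: "riemann n z s t - riemann (n + j) z s t =
    (\<Sum>k<K. \<Xi> z (clip s t (real k / 2 ^ n)) (clip s t (real (Suc k) / 2 ^ n)) - (\<Sum>i<2 ^ j. X (i + k * 2 ^ j)))"
    unfolding S2 by (simp add: riemann_def K_def sum_subtractf)
  have "norm (riemann n z s t - riemann (n + j) z s t) \<le> (\<Sum>k<K. e * (growth (clip s t (real (Suc k) / 2 ^ n)) - growth (clip s t (real k / 2 ^ n))))"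
    unfolding E
  proof (rule sum_norm_le)
    fix k
    define p where "p = (\<lambda>i::nat. clip s t (real (i + k * 2 ^ j) / 2 ^ (n + j)))"
    have m: "mono p" unfolding p_def by (intro monoI clip_mono divide_right_mono) auto
    have p0: "p 0 = clip s t (real k / 2 ^ n)" by (simp add: p_def power_add)
    have "real (2 ^ j + k * 2 ^ j) / 2 ^ (n + j) = real (Suc k) / 2 ^ n"
      by (simp add: power_add field_simps)
    hence pj: "p (2 ^ j) = clip s t (real (Suc k) / 2 ^ n)" by (simp only: p_def)
    have "norm (\<Xi> z (p 0) (p (2 ^ j)) - (\<Sum>i<2 ^ j. \<Xi> z (p i) (p (Suc i)))) \<le> e * (growth (p (2 ^ j)) - growth (p 0))"
    proof (rule refinedD[OF r m _ _ _ z])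
      show "0 \<le> p 0" "p (2 ^ j) \<le> T" using clip_range[OF s(2)] s unfolding p_def by (force intro: order_trans)+
      have "p (2 ^ j) - p 0 \<le> real (Suc k) / 2 ^ n - real k / 2 ^ n"
        unfolding p0 pj by (rule clip_diff) (simp add: divide_right_mono)
      also have "\<dots> = 1 / 2 ^ n" by (simp add: field_simps)
      finally show "p (2 ^ j) - p 0 < d" using n by simp
    qed
    moreover have "\<Xi> z (p i) (p (Suc i)) = X (i + k * 2 ^ j)" for i by (simp add: p_def X_def add.assoc)
    ultimately show "norm (\<Xi> z (clip s t (real k / 2 ^ n)) (clip s t (real (Suc k) / 2 ^ n)) - (\<Sum>i<2 ^ j. X (i + k * 2 ^ j)))
      \<le> e * (growth (clip s t (real (Suc k) / 2 ^ n)) - growth (clip s t (real k / 2 ^ n)))" by (simp add: p0 pj)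
  qed
  thus ?thesis by (subst (asm) telescope_clip[OF s(1,2)]) (use grid_end[of t n K] in \<open>simp_all add: K_def\<close>)
qed

text \<open>The three sums differ only in the one grid interval that contains \<open>t\<close>, and there the error is controlled by refining this
interval at \<open>t\<close>; the telescoping bound over all intervals avoids singling it out.\<close>

lemma riemann_additive:
  assumes T: "T \<in> I" and Z: "Z \<subseteq> upper_half_plane" and r: "refined T Z e d" and n: "1 / 2 ^ n < d" and e: "0 < e"
    and s: "0 \<le> s" "s \<le> t" "t \<le> u" "u \<le> T" and z: "z \<in> Z"
  shows "norm (riemann n z s u - riemann n z s t - riemann n z t u) \<le> e * (growth u - growth s)"
proof -
  have zp: "0 < Im z" using z Z by (auto simp: upper_half_plane_def)
  have I: "t \<in> I" "u \<in> I" using I_down[OF T] s by auto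
  define K where "K = nat \<lceil>u\<rceil> * 2 ^ n"
  have "nat \<lceil>t\<rceil> * 2 ^ n \<le> K" using s unfolding K_def by (intro mult_right_mono nat_mono ceiling_mono) auto
  hence S1: "riemann n z s t = (\<Sum>k<K. \<Xi> z (clip s t (real k / 2 ^ n)) (clip s t (real (Suc k) / 2 ^ n)))"
    using riemann_extend[OF I(1) s(1,2) zp] by blast
  have E: "riemann n z s u - riemann n z s t - riemann n z t u = (\<Sum>k<K. \<Xi> z (clip s u (real k / 2 ^ n)) (clip s u (real (Suc k) / 2 ^ n))
     - \<Xi> z (clip s t (real k / 2 ^ n)) (clip s t (real (Suc k) / 2 ^ n)) - \<Xi> z (clip t u (real k / 2 ^ n)) (clip t u (real (Suc k) / 2 ^ n)))"
    unfolding S1 by (simp add: riemann_def K_def sum_subtractf)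
  have "norm (riemann n z s u - riemann n z s t - riemann n z t u) \<le> (\<Sum>k<K. e * (growth (clip s u (real (Suc k) / 2 ^ n)) - growth (clip s u (real k / 2 ^ n))))"
    unfolding E
  proof (rule sum_norm_le)
    fix k
    define a where "a = real k / 2 ^ n"
    define b where "b = real (Suc k) / 2 ^ n"
    have ab: "a \<le> b" "b - a < d" using n by (auto simp: a_def b_def field_simps)
    have su: "s \<le> u" using s by simp
    have hm: "growth (clip s u a) \<le> growth (clip s u b)"
      using clip_range[OF su, of a] clip_range[OF su, of b] clip_mono[OF ab(1), of s u] s I_down[OF T, of "clip s u b"]
      by (intro growth_mono) auto
    have rf: "\<Xi> z x x = 0" if "x \<in> {0..T}" for x using \<Xi>_refl[OF I_down[OF T] zp] that by auto
    consider "b \<le> t" | "t \<le> a" | "a < t" "t < b" by linarith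
    hence "norm (\<Xi> z (clip s u a) (clip s u b) - \<Xi> z (clip s t a) (clip s t b) - \<Xi> z (clip t u a) (clip t u b)) \<le> e * (growth (clip s u b) - growth (clip s u a))"
    proof cases
      case 1
      hence "clip s u a = clip s t a" "clip s u b = clip s t b" "clip t u a = t" "clip t u b = t" using ab s by (auto simp: clip_def)
      thus ?thesis using hm e rf[of t] s by simp
    next
      case 2
      hence "clip s u a = clip t u a" "clip s u b = clip t u b" "clip s t a = t" "clip s t b = t" using ab s by (auto simp: clip_def)
      thus ?thesis using hm e rf[of t] s by simp
    next
      case 3
      define p where "p = (\<lambda>i::nat. if i = 0 then clip s u a else if i = 1 then t else clip s u b)"
      have c: "clip s t a = clip s u a" "clip s t b = t" "clip t u a = t" "clip t u b = clip s u b"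
        "clip s u a \<le> t" "t \<le> clip s u b" using 3 s by (auto simp: clip_def)
      have m: "mono p" using c clip_mono[OF ab(1), of s u] by (intro monoI) (auto simp: p_def)
      have "norm (\<Xi> z (p 0) (p 2) - (\<Sum>i<2. \<Xi> z (p i) (p (Suc i)))) \<le> e * (growth (p 2) - growth (p 0))"
        by (rule refinedD[OF r m _ _ _ z])
          (use clip_range[OF su, of a] clip_range[OF su, of b] clip_diff[OF ab(1), of s u] ab s in \<open>auto simp: p_def\<close>)
      thus ?thesis using c by (simp add: p_def numeral_2_eq_2 algebra_simps)
    qed
    thus "norm (\<Xi> z (clip s u (real k / 2 ^ n)) (clip s u (real (Suc k) / 2 ^ n))
     - \<Xi> z (clip s t (real k / 2 ^ n)) (clip s t (real (Suc k) / 2 ^ n)) - \<Xi> z (clip t u (real k / 2 ^ n)) (clip t u (real (Suc k) / 2 ^ n)))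
     \<le> e * (growth (clip s u (real (Suc k) / 2 ^ n)) - growth (clip s u (real k / 2 ^ n)))" unfolding a_def b_def .
  qed
  also have "(\<Sum>k<K. e * (growth (clip s u (real (Suc k) / 2 ^ n)) - growth (clip s u (real k / 2 ^ n)))) = e * (growth u - growth s)"
    by (rule telescope_clip) (use s grid_end[of u n K] in \<open>auto simp: K_def\<close>)
  finally show ?thesis .
qed

definition sewn :: "complex \<Rightarrow> real \<Rightarrow> real \<Rightarrow> complex" where "sewn z s t = lim (\<lambda>n. riemann n z s t)"

lemma fine_level: assumes "0 < (d::real)" obtains n0 where "\<And>n::nat. n0 \<le> n \<Longrightarrow> 1 / 2 ^ n < d"
proof -
  have "(\<lambda>n. (1 / 2 :: real) ^ n) \<longlonglongrightarrow> 0" by (rule LIMSEQ_power_zero) simp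
  from order_tendstoD(2)[OF this assms] show ?thesis
    using that by (auto simp: eventually_sequentially power_one_over)
qed

lemma riemann_tendsto:
  assumes t: "t \<in> I" "0 \<le> s" "s \<le> t" and z: "0 < Im z"
  shows "(\<lambda>n. riemann n z s t) \<longlonglongrightarrow> sewn z s t"
proof -
  have "Cauchy (\<lambda>n. riemann n z s t)"
  proof (rule CauchyI')
    fix e :: real assume e: "0 < e"
    define e' where "e' = e / (growth t - growth s + 1)"
    have hh: "growth s \<le> growth t" by (rule growth_mono[OF t])
    have e': "0 < e'" using e hh by (simp add: e'_def)
    obtain d where d: "refined t {z} e' d"
      using refined_exists[OF t(1), of "{z}" e'] z e' by (auto simp: upper_half_plane_def)
    have d0: "0 < d" using d by (simp add: refined_def)
    obtain n0 where n0: "\<And>n::nat. n0 \<le> n \<Longrightarrow> 1 / 2 ^ n < d" using fine_level[OF d0] by blast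
    show "\<exists>M. \<forall>m\<ge>M. \<forall>n>m. dist (riemann m z s t) (riemann n z s t) < e"
    proof (intro exI[of _ n0] allI impI)
      fix m n :: nat assume mn: "n0 \<le> m" "m < n"
      have "norm (riemann m z s t - riemann (m + (n - m)) z s t) \<le> e' * (growth t - growth s)"
        by (rule riemann_cauchy[OF t(1) _ d n0]) (use mn t z in \<open>auto simp: upper_half_plane_def\<close>)
      also have "\<dots> < e' * (growth t - growth s + 1)" using e' by (intro mult_strict_left_mono) auto
      also have "\<dots> = e" using hh by (simp add: e'_def)
      finally show "dist (riemann m z s t) (riemann n z s t) < e" using mn by (simp add: dist_norm)
    qed
  qed
  thus ?thesis unfolding sewn_def by (intro convergent_LIMSEQ_iff[THEN iffD1] Cauchy_convergent)
qed

lemma sewn_near_riemann: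
  assumes T: "T \<in> I" and Z: "Z \<subseteq> upper_half_plane" and r: "refined T Z e d" and n: "1 / 2 ^ n < d"
    and s: "0 \<le> s" "s \<le> t" "t \<le> T" and z: "z \<in> Z"
  shows "norm (riemann n z s t - sewn z s t) \<le> e * (growth t - growth s)"
proof -
  have tI: "t \<in> I" using I_down[OF T] s by auto
  have zp: "0 < Im z" using z Z by (auto simp: upper_half_plane_def)
  have "(\<lambda>j. norm (riemann n z s t - riemann (j + n) z s t)) \<longlonglongrightarrow> norm (riemann n z s t - sewn z s t)"
    by (intro tendsto_intros LIMSEQ_ignore_initial_segment riemann_tendsto[OF tI s(1,2) zp])
  moreover have "\<forall>j\<ge>0. norm (riemann n z s t - riemann (j + n) z s t) \<le> e * (growth t - growth s)"
    using riemann_cauchy[OF T Z r n s z] by (simp add: add.commute)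
  ultimately show ?thesis by (rule Lim_bounded)
qed

lemma sewn_near_\<Xi>:
  assumes T: "T \<in> I" and Z: "compact Z" "Z \<subseteq> upper_half_plane" and e: "0 < e"
  obtains d where "0 < d" "\<And>s t z. 0 \<le> s \<Longrightarrow> s \<le> t \<Longrightarrow> t \<le> T \<Longrightarrow> t - s < d \<Longrightarrow> z \<in> Z \<Longrightarrow>
    norm (\<Xi> z s t - sewn z s t) \<le> e * (growth t - growth s)"
proof -
  obtain d where d: "refined T Z (e / 2) d" using refined_exists[OF T Z, of "e / 2"] e by auto
  have d0: "0 < d" using d by (simp add: refined_def)
  obtain n where n: "1 / 2 ^ n < d" using fine_level[OF d0] by blast
  show ?thesis
  proof (rule that[OF d0])
    fix s t z assume *: "0 \<le> s" "s \<le> t" "t \<le> T" "t - s < d" "z \<in> Z"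
    have "norm (\<Xi> z s t - riemann n z s t) \<le> e / 2 * (growth t - growth s)" "norm (riemann n z s t - sewn z s t) \<le> e / 2 * (growth t - growth s)"
      using riemann_near_\<Xi>[OF d *] sewn_near_riemann[OF T Z(2) d n *(1-3,5)] by auto
    thus "norm (\<Xi> z s t - sewn z s t) \<le> e * (growth t - growth s)"
      using norm_triangle_ineq[of "\<Xi> z s t - riemann n z s t" "riemann n z s t - sewn z s t"] by simp
  qed
qed

lemma sewn_add:
  assumes u: "u \<in> I" "0 \<le> s" "s \<le> t" "t \<le> u" and z: "0 < Im z"
  shows "sewn z s u = sewn z s t + sewn z t u"
proof -
  have I: "t \<in> I" "0 \<le> t" "s \<le> u" using I_down[OF u(1)] u by auto
  have "(\<lambda>n. riemann n z s u - riemann n z s t - riemann n z t u) \<longlonglongrightarrow> sewn z s u - sewn z s t - sewn z t u"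
    by (intro tendsto_intros riemann_tendsto I u z)
  moreover have "(\<lambda>n. riemann n z s u - riemann n z s t - riemann n z t u) \<longlonglongrightarrow> 0"
  proof (rule LIMSEQ_I)
    fix e :: real assume e: "0 < e"
    define e' where "e' = e / (growth u - growth s + 1)"
    have hh: "growth s \<le> growth u" by (rule growth_mono) (use u in auto)
    have e': "0 < e'" using e hh by (simp add: e'_def)
    obtain d where d: "refined u {z} e' d"
      using refined_exists[OF u(1), of "{z}" e'] z e' by (auto simp: upper_half_plane_def)
    have d0: "0 < d" using d by (simp add: refined_def)
    obtain n0 where n0: "\<And>n::nat. n0 \<le> n \<Longrightarrow> 1 / 2 ^ n < d" using fine_level[OF d0] by blast
    show "\<exists>n0. \<forall>n\<ge>n0. norm (riemann n z s u - riemann n z s t - riemann n z t u - 0) < e"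
    proof (intro exI[of _ n0] allI impI)
      fix n assume n: "n0 \<le> n"
      have "norm (riemann n z s u - riemann n z s t - riemann n z t u) \<le> e' * (growth u - growth s)"
        by (rule riemann_additive[OF u(1) _ d n0[OF n] e']) (use u z in \<open>auto simp: upper_half_plane_def\<close>)
      also have "\<dots> < e' * (growth u - growth s + 1)" using e' by (intro mult_strict_left_mono) auto
      also have "\<dots> = e" using hh by (simp add: e'_def)
      finally show "norm (riemann n z s u - riemann n z s t - riemann n z t u - 0) < e" by simp
    qed
  qed
  ultimately have "sewn z s u - sewn z s t - sewn z t u = 0" by (rule LIMSEQ_unique)
  thus ?thesis by (simp add: algebra_simps)
qed

lemma \<Xi>_holomorphic: "t \<in> I \<Longrightarrow> 0 \<le> s \<Longrightarrow> s \<le> t \<Longrightarrow> (\<lambda>z. \<Xi> z s t) holomorphic_on upper_half_plane"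
  unfolding \<Xi>_def by (intro holomorphic_intros \<phi>_hol)

lemma riemann_holomorphic: assumes "t \<in> I" "0 \<le> s" "s \<le> t" shows "(\<lambda>z. riemann n z s t) holomorphic_on upper_half_plane"
  unfolding riemann_def
proof (rule holomorphic_on_sum)
  fix k
  have "real k / 2 ^ n \<le> real (Suc k) / 2 ^ n" by (intro divide_right_mono) auto
  thus "(\<lambda>z. \<Xi> z (clip s t (real k / 2 ^ n)) (clip s t (real (Suc k) / 2 ^ n))) holomorphic_on upper_half_plane"
    using clip_range[OF assms(3), of "real k / 2 ^ n"] clip_range[OF assms(3), of "real (Suc k) / 2 ^ n"] assms(2)
    by (intro \<Xi>_holomorphic clip_mono I_down[OF assms(1)]) auto
qed

lemma sewn_holomorphic: assumes t: "t \<in> I" "0 \<le> s" "s \<le> t" shows "(\<lambda>z. sewn z s t) holomorphic_on upper_half_plane"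
proof (rule holomorphic_uniform_sequence[OF open_uhp riemann_holomorphic[OF t]])
  fix x assume "x \<in> upper_half_plane"
  then obtain r where r: "0 < r" "cball x r \<subseteq> upper_half_plane" using open_uhp by (meson open_contains_cball)
  have "uniform_limit (cball x r) (\<lambda>n z. riemann n z s t) (\<lambda>z. sewn z s t) sequentially"
  proof (rule uniform_limitI)
    fix e :: real assume e: "0 < e"
    define e' where "e' = e / (growth t - growth s + 1)"
    have hh: "growth s \<le> growth t" by (rule growth_mono[OF t])
    have e': "0 < e'" using e hh by (simp add: e'_def)
    obtain d where d: "refined t (cball x r) e' d" using refined_exists[OF t(1) compact_cball r(2) e'] by blast
    have d0: "0 < d" using d by (simp add: refined_def)
    obtain n0 where n0: "\<And>n::nat. n0 \<le> n \<Longrightarrow> 1 / 2 ^ n < d" using fine_level[OF d0] by blast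
    have "norm (riemann n z s t - sewn z s t) < e" if "n0 \<le> n" "z \<in> cball x r" for n z
    proof -
      have "norm (riemann n z s t - sewn z s t) \<le> e' * (growth t - growth s)"
        by (rule sewn_near_riemann[OF t(1) r(2) d n0[OF that(1)]]) (use t that in auto)
      also have "\<dots> < e' * (growth t - growth s + 1)" using e' by (intro mult_strict_left_mono) auto
      also have "\<dots> = e" using hh by (simp add: e'_def)
      finally show ?thesis .
    qed
    thus "\<forall>\<^sub>F n in sequentially. \<forall>z\<in>cball x r. dist (riemann n z s t) (sewn z s t) < e"
      unfolding eventually_sequentially dist_norm by blast
  qed
  thus "\<exists>d>0. cball x d \<subseteq> upper_half_plane \<and> uniform_limit (cball x d) (\<lambda>n z. riemann n z s t) (\<lambda>z. sewn z s t) sequentially"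
    using r by blast
qed

lemma Im_\<Xi>_nonneg: assumes "t \<in> I" "0 \<le> s" "s \<le> t" "0 < Im z" shows "0 \<le> Im (\<Xi> z s t)"
  unfolding \<rho>(2)[OF assms] by (rule fin_borel.Im_nev_transform_nonneg[OF \<rho>(1)[OF assms(1-3)] assms(4)])

lemma Im_f_nonneg: assumes t: "t \<in> I" "0 \<le> s" "s \<le> t" and z: "0 < Im z" shows "0 \<le> Im (sewn z s t)"
proof (rule LIMSEQ_le_const[OF tendsto_Im[OF riemann_tendsto[OF t z]]])
  have "0 \<le> Im (riemann n z s t)" for n
    unfolding riemann_def Im_sum
  proof (rule sum_nonneg)
    fix k
    have "real k / 2 ^ n \<le> real (Suc k) / 2 ^ n" by (intro divide_right_mono) auto
    thus "0 \<le> Im (\<Xi> z (clip s t (real k / 2 ^ n)) (clip s t (real (Suc k) / 2 ^ n)))"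
      using clip_range[OF t(3), of "real k / 2 ^ n"] clip_range[OF t(3), of "real (Suc k) / 2 ^ n"] t(2)
      by (intro Im_\<Xi>_nonneg clip_mono z I_down[OF t(1)]) auto
  qed
  thus "\<exists>N. \<forall>n\<ge>N. 0 \<le> Im (riemann n z s t)" by blast
qed

lemma Re_f_i: assumes t: "t \<in> I" "0 \<le> s" "s \<le> t" shows "Re (sewn \<i> s t) = 0"
proof -
  have "Re (riemann n \<i> s t) = 0" for n by (simp add: riemann_def Re_sum \<Xi>_def)
  hence "(\<lambda>n. Re (riemann n \<i> s t)) \<longlonglongrightarrow> 0" by simp
  thus ?thesis using LIMSEQ_unique[OF tendsto_Re[OF riemann_tendsto[OF t]]] by simp
qed

text \<open>The constant term vanishes because the kernel is imaginary at \<open>\<i>\<close>.\<close>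

lemma sewn_nevanlinna:
  assumes t: "t \<in> I" "0 \<le> s" "s \<le> t"
  obtains c \<nu> where "0 \<le> c" "fin_borel \<nu>" "\<And>z. 0 < Im z \<Longrightarrow> sewn z s t = of_real c * z + nev_transform \<nu> z"
proof -
  obtain a c \<nu> where r: "0 \<le> c" "fin_borel \<nu>" "\<And>z. 0 < Im z \<Longrightarrow> sewn z s t = complex_of_real a + of_real c * z + nev_transform \<nu> z"
    by (rule nevanlinna_representation[OF sewn_holomorphic[OF t] Im_f_nonneg[OF t]]) (assumption, rule that)
  have "a = 0" using r(3)[of \<i>] Re_f_i[OF t] fin_borel.nev_transform_i[OF r(2)] by simp
  thus ?thesis using r that by simp
qed

text \<open>The coefficient of the linear term of the Nevanlinna representation, that is the mass that escapes to infinity in space.\<close>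

definition slope :: "real \<Rightarrow> real \<Rightarrow> real" where
  "slope s t = Re (Lim at_top (\<lambda>y. sewn (\<i> * of_real y) s t / (\<i> * of_real y)))"

lemma slope_eq:
  assumes "fin_borel \<nu>" "\<And>z. 0 < Im z \<Longrightarrow> sewn z s t = of_real k * z + nev_transform \<nu> z" shows "slope s t = k"
proof -
  have "((\<lambda>y. sewn (\<i> * of_real y) s t / (\<i> * of_real y)) \<longlongrightarrow> of_real k) at_top"
    by (rule nevanlinna_slope[OF assms(1), of _ 0]) (simp add: assms(2))
  hence "Lim at_top (\<lambda>y. sewn (\<i> * of_real y) s t / (\<i> * of_real y)) = of_real k" by (intro tendsto_Lim) auto
  thus ?thesis by (simp add: slope_def)
qed

lemma slope_facts: assumes t: "t \<in> I" "0 \<le> s" "s \<le> t"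
  shows "0 \<le> slope s t" "((\<lambda>y. sewn (\<i> * of_real y) s t / (\<i> * of_real y)) \<longlongrightarrow> of_real (slope s t)) at_top"
    "\<And>z. 0 < Im z \<Longrightarrow> slope s t * Im z \<le> Im (sewn z s t)"
proof -
  obtain k \<nu> where r: "0 \<le> k" "fin_borel \<nu>" "\<And>z. 0 < Im z \<Longrightarrow> sewn z s t = of_real k * z + nev_transform \<nu> z"
    by (rule sewn_nevanlinna[OF t]) (rule that)
  have k: "slope s t = k" by (rule slope_eq[OF r(2,3)])
  show "0 \<le> slope s t" using r k by simp
  show "((\<lambda>y. sewn (\<i> * of_real y) s t / (\<i> * of_real y)) \<longlongrightarrow> of_real (slope s t)) at_top"
    unfolding k by (rule nevanlinna_slope[OF r(2), of _ 0]) (simp add: r(3))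
  fix z assume z: "0 < Im z"
  show "slope s t * Im z \<le> Im (sewn z s t)" using r(3)[OF z] k fin_borel.Im_nev_transform_nonneg[OF r(2) z] by simp
qed

lemma slope_add: assumes u: "u \<in> I" "0 \<le> s" "s \<le> t" "t \<le> u" shows "slope s u = slope s t + slope t u"
proof -
  have I: "t \<in> I" "0 \<le> t" "s \<le> u" using I_down[OF u(1)] u by auto
  have "((\<lambda>y. sewn (\<i> * of_real y) s t / (\<i> * of_real y) + sewn (\<i> * of_real y) t u / (\<i> * of_real y)) \<longlongrightarrow> of_real (slope s t) + of_real (slope t u)) at_top"
    by (intro tendsto_add slope_facts I u)
  moreover have "\<forall>\<^sub>F y in at_top. sewn (\<i> * of_real y) s t / (\<i> * of_real y) + sewn (\<i> * of_real y) t u / (\<i> * of_real y) = sewn (\<i> * of_real y) s u / (\<i> * of_real y)"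
    using eventually_gt_at_top[of 0] by eventually_elim (simp add: sewn_add[OF u] add_divide_distrib)
  ultimately have "((\<lambda>y. sewn (\<i> * of_real y) s u / (\<i> * of_real y)) \<longlongrightarrow> of_real (slope s t) + of_real (slope t u)) at_top"
    by (rule Lim_transform_eventually)
  from tendsto_unique[OF _ slope_facts(2)[OF u(1,2) I(3)] this]
  have "complex_of_real (slope s u) = of_real (slope s t + slope t u)" by simp
  thus ?thesis by (simp only: of_real_eq_iff)
qed

lemma Im_\<phi>_ge: assumes t: "t \<in> I" "0 \<le> s" "s \<le> t" and z: "0 < Im z" shows "Im z \<le> Im (\<phi> s t z)"
  using Im_\<Xi>_nonneg[OF assms] by (simp add: \<Xi>_def)

text \<open>Along the curve from \<open>\<i> * y\<close> the linear term contributes at least \<open>slope 0 T * y\<close> to the imaginary part.  After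
division by \<open>y\<close> this contradicts the slope 1 of \<open>\<phi> 0 T\<close> at infinity unless \<open>slope 0 T\<close> vanishes.\<close>

lemma slope_zero_from_0: assumes T: "T \<in> I" shows "slope 0 T = 0"
proof -
  have T0: "0 \<le> T" using I_nonneg[OF T] .
  have key: "1 + slope 0 T \<le> Im (\<phi> 0 T (\<i> * of_real y)) / y" if y: "0 < y" for y
  proof -
    let ?z = "\<i> * complex_of_real y"
    define Z where "Z = (\<lambda>t. \<phi> 0 t ?z) ` {0..T}"
    have z: "0 < Im ?z" using y by simp
    have Z: "compact Z" "Z \<subseteq> upper_half_plane"
      using \<phi>_time_continuous[OF T order_refl z] \<phi>_pos[OF I_down[OF T]] y unfolding Z_def
      by (auto intro!: compact_continuous_image simp: upper_half_plane_def)
    define D where "D = (\<lambda>t. Im (\<phi> 0 t ?z) - slope 0 t * y)"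
    have "D 0 \<le> D T"
    proof (rule increments_nonneg[OF T0, of growth])
      show "growth 0 \<le> growth T" by (rule growth_mono[OF T order_refl T0])
      fix e :: real assume e: "0 < e"
      obtain d where d: "0 < d" "\<And>s t z. 0 \<le> s \<Longrightarrow> s \<le> t \<Longrightarrow> t \<le> T \<Longrightarrow> t - s < d \<Longrightarrow> z \<in> Z \<Longrightarrow>
        norm (\<Xi> z s t - sewn z s t) \<le> e * (growth t - growth s)" using sewn_near_\<Xi>[OF T Z e] by blast
      show "\<exists>d>0. \<forall>s t. 0 \<le> s \<and> s \<le> t \<and> t \<le> T \<and> t - s < d \<longrightarrow> - e * (growth t - growth s) \<le> D t - D s"
      proof (intro exI[of _ d] conjI allI impI)
        fix s t assume "0 \<le> s \<and> s \<le> t \<and> t \<le> T \<and> t - s < d"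
        hence st: "0 \<le> s" "s \<le> t" "t \<le> T" "t - s < d" by auto
        have tI: "t \<in> I" and sI: "s \<in> I" using I_down[OF T] st by auto
        define w where "w = \<phi> 0 s ?z"
        have w: "w \<in> Z" "y \<le> Im w" using st Im_\<phi>_ge[OF sI order_refl st(1) z] y by (auto simp: w_def Z_def)
        have "\<bar>Im (\<Xi> w s t - sewn w s t)\<bar> \<le> e * (growth t - growth s)"
          using d(2)[OF st w(1)] abs_Im_le_cmod order_trans by blast
        moreover have "slope s t * y \<le> slope s t * Im w" using slope_facts(1)[OF tI st(1,2)] w by (intro mult_left_mono)
        moreover have "slope s t * Im w \<le> Im (sewn w s t)" by (rule slope_facts(3)[OF tI st(1,2)]) (use w y in linarith)
        moreover have "Im (\<phi> 0 t ?z) - Im (\<phi> 0 s ?z) = Im (\<Xi> w s t)"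
          using arg_cong[OF \<phi>_step[OF tI order_refl st(1,2) z], of Im] by (simp add: w_def)
        moreover have "slope 0 t = slope 0 s + slope s t" by (rule slope_add[OF tI order_refl st(1,2)])
        ultimately show "- e * (growth t - growth s) \<le> D t - D s" by (simp add: D_def algebra_simps)
      qed (rule d)
    qed
    moreover have "D 0 = y"
      using \<phi>_refl[OF I0 z] slope_add[OF I0 order_refl order_refl order_refl] by (simp add: D_def)
    ultimately have "(1 + slope 0 T) * y \<le> Im (\<phi> 0 T ?z)" by (simp add: D_def algebra_simps)
    thus ?thesis using y by (simp add: pos_le_divide_eq)
  qed
  have "((\<lambda>y. Re (\<phi> 0 T (\<i> * of_real y) / (\<i> * of_real y))) \<longlongrightarrow> Re 1) at_top"
    by (intro tendsto_Re class_P_slope \<phi>_P[OF T order_refl T0])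
  moreover have "\<forall>\<^sub>F y in at_top. 1 + slope 0 T \<le> Re (\<phi> 0 T (\<i> * of_real y) / (\<i> * of_real y))"
    using eventually_gt_at_top[of 0]
  proof eventually_elim
    case (elim y)
    have "Re (\<phi> 0 T (\<i> * of_real y) / (\<i> * of_real y)) = Im (\<phi> 0 T (\<i> * of_real y)) / y"
      using elim by (simp add: Re_divide power2_eq_square)
    thus ?case using key[OF elim] by simp
  qed
  ultimately have "1 + slope 0 T \<le> Re 1" by (rule tendsto_lowerbound) simp
  thus ?thesis using slope_facts(1)[OF T order_refl T0] by simp
qed

definition \<nu> :: "real \<Rightarrow> real \<Rightarrow> real measure" where
  "\<nu> s t = (SOME \<nu>. fin_borel \<nu> \<and> (\<forall>z. 0 < Im z \<longrightarrow> sewn z s t = nev_transform \<nu> z))"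

lemma \<nu>:
  assumes t: "t \<in> I" "0 \<le> s" "s \<le> t"
  shows "fin_borel (\<nu> s t)" "0 < Im z \<Longrightarrow> sewn z s t = nev_transform (\<nu> s t) z"
proof -
  obtain k \<nu>' where r: "0 \<le> k" "fin_borel \<nu>'" "\<And>z. 0 < Im z \<Longrightarrow> sewn z s t = of_real k * z + nev_transform \<nu>' z"
    by (rule sewn_nevanlinna[OF t]) (rule that)
  have sI: "s \<in> I" using I_down[OF t(1)] t by auto
  have "slope 0 t = slope 0 s + slope s t" by (rule slope_add[OF t(1) order_refl t(2,3)])
  hence "slope s t = 0" using slope_zero_from_0[OF t(1)] slope_zero_from_0[OF sI] by simp
  hence "k = 0" using slope_eq[OF r(2,3)] by simp
  hence "fin_borel \<nu>' \<and> (\<forall>z. 0 < Im z \<longrightarrow> sewn z s t = nev_transform \<nu>' z)" using r by simp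
  hence "fin_borel (\<nu> s t) \<and> (\<forall>z. 0 < Im z \<longrightarrow> sewn z s t = nev_transform (\<nu> s t) z)" unfolding \<nu>_def by (rule someI)
  thus "fin_borel (\<nu> s t)" "0 < Im z \<Longrightarrow> sewn z s t = nev_transform (\<nu> s t) z" by auto
qed

end

section \<open>Measures on the plane from increasing families\<close>

text \<open>The sum of two measures, needed to turn additivity of transforms into additivity of measures.\<close>

lemma add_fin_borel:
  assumes "fin_borel \<mu>" "fin_borel \<nu>"
  obtains M where "fin_borel M" "\<And>A. A \<in> sets borel \<Longrightarrow> emeasure M A = emeasure \<mu> A + emeasure \<nu> A"
    "\<And>z. 0 < Im z \<Longrightarrow> nev_transform M z = nev_transform \<mu> z + nev_transform \<nu> z"
proof -
  interpret A: fin_borel \<mu> by fact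
  interpret B: fin_borel \<nu> by fact
  define M where "M = measure_of (UNIV :: real set) (sets borel) (\<lambda>A. emeasure \<mu> A + emeasure \<nu> A)"
  have sM [simp, measurable_cong]: "sets M = sets borel"
    unfolding M_def by (metis sets.sets_measure_of_eq space_borel)
  have em: "emeasure M A = emeasure \<mu> A + emeasure \<nu> A" if "A \<in> sets borel" for A
  proof -
    have "countably_additive (sets M) (\<lambda>A. emeasure \<mu> A + emeasure \<nu> A)"
    proof (rule countably_additiveI)
      fix F :: "nat \<Rightarrow> real set" assume F: "range F \<subseteq> sets M" "disjoint_family F"
      hence "range F \<subseteq> sets \<mu>" "range F \<subseteq> sets \<nu>" by auto
      thus "(\<Sum>i. emeasure \<mu> (F i) + emeasure \<nu> (F i)) = emeasure \<mu> (\<Union> (range F)) + emeasure \<nu> (\<Union> (range F))"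
        by (subst suminf_add[symmetric]) (auto simp: suminf_emeasure F)
    qed
    thus ?thesis
      by (intro emeasure_measure_of[OF M_def]) (use that in \<open>auto simp: positive_def\<close>)
  qed
  have spM: "space M = UNIV" using sets_eq_imp_space_eq[OF sM] by simp
  interpret M: fin_borel M
  proof (intro fin_borel.intro finite_measureI fin_borel_axioms.intro)
    have "emeasure M UNIV \<noteq> \<infinity>" using A.emeasure_finite[of UNIV] B.emeasure_finite[of UNIV] by (simp add: em)
    thus "emeasure M (space M) \<noteq> \<infinity>" by (simp add: spM)
  qed simp
  have nn: "(\<integral>\<^sup>+x. f x \<partial>M) = (\<integral>\<^sup>+x. f x \<partial>\<mu>) + (\<integral>\<^sup>+x. f x \<partial>\<nu>)" if "f \<in> borel_measurable borel" for f
    using that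
  proof (induction rule: borel_measurable_induct)
    case (cong f g) thus ?case by (simp cong: nn_integral_cong)
  next
    case (set A) thus ?case by (simp add: em)
  next
    case (mult u c)
    hence [measurable]: "u \<in> borel_measurable borel" by simp
    show ?case using mult by (simp add: nn_integral_cmult distrib_left)
  next
    case (add u v)
    hence [measurable]: "u \<in> borel_measurable borel" "v \<in> borel_measurable borel" by auto
    show ?case using add by (simp add: nn_integral_add algebra_simps)
  next
    case (seq U)
    hence [measurable]: "\<And>i. U i \<in> borel_measurable borel" by simp
    have inc: "incseq (\<lambda>i. integral\<^sup>N \<tau> (U i))" for \<tau>
      using seq(3) by (auto simp: incseq_def le_fun_def intro!: nn_integral_mono)
    have "(\<integral>\<^sup>+x. (SUP i. U i x) \<partial>\<tau>) = (SUP i. integral\<^sup>N \<tau> (U i))" if "fin_borel \<tau>" for \<tau>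
    proof -
      interpret T: fin_borel \<tau> by fact
      show ?thesis by (rule nn_integral_monotone_convergence_SUP[OF seq(3)]) simp
    qed
    note lim = this
    show ?case
      using lim[OF assms(1)] lim[OF assms(2)] lim[OF M.fin_borel_axioms] seq.IH
      by (simp add: image_image ennreal_SUP_add[OF inc inc])
  qed
  have re: "(LINT x|M. f x) = (LINT x|\<mu>. f x) + (LINT x|\<nu>. f x)"
    if [measurable]: "f \<in> borel_measurable borel" and b: "\<And>x. \<bar>f x\<bar> \<le> R" for f :: "real \<Rightarrow> real" and R
  proof -
    have pos: "0 \<le> f x + R" for x using b[of x] by linarith
    have i: "integrable \<tau> f" "(LINT x|\<tau>. f x) = enn2real (\<integral>\<^sup>+x. ennreal (f x + R) \<partial>\<tau>) - R * measure \<tau> UNIV" 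
      "(\<integral>\<^sup>+x. ennreal (f x + R) \<partial>\<tau>) < \<top>" if "fin_borel \<tau>" for \<tau>
    proof -
      interpret T: fin_borel \<tau> by fact
      show i: "integrable \<tau> f" by (rule T.integrable_const_bound[where B = R]) (use b in auto)
      have "(LINT x|\<tau>. f x + R) = enn2real (\<integral>\<^sup>+x. ennreal (f x + R) \<partial>\<tau>)"
        by (rule integral_eq_nn_integral) (use pos in auto)
      thus "(LINT x|\<tau>. f x) = enn2real (\<integral>\<^sup>+x. ennreal (f x + R) \<partial>\<tau>) - R * measure \<tau> UNIV"
        using i by (simp add: mult.commute)
      have "(\<integral>\<^sup>+x. ennreal (f x + R) \<partial>\<tau>) = ennreal (LINT x|\<tau>. f x + R)"
        by (rule nn_integral_eq_integral) (use i pos in auto)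
      thus "(\<integral>\<^sup>+x. ennreal (f x + R) \<partial>\<tau>) < \<top>" by simp
    qed
    have "measure M UNIV = measure \<mu> UNIV + measure \<nu> UNIV"
      using em[of UNIV] by (simp add: measure_def enn2real_plus less_top[symmetric])
    thus ?thesis unfolding i(2)[OF assms(1)] i(2)[OF assms(2)] i(2)[OF M.fin_borel_axioms]
      using nn[of "\<lambda>x. ennreal (f x + R)"] enn2real_plus[OF i(3)[OF assms(1)] i(3)[OF assms(2)]] by (simp add: algebra_simps)
  qed
  have "nev_transform M z = nev_transform \<mu> z + nev_transform \<nu> z" if z: "0 < Im z" for z
  proof -
    obtain R where R: "z \<in> region R" using in_some_region[OF z] by blast
    have b: "\<bar>Re (nev x z)\<bar> \<le> R" "\<bar>Im (nev x z)\<bar> \<le> R" for x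
      using norm_nev_le[OF R, of x] abs_Re_le_cmod[of "nev x z"] abs_Im_le_cmod[of "nev x z"] by linarith+
    show ?thesis
      unfolding complex_eq_iff nev_transform_def plus_complex.sel
        integral_Re[OF A.integrable_nev[OF z], symmetric] integral_Re[OF B.integrable_nev[OF z], symmetric] integral_Re[OF M.integrable_nev[OF z], symmetric]
        integral_Im[OF A.integrable_nev[OF z], symmetric] integral_Im[OF B.integrable_nev[OF z], symmetric] integral_Im[OF M.integrable_nev[OF z], symmetric]
      by (intro conjI re[of _ R] b) measurable
  qed
  thus ?thesis using that[OF M.fin_borel_axioms] em by blast
qed

lemma borel_rect_generator:
  "sets (borel :: (real \<times> real) measure) = sigma_sets UNIV {A \<times> {..t} |A t. A \<in> sets borel}"
proof -
  have "sets (borel \<Otimes>\<^sub>M borel :: (real \<times> real) measure) = sets (sigma (space borel \<times> space borel) {A \<times> B |A B. A \<in> sets borel \<and> B \<in> range (\<lambda>t::real. {..t})})"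
  proof (rule sets_pair_eq[where Ca = "{UNIV}" and Cb = "(\<lambda>n::nat. {..real n}) ` UNIV"])
    show "sets (borel :: real measure) = sigma_sets (space borel) (sets borel)" using sets.sigma_sets_eq[of "borel :: real measure"] by simp
    show "sets (borel :: real measure) = sigma_sets (space borel) (range (\<lambda>t. {..t}))"
      by (subst borel_eq_atMost) simp
    show "\<Union> ((\<lambda>n::nat. {..real n}) ` UNIV) = space (borel :: real measure)" using real_arch_simple by auto
  qed auto
  also have "\<dots> = sigma_sets UNIV {A \<times> {..t} |A t. A \<in> sets borel}"
    by (subst sets_measure_of) (auto intro!: arg_cong[where f = "sigma_sets UNIV"])
  finally show ?thesis unfolding borel_prod .
qed

lemma rect_unique:
  fixes M N :: "(real \<times> real) measure"
  assumes "finite_measure M" "sets M = sets borel" "sets N = sets borel"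
    and eq: "\<And>A t. A \<in> sets borel \<Longrightarrow> emeasure M (A \<times> {..t}) = emeasure N (A \<times> {..t})"
  shows "M = N"
proof (rule measure_eqI_generator_eq[where \<Omega> = UNIV and E = "{A \<times> {..t} |A t. A \<in> sets borel}" and A = "\<lambda>n::nat. UNIV \<times> {..real n}"])
  interpret finite_measure M by fact
  show "Int_stable {A \<times> {..t::real} |A t. A \<in> sets (borel :: real measure)}"
  proof (rule Int_stableI)
    fix a b :: "(real \<times> real) set" assume "a \<in> {A \<times> {..t::real} |A t. A \<in> sets (borel :: real measure)}" "b \<in> {A \<times> {..t} |A t. A \<in> sets (borel :: real measure)}"
    then obtain A B :: "real set" and s t :: real where "a = A \<times> {..s}" "b = B \<times> {..t}" "A \<in> sets borel" "B \<in> sets borel" by auto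
    moreover have "A \<times> {..s} \<inter> B \<times> {..t} = (A \<inter> B) \<times> {..min s t}" by auto
    ultimately show "a \<inter> b \<in> {A \<times> {..t} |A t. A \<in> sets (borel :: real measure)}" by blast
  qed
  show "(\<Union>n::nat. UNIV \<times> {..real n}) = (UNIV :: (real \<times> real) set)" using real_arch_simple by auto
  show "emeasure M (UNIV \<times> {..real n}) \<noteq> \<infinity>" for n by simp
qed (use assms borel_rect_generator in auto)

text \<open>On the set where \<open>f\<close> exceeds \<open>g\<close> both densities have the same finite integral, so this set is null.\<close>

lemma density_le_AE:
  assumes "finite_measure M" and [measurable]: "f \<in> borel_measurable M" "g \<in> borel_measurable M"
    and le: "\<And>A. A \<in> sets M \<Longrightarrow> emeasure (density M f) A \<le> emeasure (density M g) A"
    and fin: "emeasure (density M g) (space M) < \<infinity>"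
  shows "AE x in M. f x \<le> g x"
proof -
  define B where "B = {x \<in> space M. g x < f x}"
  have B [measurable]: "B \<in> sets M" unfolding B_def by measurable
  have gB: "(\<integral>\<^sup>+x. g x * indicator B x \<partial>M) < \<infinity>"
    using fin emeasure_mono[of B "space M" "density M g"] B sets.sets_into_space[OF B] by (auto simp: emeasure_density intro: le_less_trans)
  have fg: "(\<integral>\<^sup>+x. f x * indicator B x \<partial>M) \<le> (\<integral>\<^sup>+x. g x * indicator B x \<partial>M)"
    using le[OF B] by (simp add: emeasure_density)
  have "(\<integral>\<^sup>+x. f x * indicator B x - g x * indicator B x \<partial>M) = (\<integral>\<^sup>+x. f x * indicator B x \<partial>M) - (\<integral>\<^sup>+x. g x * indicator B x \<partial>M)"
    by (rule nn_integral_diff) (use gB in \<open>auto simp: B_def indicator_def intro!: AE_I2\<close>)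
  also have "\<dots> = 0" using fg le_less_trans[OF fg gB] by (simp add: diff_eq_0_iff_ennreal)
  finally have "AE x in M. f x * indicator B x - g x * indicator B x = 0"
    by (subst (asm) nn_integral_0_iff_AE) auto
  moreover have "AE x in M. x \<in> space M" by (rule AE_space)
  ultimately show ?thesis
  proof eventually_elim
    case (elim x)
    show ?case
    proof (rule ccontr)
      assume "\<not> f x \<le> g x"
      hence "g x < f x" "x \<in> B" using elim by (auto simp: B_def)
      with elim show False by (auto simp: diff_eq_0_iff_ennreal)
    qed
  qed
qed

lemma increasing_measure_limit:
  fixes M :: "nat \<Rightarrow> 'a measure"
  assumes sets: "\<And>n. sets (M n) = sets K"
    and inc: "\<And>n A. A \<in> sets K \<Longrightarrow> emeasure (M n) A \<le> emeasure (M (Suc n)) A"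
  obtains H where "sets H = sets K" "\<And>A. A \<in> sets K \<Longrightarrow> emeasure H A = (SUP n. emeasure (M n) A)"
proof -
  define H where "H = measure_of (space K) (sets K) (\<lambda>A. SUP n. emeasure (M n) A)"
  have sH: "sets H = sets K" unfolding H_def by (metis sets.sets_measure_of_eq)
  have ca: "countably_additive (sets H) (\<lambda>A. SUP n. emeasure (M n) A)"
  proof (rule countably_additiveI)
    fix F :: "nat \<Rightarrow> 'a set" assume F: "range F \<subseteq> sets H" "disjoint_family F"
    have "(\<Sum>i. SUP n. emeasure (M n) (F i)) = (SUP n. \<Sum>i. emeasure (M n) (F i))"
      by (rule ennreal_suminf_SUP_eq) (use F inc sH in \<open>auto intro!: incseq_SucI\<close>)
    also have "\<dots> = (SUP n. emeasure (M n) (\<Union> (range F)))"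
      using F sets sH by (intro SUP_cong refl suminf_emeasure) auto
    finally show "(\<Sum>i. SUP n. emeasure (M n) (F i)) = (SUP n. emeasure (M n) (\<Union> (range F)))" .
  qed
  show ?thesis
  proof (rule that[OF sH])
    fix A assume "A \<in> sets K"
    thus "emeasure H A = (SUP n. emeasure (M n) A)"
      by (intro emeasure_measure_of[OF H_def _ _ ca]) (use sets.space_closed sH in \<open>auto simp: positive_def\<close>)
  qed
qed

text \<open>Each \<open>\<nu> t\<close> has a density \<open>h\<close> with respect to \<open>\<nu> T\<close>, and at almost every \<open>x\<close> these densities increase from \<open>0\<close> to \<open>1\<close>
in \<open>t\<close>.  Draw \<open>v\<close> uniformly from \<open>{0..<1}\<close> and let \<open>\<tau>\<close> be the first rational time at which the density
exceeds \<open>v\<close>: the image of the product measure under \<open>(x, \<tau>)\<close> has the required values.  Rational times keep the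
exceptional null sets countable; continuity of the masses covers the remaining times.\<close>

lemma disintegrate:
  fixes \<nu> :: "real \<Rightarrow> real measure" and T :: real
  assumes T: "0 \<le> T" and fin: "\<And>t. 0 \<le> t \<Longrightarrow> t \<le> T \<Longrightarrow> fin_borel (\<nu> t)"
    and mono: "\<And>s t A. 0 \<le> s \<Longrightarrow> s \<le> t \<Longrightarrow> t \<le> T \<Longrightarrow> A \<in> sets borel \<Longrightarrow> emeasure (\<nu> s) A \<le> emeasure (\<nu> t) A"
    and zero: "emeasure (\<nu> 0) UNIV = 0"
    and cont: "continuous_on {0..T} (\<lambda>t. measure (\<nu> t) UNIV)"
  obtains N where "finite_measure N" "sets N = sets borel"
    "\<And>t A. 0 \<le> t \<Longrightarrow> t \<le> T \<Longrightarrow> A \<in> sets borel \<Longrightarrow> emeasure N (A \<times> {..t}) = emeasure (\<nu> t) A"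
    "emeasure N (UNIV \<times> {T<..}) = 0"
proof -
  interpret V: fin_borel "\<nu> T" by (rule fin[OF T order_refl])
  define h0 where "h0 t = (SOME h. h \<in> borel_measurable (\<nu> T) \<and> density (\<nu> T) h = \<nu> t)" for t
  have h0: "h0 t \<in> borel_measurable (\<nu> T) \<and> density (\<nu> T) (h0 t) = \<nu> t" if t: "0 \<le> t" "t \<le> T" for t
  proof -
    interpret F: fin_borel "\<nu> t" by (rule fin[OF t])
    have "absolutely_continuous (\<nu> T) (\<nu> t)"
      using mono[OF t order_refl] by (auto simp: absolutely_continuous_def null_sets_def) (metis le_zero_eq)
    hence "\<exists>h\<in>borel_measurable (\<nu> T). density (\<nu> T) h = \<nu> t"
      by (intro V.Radon_Nikodym_finite_measure F.finite_measure_axioms) auto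
    thus ?thesis unfolding h0_def by (intro someI_ex[of "\<lambda>h. h \<in> borel_measurable (\<nu> T) \<and> density (\<nu> T) h = \<nu> t"]) auto
  qed
  define hh where "hh t = (if 0 \<le> t \<and> t \<le> T then h0 t else (\<lambda>_. 0))" for t
  have hm [measurable]: "hh t \<in> borel_measurable borel" for t
    using h0[of t] by (simp add: hh_def measurable_cong_sets[OF V.sets_borel refl])
  have hd: "density (\<nu> T) (hh t) = \<nu> t" if "0 \<le> t" "t \<le> T" for t using h0[OF that] that by (simp add: hh_def)
  have hle: "AE x in \<nu> T. hh s x \<le> hh t x" if "0 \<le> s" "s \<le> t" "t \<le> T" for s t
  proof (rule density_le_AE[OF V.finite_measure_axioms])
    interpret F: fin_borel "\<nu> t" by (rule fin) (use that in auto)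
    show "emeasure (density (\<nu> T) (hh t)) (space (\<nu> T)) < \<infinity>"
      using that by (simp add: hd less_top[symmetric])
    show "emeasure (density (\<nu> T) (hh s)) A \<le> emeasure (density (\<nu> T) (hh t)) A" if "A \<in> sets (\<nu> T)" for A
      using mono[of s t A] that \<open>0 \<le> s\<close> \<open>s \<le> t\<close> \<open>t \<le> T\<close> by (simp add: hd)
  qed auto
  have hle1: "AE x in \<nu> T. hh t x \<le> 1" if "0 \<le> t" "t \<le> T" for t
  proof (rule density_le_AE[OF V.finite_measure_axioms])
    have d1: "density (\<nu> T) (\<lambda>_. 1) = \<nu> T" by (rule measure_eqI) (auto simp: emeasure_density)
    show "emeasure (density (\<nu> T) (\<lambda>_. 1)) (space (\<nu> T)) < \<infinity>" unfolding d1 by (simp add: less_top[symmetric])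
    show "emeasure (density (\<nu> T) (hh t)) A \<le> emeasure (density (\<nu> T) (\<lambda>_. 1)) A" if "A \<in> sets (\<nu> T)" for A
      unfolding d1 using mono[of t T A] that \<open>0 \<le> t\<close> \<open>t \<le> T\<close> by (simp add: hd)
  qed auto
  define U where "U = density lborel (indicator {0..<1::real})"
  have sU [simp, measurable_cong]: "sets U = sets borel" by (simp add: U_def)
  have spU [simp]: "space U = UNIV" by (simp add: U_def)
  have U1: "emeasure U UNIV = 1" by (simp add: U_def emeasure_density)
  interpret U: finite_measure U by (rule finite_measureI) (simp add: U1)
  have Ue: "emeasure U {v. ennreal v < y} = y" if "y \<le> 1" for y
  proof -
    obtain r where r: "y = ennreal r" "0 \<le> r" "r \<le> 1" using \<open>y \<le> 1\<close> by (cases y) (auto simp: top_unique)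
    have "emeasure U {v. ennreal v < y} = (\<integral>\<^sup>+v. indicator {0..<1} v * indicator {v. ennreal v < y} v \<partial>lborel)"
      unfolding U_def by (rule emeasure_density) auto
    also have "\<dots> = (\<integral>\<^sup>+v. indicator {0..<r} v \<partial>lborel)"
      by (intro nn_integral_cong) (use r in \<open>auto simp: indicator_def ennreal_less_iff\<close>)
    also have "\<dots> = y" using r by simp
    finally show ?thesis .
  qed
  define P where "P = \<nu> T \<Otimes>\<^sub>M U"
  have sP [measurable_cong]: "sets P = sets (borel \<Otimes>\<^sub>M borel)" unfolding P_def by (intro sets_pair_measure_cong) auto
  have spP: "space P = UNIV" by (simp add: P_def space_pair_measure)
  interpret P: finite_measure P
    unfolding P_def by (rule finite_measure_pair_measure) (unfold_locales)
  define E where "E A t = {p. fst p \<in> A \<and> ennreal (snd p) < hh t (fst p)}" for A t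
  have Em: "E A t \<in> sets P" if [measurable]: "A \<in> sets borel" for A t
  proof -
    have "E A t = {p \<in> space (borel \<Otimes>\<^sub>M borel). fst p \<in> A \<and> ennreal (snd p) < hh t (fst p)}" by (simp add: E_def space_pair_measure)
    also have "\<dots> \<in> sets (borel \<Otimes>\<^sub>M borel)" by measurable
    finally show ?thesis by (simp add: sP)
  qed
  have PE: "emeasure P (E A t) = emeasure (\<nu> t) A" if A: "A \<in> sets borel" and t: "0 \<le> t" "t \<le> T" for A t
  proof -
    have "emeasure P (E A t) = (\<integral>\<^sup>+x. emeasure U (Pair x -` E A t) \<partial>\<nu> T)"
      unfolding P_def by (rule U.emeasure_pair_measure_alt) (use Em[OF A] in \<open>simp only: P_def\<close>)
    also have "\<dots> = (\<integral>\<^sup>+x. hh t x * indicator A x \<partial>\<nu> T)"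
    proof (rule nn_integral_cong_AE)
      show "AE x in \<nu> T. emeasure U (Pair x -` E A t) = hh t x * indicator A x"
        using hle1[OF t]
      proof eventually_elim
        case (elim x)
        have "Pair x -` E A t = (if x \<in> A then {v. ennreal v < hh t x} else {})" by (auto simp: E_def)
        thus ?case using Ue[OF elim] by (auto simp: indicator_def)
      qed
    qed
    also have "\<dots> = emeasure (density (\<nu> T) (hh t)) A" by (rule emeasure_density[symmetric]) (use A in auto)
    finally show ?thesis by (simp add: hd t)
  qed
  define Q where "Q = \<rat> \<inter> {0..T}"
  have Q: "countable Q" unfolding Q_def using countable_rat by (rule countable_Int1)
  define \<tau> where "\<tau> = (\<lambda>p. Inf ({q \<in> Q. ennreal (snd p) < hh q (fst p)} \<union> {T}))"
  have \<tau>_less: "\<tau> p < t \<longleftrightarrow> (\<exists>q\<in>Q. q < t \<and> p \<in> E UNIV q) \<or> T < t" for p t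
    unfolding \<tau>_def by (subst cInf_less_iff) (auto simp: E_def Q_def intro!: bdd_belowI[of _ 0] T)
  have \<tau>_le: "\<tau> p \<le> q" if "q \<in> Q" "p \<in> E UNIV q" for p q
    unfolding \<tau>_def by (rule cInf_lower) (use that in \<open>auto simp: E_def Q_def intro!: bdd_belowI[of _ 0] T\<close>)
  have \<tau>_T: "\<tau> p \<le> T" for p
    unfolding \<tau>_def by (rule cInf_lower) (auto simp: Q_def intro!: bdd_belowI[of _ 0] T)
  have [measurable]: "\<tau> \<in> borel_measurable P"
    unfolding borel_measurable_iff_less
  proof
    fix t
    have "{p \<in> space P. \<tau> p < t} = (\<Union>q\<in>{q\<in>Q. q < t}. E UNIV q) \<union> (if T < t then UNIV else {})"
      by (auto simp: \<tau>_less spP)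
    also have "\<dots> \<in> sets P"
      using Em[of UNIV] Q sets.top[of P] by (intro sets.Un sets.countable_UN'') (auto simp: spP intro: countable_subset)
    finally show "{p \<in> space P. \<tau> p < t} \<in> sets P" .
  qed
  have fstP [measurable]: "fst \<in> borel_measurable P" unfolding measurable_cong_sets[OF sP refl] by measurable
  define N where "N = distr P borel (\<lambda>p. (fst p, \<tau> p))"
  have mN: "(\<lambda>p. (fst p, \<tau> p)) \<in> measurable P borel" unfolding borel_prod[symmetric] by measurable
  have sN: "sets N = sets borel" by (simp add: N_def)
  interpret N: finite_measure N unfolding N_def by (rule P.finite_measure_distr[OF mN])
  have rect: "A \<times> B \<in> sets (borel :: (real \<times> real) measure)" if "A \<in> sets borel" "B \<in> sets borel" for A B :: "real set"
    unfolding borel_prod[symmetric] using that by simp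
  have emN: "emeasure N (A \<times> B) = emeasure P {p. fst p \<in> A \<and> \<tau> p \<in> B}" if "A \<in> sets borel" "B \<in> sets borel" for A B
    unfolding N_def using rect[OF that] by (subst emeasure_distr[OF mN]) (auto simp: spP intro!: arg_cong[where f = "emeasure P"])
  have mP: "{p. fst p \<in> A \<and> \<tau> p \<in> B} \<in> sets P" if [measurable]: "A \<in> sets borel" "B \<in> sets borel" for A B
  proof -
    have "{p \<in> space P. fst p \<in> A \<and> \<tau> p \<in> B} \<in> sets P" by measurable
    thus ?thesis by (simp add: spP)
  qed
  have lower: "emeasure (\<nu> q) A \<le> emeasure N (A \<times> {..t})" if A: "A \<in> sets borel" and q: "q \<in> Q" "q \<le> t" for A q t
  proof -
    have "emeasure (\<nu> q) A = emeasure P (E A q)" using q A by (intro PE[symmetric]) (auto simp: Q_def)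
    also have "\<dots> \<le> emeasure P {p. fst p \<in> A \<and> \<tau> p \<in> {..t}}"
      using \<tau>_le[OF q(1)] q(2) by (intro emeasure_mono mP A) (force simp: E_def intro: order_trans)+
    finally show ?thesis using emN A by simp
  qed
  have upper: "emeasure N (A \<times> {..t}) \<le> emeasure (\<nu> t') A" if A: "A \<in> sets borel" and t: "0 \<le> t" "t < t'" "t' \<le> T" for A t t'
  proof -
    have ae: "AE x in \<nu> T. \<forall>q\<in>{q\<in>Q. q < t'}. hh q x \<le> hh t' x"
    proof -
      have "countable {q\<in>Q. q < t'}" by (rule countable_subset[OF _ Q]) auto
      thus ?thesis using t by (subst AE_ball_countable) (auto simp: Q_def intro!: hle)
    qed
    then obtain Z where Z: "Z \<in> null_sets (\<nu> T)" "{x. \<not> (\<forall>q\<in>{q\<in>Q. q < t'}. hh q x \<le> hh t' x)} \<subseteq> Z"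
      by (auto simp: eventually_ae_filter)
    have Zn: "emeasure P (Z \<times> UNIV) = 0"
      using U.emeasure_pair_measure_Times[of Z "\<nu> T" UNIV] Z by (auto simp: P_def null_sets_def)
    have Zm: "Z \<times> UNIV \<in> sets P" using Z by (auto simp: sP)
    have "{p. fst p \<in> A \<and> \<tau> p \<in> {..t}} \<subseteq> E A t' \<union> Z \<times> UNIV"
    proof
      fix p assume p: "p \<in> {p. fst p \<in> A \<and> \<tau> p \<in> {..t}}"
      hence "\<tau> p < t'" using t by auto
      then obtain q where q: "q \<in> Q" "q < t'" "p \<in> E UNIV q" using \<tau>_less[of p t'] t by auto
      show "p \<in> E A t' \<union> Z \<times> UNIV"
      proof (cases "fst p \<in> Z")
        case True thus ?thesis by (cases p) auto
      next
        case False
        hence "hh q (fst p) \<le> hh t' (fst p)" using Z(2) q by blast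
        thus ?thesis using q p by (auto simp: E_def)
      qed
    qed
    hence "emeasure N (A \<times> {..t}) \<le> emeasure P (E A t' \<union> Z \<times> UNIV)"
      using emN A Em[OF A] Zm by (auto intro!: emeasure_mono)
    also have "\<dots> \<le> emeasure P (E A t') + emeasure P (Z \<times> UNIV)" by (rule emeasure_subadditive[OF Em[OF A] Zm])
    also have "\<dots> = emeasure (\<nu> t') A" using PE[OF A] t by (simp add: Zn)
    finally show ?thesis .
  qed
  have top: "emeasure N (A \<times> {..T}) = emeasure (\<nu> T) A" if A: "A \<in> sets borel" for A
  proof -
    have "{p. fst p \<in> A \<and> \<tau> p \<in> {..T}} = A \<times> UNIV" using \<tau>_T by auto
    hence "emeasure N (A \<times> {..T}) = emeasure P (A \<times> UNIV)" using emN A by simp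
    also have "\<dots> = emeasure (\<nu> T) A" unfolding P_def
      using U.emeasure_pair_measure_Times[of A "\<nu> T" UNIV] A U1 by simp
    finally show ?thesis .
  qed
  have dm: "measure (\<nu> t) A - measure (\<nu> s) A \<le> measure (\<nu> t) UNIV - measure (\<nu> s) UNIV"
    if st: "0 \<le> s" "s \<le> t" "t \<le> T" and A: "A \<in> sets borel" for s t A
  proof -
    interpret S: fin_borel "\<nu> s" by (rule fin) (use st in auto)
    interpret T: fin_borel "\<nu> t" by (rule fin) (use st in auto)
    have "measure (\<nu> s) (UNIV - A) \<le> measure (\<nu> t) (UNIV - A)"
      using mono[OF st, of "UNIV - A"] A by (simp add: S.emeasure_eq_measure T.emeasure_eq_measure)
    moreover have "measure (\<nu> s) (UNIV - A) = measure (\<nu> s) UNIV - measure (\<nu> s) A" "measure (\<nu> t) (UNIV - A) = measure (\<nu> t) UNIV - measure (\<nu> t) A"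
      using A by (auto intro!: S.finite_measure_Diff T.finite_measure_Diff)
    ultimately show ?thesis by linarith
  qed
  have main: "emeasure N (A \<times> {..t}) = emeasure (\<nu> t) A" if t: "0 \<le> t" "t \<le> T" and A: "A \<in> sets borel" for t A
  proof (cases "t = T")
    case True thus ?thesis using top[OF A] by simp
  next
    case False
    hence tT: "t < T" using t by simp
    interpret F: fin_borel "\<nu> t" by (rule fin[OF t])
    have "\<bar>measure N (A \<times> {..t}) - measure (\<nu> t) A\<bar> \<le> 0"
    proof (rule field_le_epsilon)
      fix e :: real assume e: "0 < e"
      have "t \<in> {0..T}" using t by simp
      with cont e obtain d where d: "0 < d" "\<And>t'. t' \<in> {0..T} \<Longrightarrow> \<bar>t' - t\<bar> < d \<Longrightarrow> \<bar>measure (\<nu> t') UNIV - measure (\<nu> t) UNIV\<bar> < e"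
        unfolding continuous_on_iff dist_real_def by metis
      define t' where "t' = min T (t + d / 2)"
      have t': "t < t'" "t' \<le> T" "\<bar>t' - t\<bar> < d" using tT d by (auto simp: t'_def)
      have "measure N (A \<times> {..t}) \<le> measure (\<nu> t') A"
      proof -
        interpret F': fin_borel "\<nu> t'" by (rule fin) (use t t' in auto)
        show ?thesis using upper[OF A t(1) t'(1,2)] by (simp add: N.emeasure_eq_measure F'.emeasure_eq_measure)
      qed
      hence 1: "measure N (A \<times> {..t}) - measure (\<nu> t) A \<le> e"
        using dm[OF t(1) _ t'(2) A] d(2)[of t'] t' t by force
      have "\<exists>q\<in>Q. q \<le> t \<and> \<bar>q - t\<bar> < d"
      proof (cases "t = 0")
        case True thus ?thesis using T d by (intro bexI[of _ 0]) (auto simp: Q_def)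
      next
        case False
        hence "max 0 (t - d) < t" using t d by auto
        from Rats_dense_in_real[OF this] obtain q where "q \<in> \<rat>" "max 0 (t - d) < q" "q < t" by blast
        thus ?thesis using t by (intro bexI[of _ q]) (auto simp: Q_def)
      qed
      then obtain q where q: "q \<in> Q" "q \<le> t" "\<bar>q - t\<bar> < d" by blast
      have "measure (\<nu> q) A \<le> measure N (A \<times> {..t})"
      proof -
        interpret F': fin_borel "\<nu> q" by (rule fin) (use q in \<open>auto simp: Q_def\<close>)
        show ?thesis using lower[OF A q(1,2)] by (simp add: N.emeasure_eq_measure F'.emeasure_eq_measure)
      qed
      hence 2: "measure (\<nu> t) A - measure N (A \<times> {..t}) \<le> e"
        using dm[OF _ q(2) t(2) A] d(2)[of q] q t by (force simp: Q_def)
      show "\<bar>measure N (A \<times> {..t}) - measure (\<nu> t) A\<bar> \<le> 0 + e" using 1 2 by linarith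
    qed
    thus ?thesis by (simp add: N.emeasure_eq_measure F.emeasure_eq_measure)
  qed
  have "emeasure N (UNIV \<times> {T<..}) = 0"
  proof -
    have "emeasure N (UNIV \<times> {T<..}) = emeasure P {p. fst p \<in> UNIV \<and> \<tau> p \<in> {T<..}}" by (rule emN) auto
    also have "{p. fst p \<in> UNIV \<and> \<tau> p \<in> {T<..}} = {}" using \<tau>_T by (auto simp: not_less)
    finally show ?thesis by simp
  qed
  thus ?thesis using that[OF N.finite_measure_axioms sN main] by blast
qed

section \<open>Driving pairs on a time interval\<close>

lemma time_interval_borel: "time_interval I \<Longrightarrow> I \<in> sets borel"
proof -
  assume "time_interval I"
  moreover have "{t::real. 0 \<le> t \<and> ereal t < T0} \<in> sets borel" for T0 by measurable
  ultimately show ?thesis unfolding time_interval_def by auto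
qed

lemma rect_borel: "A \<in> sets borel \<Longrightarrow> B \<in> sets borel \<Longrightarrow> A \<times> B \<in> sets (borel :: (real \<times> real) measure)"
  unfolding borel_prod[symmetric] by simp

locale driving =
  fixes I :: "real set" and \<gamma> :: "real \<Rightarrow> real" and H :: "(real \<times> real) measure"
  assumes I: "time_interval I" and pair: "driving_pair I \<gamma> H"
begin

lemmas I0 = time_interval_facts(1)[OF I] and I_nonneg = time_interval_facts(2)[OF I] and I_down = time_interval_facts(3)[OF I]

lemma sets_H: "sets H = sets (restrict_space borel (UNIV \<times> I))" using pair by (simp add: driving_pair_def)

lemma strip_borel: "UNIV \<times> I \<in> sets (borel :: (real \<times> real) measure)"
  by (rule rect_borel[OF _ time_interval_borel[OF I]]) simp

lemma in_sets_H: "B \<in> sets H \<longleftrightarrow> B \<in> sets borel \<and> B \<subseteq> UNIV \<times> I"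
  unfolding sets_H using strip_borel by (subst sets_restrict_space_iff) auto

lemma strip_sub: "T \<in> I \<Longrightarrow> UNIV \<times> {0..T} \<subseteq> UNIV \<times> I" using I_down by auto

lemma restriction_in_H: "T \<in> I \<Longrightarrow> B \<in> sets borel \<Longrightarrow> B \<inter> UNIV \<times> {0..T} \<in> sets H"
  unfolding in_sets_H using strip_sub[of T] rect_borel[of UNIV "{0..T}"] by auto

text \<open>Only the times up to \<open>T\<close>, as a finite measure on the whole plane.\<close>

definition cut :: "real \<Rightarrow> (real \<times> real) measure" where
  "cut T = distr (restrict_space H (UNIV \<times> {0..T})) borel (\<lambda>p. p)"

lemma id_H: "(\<lambda>p. p) \<in> measurable (restrict_space H S) borel"
  by (intro measurable_restrict_space1) (simp add: measurable_cong_sets[OF sets_H refl] measurable_restrict_space1)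

lemma space_H: "space H = UNIV \<times> I"
  using sets_eq_imp_space_eq[OF sets_H] by (simp add: space_restrict_space)

lemma strip_in_H: assumes T: "T \<in> I" shows "UNIV \<times> {0..T} \<inter> space H \<in> sets H"
proof -
  have "UNIV \<times> {0..T} \<inter> space H = UNIV \<inter> UNIV \<times> {0..T}" using strip_sub[OF T] by (auto simp: space_H)
  thus ?thesis using restriction_in_H[OF T, of UNIV] by simp
qed

lemma cut_emeasure:
  assumes T: "T \<in> I" and B: "B \<in> sets borel" shows "emeasure (cut T) B = emeasure H (B \<inter> UNIV \<times> {0..T})"
proof -
  note S = strip_in_H[OF T]
  have "emeasure (cut T) B = emeasure (restrict_space H (UNIV \<times> {0..T})) (B \<inter> (UNIV \<times> {0..T} \<inter> space H))"
    unfolding cut_def by (subst emeasure_distr[OF id_H B]) (simp add: space_restrict_space vimage_def)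
  also have "B \<inter> (UNIV \<times> {0..T} \<inter> space H) = B \<inter> UNIV \<times> {0..T}" using strip_sub[OF T] by (auto simp: space_H)
  also have "emeasure (restrict_space H (UNIV \<times> {0..T})) (B \<inter> UNIV \<times> {0..T}) = emeasure H (B \<inter> UNIV \<times> {0..T})"
    by (rule emeasure_restrict_space[OF S]) auto
  finally show ?thesis .
qed

lemma cut_st: assumes T: "T \<in> I" shows "st_measure (cut T)"
proof (intro st_measure.intro st_measure_axioms.intro finite_measureI)
  show s: "sets (cut T) = sets borel" by (simp add: cut_def)
  have "emeasure H (UNIV \<times> {0..T}) < \<infinity>" using pair T unfolding driving_pair_def by blast
  thus "emeasure (cut T) (space (cut T)) \<noteq> \<infinity>" using cut_emeasure[OF T, of UNIV] by (simp add: cut_def)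
  fix t
  have "UNIV \<times> {t} \<inter> (UNIV :: real set) \<times> {0..T} = (if t \<in> {0..T} then UNIV \<times> {t} else {})" by auto
  moreover have "t \<in> {0..T} \<Longrightarrow> emeasure H (UNIV \<times> {t}) = 0" using pair I_down[OF T, of t] unfolding driving_pair_def by simp
  ultimately have "emeasure (cut T) (UNIV \<times> {t}) = 0" using cut_emeasure[OF T, of "UNIV \<times> {t}"] rect_borel[of UNIV "{t}"] by simp
  thus "measure (cut T) (UNIV \<times> {t}) = 0" by (simp add: measure_def)
qed

lemma cut_integral:
  fixes f :: "real \<times> real \<Rightarrow> complex"
  assumes T: "T \<in> I" and s: "0 \<le> s" "t \<le> T"
    and m: "(\<lambda>p. indicator (UNIV \<times> {s..t}) p *\<^sub>R f p) \<in> borel_measurable borel"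
  shows "set_integrable H (UNIV \<times> {s..t}) f \<longleftrightarrow> set_integrable (cut T) (UNIV \<times> {s<..t}) f"
    "set_lebesgue_integral H (UNIV \<times> {s..t}) f = set_lebesgue_integral (cut T) (UNIV \<times> {s<..t}) f"
proof -
  interpret N: st_measure "cut T" by (rule cut_st[OF T])
  let ?g = "\<lambda>p. indicator (UNIV \<times> {s..t}) p *\<^sub>R f p"
  let ?g' = "\<lambda>p. indicator (UNIV \<times> {s<..t}) p *\<^sub>R f p"
  note S = strip_in_H[OF T]
  have ind: "indicat_real (UNIV \<times> {0..T}) p *\<^sub>R ?g p = ?g p" for p using s by (auto simp: indicator_def)
  have "UNIV \<times> {s} \<in> null_sets (cut T)"
    using N.atomless[of s] by (auto simp: null_sets_def N.emeasure_eq_measure)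
  hence ae: "AE p in cut T. ?g p = ?g' p"
    by (rule AE_I') (auto simp: indicator_def)
  have m': "?g' \<in> borel_measurable (cut T)"
  proof -
    have [measurable]: "UNIV \<times> {s<..t} \<in> sets (borel :: (real \<times> real) measure)" by (rule rect_borel) auto
    have "(\<lambda>p. indicat_real (UNIV \<times> {s<..t}) p *\<^sub>R ?g p) \<in> borel_measurable borel"
      by (intro borel_measurable_scaleR borel_measurable_indicator m) simp
    moreover have e: "(\<lambda>p. indicat_real (UNIV \<times> {s<..t}) p *\<^sub>R ?g p) = ?g'" by (auto simp: indicator_def fun_eq_iff)
    ultimately show ?thesis unfolding measurable_cong_sets[OF N.sets_N refl] e by blast
  qed
  have mN: "?g \<in> borel_measurable (cut T)" using m unfolding measurable_cong_sets[OF N.sets_N refl] .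
  have "integrable (cut T) ?g \<longleftrightarrow> integrable (restrict_space H (UNIV \<times> {0..T})) ?g"
    unfolding cut_def by (rule integrable_distr_eq[OF id_H m])
  also have "\<dots> \<longleftrightarrow> integrable H ?g" by (subst integrable_restrict_space[OF S]) (simp only: ind)
  finally show "set_integrable H (UNIV \<times> {s..t}) f \<longleftrightarrow> set_integrable (cut T) (UNIV \<times> {s<..t}) f"
    unfolding set_integrable_def using integrable_cong_AE[OF mN m' ae] by simp
  have "integral\<^sup>L (cut T) ?g = integral\<^sup>L (restrict_space H (UNIV \<times> {0..T})) ?g"
    unfolding cut_def by (rule integral_distr[OF id_H m])
  also have "\<dots> = integral\<^sup>L H ?g" by (subst integral_restrict_space[OF S]) (simp only: ind)
  finally show "set_lebesgue_integral H (UNIV \<times> {s..t}) f = set_lebesgue_integral (cut T) (UNIV \<times> {s<..t}) f"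
    unfolding set_lebesgue_integral_def using integral_cong_AE[OF mN m' ae] by simp
qed

lemma kernel_integral:
  assumes T: "T \<in> I" and s: "0 \<le> s" "s \<le> t" "t \<le> T"
    and w: "continuous_on {s..t} w" "\<And>u. u \<in> {s..t} \<Longrightarrow> 0 < Im (w u)"
  shows "set_integrable H (UNIV \<times> {s..t}) (\<lambda>(x, u). (1 + of_real x * w u) / (of_real x - w u))"
    "set_lebesgue_integral H (UNIV \<times> {s..t}) (\<lambda>(x, u). (1 + of_real x * w u) / (of_real x - w u)) = st_measure.nev_integral (cut T) w s t"
proof -
  interpret N: st_measure "cut T" by (rule cut_st[OF T])
  have f: "(\<lambda>(x, u). (1 + of_real x * w u) / (of_real x - w u)) = (\<lambda>p. nev (fst p) (w (snd p)))"
    by (auto simp: nev_def)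
  have "compact (w ` {s..t})" "w ` {s..t} \<subseteq> upper_half_plane"
    using w by (auto simp: upper_half_plane_def intro!: compact_continuous_image)
  then obtain R where R: "w ` {s..t} \<subseteq> region R" using compact_subset_region by blast
  have "continuous_on (UNIV \<times> {s..t}) (\<lambda>p. nev (fst p) (w (snd p)))"
    by (rule continuous_on_nev) (use w in \<open>auto intro!: continuous_intros continuous_on_compose2[OF w(1)]\<close>)
  hence m: "(\<lambda>p. indicator (UNIV \<times> {s..t}) p *\<^sub>R nev (fst p) (w (snd p))) \<in> borel_measurable borel"
    by (intro borel_measurable_continuous_on_indicator rect_borel) auto
  have ad: "N.admissible R w s t" by (rule N.admissibleI_cont[OF w(1)]) (use R in auto)
  show "set_integrable H (UNIV \<times> {s..t}) (\<lambda>(x, u). (1 + of_real x * w u) / (of_real x - w u))"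
    unfolding f using cut_integral(1)[OF T s(1,3) m] N.admissible_integrable[OF ad] by simp
  show "set_lebesgue_integral H (UNIV \<times> {s..t}) (\<lambda>(x, u). (1 + of_real x * w u) / (of_real x - w u)) = st_measure.nev_integral (cut T) w s t"
    unfolding f N.nev_integral_def by (rule cut_integral(2)[OF T s(1,3) m])
qed

end

lemma cofinal_sequence:
  assumes I: "time_interval I"
  obtains T :: "nat \<Rightarrow> real" where "mono T" "\<And>n. T n \<in> I" "\<And>t. t \<in> I \<Longrightarrow> \<exists>n. t \<le> T n"
proof -
  consider (closed) T0 where "0 < T0" "I = {0..T0}" | (inf) "I = {0..}" | (opn) T0 where "0 < T0" "I = {0..<T0}"
  proof -
    from I consider (a) T0 :: ereal where "0 < T0" "I = {t. 0 \<le> t \<and> ereal t < T0}" | (b) T0 :: real where "0 < T0" "I = {0..T0}"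
      unfolding time_interval_def by blast
    thus thesis
    proof cases
      case a
      show ?thesis
      proof (cases T0)
        case (real r)
        have "{t. 0 \<le> t \<and> t < r} = {0..<r}" by auto
        thus ?thesis using a real that(3)[of r] by (simp add: zero_ereal_def)
      next
        case PInf thus ?thesis using a that(2) by auto
      next
        case MInf thus ?thesis using a by simp
      qed
    next
      case b thus ?thesis using that(1) by blast
    qed
  qed
  thus ?thesis
  proof cases
    case closed
    show ?thesis by (rule that[of "\<lambda>_. T0"]) (use closed in \<open>auto intro: monoI\<close>)
  next
    case inf
    show ?thesis by (rule that[of real]) (use inf real_arch_simple in \<open>auto intro!: monoI\<close>)
  next
    case opn
    define T where "T = (\<lambda>n::nat. T0 - T0 / real (Suc n))"
    show ?thesis
    proof (rule that[of T])
      show "mono T" unfolding T_def using opn by (intro monoI diff_left_mono divide_left_mono) auto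
      show "T n \<in> I" for n using opn by (auto simp: T_def field_simps)
      fix t assume "t \<in> I"
      hence t: "0 \<le> t" "t < T0" using opn by auto
      obtain n :: nat where "T0 / (T0 - t) < real n" using reals_Archimedean2 by blast
      hence "T0 / (T0 - t) \<le> real (Suc n)" by simp
      hence "T0 \<le> real (Suc n) * (T0 - t)" using t by (simp add: pos_divide_le_eq)
      hence "t \<le> T n" by (simp add: T_def field_simps)
      thus "\<exists>n. t \<le> T n" ..
    qed
  qed
qed

lemma driving_measure_eqI:
  assumes "driving I \<gamma> H" "driving I \<gamma>' H'"
    and eq: "\<And>T. T \<in> I \<Longrightarrow> driving.cut H T = driving.cut H' T"
  shows "H = H'"
proof -
  interpret A: driving I \<gamma> H by fact
  interpret B: driving I \<gamma>' H' by fact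
  obtain T :: "nat \<Rightarrow> real" where T: "mono T" "\<And>n. T n \<in> I" "\<And>t. t \<in> I \<Longrightarrow> \<exists>n. t \<le> T n"
    using cofinal_sequence[OF A.I] by metis
  show ?thesis
  proof (rule measure_eqI)
    show "sets H = sets H'" by (simp add: A.sets_H B.sets_H)
    fix B assume "B \<in> sets H"
    hence B: "B \<in> sets borel" "B \<subseteq> UNIV \<times> I" by (auto simp: A.in_sets_H)
    have inc: "incseq (\<lambda>n::nat. B \<inter> UNIV \<times> {0..T n})" using monoD[OF T(1)] by (fastforce simp: incseq_def intro: order_trans)
    have U: "(\<Union>n. B \<inter> UNIV \<times> {0..T n}) = B"
    proof
      show "B \<subseteq> (\<Union>n. B \<inter> UNIV \<times> {0..T n})"
      proof
        fix p assume p: "p \<in> B"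
        hence "snd p \<in> I" using B by auto
        moreover from this obtain n where "snd p \<le> T n" using T(3) by blast
        ultimately have "p \<in> B \<inter> UNIV \<times> {0..T n}" using p A.I_nonneg by (cases p) auto
        thus "p \<in> (\<Union>n. B \<inter> UNIV \<times> {0..T n})" by blast
      qed
    qed auto
    have lim: "(SUP n. emeasure K (B \<inter> UNIV \<times> {0..T n})) = emeasure K B"
      if "\<And>n. B \<inter> UNIV \<times> {0..T n} \<in> sets K" for K
      using SUP_emeasure_incseq[OF _ inc, of K] that unfolding U by (simp add: image_subset_iff)
    have "emeasure H B = (SUP n. emeasure H (B \<inter> UNIV \<times> {0..T n}))"
      by (rule lim[symmetric]) (rule A.restriction_in_H[OF T(2) B(1)])
    also have "\<dots> = (SUP n. emeasure H' (B \<inter> UNIV \<times> {0..T n}))"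
      using A.cut_emeasure[OF T(2) B(1)] B.cut_emeasure[OF T(2) B(1)] eq[OF T(2)] by simp
    also have "\<dots> = emeasure H' B"
      by (rule lim) (rule B.restriction_in_H[OF T(2) B(1)])
    finally show "emeasure H B = emeasure H' B" .
  qed
qed

section \<open>Uniqueness of the driving pair\<close>

context st_measure begin

lemma strip_mass_split: "strip_mass 0 t - strip_mass 0 s = strip_mass s t" if "0 \<le> s" "s \<le> t" using strip_mass_add[OF that] by simp

lemma nev_transform_x_marginal_add: "0 < Im z \<Longrightarrow> r \<le> s \<Longrightarrow> s \<le> t \<Longrightarrow> nev_transform (x_marginal r t) z = nev_transform (x_marginal r s) z + nev_transform (x_marginal s t) z"
proof -
  assume z: "0 < Im z" and st: "r \<le> s" "s \<le> t"
  obtain R where R: "z \<in> region R" using in_some_region[OF z] by blast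
  show ?thesis unfolding nev_integral_const[OF z, symmetric] by (rule nev_integral_add[OF admissible_const[OF R] st])
qed

end

text \<open>By the equation \<open>\<Xi> z s t\<close> is the integral of the kernel along the curves from \<open>z\<close> and \<open>\<i>\<close>.  Over a short time these
curves may be replaced by their starting points.\<close>

lemma (in evolution) \<Xi>_near_x_marginal:
  assumes "st_measure N" and T: "T \<in> I" and z: "0 < Im z" and e: "0 < e"
    and eq: "\<And>s t z. 0 \<le> s \<Longrightarrow> s \<le> t \<Longrightarrow> t \<le> T \<Longrightarrow> 0 < Im z \<Longrightarrow>
      \<exists>a::real. \<phi> s t z = z + of_real a + st_measure.nev_integral N (\<lambda>u. \<phi> s u z) s t \<and> \<phi> s t \<i> = \<i> + of_real a + st_measure.nev_integral N (\<lambda>u. \<phi> s u \<i>) s t"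
  obtains d where "0 < d" "\<And>s t. 0 \<le> s \<Longrightarrow> s \<le> t \<Longrightarrow> t \<le> T \<Longrightarrow> t - s < d \<Longrightarrow>
    norm (\<Xi> z s t - nev_transform (st_measure.x_marginal N s t) z) \<le> e * st_measure.strip_mass N s t"
proof -
  interpret N: st_measure N by fact
  define Z where "Z = {z, \<i>}"
  have Z: "compact Z" "Z \<subseteq> upper_half_plane" using z by (auto simp: Z_def upper_half_plane_def)
  obtain R where R: "0 < R" "\<And>s t z. 0 \<le> s \<Longrightarrow> s \<le> t \<Longrightarrow> t \<le> T \<Longrightarrow> z \<in> Z \<Longrightarrow> \<phi> s t z \<in> region R"
    using orbit_region[OF T Z] by blast
  define e' where "e' = e / (2 * R\<^sup>2)"
  have e': "0 < e'" using e R by (simp add: e'_def)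
  obtain d where d: "0 < d" "\<And>s t z. 0 \<le> s \<Longrightarrow> s \<le> t \<Longrightarrow> t \<le> T \<Longrightarrow> t - s < d \<Longrightarrow> z \<in> Z \<Longrightarrow> norm (\<phi> s t z - z) < e'"
    using orbit_equicontinuous[OF T Z e'] by blast
  show ?thesis
  proof (rule that[OF d(1)])
    fix s t assume st: "0 \<le> s" "s \<le> t" "t \<le> T" "t - s < d"
    interpret m: fin_borel "N.x_marginal s t" by (rule N.x_marginal_fin)
    have tI: "t \<in> I" and sI: "s \<in> I" using I_down[OF T] st by auto
    define \<Delta> where "\<Delta> = (\<lambda>y. N.nev_integral (\<lambda>u. \<phi> s u y) s t - N.nev_integral (\<lambda>_. y) s t)"
    have \<Delta>: "norm (\<Delta> y) \<le> e / 2 * N.strip_mass s t" if y: "y \<in> Z" for y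
    proof -
      have yp: "0 < Im y" using y Z by (auto simp: upper_half_plane_def)
      have "norm (\<Delta> y) \<le> R\<^sup>2 * e' * N.strip_mass s t"
        unfolding \<Delta>_def
      proof (rule N.nev_integral_diff_le)
        show "N.admissible R (\<lambda>u. \<phi> s u y) s t"
          by (rule N.admissibleI_cont[OF \<phi>_time_continuous[OF tI st(1) yp]]) (use R st y in auto)
        show "N.admissible R (\<lambda>_. y) s t"
          using R(2)[of s s y] \<phi>_refl[OF sI yp] st y by (intro N.admissible_const) auto
        show "norm (\<phi> s u y - y) \<le> e'" if "u \<in> {s<..t}" for u
          using d(2)[of s u y] that st y by (simp add: less_imp_le)
      qed
      thus ?thesis using R by (simp add: e'_def)
    qed
    obtain a where a: "\<phi> s t z = z + of_real a + N.nev_integral (\<lambda>u. \<phi> s u z) s t" "\<phi> s t \<i> = \<i> + of_real a + N.nev_integral (\<lambda>u. \<phi> s u \<i>) s t"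
      using eq[OF st(1-3) z] by blast
    have Ji: "N.nev_integral (\<lambda>_. \<i>) s t = \<i> * of_real m.mass" using N.nev_integral_const[of \<i> s t] by simp
    have "\<Xi> z s t - nev_transform (N.x_marginal s t) z = \<Delta> z - of_real (Re (\<Delta> \<i>))"
      unfolding \<Xi>_def \<Delta>_def Ji N.nev_integral_const[OF z] a by simp
    hence "norm (\<Xi> z s t - nev_transform (N.x_marginal s t) z) \<le> norm (\<Delta> z) + norm (\<Delta> \<i>)"
      using norm_triangle_ineq4[of "\<Delta> z" "of_real (Re (\<Delta> \<i>))"] abs_Re_le_cmod[of "\<Delta> \<i>"] by simp
    thus "norm (\<Xi> z s t - nev_transform (N.x_marginal s t) z) \<le> e * N.strip_mass s t"
      using \<Delta>[of z] \<Delta>[of \<i>] by (simp add: Z_def)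
  qed
qed

lemma (in evolution) driving_equation:
  assumes "driving I \<gamma> H" and eq: "evolution_equation I \<phi> \<gamma> H"
    and T: "T \<in> I" and st: "0 \<le> s" "s \<le> t" "t \<le> T" and z: "0 < Im z"
  shows "\<phi> s t z = z + of_real (\<gamma> s - \<gamma> t) + st_measure.nev_integral (driving.cut H T) (\<lambda>u. \<phi> s u z) s t"
proof -
  interpret D: driving I \<gamma> H by fact
  have tI: "t \<in> I" using I_down[OF T] st by auto
  have c: "continuous_on {s..t} (\<lambda>u. \<phi> s u z)" by (rule \<phi>_time_continuous[OF tI st(1) z])
  have p: "0 < Im (\<phi> s u z)" if "u \<in> {s..t}" for u
    using \<phi>_pos[OF I_down[OF tI] st(1) _ z, of u] that st by auto
  have "\<phi> s t z = z + of_real (\<gamma> s) - of_real (\<gamma> t) +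
      set_lebesgue_integral H (UNIV \<times> {s..t}) (\<lambda>(x, u). (1 + of_real x * \<phi> s u z) / (of_real x - \<phi> s u z))"
    using eq pairs[OF tI st(1,2)] z unfolding evolution_equation_def upper_half_plane_def by fast
  thus ?thesis using D.kernel_integral(2)[OF T st c p] by simp
qed

text \<open>The transforms of the marginals of both measures have the same increments as \<open>\<Xi>\<close> up to negligible errors, so they
coincide, and the marginals over all time intervals determine the measure.\<close>

lemma (in evolution) pair_unique:
  assumes 1: "driving I \<gamma> H" "evolution_equation I \<phi> \<gamma> H" and 2: "driving I \<gamma>' H'" "evolution_equation I \<phi> \<gamma>' H'"
  shows "H' = H" "t \<in> I \<Longrightarrow> \<gamma>' t = \<gamma> t"
proof -
  interpret A: driving I \<gamma> H by fact
  interpret B: driving I \<gamma>' H' by fact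
  have N: "A.cut T = B.cut T" if T: "T \<in> I" for T
  proof -
    interpret M: st_measure "A.cut T" by (rule A.cut_st[OF T])
    interpret N: st_measure "B.cut T" by (rule B.cut_st[OF T])
    have eqA: "\<exists>a::real. \<phi> s t z = z + of_real a + M.nev_integral (\<lambda>u. \<phi> s u z) s t \<and> \<phi> s t \<i> = \<i> + of_real a + M.nev_integral (\<lambda>u. \<phi> s u \<i>) s t"
      if "0 \<le> s" "s \<le> t" "t \<le> T" "0 < Im z" for s t z
      using driving_equation[OF 1 T that(1-3), of z] driving_equation[OF 1 T that(1-3), of \<i>] that(4)
      by (intro exI[of _ "\<gamma> s - \<gamma> t"]) auto
    have eqB: "\<exists>a::real. \<phi> s t z = z + of_real a + N.nev_integral (\<lambda>u. \<phi> s u z) s t \<and> \<phi> s t \<i> = \<i> + of_real a + N.nev_integral (\<lambda>u. \<phi> s u \<i>) s t"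
      if "0 \<le> s" "s \<le> t" "t \<le> T" "0 < Im z" for s t z
      using driving_equation[OF 2 T that(1-3), of z] driving_equation[OF 2 T that(1-3), of \<i>] that(4)
      by (intro exI[of _ "\<gamma>' s - \<gamma>' t"]) auto
    have x_marginal: "M.x_marginal 0 t = N.x_marginal 0 t" if t: "0 \<le> t" "t \<le> T" for t
    proof (rule nev_transform_inject[OF M.x_marginal_fin N.x_marginal_fin])
      fix z :: complex assume z: "0 < Im z"
      define D where "D = (\<lambda>t. nev_transform (M.x_marginal 0 t) z - nev_transform (N.x_marginal 0 t) z)"
      define A where "A = (\<lambda>t. M.strip_mass 0 t + N.strip_mass 0 t)"
      have "D t = D 0"
      proof (rule increments_zero[OF t(1), of A])
        show "A 0 \<le> A t" by (simp add: A_def)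
        fix e :: real assume e: "0 < e"
        obtain d1 where d1: "0 < d1" "\<And>s t. 0 \<le> s \<Longrightarrow> s \<le> t \<Longrightarrow> t \<le> T \<Longrightarrow> t - s < d1 \<Longrightarrow> norm (\<Xi> z s t - nev_transform (M.x_marginal s t) z) \<le> e * M.strip_mass s t"
          by (rule \<Xi>_near_x_marginal[OF M.st_measure_axioms T z e]) (erule (3) eqA, rule that)
        obtain d2 where d2: "0 < d2" "\<And>s t. 0 \<le> s \<Longrightarrow> s \<le> t \<Longrightarrow> t \<le> T \<Longrightarrow> t - s < d2 \<Longrightarrow> norm (\<Xi> z s t - nev_transform (N.x_marginal s t) z) \<le> e * N.strip_mass s t"
          by (rule \<Xi>_near_x_marginal[OF N.st_measure_axioms T z e]) (erule (3) eqB, rule that)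
        show "\<exists>d>0. \<forall>s t'. 0 \<le> s \<and> s \<le> t' \<and> t' \<le> t \<and> t' - s < d \<longrightarrow> norm (D t' - D s) \<le> e * (A t' - A s)"
        proof (intro exI[of _ "min d1 d2"] conjI allI impI)
          fix s t' assume "0 \<le> s \<and> s \<le> t' \<and> t' \<le> t \<and> t' - s < min d1 d2"
          hence st: "0 \<le> s" "s \<le> t'" "t' \<le> T" "t' - s < d1" "t' - s < d2" using t by auto
          have "D t' - D s = (\<Xi> z s t' - nev_transform (N.x_marginal s t') z) - (\<Xi> z s t' - nev_transform (M.x_marginal s t') z)"
            using M.nev_transform_x_marginal_add[OF z st(1,2)] N.nev_transform_x_marginal_add[OF z st(1,2)] by (simp add: D_def)
          hence "norm (D t' - D s) \<le> e * N.strip_mass s t' + e * M.strip_mass s t'"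
            using norm_triangle_ineq4[of "\<Xi> z s t' - nev_transform (N.x_marginal s t') z" "\<Xi> z s t' - nev_transform (M.x_marginal s t') z"]
              d1(2)[OF st(1-4)] d2(2)[OF st(1-3,5)] by simp
          also have "\<dots> = e * (A t' - A s)"
            using M.strip_mass_split[OF st(1,2)] N.strip_mass_split[OF st(1,2)] by (simp add: A_def algebra_simps)
          finally show "norm (D t' - D s) \<le> e * (A t' - A s)" .
        qed (use d1 d2 in auto)
      qed
      moreover have "D 0 = 0" using M.nev_integral_const[OF z, of 0 0] N.nev_integral_const[OF z, of 0 0] by (simp add: D_def)
      ultimately show "nev_transform (M.x_marginal 0 t) z = nev_transform (N.x_marginal 0 t) z" by (simp add: D_def)
    qed
    have red: "emeasure (A.cut T) (X \<times> {..t}) = (if t < 0 then 0 else emeasure (M.x_marginal 0 (min t T)) X)"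
      "emeasure (B.cut T) (X \<times> {..t}) = (if t < 0 then 0 else emeasure (N.x_marginal 0 (min t T)) X)"
      if X: "X \<in> sets borel" for X t
    proof -
      have gen: "emeasure K (X \<times> {..t}) = (if t < 0 then 0 else emeasure (st_measure.x_marginal K 0 (min t T)) X)"
        if "st_measure K" "\<And>B. B \<in> sets borel \<Longrightarrow> emeasure K B = emeasure L (B \<inter> UNIV \<times> {0..T})" for K L
      proof -
        interpret K: st_measure K by fact
        have [simp]: "A \<times> B \<in> sets (borel :: (real \<times> real) measure)" if "A \<in> sets borel" "B \<in> sets borel" for A B
          using rect_borel[OF that] .
        have "emeasure K (X \<times> {..t}) = emeasure K (X \<times> {0..min t T})"
          unfolding that(2)[OF rect_borel[OF X, of "{..t}", simplified]] that(2)[OF rect_borel[OF X, of "{0..min t T}", simplified]]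
          by (rule arg_cong[where f = "emeasure L"]) auto
        also have "\<dots> = (if t < 0 then 0 else emeasure (K.x_marginal 0 (min t T)) X)"
        proof (cases "t < 0")
          case True
          hence "X \<times> {0..min t T} = {}" by auto
          thus ?thesis using True by simp
        next
          case False
          have n: "UNIV \<times> {0} \<in> null_sets K" using K.atomless[of 0] by (auto simp: null_sets_def K.emeasure_eq_measure)
          have "emeasure K (X \<times> {0..min t T}) = emeasure K (X \<times> {0<..min t T})"
          proof (rule emeasure_eq_AE)
            show "AE p in K. p \<in> X \<times> {0..min t T} \<longleftrightarrow> p \<in> X \<times> {0<..min t T}"
              by (rule AE_I'[OF n]) auto
          qed (use X in auto)
          thus ?thesis using False K.x_marginal_emeasure[OF X] by simp
        qed
        finally show ?thesis .
      qed
      show "emeasure (A.cut T) (X \<times> {..t}) = (if t < 0 then 0 else emeasure (M.x_marginal 0 (min t T)) X)"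
        by (rule gen[OF M.st_measure_axioms A.cut_emeasure[OF T]])
      show "emeasure (B.cut T) (X \<times> {..t}) = (if t < 0 then 0 else emeasure (N.x_marginal 0 (min t T)) X)"
        by (rule gen[OF N.st_measure_axioms B.cut_emeasure[OF T]])
    qed
    show ?thesis
    proof (rule rect_unique[OF M.finite_measure_axioms M.sets_N N.sets_N])
      fix X :: "real set" and t assume X: "X \<in> sets borel"
      show "emeasure (A.cut T) (X \<times> {..t}) = emeasure (B.cut T) (X \<times> {..t})"
        unfolding red[OF X] using x_marginal[of "min t T"] I_nonneg[OF T] by auto
    qed
  qed
  show "H' = H" by (rule driving_measure_eqI[OF 2(1) 1(1)]) (rule N[symmetric])
  assume t: "t \<in> I"
  have g0: "\<gamma> 0 = 0" "\<gamma>' 0 = 0" using A.pair B.pair by (auto simp: driving_pair_def)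
  have "of_real (\<gamma> 0 - \<gamma> t) = (of_real (\<gamma>' 0 - \<gamma>' t) :: complex)"
    using driving_equation[OF 1 t order_refl I_nonneg[OF t] order_refl, of \<i>]
      driving_equation[OF 2 t order_refl I_nonneg[OF t] order_refl, of \<i>] N[OF t] by simp
  hence "\<gamma> 0 - \<gamma> t = \<gamma>' 0 - \<gamma>' t" by (simp only: of_real_eq_iff)
  thus "\<gamma>' t = \<gamma> t" using g0 by simp
qed

section \<open>Existence of the driving pair\<close>

context evolution begin

text \<open>Both sides have the same transform.\<close>

lemma \<nu>_add:
  assumes u: "u \<in> I" "0 \<le> s" "s \<le> t" "t \<le> u" and A: "A \<in> sets borel"
  shows "emeasure (\<nu> s u) A = emeasure (\<nu> s t) A + emeasure (\<nu> t u) A"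
proof -
  have t: "t \<in> I" "0 \<le> t" "s \<le> u" using I_down[OF u(1)] u by auto
  obtain M where M: "fin_borel M" "\<And>A. A \<in> sets borel \<Longrightarrow> emeasure M A = emeasure (\<nu> s t) A + emeasure (\<nu> t u) A"
    "\<And>z. 0 < Im z \<Longrightarrow> nev_transform M z = nev_transform (\<nu> s t) z + nev_transform (\<nu> t u) z"
    using add_fin_borel[OF \<nu>(1)[OF t(1) u(2,3)] \<nu>(1)[OF u(1) t(2) u(4)]] by metis
  have "\<nu> s u = M"
  proof (rule nev_transform_inject[OF \<nu>(1)[OF u(1,2) t(3)] M(1)])
    fix z :: complex assume z: "0 < Im z"
    show "nev_transform (\<nu> s u) z = nev_transform M z"
      using sewn_add[OF u z] \<nu>(2)[OF t(1) u(2,3) z] \<nu>(2)[OF u(1) t(2) u(4) z] \<nu>(2)[OF u(1,2) t(3) z] M(3)[OF z] by simp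
  qed
  thus ?thesis using M(2)[OF A] by simp
qed

lemma \<nu>_mass: assumes t: "t \<in> I" "0 \<le> s" "s \<le> t" shows "measure (\<nu> s t) UNIV = Im (sewn \<i> s t)"
  using \<nu>(2)[OF t, of \<i>] fin_borel.nev_transform_i[OF \<nu>(1)[OF t]] by simp

text \<open>The mass is compared with \<open>\<Xi>\<close>, whose value at \<open>\<i>\<close> is small over short times by equicontinuity.\<close>

lemma mass_small:
  assumes T: "T \<in> I" and e: "0 < e"
  obtains d where "0 < d" "\<And>s t. 0 \<le> s \<Longrightarrow> s \<le> t \<Longrightarrow> t \<le> T \<Longrightarrow> t - s < d \<Longrightarrow> Im (sewn \<i> s t) < e"
proof -
  define Z where "Z = {\<i>}"
  have Z: "compact Z" "Z \<subseteq> upper_half_plane" by (auto simp: Z_def upper_half_plane_def)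
  have T0: "0 \<le> T" by (rule I_nonneg[OF T])
  define k where "k = e / (2 * (growth T - growth 0 + 1))"
  have hh: "growth 0 \<le> growth T" by (rule growth_mono[OF T order_refl T0])
  have k: "0 < k" using e hh by (simp add: k_def)
  obtain d1 where d1: "0 < d1" "\<And>s t z. 0 \<le> s \<Longrightarrow> s \<le> t \<Longrightarrow> t \<le> T \<Longrightarrow> t - s < d1 \<Longrightarrow> z \<in> Z \<Longrightarrow> norm (\<Xi> z s t - sewn z s t) \<le> k * (growth t - growth s)"
    using sewn_near_\<Xi>[OF T Z k] by metis
  obtain d2 where d2: "0 < d2" "\<And>s t z. 0 \<le> s \<Longrightarrow> s \<le> t \<Longrightarrow> t \<le> T \<Longrightarrow> t - s < d2 \<Longrightarrow> z \<in> Z \<Longrightarrow> norm (\<phi> s t z - z) < e / 2"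
    using orbit_equicontinuous[OF T Z, of "e / 2"] e by auto
  show ?thesis
  proof (rule that[of "min d1 d2"])
    fix s t assume st: "0 \<le> s" "s \<le> t" "t \<le> T" "t - s < min d1 d2"
    have sI: "s \<in> I" and tI: "t \<in> I" using I_down[OF T] st by auto
    have "\<bar>Im (\<Xi> \<i> s t - sewn \<i> s t)\<bar> \<le> k * (growth t - growth s)"
      using d1(2)[of s t \<i>] st abs_Im_le_cmod[of "\<Xi> \<i> s t - sewn \<i> s t"] by (simp add: Z_def)
    moreover have "k * (growth t - growth s) \<le> k * (growth T - growth 0 + 1)"
      using growth_mono[OF T _ st(3)] growth_mono[OF sI order_refl st(1)] st k by (intro mult_left_mono) auto
    moreover have "k * (growth T - growth 0 + 1) = e / 2"
    proof -
      have "growth T - growth 0 + 1 \<noteq> 0" using hh by simp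
      thus ?thesis by (simp add: k_def field_simps)
    qed
    moreover have "Im (\<Xi> \<i> s t) \<le> norm (\<phi> s t \<i> - \<i>)"
      using abs_Im_le_cmod[of "\<phi> s t \<i> - \<i>"] by (simp add: \<Xi>_def)
    ultimately show "Im (sewn \<i> s t) < e" using d2(2)[of s t \<i>] st by (simp add: Z_def)
  qed (use d1 d2 in auto)
qed

lemma space_time_measure:
  assumes T: "T \<in> I"
  obtains N where "st_measure N" "\<And>t A. 0 \<le> t \<Longrightarrow> t \<le> T \<Longrightarrow> A \<in> sets borel \<Longrightarrow> emeasure N (A \<times> {..t}) = emeasure (\<nu> 0 t) A"
    "emeasure N (UNIV \<times> {T<..}) = 0"
proof -
  have T0: "0 \<le> T" by (rule I_nonneg[OF T])
  have tI: "t \<in> I" if "0 \<le> t" "t \<le> T" for t using I_down[OF T that] .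
  have mono: "emeasure (\<nu> 0 s) A \<le> emeasure (\<nu> 0 t) A" if "0 \<le> s" "s \<le> t" "t \<le> T" "A \<in> sets borel" for s t A
    using \<nu>_add[OF tI order_refl that(1,2) that(4)] that by simp
  have mass: "measure (\<nu> 0 t) UNIV - measure (\<nu> 0 s) UNIV = Im (sewn \<i> s t)" if "0 \<le> s" "s \<le> t" "t \<le> T" for s t
  proof -
    have t: "t \<in> I" "0 \<le> t" using tI[of t] that by auto
    have s: "s \<in> I" using tI[of s] that by auto
    show ?thesis using \<nu>_mass[OF t(1) order_refl t(2)] \<nu>_mass[OF s order_refl that(1)] sewn_add[OF t(1) order_refl that(1,2), of \<i>] by simp
  qed
  have cont: "continuous_on {0..T} (\<lambda>t. measure (\<nu> 0 t) UNIV)"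
    unfolding continuous_on_iff
  proof (intro ballI allI impI)
    fix t and e :: real assume t: "t \<in> {0..T}" and e: "0 < e"
    obtain d where d: "0 < d" "\<And>s t. 0 \<le> s \<Longrightarrow> s \<le> t \<Longrightarrow> t \<le> T \<Longrightarrow> t - s < d \<Longrightarrow> Im (sewn \<i> s t) < e"
      using mass_small[OF T e] by metis
    have *: "\<bar>measure (\<nu> 0 t) UNIV - measure (\<nu> 0 s) UNIV\<bar> < e" if "0 \<le> s" "s \<le> t" "t \<le> T" "t - s < d" for s t
      using mass[OF that(1-3)] d(2)[OF that] Im_f_nonneg[OF tI that(1,2), of \<i>] that by simp
    show "\<exists>d>0. \<forall>t'\<in>{0..T}. dist t' t < d \<longrightarrow> dist (measure (\<nu> 0 t') UNIV) (measure (\<nu> 0 t) UNIV) < e"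
    proof (intro exI[of _ d] conjI ballI impI d(1))
      fix t' assume t': "t' \<in> {0..T}" "dist t' t < d"
      show "dist (measure (\<nu> 0 t') UNIV) (measure (\<nu> 0 t) UNIV) < e"
        using *[of t t'] *[of t' t] t t' by (cases "t \<le> t'") (auto simp: dist_real_def abs_minus_commute)
    qed
  qed
  have zero: "emeasure (\<nu> 0 0) UNIV = 0"
  proof -
    interpret F: fin_borel "\<nu> 0 0" by (rule \<nu>(1)[OF I0]) auto
    have "sewn \<i> 0 0 = 0" using sewn_add[OF I0, of 0 0 \<i>] by simp
    thus ?thesis using \<nu>_mass[OF I0, of 0] by (simp add: F.emeasure_eq_measure)
  qed
  obtain N where N: "finite_measure N" "sets N = sets borel"
    "\<And>t A. 0 \<le> t \<Longrightarrow> t \<le> T \<Longrightarrow> A \<in> sets borel \<Longrightarrow> emeasure N (A \<times> {..t}) = emeasure (\<nu> 0 t) A"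
    "emeasure N (UNIV \<times> {T<..}) = 0"
    by (rule disintegrate[OF T0 \<nu>(1)[OF tI order_refl] mono zero cont]) (assumption+, rule that)
  interpret N: finite_measure N by (rule N(1))
  have rb: "A \<times> B \<in> sets N" if "A \<in> sets borel" "B \<in> sets borel" for A B using rect_borel[OF that] N(2) by simp
  have up: "measure N (UNIV \<times> {..t}) = measure (\<nu> 0 t) UNIV" if "0 \<le> t" "t \<le> T" for t
    using N(3)[OF that, of UNIV] by (simp add: measure_def)
  have "measure N (UNIV \<times> {t}) = 0" for t
  proof -
    consider "t < 0" | "t = 0" | "0 < t" "t \<le> T" | "T < t" by linarith
    thus ?thesis
    proof cases
      case 1
      have "emeasure N (UNIV \<times> {t}) \<le> emeasure N (UNIV \<times> {..0})" using 1 rb by (intro emeasure_mono) auto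
      thus ?thesis using N(3)[OF order_refl T0, of UNIV] zero by (simp add: measure_def)
    next
      case 2
      have "emeasure N (UNIV \<times> {t}) \<le> emeasure N (UNIV \<times> {..0})" using 2 rb by (intro emeasure_mono) auto
      thus ?thesis using N(3)[OF order_refl T0, of UNIV] zero by (simp add: measure_def)
    next
      case 4
      have "emeasure N (UNIV \<times> {t}) \<le> emeasure N (UNIV \<times> {T<..})" using 4 rb by (intro emeasure_mono) auto
      thus ?thesis using N(4) by (simp add: measure_def)
    next
      case 3
      have "measure N (UNIV \<times> {t}) \<le> 0"
      proof (rule field_le_epsilon)
        fix e :: real assume e: "0 < e"
        obtain d where d: "0 < d" "\<And>s t. 0 \<le> s \<Longrightarrow> s \<le> t \<Longrightarrow> t \<le> T \<Longrightarrow> t - s < d \<Longrightarrow> Im (sewn \<i> s t) < e"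
          using mass_small[OF T e] by metis
        define s where "s = max 0 (t - d / 2)"
        have s: "0 \<le> s" "s < t" "t - s < d" using 3 d by (auto simp: s_def)
        have "measure N (UNIV \<times> {t}) \<le> measure N (UNIV \<times> {..t} - UNIV \<times> {..s})"
          using s rb by (intro N.finite_measure_mono) auto
        also have "\<dots> = measure N (UNIV \<times> {..t}) - measure N (UNIV \<times> {..s})"
          using s rb by (intro N.finite_measure_Diff) auto
        also have "\<dots> = Im (sewn \<i> s t)" using up[of t] up[of s] mass[of s t] s 3 by simp
        finally show "measure N (UNIV \<times> {t}) \<le> 0 + e" using d(2)[of s t] s 3 by simp
      qed
      thus ?thesis using measure_nonneg[of N "UNIV \<times> {t}"] by linarith
    qed
  qed
  hence "st_measure N" using N by (intro st_measure.intro st_measure_axioms.intro) auto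
  thus ?thesis using that N(3,4) by blast
qed

definition space_time :: "real \<Rightarrow> (real \<times> real) measure" where
  "space_time T = (SOME N. st_measure N \<and> (\<forall>t A. 0 \<le> t \<longrightarrow> t \<le> T \<longrightarrow> A \<in> sets borel \<longrightarrow> emeasure N (A \<times> {..t}) = emeasure (\<nu> 0 t) A) \<and>
    emeasure N (UNIV \<times> {T<..}) = 0)"

lemma space_time:
  assumes T: "T \<in> I"
  shows "st_measure (space_time T)" "\<And>t A. 0 \<le> t \<Longrightarrow> t \<le> T \<Longrightarrow> A \<in> sets borel \<Longrightarrow> emeasure (space_time T) (A \<times> {..t}) = emeasure (\<nu> 0 t) A"
    "emeasure (space_time T) (UNIV \<times> {T<..}) = 0"
proof -
  have "st_measure (space_time T) \<and> (\<forall>t A. 0 \<le> t \<longrightarrow> t \<le> T \<longrightarrow> A \<in> sets borel \<longrightarrow> emeasure (space_time T) (A \<times> {..t}) = emeasure (\<nu> 0 t) A) \<and>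
    emeasure (space_time T) (UNIV \<times> {T<..}) = 0"
    unfolding space_time_def by (rule someI_ex) (use space_time_measure[OF T] in metis)
  thus "st_measure (space_time T)" "\<And>t A. 0 \<le> t \<Longrightarrow> t \<le> T \<Longrightarrow> A \<in> sets borel \<Longrightarrow> emeasure (space_time T) (A \<times> {..t}) = emeasure (\<nu> 0 t) A"
    "emeasure (space_time T) (UNIV \<times> {T<..}) = 0" by auto
qed

lemma space_time_rect:
  assumes T: "T \<in> I" and A: "A \<in> sets borel"
  shows "emeasure (space_time T) (A \<times> {..t}) = (if t < 0 then 0 else emeasure (\<nu> 0 (min t T)) A)"
proof -
  interpret N: st_measure "space_time T" by (rule space_time(1)[OF T])
  have T0: "0 \<le> T" by (rule I_nonneg[OF T])
  have m: "A \<times> B \<in> sets (space_time T)" if "B \<in> sets borel" for B using rect_borel[OF A that] by simp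
  consider "t < 0" | "0 \<le> t" "t \<le> T" | "T < t" by linarith
  thus ?thesis
  proof cases
    case 1
    have "emeasure (space_time T) (A \<times> {..t}) \<le> emeasure (space_time T) (UNIV \<times> {..0})" using 1 by (intro emeasure_mono) auto
    also have "\<dots> = 0"
    proof -
      interpret F: fin_borel "\<nu> 0 0" by (rule \<nu>(1)[OF I0]) auto
      have "sewn \<i> 0 0 = 0" using sewn_add[OF I0, of 0 0 \<i>] by simp
      thus ?thesis using space_time(2)[OF T order_refl T0, of UNIV] \<nu>_mass[OF I0, of 0] by (simp add: F.emeasure_eq_measure)
    qed
    finally show ?thesis using 1 by simp
  next
    case 2 thus ?thesis using space_time(2)[OF T _ _ A] by simp
  next
    case 3
    have "UNIV \<times> {T<..} \<in> null_sets (space_time T)" using space_time(3)[OF T] rect_borel[of UNIV "{T<..}"] by (auto simp: null_sets_def)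
    hence ae: "AE p in space_time T. p \<in> A \<times> {..t} \<longleftrightarrow> p \<in> A \<times> {..T}" by (rule AE_I') (use 3 in auto)
    have "emeasure (space_time T) (A \<times> {..t}) = emeasure (space_time T) (A \<times> {..T})"
      by (rule emeasure_eq_AE[OF ae]) (use m in auto)
    thus ?thesis using space_time(2)[OF T T0 order_refl A] 3 T0 by simp
  qed
qed

text \<open>Both measures have the same values on the rectangles that generate the Borel sets.\<close>

lemma space_time_consistent:
  assumes T: "T \<in> I" "T' \<in> I" "T' \<le> T" and B: "B \<in> sets borel"
  shows "emeasure (space_time T') B = emeasure (space_time T) (B \<inter> UNIV \<times> {..T'})"
proof -
  interpret M: st_measure "space_time T'" by (rule space_time(1)[OF T(2)])
  interpret N: st_measure "space_time T" by (rule space_time(1)[OF T(1)])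
  have St: "UNIV \<times> {..T'} \<in> sets (borel :: (real \<times> real) measure)" by (rule rect_borel) auto
  define K where "K = density (space_time T) (indicator (UNIV \<times> {..T'}))"
  have K: "emeasure K B = emeasure (space_time T) (B \<inter> UNIV \<times> {..T'})" if "B \<in> sets borel" for B
  proof -
    have "emeasure K B = (\<integral>\<^sup>+p. indicator (UNIV \<times> {..T'}) p * indicator B p \<partial>space_time T)"
      unfolding K_def by (rule emeasure_density) (use that St in auto)
    also have "\<dots> = (\<integral>\<^sup>+p. indicator (B \<inter> UNIV \<times> {..T'}) p \<partial>space_time T)" by (intro nn_integral_cong) (auto simp: indicator_def)
    finally show ?thesis using that St by simp
  qed
  have "space_time T' = K"
  proof (rule rect_unique[OF M.finite_measure_axioms M.sets_N])
    show "sets K = sets borel" by (simp add: K_def)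
    fix A :: "real set" and t assume A: "A \<in> sets borel"
    have "A \<times> {..t} \<inter> UNIV \<times> {..T'} = A \<times> {..min t T'}" by auto
    hence "emeasure K (A \<times> {..t}) = emeasure (space_time T) (A \<times> {..min t T'})" using K[OF rect_borel[OF A, of "{..t}"]] by simp
    thus "emeasure (space_time T') (A \<times> {..t}) = emeasure K (A \<times> {..t})"
      using T I_nonneg[OF T(2)] by (auto simp: space_time_rect[OF T(1) A] space_time_rect[OF T(2) A] min_def)
  qed
  thus ?thesis using K[OF B] by simp
qed

text \<open>If the time interval has no last point, the measures up to the times of a cofinal sequence increase to the one sought.\<close>

lemma driving_measure_exists:
  obtains H where "sets H = sets (restrict_space borel (UNIV \<times> I))"
    "\<And>T B. T \<in> I \<Longrightarrow> B \<in> sets borel \<Longrightarrow> emeasure H (B \<inter> UNIV \<times> {0..T}) = emeasure (space_time T) B"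
proof -
  obtain T :: "nat \<Rightarrow> real" where T: "mono T" "\<And>n. T n \<in> I" "\<And>t. t \<in> I \<Longrightarrow> \<exists>n. t \<le> T n"
    using cofinal_sequence[OF I] by metis
  let ?K = "restrict_space borel (UNIV \<times> I) :: (real \<times> real) measure"
  have UI: "UNIV \<times> I \<in> sets (borel :: (real \<times> real) measure)" by (rule rect_borel[OF _ time_interval_borel[OF I]]) simp
  have inK: "B \<in> sets ?K \<longleftrightarrow> B \<in> sets borel \<and> B \<subseteq> UNIV \<times> I" for B
    using UI by (subst sets_restrict_space_iff) auto
  define M where "M = (\<lambda>n. restrict_space (space_time (T n)) (UNIV \<times> I))"
  have sM: "sets (M n) = sets ?K" for n
    unfolding M_def by (intro sets_restrict_space_cong st_measure.sets_N space_time T)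
  have eM: "emeasure (M n) B = emeasure (space_time (T n)) B" if "B \<in> sets ?K" for B n
    unfolding M_def
  proof (rule emeasure_restrict_space)
    interpret N: st_measure "space_time (T n)" by (rule space_time(1)[OF T(2)])
    show "UNIV \<times> I \<inter> space (space_time (T n)) \<in> sets (space_time (T n))" using UI by simp
  qed (use that inK in auto)
  have inc: "emeasure (M n) B \<le> emeasure (M (Suc n)) B" if B: "B \<in> sets ?K" for B n
  proof -
    interpret N: st_measure "space_time (T (Suc n))" by (rule space_time(1)[OF T(2)])
    have "emeasure (space_time (T n)) B \<le> emeasure (space_time (T (Suc n))) B"
      using space_time_consistent[OF T(2) T(2) monoD[OF T(1)], of n "Suc n" B] B inK
      by (auto intro!: emeasure_mono)
    thus ?thesis by (simp add: eM[OF B])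
  qed
  obtain H where H: "sets H = sets ?K" "\<And>A. A \<in> sets ?K \<Longrightarrow> emeasure H A = (SUP n. emeasure (M n) A)"
    using increasing_measure_limit[of M ?K, OF sM inc] by metis
  show ?thesis
  proof (rule that[OF H(1)])
    fix t B assume t: "t \<in> I" and B: "B \<in> sets (borel :: (real \<times> real) measure)"
    interpret N: st_measure "space_time t" by (rule space_time(1)[OF t])
    define C where "C = B \<inter> UNIV \<times> {0..t}"
    have Cb: "C \<in> sets borel" unfolding C_def using B rect_borel[of UNIV "{0..t}"] by auto
    have CK: "C \<in> sets ?K" unfolding inK using Cb I_down[OF t] by (auto simp: C_def)
    have tN: "emeasure (space_time t) C = emeasure (space_time t) B"
    proof (rule emeasure_eq_AE)
      have "emeasure (space_time t) (UNIV \<times> {..0}) = 0" using space_time_rect[OF t, of UNIV 0] space_time_rect[OF I0, of UNIV 0] space_time_rect[OF t, of UNIV 0] I_nonneg[OF t]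
          \<nu>_mass[OF I0, of 0] sewn_add[OF I0, of 0 0 \<i>] fin_borel.axioms(1)[OF \<nu>(1)[OF I0, of 0]]
        by (simp add: finite_measure.emeasure_eq_measure)
      hence "UNIV \<times> {..0} \<union> UNIV \<times> {t<..} \<in> null_sets (space_time t)"
        using space_time(3)[OF t] rect_borel[of UNIV "{t<..}"] rect_borel[of UNIV "{..0}"] by (intro null_sets.Un) (auto simp: null_sets_def)
      thus "AE p in space_time t. p \<in> C \<longleftrightarrow> p \<in> B" by (rule AE_I') (auto simp: C_def)
    qed (use B Cb in auto)
    obtain n where n: "t \<le> T n" using T(3)[OF t] by blast
    have le: "emeasure (M k) C \<le> emeasure (space_time t) C" for k
    proof (cases "t \<le> T k")
      case True
      have "C \<inter> UNIV \<times> {..t} = C" by (auto simp: C_def)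
      thus ?thesis using space_time_consistent[OF T(2) t True Cb] by (simp add: eM[OF CK])
    next
      case False
      thus ?thesis using space_time_consistent[OF t T(2) _ Cb, of k] Cb by (auto simp: eM[OF CK] intro!: emeasure_mono)
    qed
    have eq: "emeasure (M n) C = emeasure (space_time t) C"
    proof -
      have "C \<inter> UNIV \<times> {..t} = C" by (auto simp: C_def)
      thus ?thesis using space_time_consistent[OF T(2) t n Cb] by (simp add: eM[OF CK])
    qed
    have "emeasure H C = (SUP k. emeasure (M k) C)" by (rule H(2)[OF CK])
    also have "\<dots> = emeasure (space_time t) C"
      by (rule antisym[OF SUP_least[OF le]]) (rule SUP_upper2[of n], simp, simp add: eq)
    finally show "emeasure H (B \<inter> UNIV \<times> {0..t}) = emeasure (space_time t) B" using tN by (simp add: C_def)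
  qed
qed

lemma nev_transform_x_marginal_space_time:
  assumes T: "T \<in> I" and st: "0 \<le> s" "s \<le> t" "t \<le> T" and z: "0 < Im z"
  shows "nev_transform (st_measure.x_marginal (space_time T) s t) z = sewn z s t"
proof -
  interpret N: st_measure "space_time T" by (rule space_time(1)[OF T])
  have 0: "nev_transform (N.x_marginal 0 t) z = sewn z 0 t" if t: "0 \<le> t" "t \<le> T" for t
  proof -
    have tI: "t \<in> I" using I_down[OF T t] .
    interpret F: fin_borel "\<nu> 0 t" by (rule \<nu>(1)[OF tI order_refl t(1)])
    interpret G: fin_borel "N.x_marginal 0 t" by (rule N.x_marginal_fin)
    have "N.x_marginal 0 t = \<nu> 0 t"
    proof (rule measure_eqI)
      fix A assume "A \<in> sets (N.x_marginal 0 t)"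
      hence A: "A \<in> sets borel" by simp
      have e0: "emeasure (space_time T) (UNIV \<times> {..0}) = 0"
        using space_time_rect[OF T, of UNIV 0] I_nonneg[OF T] \<nu>_mass[OF I0, of 0] sewn_add[OF I0, of 0 0 \<i>] fin_borel.axioms(1)[OF \<nu>(1)[OF I0, of 0]]
        by (simp add: finite_measure.emeasure_eq_measure)
      hence "UNIV \<times> {..0} \<in> null_sets (space_time T)" using rect_borel[of UNIV "{..0}"] by (auto simp: null_sets_def)
      hence ae: "AE p in space_time T. p \<in> A \<times> {0<..t} \<longleftrightarrow> p \<in> A \<times> {..t}" by (rule AE_I') auto
      have "emeasure (space_time T) (A \<times> {0<..t}) = emeasure (space_time T) (A \<times> {..t})"
        by (rule emeasure_eq_AE[OF ae]) (use A rect_borel in auto)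
      thus "emeasure (N.x_marginal 0 t) A = emeasure (\<nu> 0 t) A"
        using space_time(2)[OF T t A] N.x_marginal_emeasure[OF A] by simp
    qed simp
    thus ?thesis using \<nu>(2)[OF tI order_refl t(1) z] by simp
  qed
  have tI: "t \<in> I" using I_down[OF T] st by auto
  show ?thesis
    using N.nev_transform_x_marginal_add[OF z st(1,2)] 0[of t] 0[of s] st sewn_add[OF tI order_refl st(1,2) z] by simp
qed

end

context evolution begin

lemma cut_eq_space_time:
  assumes "driving I \<gamma> H" and H: "\<And>T B. T \<in> I \<Longrightarrow> B \<in> sets borel \<Longrightarrow> emeasure H (B \<inter> UNIV \<times> {0..T}) = emeasure (space_time T) B"
    and T: "T \<in> I"
  shows "driving.cut H T = space_time T"
proof -
  interpret D: driving I \<gamma> H by fact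
  interpret A: st_measure "D.cut T" by (rule D.cut_st[OF T])
  interpret B: st_measure "space_time T" by (rule space_time(1)[OF T])
  show ?thesis by (rule measure_eqI) (auto simp: D.cut_emeasure[OF T] H[OF T])
qed

text \<open>Over a short time the increment of the curve is the drift plus \<open>\<Xi>\<close> at its current point, \<open>\<Xi>\<close> is close to \<open>sewn\<close>, and \<open>sewn\<close>
is the integral of the kernel with the curve frozen.\<close>

lemma drift:
  assumes T: "T \<in> I" and s: "0 \<le> s" "s \<le> T" and z: "0 < Im z"
  defines "D \<equiv> (\<lambda>s z t. \<phi> s t z - st_measure.nev_integral (space_time T) (\<lambda>u. \<phi> s u z) s t)"
  shows "\<forall>e>0. \<exists>d>0. \<forall>t t'. s \<le> t \<and> t \<le> t' \<and> t' \<le> T \<and> t' - t < d \<longrightarrow>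
    norm (D s z t' - D s z t - of_real (Re (\<phi> t t' \<i>))) \<le> e * ((growth t' + st_measure.strip_mass (space_time T) 0 t') - (growth t + st_measure.strip_mass (space_time T) 0 t))"
proof (intro allI impI)
  fix e :: real assume e: "0 < e"
  interpret N: st_measure "space_time T" by (rule space_time(1)[OF T])
  have sI: "s \<in> I" by (rule I_down[OF T s])
  define w where "w = (\<lambda>t. \<phi> s t z)"
  define Z where "Z = w ` {s..T}"
  have cw: "continuous_on {s..T} w" unfolding w_def by (rule \<phi>_time_continuous[OF T s(1) z])
  have wp: "0 < Im (w t)" if "s \<le> t" "t \<le> T" for t
    using \<phi>_pos[OF I_down[OF T] s(1) that(1) z] that s by (auto simp: w_def)
  have Z: "compact Z" "Z \<subseteq> upper_half_plane"
    using cw wp unfolding Z_def by (auto intro!: compact_continuous_image simp: upper_half_plane_def)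
  obtain R where R: "0 < R" "Z \<subseteq> region R" using compact_subset_region[OF Z] by blast
  define e' where "e' = e / R\<^sup>2"
  have e': "0 < e'" using e R by (simp add: e'_def)
  obtain d1 where d1: "0 < d1" "\<And>t t' z. 0 \<le> t \<Longrightarrow> t \<le> t' \<Longrightarrow> t' \<le> T \<Longrightarrow> t' - t < d1 \<Longrightarrow> z \<in> Z \<Longrightarrow> norm (\<Xi> z t t' - sewn z t t') \<le> e * (growth t' - growth t)"
    using sewn_near_\<Xi>[OF T Z e] by metis
  obtain d2 where d2: "0 < d2" "\<And>t t' z. 0 \<le> t \<Longrightarrow> t \<le> t' \<Longrightarrow> t' \<le> T \<Longrightarrow> t' - t < d2 \<Longrightarrow> z \<in> Z \<Longrightarrow> norm (\<phi> t t' z - z) < e'"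
    using orbit_equicontinuous[OF T Z e'] by metis
  have ad: "N.admissible R w s T" by (rule N.admissibleI_cont[OF cw]) (use R in \<open>auto simp: Z_def\<close>)
  show "\<exists>d>0. \<forall>t t'. s \<le> t \<and> t \<le> t' \<and> t' \<le> T \<and> t' - t < d \<longrightarrow>
    norm (D s z t' - D s z t - of_real (Re (\<phi> t t' \<i>))) \<le> e * ((growth t' + N.strip_mass 0 t') - (growth t + N.strip_mass 0 t))"
  proof (intro exI[of _ "min d1 d2"] conjI allI impI)
    fix t t' assume "s \<le> t \<and> t \<le> t' \<and> t' \<le> T \<and> t' - t < min d1 d2"
    hence t: "s \<le> t" "t \<le> t'" "t' \<le> T" "t' - t < d1" "t' - t < d2" by auto
    have t0: "0 \<le> t" "t \<le> T" using t s by auto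
    have t'I: "t' \<in> I" using I_down[OF T] t t0 by auto
    have wZ: "w t \<in> Z" using t t0 by (auto simp: Z_def)
    have Jadd: "N.nev_integral w s t' = N.nev_integral w s t + N.nev_integral w t t'" by (rule N.nev_integral_add[OF N.admissible_sub[OF ad]]) (use t in auto)
    have 1: "norm (\<Xi> (w t) t t' - sewn (w t) t t') \<le> e * (growth t' - growth t)" by (rule d1(2)[OF t0(1) t(2-4) wZ])
    have 2: "norm (N.nev_integral (\<lambda>_. w t) t t' - N.nev_integral w t t') \<le> e * N.strip_mass t t'"
    proof -
      have "norm (N.nev_integral (\<lambda>_. w t) t t' - N.nev_integral w t t') \<le> R\<^sup>2 * e' * N.strip_mass t t'"
      proof (rule N.nev_integral_diff_le)
        show "N.admissible R (\<lambda>_. w t) t t'" using wZ R by (intro N.admissible_const) auto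
        show "N.admissible R w t t'" by (rule N.admissible_sub[OF ad]) (use t in auto)
        fix u assume u: "u \<in> {t<..t'}"
        have "w u = \<phi> t u (w t)"
          using \<phi>_comp[OF I_down[OF T] s(1) t(1) _ z, of u] u t t0 by (simp add: w_def)
        thus "norm (w t - w u) \<le> e'" using d2(2)[of t u "w t"] u t t0 wZ by (simp add: norm_minus_commute less_imp_le)
      qed
      thus ?thesis using R by (simp add: e'_def)
    qed
    have f: "sewn (w t) t t' = N.nev_integral (\<lambda>_. w t) t t'"
      using nev_transform_x_marginal_space_time[OF T t0(1) t(2,3) wp[OF t(1) t0(2)]] N.nev_integral_const[OF wp[OF t(1) t0(2)]] by simp
    have "w t' - w t = of_real (Re (\<phi> t t' \<i>)) + \<Xi> (w t) t t'"
      unfolding w_def by (rule \<phi>_step[OF t'I s(1) t(1,2) z])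
    moreover have Dx: "D s z x = w x - N.nev_integral w s x" for x by (simp add: D_def w_def)
    ultimately have "D s z t' - D s z t - of_real (Re (\<phi> t t' \<i>)) = (\<Xi> (w t) t t' - sewn (w t) t t') + (N.nev_integral (\<lambda>_. w t) t t' - N.nev_integral w t t')"
      unfolding Dx Jadd f by (simp add: algebra_simps)
    hence "norm (D s z t' - D s z t - of_real (Re (\<phi> t t' \<i>))) \<le> e * (growth t' - growth t) + e * N.strip_mass t t'"
      using norm_triangle_mono[OF 1 2] by simp
    also have "\<dots> = e * ((growth t' + N.strip_mass 0 t') - (growth t + N.strip_mass 0 t))"
      using N.strip_mass_split[OF t0(1) t(2)] by (simp add: algebra_simps)
    finally show "norm (D s z t' - D s z t - of_real (Re (\<phi> t t' \<i>))) \<le> e * ((growth t' + N.strip_mass 0 t') - (growth t + N.strip_mass 0 t))" .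
  qed (use d1 d2 in auto)
qed

text \<open>The curve from \<open>z\<close> at time \<open>s\<close> and the curve from \<open>\<i>\<close> at time \<open>0\<close> have the same drift, so the difference of their
non-integral parts is constant in time.\<close>

lemma driven_equation_space_time:
  assumes T: "T \<in> I" and s: "0 \<le> s" "s \<le> T" and z: "0 < Im z"
  defines "G \<equiv> (\<lambda>t. - Re (\<phi> 0 t \<i> - st_measure.nev_integral (space_time T) (\<lambda>u. \<phi> 0 u \<i>) 0 t))"
  shows "\<phi> s T z = z + of_real (G s) - of_real (G T) + st_measure.nev_integral (space_time T) (\<lambda>u. \<phi> s u z) s T"
proof -
  interpret N: st_measure "space_time T" by (rule space_time(1)[OF T])
  have T0: "0 \<le> T" by (rule I_nonneg[OF T])
  define D where "D = (\<lambda>s z t. \<phi> s t z - N.nev_integral (\<lambda>u. \<phi> s u z) s t)"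
  define A where "A = (\<lambda>t. growth t + N.strip_mass 0 t)"
  have "D s z T + of_real (G T) = D s z s + of_real (G s)"
  proof (rule increments_zero[OF s(2), of A])
    show "A s \<le> A T" unfolding A_def using growth_mono[OF T s] N.strip_mass_mono[of 0 0 s T] s by simp
    fix e :: real assume e: "0 < e"
    have e2: "0 < e / 2" using e by simp
    obtain d1 where d1: "0 < d1" "\<forall>t t'. s \<le> t \<and> t \<le> t' \<and> t' \<le> T \<and> t' - t < d1 \<longrightarrow>
      norm (D s z t' - D s z t - of_real (Re (\<phi> t t' \<i>))) \<le> e / 2 * (A t' - A t)"
      using drift[OF T s z, THEN spec, THEN mp, OF e2] unfolding D_def A_def by blast
    have i: "0 < Im \<i>" by simp
    obtain d2 where d2: "0 < d2" "\<forall>t t'. 0 \<le> t \<and> t \<le> t' \<and> t' \<le> T \<and> t' - t < d2 \<longrightarrow>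
      norm (D 0 \<i> t' - D 0 \<i> t - of_real (Re (\<phi> t t' \<i>))) \<le> e / 2 * (A t' - A t)"
      using drift[OF T order_refl T0 i, THEN spec, THEN mp, OF e2] unfolding D_def A_def by blast
    show "\<exists>d>0. \<forall>t t'. s \<le> t \<and> t \<le> t' \<and> t' \<le> T \<and> t' - t < d \<longrightarrow>
      norm (D s z t' + of_real (G t') - (D s z t + of_real (G t))) \<le> e * (A t' - A t)"
    proof (intro exI[of _ "min d1 d2"] conjI allI impI)
      fix t t' assume "s \<le> t \<and> t \<le> t' \<and> t' \<le> T \<and> t' - t < min d1 d2"
      hence t: "s \<le> t" "t \<le> t'" "t' \<le> T" "t' - t < d1" "t' - t < d2" by auto
      define X where "X = D s z t' - D s z t - of_real (Re (\<phi> t t' \<i>))"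
      define Y where "Y = D 0 \<i> t' - D 0 \<i> t - of_real (Re (\<phi> t t' \<i>))"
      have X: "norm X \<le> e / 2 * (A t' - A t)" unfolding X_def using d1(2) t(1-4) by blast
      have Y: "norm Y \<le> e / 2 * (A t' - A t)" unfolding Y_def using d2(2) t(2,3,5) order_trans[OF s(1) t(1)] by blast
      have "G t' - G t = - (Re (\<phi> t t' \<i>)) - Re Y" by (simp add: G_def Y_def D_def)
      from arg_cong[OF this, of complex_of_real]
      have "D s z t' + of_real (G t') - (D s z t + of_real (G t)) = X - of_real (Re Y)"
        unfolding X_def by (simp add: algebra_simps)
      hence "norm (D s z t' + of_real (G t') - (D s z t + of_real (G t))) \<le> norm X + norm Y"
        using norm_triangle_ineq4[of X "of_real (Re Y)"] abs_Re_le_cmod[of Y] by simp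
      thus "norm (D s z t' + of_real (G t') - (D s z t + of_real (G t))) \<le> e * (A t' - A t)" using X Y by simp
    qed (use d1 d2 in auto)
  qed
  moreover have "D s z s = z" using \<phi>_refl[OF I_down[OF T s] z] by (simp add: D_def)
  ultimately show ?thesis by (simp add: D_def algebra_simps)
qed

lemma continuous_on_time_interval:
  fixes g :: "real \<Rightarrow> real"
  assumes "\<And>T. T \<in> I \<Longrightarrow> continuous_on {0..T} g" shows "continuous_on I g"
  unfolding continuous_on_iff
proof (intro ballI allI impI)
  fix t and e :: real assume t: "t \<in> I" and e: "0 < e"
  \<comment> \<open>a time that bounds a neighbourhood of \<open>t\<close> in \<open>I\<close>\<close>
  obtain T r where T: "T \<in> I" "0 < r" "\<And>t'. t' \<in> I \<Longrightarrow> \<bar>t' - t\<bar> < r \<Longrightarrow> t' \<le> T" "t \<le> T"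
  proof (cases "\<exists>T\<in>I. t < T")
    case True
    then obtain T where "T \<in> I" "t < T" by blast
    thus ?thesis using that[of T "T - t"] by auto
  next
    case False
    thus ?thesis using that[OF t zero_less_one] by (auto simp: not_less)
  qed
  have "t \<in> {0..T}" using I_nonneg[OF t] T by auto
  with assms[OF T(1)] e obtain d where d: "0 < d" "\<And>t'. t' \<in> {0..T} \<Longrightarrow> dist t' t < d \<Longrightarrow> dist (g t') (g t) < e"
    unfolding continuous_on_iff by metis
  show "\<exists>d>0. \<forall>t'\<in>I. dist t' t < d \<longrightarrow> dist (g t') (g t) < e"
    by (intro exI[of _ "min r d"]) (use d T I_nonneg in \<open>auto simp: dist_real_def\<close>)
qed

theorem pair_exists:
  obtains \<gamma> H where "driving_pair I \<gamma> H" "evolution_equation I \<phi> \<gamma> H"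
proof -
  obtain H where sH: "sets H = sets (restrict_space borel (UNIV \<times> I))"
    and eH: "\<And>T B. T \<in> I \<Longrightarrow> B \<in> sets borel \<Longrightarrow> emeasure H (B \<inter> UNIV \<times> {0..T}) = emeasure (space_time T) B"
    using driving_measure_exists by metis
  have fin: "emeasure H (UNIV \<times> {0..t}) < \<infinity>" "emeasure H (UNIV \<times> {t}) = 0" if t: "t \<in> I" for t
  proof -
    interpret N: st_measure "space_time t" by (rule space_time(1)[OF t])
    show "emeasure H (UNIV \<times> {0..t}) < \<infinity>" using eH[OF t, of UNIV] by (simp add: less_top[symmetric])
    have "UNIV \<times> {t} \<inter> UNIV \<times> {0..t} = (UNIV :: real set) \<times> {t}" using I_nonneg[OF t] by auto
    thus "emeasure H (UNIV \<times> {t}) = 0"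
      using eH[OF t rect_borel[of UNIV "{t}"]] N.atomless[of t] by (simp add: N.emeasure_eq_measure)
  qed
  have pre: "driving_pair I (\<lambda>_. 0) H" using sH fin by (simp add: driving_pair_def)
  interpret D0: driving I "\<lambda>_. 0" H by (intro driving.intro I pre)
  have cut: "D0.cut T = space_time T" if "T \<in> I" for T by (rule cut_eq_space_time[OF D0.driving_axioms eH that])
  define G where "G = (\<lambda>T t. - Re (\<phi> 0 t \<i> - st_measure.nev_integral (space_time T) (\<lambda>u. \<phi> 0 u \<i>) 0 t))"
  define \<gamma> where "\<gamma> = (\<lambda>t. G t t)"
  have ci: "continuous_on {0..t} (\<lambda>u. \<phi> 0 u \<i>)" if "t \<in> I" for t by (rule \<phi>_time_continuous[OF that]) auto
  have pi: "0 < Im (\<phi> 0 u \<i>)" if "t \<in> I" "u \<in> {0..t}" for u t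
    using \<phi>_pos[OF I_down[OF that(1)] order_refl, of u \<i>] that by auto
  have G\<gamma>: "G T t = \<gamma> t" if T: "T \<in> I" and t: "0 \<le> t" "t \<le> T" for T t
  proof -
    have tI: "t \<in> I" using I_down[OF T t] .
    have "st_measure.nev_integral (space_time T) (\<lambda>u. \<phi> 0 u \<i>) 0 t = st_measure.nev_integral (space_time t) (\<lambda>u. \<phi> 0 u \<i>) 0 t"
      using D0.kernel_integral(2)[OF T order_refl t ci[OF tI] pi[OF tI]] D0.kernel_integral(2)[OF tI order_refl t(1) order_refl ci[OF tI] pi[OF tI]]
      by (simp add: cut[OF T] cut[OF tI])
    thus ?thesis by (simp add: \<gamma>_def G_def)
  qed
  have "continuous_on {0..T} \<gamma>" if T: "T \<in> I" for T
  proof -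
    interpret N: st_measure "space_time T" by (rule space_time(1)[OF T])
    interpret V: driven "space_time T" "\<lambda>_. 0" 0 by unfold_locales auto
    have "compact ((\<lambda>u. \<phi> 0 u \<i>) ` {0..T})" "(\<lambda>u. \<phi> 0 u \<i>) ` {0..T} \<subseteq> upper_half_plane"
      using ci[OF T] pi[OF T] by (auto intro!: compact_continuous_image simp: upper_half_plane_def)
    then obtain R where R: "(\<lambda>u. \<phi> 0 u \<i>) ` {0..T} \<subseteq> region R" using compact_subset_region by blast
    have "N.admissible R (\<lambda>u. \<phi> 0 u \<i>) 0 T" by (rule N.admissibleI_cont[OF ci[OF T]]) (use R in auto)
    hence "continuous_on {0..T} (G T)"
      unfolding G_def by (intro continuous_intros ci[OF T] V.nev_integral_continuous)
    thus ?thesis by (rule continuous_on_eq) (use G\<gamma>[OF T] in auto)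
  qed
  hence c\<gamma>: "continuous_on I \<gamma>" by (rule continuous_on_time_interval)
  have "\<gamma> 0 = 0" using \<phi>_refl[OF I0, of \<i>] st_measure.nev_integral_refl[OF space_time(1)[OF I0]] by (simp add: \<gamma>_def G_def)
  hence dp: "driving_pair I \<gamma> H" using c\<gamma> sH fin by (simp add: driving_pair_def)
  have "evolution_equation I \<phi> \<gamma> H"
    unfolding evolution_equation_def
  proof (clarify)
    fix s t z assume p: "(s, t) \<in> time_pairs I" and z: "z \<in> upper_half_plane"
    have st: "s \<in> I" "t \<in> I" "0 \<le> s" "s \<le> t" "0 < Im z" using p z I_nonneg by (auto simp: time_pairs_def upper_half_plane_def)
    have c: "continuous_on {s..t} (\<lambda>u. \<phi> s u z)" by (rule \<phi>_time_continuous[OF st(2,3,5)])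
    have q: "0 < Im (\<phi> s u z)" if "u \<in> {s..t}" for u
      using \<phi>_pos[OF I_down[OF st(2)] st(3) _ st(5), of u] that st by auto
    note K = D0.kernel_integral[OF st(2,3,4) order_refl c q]
    have "\<phi> s t z = z + of_real (G t s) - of_real (G t t) + st_measure.nev_integral (space_time t) (\<lambda>u. \<phi> s u z) s t"
      unfolding G_def by (rule driven_equation_space_time[OF st(2-5)])
    hence "\<phi> s t z = z + of_real (\<gamma> s) - of_real (\<gamma> t) + set_lebesgue_integral H (UNIV \<times> {s..t}) (\<lambda>(x, u). (1 + of_real x * \<phi> s u z) / (of_real x - \<phi> s u z))"
      using K(2) cut[OF st(2)] G\<gamma>[OF st(2,3,4)] by (simp add: \<gamma>_def)
    thus "set_integrable H (UNIV \<times> {s..t}) (\<lambda>(x, u). (1 + of_real x * \<phi> s u z) / (of_real x - \<phi> s u z)) \<and>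
      \<phi> s t z = z + of_real (\<gamma> s) - of_real (\<gamma> t) + set_lebesgue_integral H (UNIV \<times> {s..t}) (\<lambda>(x, u). (1 + of_real x * \<phi> s u z) / (of_real x - \<phi> s u z))"
      using K(1) by blast
  qed
  thus ?thesis using that dp by blast
qed

end

section \<open>The evolution family of a driving pair\<close>

context driving begin

text \<open>Constant continuation beyond \<open>{0..T}\<close>, which makes the drift bounded and continuous on the whole line.\<close>

definition \<gamma>\<^sub>c :: "real \<Rightarrow> real \<Rightarrow> real" where "\<gamma>\<^sub>c T t = \<gamma> (max 0 (min T t))"

definition \<gamma>bound :: "real \<Rightarrow> real" where "\<gamma>bound T = (SOME g. \<forall>t. \<bar>\<gamma>\<^sub>c T t\<bar> \<le> g)"

lemma \<gamma>\<^sub>c_eq: "0 \<le> t \<Longrightarrow> t \<le> T \<Longrightarrow> \<gamma>\<^sub>c T t = \<gamma> t" by (simp add: \<gamma>\<^sub>c_def)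

lemma cut_driven: assumes T: "T \<in> I" shows "driven (cut T) (\<gamma>\<^sub>c T) (\<gamma>bound T)"
proof -
  interpret N: st_measure "cut T" by (rule cut_st[OF T])
  have T0: "0 \<le> T" by (rule I_nonneg[OF T])
  have c: "continuous_on {0..T} \<gamma>"
    using pair I_down[OF T] unfolding driving_pair_def by (auto intro: continuous_on_subset)
  have rng: "max 0 (min T t) \<in> {0..T}" for t using T0 by auto
  have "continuous_on UNIV (\<lambda>t. \<gamma> (max 0 (min T t)))"
    by (rule continuous_on_compose2[OF c]) (use T0 in \<open>auto intro!: continuous_intros\<close>)
  moreover have "\<exists>g. \<forall>t. \<bar>\<gamma>\<^sub>c T t\<bar> \<le> g"
  proof -
    have "bounded (\<gamma> ` {0..T})" by (intro compact_imp_bounded compact_continuous_image c) simp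
    then obtain B where "\<forall>x\<in>\<gamma> ` {0..T}. norm x \<le> B" unfolding bounded_iff by blast
    thus ?thesis using rng by (intro exI[of _ B]) (auto simp: \<gamma>\<^sub>c_def)
  qed
  hence "\<forall>t. \<bar>\<gamma>\<^sub>c T t\<bar> \<le> \<gamma>bound T" unfolding \<gamma>bound_def by (rule someI_ex)
  ultimately show ?thesis
    by (intro driven.intro N.st_measure_axioms driven_axioms.intro) (auto simp: \<gamma>\<^sub>c_def[abs_def])
qed

text \<open>The final time serves as the cut; by \<open>\<Phi>_eq_flow\<close> every later cut gives the same value.\<close>

definition \<Phi> :: "real \<Rightarrow> real \<Rightarrow> complex \<Rightarrow> complex" where
  "\<Phi> s t = driven.flow (cut t) (\<gamma>\<^sub>c t) s t"

lemma driven_by_transfer: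
  assumes T: "T \<in> I" and S: "S \<in> I" and t: "0 \<le> s" "s \<le> t" "t \<le> T" "t \<le> S"
    and w: "driven.driven_by (cut T) (\<gamma>\<^sub>c T) w s t"
  shows "driven.driven_by (cut S) (\<gamma>\<^sub>c S) w s t"
proof -
  interpret A: driven "cut T" "\<gamma>\<^sub>c T" "\<gamma>bound T" by (rule cut_driven[OF T])
  interpret B: driven "cut S" "\<gamma>\<^sub>c S" "\<gamma>bound S" by (rule cut_driven[OF S])
  note c = A.driven_byD(1)[OF w] and p = A.driven_byD(2)[OF w]
  have nev_integral: "A.nev_integral w s u = B.nev_integral w s u" if u: "u \<in> {s..t}" for u
  proof -
    have cu: "continuous_on {s..u} w" by (rule continuous_on_subset[OF c]) (use u in auto)
    have pu: "0 < Im (w v)" if "v \<in> {s..u}" for v using p[of v] that u by auto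
    show ?thesis
      using kernel_integral(2)[OF T t(1) _ _ cu pu] kernel_integral(2)[OF S t(1) _ _ cu pu] u t by simp
  qed
  show ?thesis unfolding B.driven_by_def
  proof (intro conjI ballI c p)
    fix u assume u: "u \<in> {s..t}"
    show "w u = w s + of_real (\<gamma>\<^sub>c S s) - of_real (\<gamma>\<^sub>c S u) + B.nev_integral w s u"
      using A.driven_byD(3)[OF w u] nev_integral[OF u] u t by (simp add: \<gamma>\<^sub>c_eq)
  qed
qed

lemma \<Phi>_eq_flow:
  assumes T: "T \<in> I" and t: "0 \<le> s" "s \<le> t" "t \<le> T" and z: "0 < Im z"
  shows "\<Phi> s t z = driven.flow (cut T) (\<gamma>\<^sub>c T) s t z"
proof -
  have tI: "t \<in> I" using I_down[OF T] t by auto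
  interpret A: driven "cut T" "\<gamma>\<^sub>c T" "\<gamma>bound T" by (rule cut_driven[OF T])
  interpret B: driven "cut t" "\<gamma>\<^sub>c t" "\<gamma>bound t" by (rule cut_driven[OF tI])
  have "B.driven_by (\<lambda>u. A.flow s u z) s t"
    by (rule driven_by_transfer[OF T tI t(1,2,3) order_refl A.flow_driven[OF z]])
  from B.flow_unique[OF this, of t] show ?thesis using t by (simp add: \<Phi>_def)
qed

lemma \<Phi>_driven:
  assumes T: "T \<in> I" and s: "0 \<le> s" "s \<le> T" and z: "0 < Im z"
  shows "driven.driven_by (cut T) (\<gamma>\<^sub>c T) (\<lambda>u. \<Phi> s u z) s T"
proof -
  interpret A: driven "cut T" "\<gamma>\<^sub>c T" "\<gamma>bound T" by (rule cut_driven[OF T])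
  have e: "\<Phi> s u z = A.flow s u z" if "u \<in> {s..T}" for u using \<Phi>_eq_flow[OF T s(1) _ _ z] that by auto
  note d = A.flow_driven[OF z, of s T]
  have nev_integral: "A.nev_integral (\<lambda>u. \<Phi> s u z) s t = A.nev_integral (\<lambda>u. A.flow s u z) s t" if "t \<in> {s..T}" for t
    unfolding A.nev_integral_def by (intro set_lebesgue_integral_cong) (use that e in auto)
  show ?thesis unfolding A.driven_by_def
  proof (intro conjI ballI)
    show "continuous_on {s..T} (\<lambda>u. \<Phi> s u z)"
      by (rule continuous_on_eq[OF A.driven_byD(1)[OF d]]) (simp add: e)
    fix t assume t: "t \<in> {s..T}"
    have ss: "s \<in> {s..T}" using s by simp
    show "0 < Im (\<Phi> s t z)" unfolding e[OF t] by (rule A.driven_byD(2)[OF d t])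
    show "\<Phi> s t z = \<Phi> s s z + of_real (\<gamma>\<^sub>c T s) - of_real (\<gamma>\<^sub>c T t) + A.nev_integral (\<lambda>u. \<Phi> s u z) s t"
      unfolding nev_integral[OF t] e[OF t] e[OF ss] by (rule A.driven_byD(3)[OF d t])
  qed
qed

lemma \<Phi>_refl: "s \<in> I \<Longrightarrow> 0 < Im z \<Longrightarrow> \<Phi> s s z = z"
proof -
  assume s: "s \<in> I" and z: "0 < Im z"
  interpret A: driven "cut s" "\<gamma>\<^sub>c s" "\<gamma>bound s" by (rule cut_driven[OF s])
  show ?thesis by (simp add: \<Phi>_def)
qed

lemma \<Phi>_pos:
  assumes "t \<in> I" "0 \<le> s" "s \<le> t" "0 < Im z" shows "0 < Im (\<Phi> s t z)"
proof -
  interpret A: driven "cut t" "\<gamma>\<^sub>c t" "\<gamma>bound t" by (rule cut_driven[OF assms(1)])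
  show ?thesis using A.driven_byD(2)[OF \<Phi>_driven[OF assms], of t] assms by simp
qed

lemma \<Phi>_locally_uniformly: "continuous_locally_uniformly I \<Phi>"
  unfolding continuous_locally_uniformly_def
proof (clarify)
  fix s t and K :: "complex set" assume p: "(s, t) \<in> time_pairs I" and K: "compact K" "K \<subseteq> upper_half_plane"
  have st: "s \<in> I" "t \<in> I" "0 \<le> s" "s \<le> t" using p I_nonneg by (auto simp: time_pairs_def)
  \<comment> \<open>a time that bounds a neighbourhood of \<open>t\<close> in \<open>I\<close>\<close>
  obtain T r where T: "T \<in> I" "0 < r" "\<And>t'. t' \<in> I \<Longrightarrow> \<bar>t' - t\<bar> < r \<Longrightarrow> t' \<le> T" "t \<le> T"
  proof (cases "\<exists>T\<in>I. t < T")
    case True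
    then obtain T where "T \<in> I" "t < T" by blast
    thus ?thesis using that[of T "T - t"] by auto
  next
    case False
    thus ?thesis using that[OF st(2) zero_less_one] by (auto simp: not_less)
  qed
  interpret A: driven "cut T" "\<gamma>\<^sub>c T" "\<gamma>bound T" by (rule cut_driven[OF T(1)])
  have T0: "0 \<le> T" by (rule I_nonneg[OF T(1)])
  obtain R where R: "0 < R" "K \<subseteq> region R" using compact_subset_region[OF K] by blast
  show "uniform_limit K (\<lambda>(s', t'). \<Phi> s' t') (\<Phi> s t) (at (s, t) within time_pairs I)"
  proof (rule uniform_limitI)
    fix e :: real assume e: "0 < e"
    obtain d where d: "0 < d" "\<And>s t s' t' z. 0 \<le> s \<Longrightarrow> s \<le> t \<Longrightarrow> t \<le> T \<Longrightarrow> 0 \<le> s' \<Longrightarrow> s' \<le> t' \<Longrightarrow> t' \<le> T \<Longrightarrow>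
      \<bar>s - s'\<bar> < d \<Longrightarrow> \<bar>t - t'\<bar> < d \<Longrightarrow> z \<in> region R \<Longrightarrow> norm (A.flow s t z - A.flow s' t' z) < e"
      using A.flow_continuous[OF T0 R(1) e] by metis
    show "\<forall>\<^sub>F x in at (s, t) within time_pairs I. \<forall>z\<in>K. dist ((case x of (s', t') \<Rightarrow> \<Phi> s' t') z) (\<Phi> s t z) < e"
      unfolding eventually_at
    proof (intro exI[of _ "min r d"] conjI ballI impI)
      fix x z assume x: "x \<in> time_pairs I" "x \<noteq> (s, t) \<and> dist x (s, t) < min r d" and z: "z \<in> K"
      obtain s' t' where [simp]: "x = (s', t')" by (cases x)
      have x': "s' \<in> I" "t' \<in> I" "0 \<le> s'" "s' \<le> t'" using x I_nonneg by (auto simp: time_pairs_def)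
      have dd: "\<bar>s' - s\<bar> < min r d" "\<bar>t' - t\<bar> < min r d"
        using x(2) dist_fst_le[of x "(s, t)"] dist_snd_le[of x "(s, t)"] by (auto simp: dist_real_def)
      have t'T: "t' \<le> T" using T(3)[OF x'(2)] dd by auto
      have zR: "z \<in> region R" "0 < Im z" using z R(2) K(2) by (auto simp: upper_half_plane_def)
      have "norm (A.flow s' t' z - A.flow s t z) < e"
        by (rule d(2)) (use x' st t'T T(4) dd zR in auto)
      thus "dist ((case x of (s', t') \<Rightarrow> \<Phi> s' t') z) (\<Phi> s t z) < e"
        using \<Phi>_eq_flow[OF T(1) x'(3,4) t'T zR(2)] \<Phi>_eq_flow[OF T(1) st(3,4) T(4) zR(2)] by (simp add: dist_norm)
    qed (use T d in auto)
  qed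
qed

theorem \<Phi>_evolution_family: "P_evolution_family I \<Phi>"
  unfolding P_evolution_family_def
proof (intro conjI \<Phi>_locally_uniformly)
  show "\<forall>(s, t)\<in>time_pairs I. \<Phi> s t holomorphic_on upper_half_plane \<and> \<Phi> s t ` upper_half_plane \<subseteq> upper_half_plane \<and> \<Phi> s t \<in> class_P"
  proof (clarify)
    fix s t assume "(s, t) \<in> time_pairs I"
    hence st: "t \<in> I" "0 \<le> s" "s \<le> t" using I_nonneg by (auto simp: time_pairs_def)
    interpret A: driven "cut t" "\<gamma>\<^sub>c t" "\<gamma>bound t" by (rule cut_driven[OF st(1)])
    show "\<Phi> s t holomorphic_on upper_half_plane \<and> \<Phi> s t ` upper_half_plane \<subseteq> upper_half_plane \<and> \<Phi> s t \<in> class_P"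
      using A.flow_holomorphic[OF st(3)] A.flow_class_P[OF st(3)] \<Phi>_pos[OF st]
      by (auto simp: \<Phi>_def[symmetric] upper_half_plane_def)
  qed
  show "\<forall>s\<in>I. \<forall>z\<in>upper_half_plane. \<Phi> s s z = z" using \<Phi>_refl by (auto simp: upper_half_plane_def)
  show "\<forall>s\<in>I. \<forall>t\<in>I. \<forall>u\<in>I. s \<le> t \<and> t \<le> u \<longrightarrow> (\<forall>z\<in>upper_half_plane. \<Phi> t u (\<Phi> s t z) = \<Phi> s u z)"
  proof (clarify)
    fix s t u z assume *: "s \<in> I" "t \<in> I" "u \<in> I" "s \<le> t" "t \<le> u" "z \<in> upper_half_plane"
    interpret A: driven "cut u" "\<gamma>\<^sub>c u" "\<gamma>bound u" by (rule cut_driven[OF *(3)])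
    have z: "0 < Im z" using * by (simp add: upper_half_plane_def)
    have 0: "0 \<le> s" "0 \<le> t" using I_nonneg * by auto
    show "\<Phi> t u (\<Phi> s t z) = \<Phi> s u z"
      using \<Phi>_eq_flow[OF *(3) 0(1) *(4,5) z] \<Phi>_eq_flow[OF *(3) 0(2) *(5) order_refl \<Phi>_pos[OF *(2) 0(1) *(4) z]]
        \<Phi>_eq_flow[OF *(3) 0(1) order_trans[OF *(4,5)] order_refl z] A.flow_semigroup[OF z *(4,5)] by simp
  qed
qed

theorem \<Phi>_equation: "evolution_equation I \<Phi> \<gamma> H"
  unfolding evolution_equation_def
proof (clarify)
  fix s t z assume p: "(s, t) \<in> time_pairs I" and z: "z \<in> upper_half_plane"
  have st: "s \<in> I" "t \<in> I" "0 \<le> s" "s \<le> t" "0 < Im z" using p z I_nonneg by (auto simp: time_pairs_def upper_half_plane_def)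
  interpret A: driven "cut t" "\<gamma>\<^sub>c t" "\<gamma>bound t" by (rule cut_driven[OF st(2)])
  note d = \<Phi>_driven[OF st(2-5)]
  note K = kernel_integral[OF st(2,3,4) order_refl A.driven_byD(1)[OF d] A.driven_byD(2)[OF d]]
  have "\<Phi> s t z = z + of_real (\<gamma> s) - of_real (\<gamma> t) + A.nev_integral (\<lambda>u. \<Phi> s u z) s t"
    using A.driven_byD(3)[OF d, of t] st \<Phi>_refl[OF st(1,5)] by (simp add: \<gamma>\<^sub>c_eq)
  thus "set_integrable H (UNIV \<times> {s..t}) (\<lambda>(x, u). (1 + of_real x * \<Phi> s u z) / (of_real x - \<Phi> s u z)) \<and>
      \<Phi> s t z = z + of_real (\<gamma> s) - of_real (\<gamma> t) + set_lebesgue_integral H (UNIV \<times> {s..t}) (\<lambda>(x, u). (1 + of_real x * \<Phi> s u z) / (of_real x - \<Phi> s u z))"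
    using K by simp
qed

lemma \<Phi>_unique:
  assumes \<psi>: "P_evolution_family I \<psi>" and eq: "evolution_equation I \<psi> \<gamma> H"
    and t: "t \<in> I" "0 \<le> s" "s \<le> t" and z: "0 < Im z"
  shows "\<psi> s t z = \<Phi> s t z"
proof -
  interpret E: evolution I \<psi> by (intro evolution.intro I \<psi>)
  interpret A: driven "cut t" "\<gamma>\<^sub>c t" "\<gamma>bound t" by (rule cut_driven[OF t(1)])
  have sI: "s \<in> I" using I_down[OF t(1)] t by auto
  have "A.driven_by (\<lambda>u. \<psi> s u z) s t" unfolding A.driven_by_def
  proof (intro conjI ballI)
    show "continuous_on {s..t} (\<lambda>u. \<psi> s u z)" by (rule E.\<phi>_time_continuous[OF t(1,2) z])
    fix u assume u: "u \<in> {s..t}"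
    have uI: "u \<in> I" using I_down[OF t(1), of u] u t by auto
    show "0 < Im (\<psi> s u z)" using E.\<phi>_pos[OF uI t(2) _ z] u by auto
    show "\<psi> s u z = \<psi> s s z + of_real (\<gamma>\<^sub>c t s) - of_real (\<gamma>\<^sub>c t u) + A.nev_integral (\<lambda>u. \<psi> s u z) s u"
      using E.driving_equation[OF driving_axioms eq t(1,2) _ _ z, of u] u t E.\<phi>_refl[OF sI z] by (simp add: \<gamma>\<^sub>c_eq)
  qed
  from A.flow_unique[OF this, of t] show ?thesis using t E.\<phi>_refl[OF sI z] by (simp add: \<Phi>_def)
qed

end

theorem corollary6p12:
  fixes I :: "real set"
  assumes "time_interval I"
  shows "(\<forall>\<phi>. P_evolution_family I \<phi> \<longrightarrow>
            (\<exists>\<gamma> H. driving_pair I \<gamma> H \<and> evolution_equation I \<phi> \<gamma> H \<and>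
               (\<forall>\<gamma>' H'. driving_pair I \<gamma>' H' \<and> evolution_equation I \<phi> \<gamma>' H' \<longrightarrow>
                  (\<forall>t\<in>I. \<gamma>' t = \<gamma> t) \<and> H' = H))) \<and>
         (\<forall>\<gamma> H. driving_pair I \<gamma> H \<longrightarrow>
            (\<exists>\<phi>. P_evolution_family I \<phi> \<and> evolution_equation I \<phi> \<gamma> H \<and>
               (\<forall>\<psi>. P_evolution_family I \<psi> \<and> evolution_equation I \<psi> \<gamma> H \<longrightarrow>
                  (\<forall>(s, t)\<in>time_pairs I. \<forall>z\<in>upper_half_plane. \<psi> s t z = \<phi> s t z))))"
proof (intro conjI allI impI)
  fix \<phi> assume "P_evolution_family I \<phi>"
  then interpret evolution I \<phi> by (intro evolution.intro assms)
  obtain \<gamma> H where p: "driving_pair I \<gamma> H" "evolution_equation I \<phi> \<gamma> H" using pair_exists by blast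
  have "(\<forall>t\<in>I. \<gamma>' t = \<gamma> t) \<and> H' = H" if "driving_pair I \<gamma>' H'" "evolution_equation I \<phi> \<gamma>' H'" for \<gamma>' H'
    using pair_unique[OF driving.intro[OF assms p(1)] p(2) driving.intro[OF assms that(1)] that(2)] by blast
  thus "\<exists>\<gamma> H. driving_pair I \<gamma> H \<and> evolution_equation I \<phi> \<gamma> H \<and>
      (\<forall>\<gamma>' H'. driving_pair I \<gamma>' H' \<and> evolution_equation I \<phi> \<gamma>' H' \<longrightarrow> (\<forall>t\<in>I. \<gamma>' t = \<gamma> t) \<and> H' = H)"
    using p by blast
next
  fix \<gamma> H assume "driving_pair I \<gamma> H"
  then interpret driving I \<gamma> H by (intro driving.intro assms)
  have "\<psi> s t z = \<Phi> s t z" if "P_evolution_family I \<psi>" "evolution_equation I \<psi> \<gamma> H" "(s, t) \<in> time_pairs I" "z \<in> upper_half_plane" for \<psi> s t z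
    using \<Phi>_unique[OF that(1,2), of t s z] that(3,4) I_nonneg by (auto simp: time_pairs_def upper_half_plane_def)
  thus "\<exists>\<phi>. P_evolution_family I \<phi> \<and> evolution_equation I \<phi> \<gamma> H \<and>
      (\<forall>\<psi>. P_evolution_family I \<psi> \<and> evolution_equation I \<psi> \<gamma> H \<longrightarrow>
        (\<forall>(s, t)\<in>time_pairs I. \<forall>z\<in>upper_half_plane. \<psi> s t z = \<phi> s t z))"
    using \<Phi>_evolution_family \<Phi>_equation by (intro exI[of _ \<Phi>]) auto
qed

end
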